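(* Let $s>0$, $a>0$, $\gamma>1$ and $1<p\leq 2$. Suppose that one of the following holds: (i) $0<a<1$ and $s>\frac{2-p}{2p}+\frac{a}{4}\left(1-\frac1\gamma\right)$; (ii) $a=1$ and $s>\frac1p-\frac1{2\gamma}$; (iii) $a>1$ and $s>\frac{2-p}{2p}+\min\left\{\frac a4\left(1-\frac1\gamma\right),\frac14\right\}$. Then for every $f\in W^{s,p}(\mathbb R)$, $$\lim_{t\to 0}P_{a,\gamma}^t f(x)=f(x)\quad\text{for a.e. }x\in\mathbb R,$$ where the limit is taken over $t>0$.
   Context: The Fourier transform is $\hat f(\xi)=\int_{\mathbb R}e^{-ix\xi}f(x)\,dx$, extended to $L^p(\mathbb R)$, $1\le p\le 2$, in the usual way (Hausdorff--Young). For $a>0$, $\gamma>0$, $t>0$, the Landau type Schrödinger operator is $$P_{a,\gamma}^t f(x)=\frac{1}{2\pi}\int_{\mathbb R}\hat f(\xi)e^{ix\xi}e^{it|\xi|^a}e^{-t^\gamma|\xi|^a}\,d\xi.$$ The fractional Sobolev space $W^{s,p}(\mathbb R)$ consists of the $u\in L^p(\mathbb R)$ with finite norm, where: for $0<s<1$, $$\|u\|_{W^{s,p}(\mathbb R)}=\Big(\|u\|_{L^p(\mathbb R)}^p+\iint_{\mathbb R\times\mathbb R}\frac{|u(x)-u(y)|^p}{|x-y|^{sp+1}}\,dx\,dy\Big)^{1/p};$$ for an integer $s=k\ge1$, $\|u\|_{W^{k,p}(\mathbb R)}=\big(\|u\|_{L^p}^p+\sum_{1\le\alpha\le k}\|D^\alpha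 u\|_{L^p}^p\big)^{1/p}$ with $D^\alpha u$ the distributional derivative; for non-integer $s>1$, $s=m+\tau$ with $m\ge1$ an integer and $\tau\in(0,1)$, $$\|u\|_{W^{s,p}(\mathbb R)}=\Big(\|u\|_{W^{m,p}(\mathbb R)}^p+\iint_{\mathbb R\times\mathbb R}\frac{|D^mu(x)-D^mu(y)|^p}{|x-y|^{\tau p+1}}\,dx\,dy\Big)^{1/p}.$$ *)

theory Defs
  imports "HOL-Analysis.Analysis"
begin

text \<open>
  Elements of \<open>L\<^sup>p\<close> and of the Sobolev spaces are represented by Lebesgue measurable functions
  \<open>real \<Rightarrow> complex\<close>; no quotient by equality almost everywhere is taken.
  Quantities that may be infinite are \<open>ennreal\<close>-valued, and \<open>p\<close>-th powers of norms are used,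
  so that no \<open>p\<close>-th root in \<open>ennreal\<close> is needed.
\<close>

definition Lp_pow :: "real \<Rightarrow> (real \<Rightarrow> complex) \<Rightarrow> ennreal" where
  "Lp_pow p f = (\<integral>\<^sup>+x. ennreal (norm (f x) powr p) \<partial>lebesgue)"

definition Lp_space :: "real \<Rightarrow> (real \<Rightarrow> complex) set" where
  "Lp_space p = {f. f \<in> borel_measurable lebesgue \<and> Lp_pow p f < \<infinity>}"

definition fourier :: "(real \<Rightarrow> complex) \<Rightarrow> real \<Rightarrow> complex" where
  "fourier f \<xi> = (LINT x|lebesgue. exp (- (\<i> * of_real (x * \<xi>))) * f x)"

text \<open>
  Hausdorff--Young extension for \<open>1 < p \<le> 2\<close>: the continuous extension from
  \<open>L\<^sup>1 \<inter> L\<^sup>p\<close> to a map of \<open>L\<^sup>p\<close> into \<open>L\<^sup>q\<close>, \<open>q = p / (p - 1)\<close>. It is determined only up to a null set;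
  \<open>fourier_Lp\<close> picks one representative.
\<close>

definition is_fourier_Lp :: "real \<Rightarrow> (real \<Rightarrow> complex) \<Rightarrow> (real \<Rightarrow> complex) \<Rightarrow> bool" where
  "is_fourier_Lp p f g \<longleftrightarrow>
     g \<in> Lp_space (p / (p - 1)) \<and>
     (\<exists>F :: nat \<Rightarrow> real \<Rightarrow> complex.
        (\<forall>n. F n \<in> Lp_space 1 \<inter> Lp_space p) \<and>
        (\<lambda>n. Lp_pow p (\<lambda>x. F n x - f x)) \<longlonglongrightarrow> 0 \<and>
        (\<lambda>n. Lp_pow (p / (p - 1)) (\<lambda>\<xi>. fourier (F n) \<xi> - g \<xi>)) \<longlonglongrightarrow> 0)"

definition fourier_Lp :: "real \<Rightarrow> (real \<Rightarrow> complex) \<Rightarrow> real \<Rightarrow> complex" where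
  "fourier_Lp p f = (SOME g. is_fourier_Lp p f g)"

text \<open>The exponent \<open>p\<close> only says in which \<open>L\<^sup>p\<close> the Fourier transform of \<open>f\<close> is taken.\<close>

definition landau_schroedinger ::
  "real \<Rightarrow> real \<Rightarrow> real \<Rightarrow> real \<Rightarrow> (real \<Rightarrow> complex) \<Rightarrow> real \<Rightarrow> complex" where
  "landau_schroedinger p a \<gamma> t f x =
     1 / (2 * of_real pi) *
     (LINT \<xi>|lebesgue. fourier_Lp p f \<xi> * exp (\<i> * of_real (x * \<xi>))
        * exp (\<i> * of_real (t * \<bar>\<xi>\<bar> powr a))
        * of_real (exp (- (t powr \<gamma> * \<bar>\<xi>\<bar> powr a))))"

definition test_function :: "(real \<Rightarrow> real) \<Rightarrow> bool" where
  "test_function \<phi> \<longleftrightarrow>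
     (\<forall>k x. (deriv ^^ k) \<phi> field_differentiable at x) \<and> compact (closure {x. \<phi> x \<noteq> 0})"

definition locally_integrable :: "(real \<Rightarrow> complex) \<Rightarrow> bool" where
  "locally_integrable u \<longleftrightarrow> (\<forall>K. compact K \<longrightarrow> set_integrable lebesgue K u)"

definition is_weak_deriv :: "nat \<Rightarrow> (real \<Rightarrow> complex) \<Rightarrow> (real \<Rightarrow> complex) \<Rightarrow> bool" where
  "is_weak_deriv k u v \<longleftrightarrow>
     locally_integrable u \<and> locally_integrable v \<and>
     (\<forall>\<phi>. test_function \<phi> \<longrightarrow>
        (LINT x|lebesgue. (deriv ^^ k) \<phi> x *\<^sub>R u x) = (-1) ^ k * (LINT x|lebesgue. \<phi> x *\<^sub>R v x))"

definition weak_deriv :: "nat \<Rightarrow> (real \<Rightarrow> complex) \<Rightarrow> real \<Rightarrow> complex" where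
  "weak_deriv k u = (if k = 0 then u else (SOME v. is_weak_deriv k u v))"

definition gagliardo_pow :: "real \<Rightarrow> real \<Rightarrow> (real \<Rightarrow> complex) \<Rightarrow> ennreal" where
  "gagliardo_pow \<tau> p u =
     (\<integral>\<^sup>+(x, y). ennreal (norm (u x - u y) powr p / \<bar>x - y\<bar> powr (\<tau> * p + 1))
        \<partial>(lebesgue :: (real \<times> real) measure))"

text \<open>
  The \<open>p\<close>-th power of the \<open>W\<^sup>s\<^sup>,\<^sup>p\<close> norm, for \<open>s = m + \<tau>\<close> with \<open>m\<close> a natural number and
  \<open>0 \<le> \<tau> < 1\<close>: the cases \<open>0 < s < 1\<close> (\<open>m = 0\<close>), \<open>s\<close> integer (\<open>\<tau> = 0\<close>) and \<open>s > 1\<close> not an integer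
  in one formula. It is infinite if a distributional derivative of order at most \<open>m\<close> is not a
  locally integrable function.
\<close>

definition sobolev_norm_pow :: "real \<Rightarrow> real \<Rightarrow> (real \<Rightarrow> complex) \<Rightarrow> ennreal" where
  "sobolev_norm_pow s p u =
     (let m = nat \<lfloor>s\<rfloor>; \<tau> = frac s in
      if \<forall>\<alpha>\<in>{1..m}. \<exists>v. is_weak_deriv \<alpha> u v
      then Lp_pow p u + (\<Sum>\<alpha>\<in>{1..m}. Lp_pow p (weak_deriv \<alpha> u))
           + (if \<tau> = 0 then 0 else gagliardo_pow \<tau> p (weak_deriv m u))
      else \<infinity>)"

definition sobolev_space :: "real \<Rightarrow> real \<Rightarrow> (real \<Rightarrow> complex) set" where
  "sobolev_space s p = {u \<in> Lp_space p. sobolev_norm_pow s p u < \<infinity>}"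

end

theory Submission
  imports Defs "HOL-Probability.Characteristic_Functions"
begin

text \<open>
  Write \<open>q = p / (p - 1)\<close>, let \<open>g\<close> be the Fourier transform of \<open>f\<close>, and let \<open>s' = min s 1\<close>; all the thresholds
  lie below \<open>1\<close>, so \<open>s'\<close> satisfies them as well.

  The smoothness of \<open>f\<close> enters only through its increments: for every \<open>R \<ge> 1\<close> there is a step \<open>h\<close> of size
  about \<open>1 / R\<close> with \<open>\<parallel>f(\<cdot> + h) - f\<parallel>\<^sub>p = O(R powr - s')\<close> (\<open>sobolev_small_increments\<close>). On the Fourier side a
  translation is a multiplication by \<open>exp (\<i> h \<xi>)\<close>, and \<open>\<bar>exp (\<i> h \<xi>) - 1\<bar>\<close> is bounded below for \<open>\<bar>\<xi>\<bar>\<close> of size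
  \<open>R\<close>, so the Hausdorff--Young inequality bounds the \<open>L\<^sup>q\<close> norm of \<open>g\<close> on the annulus \<open>R \<le> \<bar>\<xi>\<bar> \<le> 2 R\<close> by
  \<open>O(R powr - s')\<close>. The annulus has measure of order \<open>R\<close>, hence the \<open>L\<^sup>2\<close> norm of \<open>g\<close> there is \<open>O(R powr - \<sigma>)\<close>
  with \<open>\<sigma> = s' - (1 / p - 1 / 2)\<close> (\<open>dyadic_L2_decay\<close>). This is the Sobolev embedding of \<open>W\<^sup>s\<^sup>,\<^sup>p\<close> into \<open>H\<^sup>\<sigma>\<close>,
  up to an arbitrarily small loss of smoothness.

  For the part of the solution with frequencies in one annulus, the maximal function over all times \<open>t > 0\<close> is
  bounded on bounded sets of \<open>x\<close> by \<open>R powr (e / 2)\<close> times the \<open>L\<^sup>2\<close> norm of that part, for some \<open>e < 2 \<sigma>\<close>. To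
  see this, replace \<open>t\<close> by a measurable function of \<open>x\<close> and apply the \<open>T T\<^sup>*\<close> argument: it is enough to bound,
  for \<open>z = x - y\<close> and \<open>\<tau> = t(x) - t(y)\<close>, the integral of \<open>exp (\<i> (z \<xi> + \<tau> \<bar>\<xi>\<bar> powr a)) exp (- B \<bar>\<xi>\<bar> powr a)\<close>
  over the annulus, where \<open>B \<ge> \<bar>\<tau>\<bar> powr \<gamma>\<close>, by a locally integrable function of \<open>z\<close> (\<open>maximal_linearized\<close>). If
  the derivative of \<open>z \<xi>\<close> dominates, the first derivative test gives nearly \<open>1 / \<bar>z\<bar>\<close>. Otherwise \<open>\<bar>\<tau>\<bar>\<close> is at
  least of order \<open>\<bar>z\<bar> R powr (1 - a)\<close>; then the second derivative test gives \<open>(R / \<bar>z\<bar>) powr (1/2)\<close> if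
  \<open>a \<noteq> 1\<close>, and the damping, which is strong because \<open>\<tau>\<close> is large, confines \<open>z\<close> effectively to
  \<open>\<bar>z\<bar> \<le> R powr (a - 1 - a / \<gamma>)\<close>. Integration over \<open>z\<close> produces the exponents \<open>a / 4 * (1 - 1 / \<gamma>)\<close> (with the
  damping) and \<open>1 / 4\<close> (without it); for \<open>a = 1\<close> there is no second derivative and the exponent doubles
  (\<open>dyadic_cos_bound\<close>, \<open>annulus_kernel_bound\<close>).

  Since \<open>e < 2 \<sigma>\<close>, the maximal functions of the dyadic parts are summable at almost every \<open>x\<close>
  (\<open>dyadic_maximal_sum\<close>). Hence the decomposition converges uniformly in \<open>t\<close>, and the limit as \<open>t\<close> tends to
  \<open>0\<close> exists and is the limit of the partial Fourier integrals \<open>\<integral>\<^bsub>\<bar>\<xi>\<bar> \<le> 2\<^sup>N\<^esub> g(\<xi>) exp (\<i> x \<xi>) d\<xi>\<close>. Testing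
  this limit on intervals identifies it with \<open>2 \<pi> f(x)\<close> (\<open>parseval_interval\<close>, \<open>wave_integral_tendsto_AE\<close>).
\<close>

section \<open>The Schur test and the Plancherel inequality\<close>

lemma integrable_tensor:
  fixes f :: "'a \<Rightarrow> complex" and g :: "'b \<Rightarrow> complex"
  assumes "pair_sigma_finite M N" and f: "integrable M f" and g: "integrable N g"
  shows "integrable (M \<Otimes>\<^sub>M N) (\<lambda>(x, y). f x * g y)"
proof -
  interpret pair_sigma_finite M N by fact
  have [measurable]: "f \<in> borel_measurable M" "g \<in> borel_measurable N" using f g by auto
  show ?thesis
    by (rule Fubini_integrable) (use f g in \<open>auto simp: norm_mult\<close>)
qed

text \<open>
  The square of the norm of \<open>\<xi> \<mapsto> \<integral> F(x) e(x, \<xi>) dx\<close> in \<open>L\<^sup>2(w)\<close> is a quadratic form in \<open>F\<close> with kernel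
  \<open>\<integral> e(x, \<xi>) cnj (e(y, \<xi>)) w(\<xi>) d\<xi>\<close>. Once this kernel is bounded by \<open>\<kappa>(x - y)\<close>, the inequality
  \<open>2 \<bar>F(x) F(y)\<bar> \<le> \<bar>F(x)\<bar>\<^sup>2 + \<bar>F(y)\<bar>\<^sup>2\<close> and the symmetry of \<open>\<kappa>\<close> finish the proof. It is applied twice: with
  the characters for \<open>e\<close> and a Gaussian for \<open>w\<close> it gives the Plancherel inequality, and with waves at times
  depending on \<open>x\<close> and the indicator of an annulus for \<open>w\<close> it gives the maximal inequality.
\<close>

lemma TT_star_schur:
  fixes e :: "real \<Rightarrow> real \<Rightarrow> complex" and w \<kappa> :: "real \<Rightarrow> real" and F :: "real \<Rightarrow> complex"
  assumes e [measurable]: "(\<lambda>(x, \<xi>). e x \<xi>) \<in> borel_measurable (borel \<Otimes>\<^sub>M borel)"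
    and e1: "\<And>x \<xi>. norm (e x \<xi>) \<le> 1"
    and w: "integrable lborel w" "\<And>\<xi>. 0 \<le> w \<xi>"
    and F: "integrable lborel F"
    and \<kappa> [measurable]: "\<kappa> \<in> borel_measurable borel"
    and \<kappa>even: "\<And>z. \<kappa> (- z) = \<kappa> z"
    and K: "\<And>x y. x \<noteq> y \<Longrightarrow> F x \<noteq> 0 \<Longrightarrow> F y \<noteq> 0 \<Longrightarrow>
        norm (LINT \<xi>|lborel. e x \<xi> * cnj (e y \<xi>) * of_real (w \<xi>)) \<le> \<kappa> (x - y)"
  shows "(\<integral>\<^sup>+\<xi>. ennreal ((norm (LINT x|lborel. F x * e x \<xi>))\<^sup>2 * w \<xi>) \<partial>lborel)
     \<le> (\<integral>\<^sup>+z. ennreal (\<kappa> z) \<partial>lborel) * (\<integral>\<^sup>+x. ennreal ((norm (F x))\<^sup>2) \<partial>lborel)"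
proof -
  have [measurable]: "F \<in> borel_measurable borel" "w \<in> borel_measurable borel"
    using F w by auto
  have [measurable]: "cnj \<in> borel_measurable borel"
    by (intro borel_measurable_continuous_onI continuous_intros)
  have [measurable]: "(\<lambda>v. e (f v) (g v)) \<in> borel_measurable N"
    if [measurable]: "f \<in> borel_measurable N" "g \<in> borel_measurable N" for N :: "'n measure" and f g
    using measurable_compose[OF measurable_Pair[OF that] e] by simp
  define H where "H \<xi> = (LINT x|lborel. F x * e x \<xi>)" for \<xi>
  have [measurable]: "H \<in> borel_measurable borel" unfolding H_def by measurable
  have iFe: "integrable lborel (\<lambda>x. F x * e x \<xi>)" for \<xi>
    by (rule Bochner_Integration.integrable_bound[OF F]) (auto simp: norm_mult intro!: mult_right_le_one_le e1)
  have iG: "integrable (lborel \<Otimes>\<^sub>M lborel) (\<lambda>(x, y). F x * cnj (F y))"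
    by (intro integrable_tensor integrable_cnj F lborel_pair.pair_sigma_finite_axioms)
  have iT: "integrable ((lborel \<Otimes>\<^sub>M lborel) \<Otimes>\<^sub>M lborel)
     (\<lambda>(z, \<xi>). (case z of (x, y) \<Rightarrow> F x * cnj (F y)) * of_real (w \<xi>))"
    by (intro integrable_tensor iG integrable_of_real w)
       (auto intro!: pair_sigma_finite.intro sigma_finite_pair_measure lborel.sigma_finite_measure_axioms)
  have iT2: "integrable ((lborel \<Otimes>\<^sub>M lborel) \<Otimes>\<^sub>M lborel)
     (\<lambda>(z, \<xi>). (case z of (x, y) \<Rightarrow> F x * cnj (F y) * (e x \<xi> * cnj (e y \<xi>) * of_real (w \<xi>))))"
  proof (rule Bochner_Integration.integrable_bound[OF iT])
    show "AE x in (lborel \<Otimes>\<^sub>M lborel) \<Otimes>\<^sub>M lborel.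
      norm (case x of (z, \<xi>) \<Rightarrow> case z of (x, y) \<Rightarrow> F x * cnj (F y) * (e x \<xi> * cnj (e y \<xi>) * of_real (w \<xi>)))
      \<le> norm (case x of (z, \<xi>) \<Rightarrow> (case z of (x, y) \<Rightarrow> F x * cnj (F y)) * of_real (w \<xi>))"
      using e1 by (auto simp: norm_mult intro!: AE_I2 mult_left_mono mult_left_le_one_le mult_le_one
          mult_right_le_one_le)
    show "(\<lambda>(z, \<xi>). (case z of (x, y) \<Rightarrow> F x * cnj (F y) * (e x \<xi> * cnj (e y \<xi>) * of_real (w \<xi>))))
      \<in> borel_measurable ((lborel \<Otimes>\<^sub>M lborel) \<Otimes>\<^sub>M lborel)"
      unfolding case_prod_beta' by measurable
  qed

  have sf: "pair_sigma_finite (lborel \<Otimes>\<^sub>M lborel :: (real\<times>real) measure) (lborel :: real measure)"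
    by (auto intro!: pair_sigma_finite.intro sigma_finite_pair_measure lborel.sigma_finite_measure_axioms)
  define k where "k x y = (LINT \<xi>|lborel. e x \<xi> * cnj (e y \<xi>) * of_real (w \<xi>))" for x y
  have H2: "complex_of_real ((norm (H \<xi>))\<^sup>2 * w \<xi>)
      = (LINT z|(lborel \<Otimes>\<^sub>M lborel). (case z of (x, y) \<Rightarrow> F x * cnj (F y) * (e x \<xi> * cnj (e y \<xi>)
          * of_real (w \<xi>))))" for \<xi>
  proof -
    have "(LINT z|(lborel \<Otimes>\<^sub>M lborel). (case z of (x, y) \<Rightarrow> F x * cnj (F y) * (e x \<xi> * cnj (e y \<xi>)
        * of_real (w \<xi>))))
       = (LINT z|(lborel \<Otimes>\<^sub>M lborel). (case z of (x, y) \<Rightarrow> (F x * e x \<xi>) * cnj (F y * e y \<xi>)) * of_real (w \<xi>))"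
      by (intro Bochner_Integration.integral_cong) (auto simp: mult_ac)
    also have "\<dots> = (LINT z|(lborel \<Otimes>\<^sub>M lborel). (case z of (x, y) \<Rightarrow> (F x * e x \<xi>) * cnj (F y * e y \<xi>)))
        * of_real (w \<xi>)"
      by (rule integral_mult_left_zero)
    also have "(LINT z|(lborel \<Otimes>\<^sub>M lborel). (case z of (x, y) \<Rightarrow> (F x * e x \<xi>) * cnj (F y * e y \<xi>)))
        = (LINT x|lborel. (LINT y|lborel. (F x * e x \<xi>) * cnj (F y * e y \<xi>)))"
    proof -
      have "integrable (lborel \<Otimes>\<^sub>M lborel) (\<lambda>(x, y). (F x * e x \<xi>) * cnj (F y * e y \<xi>))"
        by (intro integrable_tensor iFe integrable_cnj lborel_pair.pair_sigma_finite_axioms)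
      from lborel_pair.integral_fst'[OF this] show ?thesis by simp
    qed
    also have "\<dots> = H \<xi> * cnj (H \<xi>)"
      by (simp add: H_def del: complex_cnj_mult)
    finally show ?thesis by (simp only: of_real_mult complex_norm_square)
  qed
  have int_k: "(LINT \<xi>|lborel. (case z of (x, y) \<Rightarrow> F x * cnj (F y) * (e x \<xi> * cnj (e y \<xi>) * of_real (w \<xi>))))
      = (case z of (x, y) \<Rightarrow> F x * cnj (F y) * k x y)" for z
    by (auto simp: k_def split: prod.split)
  have iH: "integrable lborel (\<lambda>\<xi>. complex_of_real ((norm (H \<xi>))\<^sup>2 * w \<xi>))"
    unfolding H2 by (rule pair_sigma_finite.integrable_snd[OF sf]) (use iT2 in \<open>simp add: case_prod_beta'\<close>)
  have ik: "integrable (lborel \<Otimes>\<^sub>M lborel) (\<lambda>(x, y). F x * cnj (F y) * k x y)"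
    using pair_sigma_finite.integrable_fst[OF sf iT2] unfolding int_k .
  have iHr: "integrable lborel (\<lambda>\<xi>. (norm (H \<xi>))\<^sup>2 * w \<xi>)"
    using integrable_Re[OF iH] by (simp del: of_real_mult)
  have eq: "complex_of_real (LINT \<xi>|lborel. (norm (H \<xi>))\<^sup>2 * w \<xi>)
      = (LINT (x, y)|(lborel \<Otimes>\<^sub>M lborel). F x * cnj (F y) * k x y)"
  proof -
    have "complex_of_real (LINT \<xi>|lborel. (norm (H \<xi>))\<^sup>2 * w \<xi>)
        = (LINT \<xi>|lborel. complex_of_real ((norm (H \<xi>))\<^sup>2 * w \<xi>))"
      by (rule integral_complex_of_real[symmetric])
    also have "\<dots> = (LINT z|(lborel \<Otimes>\<^sub>M lborel). (LINT \<xi>|lborel. (case z of (x, y) \<Rightarrow> F x * cnj (F y) * (e x \<xi>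
        * cnj (e y \<xi>) * of_real (w \<xi>)))))"
      unfolding H2 using iT2 by (intro pair_sigma_finite.Fubini_integral[OF sf]) (simp add: case_prod_beta')
    also have "\<dots> = (LINT z|(lborel \<Otimes>\<^sub>M lborel). (case z of (x, y) \<Rightarrow> F x * cnj (F y) * k x y))"
      unfolding int_k ..
    finally show ?thesis .
  qed
  have "(\<integral>\<^sup>+\<xi>. ennreal ((norm (H \<xi>))\<^sup>2 * w \<xi>) \<partial>lborel) = ennreal (LINT \<xi>|lborel. (norm (H \<xi>))\<^sup>2 * w \<xi>)"
    by (rule nn_integral_eq_integral[OF iHr]) (use w in auto)
  also have "\<dots> \<le> ennreal (norm (LINT (x, y)|(lborel \<Otimes>\<^sub>M lborel). F x * cnj (F y) * k x y))"
    unfolding eq[symmetric] by (simp add: ennreal_leI)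
  also have "\<dots> \<le> (\<integral>\<^sup>+z. ennreal (norm (case z of (x, y) \<Rightarrow> F x * cnj (F y) * k x y)) \<partial>(lborel \<Otimes>\<^sub>M lborel))"
    by (rule integral_norm_bound_ennreal[OF ik])
  also have "\<dots> = (\<integral>\<^sup>+x. \<integral>\<^sup>+y. ennreal (norm (F x * cnj (F y) * k x y)) \<partial>lborel \<partial>lborel)"
    using borel_measurable_integrable[OF ik] by (subst lborel.nn_integral_fst[symmetric]) auto
  also have "\<dots> \<le> (\<integral>\<^sup>+x. \<integral>\<^sup>+y. ennreal (((norm (F x))\<^sup>2 / 2 + (norm (F y))\<^sup>2 / 2)) * ennreal (\<kappa> (x - y)) \<partial>lborel
      \<partial>lborel)"
  proof (rule nn_integral_mono, rule nn_integral_mono_AE)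
    fix x :: real
    have "AE y in lborel. y \<noteq> x" by (rule AE_lborel_singleton)
    then show "AE y in lborel. ennreal (norm (F x * cnj (F y) * k x y))
       \<le> ennreal (((norm (F x))\<^sup>2 / 2 + (norm (F y))\<^sup>2 / 2)) * ennreal (\<kappa> (x - y))"
    proof eventually_elim
      case (elim y)
      show ?case
      proof (cases "F x = 0 \<or> F y = 0")
        case False
        have k: "norm (k x y) \<le> \<kappa> (x - y)" unfolding k_def using K[of x y] False elim by auto
        have "norm (F x) * norm (F y) \<le> (norm (F x))\<^sup>2 / 2 + (norm (F y))\<^sup>2 / 2"
          using sum_squares_bound[of "norm (F x)" "norm (F y)"] by simp
        then have "norm (F x * cnj (F y) * k x y) \<le> ((norm (F x))\<^sup>2 / 2 + (norm (F y))\<^sup>2 / 2) * \<kappa> (x - y)"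
          unfolding norm_mult complex_mod_cnj by (intro mult_mono k) auto
        moreover have "0 \<le> \<kappa> (x - y)" using k norm_ge_zero order_trans by blast
        ultimately show ?thesis by (subst ennreal_mult[symmetric]) (auto intro!: ennreal_leI)
      qed auto
    qed
  qed
  also have "\<dots> = (\<integral>\<^sup>+x. \<integral>\<^sup>+y. ennreal ((norm (F x))\<^sup>2 / 2) * ennreal (\<kappa> (x - y)) + ennreal ((norm (F y))\<^sup>2 / 2)
      * ennreal (\<kappa> (x - y)) \<partial>lborel \<partial>lborel)"
    by (intro nn_integral_cong) (subst ennreal_plus, auto simp only: distrib_right, auto)
  also have "\<dots> = (\<integral>\<^sup>+x. \<integral>\<^sup>+y. ennreal ((norm (F x))\<^sup>2 / 2) * ennreal (\<kappa> (x - y)) \<partial>lborel \<partial>lborel)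
      + (\<integral>\<^sup>+x. \<integral>\<^sup>+y. ennreal ((norm (F y))\<^sup>2 / 2) * ennreal (\<kappa> (x - y)) \<partial>lborel \<partial>lborel)"
    by (simp add: nn_integral_add)
  also have "(\<integral>\<^sup>+x. \<integral>\<^sup>+y. ennreal ((norm (F y))\<^sup>2 / 2) * ennreal (\<kappa> (x - y)) \<partial>lborel \<partial>lborel)
     = (\<integral>\<^sup>+y. \<integral>\<^sup>+x. ennreal ((norm (F y))\<^sup>2 / 2) * ennreal (\<kappa> (x - y)) \<partial>lborel \<partial>lborel)"
    by (rule lborel_pair.Fubini'[symmetric]) measurable
  also have "\<dots> = (\<integral>\<^sup>+x. \<integral>\<^sup>+y. ennreal ((norm (F x))\<^sup>2 / 2) * ennreal (\<kappa> (x - y)) \<partial>lborel \<partial>lborel)"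
    by (subst \<kappa>even[of "_ - _", symmetric]) simp
  also have "(\<integral>\<^sup>+x. \<integral>\<^sup>+y. ennreal ((norm (F x))\<^sup>2 / 2) * ennreal (\<kappa> (x - y)) \<partial>lborel \<partial>lborel)
     = (\<integral>\<^sup>+x. ennreal ((norm (F x))\<^sup>2 / 2) * (\<integral>\<^sup>+z. ennreal (\<kappa> z) \<partial>lborel) \<partial>lborel)"
  proof (rule nn_integral_cong)
    fix x :: real
    have "(\<integral>\<^sup>+z. ennreal (\<kappa> z) \<partial>lborel) = (\<integral>\<^sup>+y. ennreal (\<kappa> (x - y)) \<partial>lborel)"
      using nn_integral_real_affine[of "\<lambda>z. ennreal (\<kappa> z)" "-1" x] by simp
    then show "(\<integral>\<^sup>+y. ennreal ((norm (F x))\<^sup>2 / 2) * ennreal (\<kappa> (x - y)) \<partial>lborel)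
       = ennreal ((norm (F x))\<^sup>2 / 2) * (\<integral>\<^sup>+z. ennreal (\<kappa> z) \<partial>lborel)"
      by (simp add: nn_integral_cmult)
  qed
  also have "\<dots> = (\<integral>\<^sup>+x. ennreal ((norm (F x))\<^sup>2 / 2) \<partial>lborel) * (\<integral>\<^sup>+z. ennreal (\<kappa> z) \<partial>lborel)"
    by (rule nn_integral_multc) auto
  also have "\<dots> + \<dots> = ((\<integral>\<^sup>+x. ennreal ((norm (F x))\<^sup>2 / 2) \<partial>lborel) + (\<integral>\<^sup>+x. ennreal ((norm (F x))\<^sup>2 / 2)
      \<partial>lborel)) * (\<integral>\<^sup>+z. ennreal (\<kappa> z) \<partial>lborel)"
    by (simp add: distrib_right)
  also have "(\<integral>\<^sup>+x. ennreal ((norm (F x))\<^sup>2 / 2) \<partial>lborel) + (\<integral>\<^sup>+x. ennreal ((norm (F x))\<^sup>2 / 2) \<partial>lborel)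
     = (\<integral>\<^sup>+x. ennreal ((norm (F x))\<^sup>2) \<partial>lborel)"
    by (subst nn_integral_add[symmetric]) (auto simp: ennreal_plus[symmetric] simp del: ennreal_plus)
  finally show ?thesis unfolding H_def by (simp add: mult.commute)
qed

text \<open>
  A rescaled form of the characteristic function of the standard normal distribution.
\<close>

lemma gaussian_fourier:
  assumes "s > 0"
  shows "(LINT \<xi>|lborel. exp (\<i> * of_real (z * \<xi>)) * of_real (exp (- (s * \<xi>)\<^sup>2 / 2))) =
     of_real (sqrt (2 * pi) / s * exp (- (z / s)\<^sup>2 / 2))"
proof -
  have "char std_normal_distribution (z / s) = complex_of_real (exp (- ((z / s)\<^sup>2 / 2)))"
    by (simp add: char_std_normal_distribution)
  then have "complex_of_real (exp (- ((z / s)\<^sup>2 / 2)))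
      = (LINT x|density lborel (\<lambda>x. ennreal (std_normal_density x)). exp (\<i> * of_real (z / s * x)))"
    by (simp add: char_def)
  also have "\<dots> = (LINT x|lborel. std_normal_density x *\<^sub>R exp (\<i> * of_real (z / s * x)))"
    by (rule integral_density) auto
  also have "\<dots> = s *\<^sub>R (LINT x|lborel. std_normal_density (s * x) *\<^sub>R exp (\<i> * of_real (z * x)))"
    using assms by (subst lborel_integral_real_affine[where c=s and t=0]) auto
  also have "\<dots> = of_real (s / sqrt (2 * pi)) * (LINT \<xi>|lborel. exp (\<i> * of_real (z * \<xi>)) * of_real (exp (- (s
      * \<xi>)\<^sup>2 / 2)))"
    by (simp add: std_normal_density_def scaleR_conv_of_real integral_mult_right_zero[symmetric] mult_ac del:
        integral_mult_right_zero)
  finally show ?thesis using assms by (simp add: field_simps)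
qed

text \<open>
  The weights \<open>exp (- (\<xi> / n)\<^sup>2 / 2)\<close> increase to \<open>1\<close>, and their transforms are positive kernels of total mass
  \<open>2 \<pi>\<close> for every \<open>n\<close>; so the Schur test gives the constant \<open>2 \<pi>\<close> uniformly in \<open>n\<close>.
\<close>

lemma plancherel_le:
  fixes F :: "real \<Rightarrow> complex"
  assumes F: "integrable lborel F"
  shows "(\<integral>\<^sup>+\<xi>. ennreal ((norm (LINT x|lborel. exp (- (\<i> * of_real (x * \<xi>))) * F x))\<^sup>2) \<partial>lborel)
     \<le> ennreal (2 * pi) * (\<integral>\<^sup>+x. ennreal ((norm (F x))\<^sup>2) \<partial>lborel)"
proof -
  have [measurable]: "F \<in> borel_measurable borel" using F by auto
  define H where "H \<xi> = (LINT x|lborel. exp (- (\<i> * of_real (x * \<xi>))) * F x)" for \<xi>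
  have [measurable]: "H \<in> borel_measurable borel" unfolding H_def by measurable
  define w where "w n \<xi> = exp (- (inverse (real (Suc n)) * \<xi>)\<^sup>2 / 2)" for n \<xi>
  have w_int: "integrable lborel (w n)" for n
  proof -
    have "integrable lborel (\<lambda>x. sqrt (2 * pi) * std_normal_density (0 + inverse (real (Suc n)) * x))"
      by (intro integrable_mult_right lborel_integrable_real_affine) auto
    then show ?thesis by (simp add: std_normal_density_def w_def[abs_def])
  qed
  have bound: "(\<integral>\<^sup>+\<xi>. ennreal ((norm (H \<xi>))\<^sup>2 * w n \<xi>) \<partial>lborel)
      \<le> ennreal (2 * pi) * (\<integral>\<^sup>+x. ennreal ((norm (F x))\<^sup>2) \<partial>lborel)" for n
  proof -
    define \<kappa> where "\<kappa> z = sqrt (2 * pi) * real (Suc n) * exp (- (z * real (Suc n))\<^sup>2 / 2)" for z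
    have "(\<integral>\<^sup>+\<xi>. ennreal ((norm (LINT x|lborel. F x * exp (- (\<i> * of_real (x * \<xi>)))))\<^sup>2 * w n \<xi>) \<partial>lborel)
       \<le> (\<integral>\<^sup>+z. ennreal (\<kappa> z) \<partial>lborel) * (\<integral>\<^sup>+x. ennreal ((norm (F x))\<^sup>2) \<partial>lborel)"
    proof (rule TT_star_schur[OF _ _ w_int _ F])
      fix x y :: real
      have "(LINT \<xi>|lborel. exp (- (\<i> * of_real (x * \<xi>))) * cnj (exp (- (\<i> * of_real (y * \<xi>)))) * of_real (w n
          \<xi>))
        = (LINT \<xi>|lborel. exp (\<i> * of_real ((y - x) * \<xi>)) * of_real (exp (- (inverse (real (Suc n))
            * \<xi>)\<^sup>2 / 2)))"
      proof (intro Bochner_Integration.integral_cong refl)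
        fix \<xi>
        have "exp (- (\<i> * of_real (x * \<xi>))) * cnj (exp (- (\<i> * of_real (y * \<xi>))))
            = exp (\<i> * of_real ((y - x) * \<xi>))"
          by (simp add: exp_cnj algebra_simps flip: exp_add)
        then show "exp (- (\<i> * of_real (x * \<xi>))) * cnj (exp (- (\<i> * of_real (y * \<xi>)))) * of_real (w n \<xi>)
          = exp (\<i> * of_real ((y - x) * \<xi>)) * of_real (exp (- (inverse (real (Suc n)) * \<xi>)\<^sup>2 / 2))"
          by (simp only: w_def)
      qed
      also have "\<dots> = of_real (sqrt (2 * pi) / inverse (real (Suc n)) * exp (- ((y - x) / inverse (real (Suc
          n)))\<^sup>2 / 2))"
        by (rule gaussian_fourier) simp
      also have "\<dots> = of_real (\<kappa> (y - x))"
        by (simp only: \<kappa>_def divide_inverse inverse_inverse_eq)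
      also have "\<kappa> (y - x) = \<kappa> (x - y)" by (simp add: \<kappa>_def power2_commute left_diff_distrib)
      finally show "norm (LINT \<xi>|lborel. exp (- (\<i> * of_real (x * \<xi>))) * cnj (exp (- (\<i> * of_real (y * \<xi>))))
          * of_real (w n \<xi>)) \<le> \<kappa> (x - y)"
        by (simp only: norm_of_real) (simp add: \<kappa>_def)
    qed (auto simp: w_def \<kappa>_def)
    also have "(\<integral>\<^sup>+z. ennreal (\<kappa> z) \<partial>lborel) = ennreal (2 * pi)"
    proof -
      have "(\<integral>\<^sup>+z. ennreal (\<kappa> z) \<partial>lborel) = (\<integral>\<^sup>+z. ennreal (2 * pi) * (ennreal (real (Suc n))
          * ennreal (std_normal_density (real (Suc n) * z))) \<partial>lborel)"
        by (intro nn_integral_cong) (auto simp: \<kappa>_def std_normal_density_def ennreal_mult[symmetric]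
            real_sqrt_mult field_simps simp del: of_nat_Suc)
      also have "\<dots> = ennreal (2 * pi) * (ennreal (real (Suc n)) * (\<integral>\<^sup>+z. ennreal (std_normal_density (real (Suc
          n) * z)) \<partial>lborel))"
        by (simp add: nn_integral_cmult del: of_nat_Suc)
      also have "ennreal (real (Suc n)) * (\<integral>\<^sup>+z. ennreal (std_normal_density (real (Suc n) * z)) \<partial>lborel)
          = (\<integral>\<^sup>+z. ennreal (std_normal_density z) \<partial>lborel)"
        by (subst (2) nn_integral_real_affine[where c="real (Suc n)" and t=0]) auto
      also have "\<dots> = 1"
        using prob_space.emeasure_space_1[OF prob_space_normal_density[of 1 0]] by (simp add: emeasure_density)
      finally show ?thesis by simp
    qed
    finally show ?thesis by (simp add: H_def mult.commute)
  qed
  have "(\<integral>\<^sup>+\<xi>. ennreal ((norm (H \<xi>))\<^sup>2) \<partial>lborel) = (\<integral>\<^sup>+\<xi>. liminf (\<lambda>n. ennreal ((norm (H \<xi>))\<^sup>2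
      * w n \<xi>)) \<partial>lborel)"
  proof (intro nn_integral_cong lim_imp_Liminf[symmetric])
    fix \<xi>
    have "(\<lambda>n. ennreal ((norm (H \<xi>))\<^sup>2 * w n \<xi>)) \<longlonglongrightarrow> ennreal ((norm (H \<xi>))\<^sup>2 * exp (- (0 * \<xi>)\<^sup>2 / 2))"
      unfolding w_def by (intro tendsto_intros tendsto_ennrealI LIMSEQ_inverse_real_of_nat) auto
    then show "(\<lambda>n. ennreal ((norm (H \<xi>))\<^sup>2 * w n \<xi>)) \<longlonglongrightarrow> ennreal ((norm (H \<xi>))\<^sup>2)" by simp
  qed auto
  also have "\<dots> \<le> liminf (\<lambda>n. \<integral>\<^sup>+\<xi>. ennreal ((norm (H \<xi>))\<^sup>2 * w n \<xi>) \<partial>lborel)"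
    by (rule nn_integral_liminf) (auto simp: w_def)
  also have "\<dots> \<le> ennreal (2 * pi) * (\<integral>\<^sup>+x. ennreal ((norm (F x))\<^sup>2) \<partial>lborel)"
    using bound by (auto intro!: Liminf_le)
  finally show ?thesis unfolding H_def .
qed

section \<open>The Hausdorff--Young inequality\<close>

lemma Lp_pow_lborel: "Lp_pow p f = (\<integral>\<^sup>+x. ennreal (norm (f x) powr p) \<partial>lborel)"
  unfolding Lp_pow_def by (rule nn_integral_completion)

lemma fourier_lborel:
  assumes [measurable]: "f \<in> borel_measurable borel"
  shows "fourier f \<xi> = (LINT x|lborel. exp (- (\<i> * of_real (x * \<xi>))) * f x)"
  unfolding fourier_def by (rule integral_completion) measurable

lemma borel_measurable_fourier [measurable]:
  assumes [measurable]: "f \<in> borel_measurable borel"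
  shows "fourier f \<in> borel_measurable borel"
  unfolding fourier_lborel[OF assms, abs_def] by measurable

lemma powr_two_nonneg: "0 \<le> x \<Longrightarrow> x powr 2 = (x::real)\<^sup>2"
  by (cases "x = 0") (auto simp: powr_numeral)

lemma integrable_fourier_kernel:
  assumes "integrable lborel f"
  shows "integrable lborel (\<lambda>x. exp (- (\<i> * of_real (x * \<xi>))) * f x)"
proof -
  have [measurable]: "f \<in> borel_measurable borel" using assms by auto
  show ?thesis by (rule Bochner_Integration.integrable_bound[OF assms]) (auto simp: norm_mult)
qed

lemma norm_fourier_le:
  assumes "integrable lborel f"
  shows "ennreal (norm (fourier f \<xi>)) \<le> (\<integral>\<^sup>+x. ennreal (norm (f x)) \<partial>lborel)"
proof -
  have [measurable]: "f \<in> borel_measurable borel" using assms by auto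
  have "ennreal (norm (fourier f \<xi>)) \<le> (\<integral>\<^sup>+x. ennreal (norm (exp (- (\<i> * of_real (x * \<xi>))) * f x)) \<partial>lborel)"
    unfolding fourier_lborel[OF \<open>f \<in> _\<close>]
    by (rule integral_norm_bound_ennreal[OF integrable_fourier_kernel[OF assms]])
  then show ?thesis by (simp add: norm_mult)
qed

lemma nn_integral_powr_from_0:
  assumes "r > 0" "c \<ge> 0"
  shows "(\<integral>\<^sup>+x. ennreal (x powr (r - 1)) * indicator {0..c} x \<partial>lborel) = ennreal (c powr r / r)"
  using nn_integral_has_integral_lebesgue'[OF _ has_integral_powr_from_0[of "r - 1" c]] assms by simp

text \<open>
  This is Marcinkiewicz interpolation between the bounds \<open>L\<^sup>1 \<rightarrow> L\<^sup>\<infinity>\<close> and \<open>L\<^sup>2 \<rightarrow> L\<^sup>2\<close>. For each level \<open>l\<close> of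
  the transform, \<open>F\<close> is cut at the height \<open>(2 A / l) powr (1 / (p - 1))\<close>. The part above it has \<open>L\<^sup>1\<close> norm at
  most \<open>l / 2\<close>, so where the transform of \<open>F\<close> exceeds \<open>l\<close>, that of the part below it exceeds \<open>l / 2\<close>; the
  Plancherel inequality bounds the measure of this set. Integration over \<open>l\<close> and Fubini recover the \<open>L\<^sup>p\<close> norm
  of \<open>F\<close>.
\<close>

lemma hausdorff_young_below_2:
  assumes p: "1 < p" "p < 2" and F: "integrable lborel F" and A: "A > 0"
    and FA: "Lp_pow p F \<le> ennreal A"
  shows "Lp_pow (p / (p - 1)) (fourier F)
     \<le> ennreal (8 * pi * (p / (p - 1)) * 2 powr (p / (p - 1) - 2) / (p / (p - 1) - 2) * A powr (1 / (p - 1)))"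
proof -
  define q where "q = p / (p - 1)"
  have q: "q > 2" "q - 1 = 1 / (p - 1)" "(1 - p) * (q - 2) = p - 2" using p by (auto simp: q_def field_simps)
  have [measurable]: "F \<in> borel_measurable borel" using F by auto
  define H where "H = fourier F"
  have [measurable]: "H \<in> borel_measurable borel" unfolding H_def by measurable
  \<comment> \<open>\<open>small l x\<close> says that \<open>\<bar>F x\<bar>\<close> is at most the cutting height \<open>(2 A / l) powr (1 / (p - 1))\<close>\<close>
  define small where "small l x \<longleftrightarrow> norm (F x) powr (p - 1) * l \<le> 2 * A" for l x
  have sm [measurable]: "Measurable.pred (borel \<Otimes>\<^sub>M borel) (\<lambda>(l, x). small l x)" unfolding small_def
      by measurable
  have [measurable]: "Measurable.pred borel (small l)" for l unfolding small_def by measurable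
  have level: "(\<integral>\<^sup>+\<xi>. indicator {0..norm (H \<xi>)} l \<partial>lborel)
     \<le> ennreal (8 * pi / l\<^sup>2) * (\<integral>\<^sup>+x. ennreal ((norm (F x))\<^sup>2) * of_bool (small l x) \<partial>lborel)" if l: "l > 0"
         for l :: real
  proof -
    define F1 where "F1 x = (if small l x then 0 else F x)" for x
    define F2 where "F2 x = (if small l x then F x else 0)" for x
    have [measurable]: "F1 \<in> borel_measurable borel" "F2 \<in> borel_measurable borel" unfolding F1_def F2_def
        by measurable
    have i1: "integrable lborel F1" and i2: "integrable lborel F2"
      by (rule Bochner_Integration.integrable_bound[OF F]; auto simp: F1_def F2_def)+
    have n1: "ennreal (norm (F1 x)) \<le> ennreal (l / (2 * A)) * ennreal (norm (F x) powr p)" for x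
    proof (cases "small l x")
      case False
      then have "2 * A \<le> norm (F x) powr (p - 1) * l" by (simp add: small_def)
      then have "1 \<le> l / (2 * A) * norm (F x) powr (p - 1)" using A by (simp add: field_simps)
      then have "norm (F x) * 1 \<le> norm (F x) * (l / (2 * A) * norm (F x) powr (p - 1))"
        by (intro mult_left_mono) auto
      also have "\<dots> = l / (2 * A) * norm (F x) powr p"
        by (cases "F x = 0") (auto simp: powr_diff)
      finally show ?thesis using l A False by (simp add: F1_def ennreal_mult[symmetric])
    qed (simp add: F1_def)
    have "(\<integral>\<^sup>+x. ennreal (norm (F1 x)) \<partial>lborel) \<le> (\<integral>\<^sup>+x. ennreal (l / (2 * A)) * ennreal (norm (F x) powr p)
        \<partial>lborel)"
      by (intro nn_integral_mono n1)
    also have "\<dots> = ennreal (l / (2 * A)) * Lp_pow p F" unfolding Lp_pow_lborel by (rule nn_integral_cmult) auto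
    also have "\<dots> \<le> ennreal (l / (2 * A)) * ennreal A" by (intro mult_left_mono FA) auto
    also have "\<dots> = ennreal (l / 2)" using l A by (simp add: ennreal_mult[symmetric])
    finally have "ennreal (norm (fourier F1 \<xi>)) \<le> ennreal (l / 2)" for \<xi>
      using norm_fourier_le[OF i1] order_trans by blast
    then have f1: "norm (fourier F1 \<xi>) \<le> l / 2" for \<xi> using l by (subst (asm) ennreal_le_iff) auto
    have Hsum: "H \<xi> = fourier F1 \<xi> + fourier F2 \<xi>" for \<xi>
    proof -
      have "fourier F1 \<xi> + fourier F2 \<xi> = (LINT x|lborel. exp (- (\<i> * of_real (x * \<xi>))) * F1 x + exp (- (\<i>
          * of_real (x * \<xi>))) * F2 x)"
        unfolding fourier_lborel[OF \<open>F1 \<in> _\<close>] fourier_lborel[OF \<open>F2 \<in> _\<close>]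
        by (rule Bochner_Integration.integral_add[symmetric]; intro integrable_fourier_kernel i1 i2)
      also have "\<dots> = H \<xi>" unfolding H_def fourier_lborel[OF \<open>F \<in> _\<close>]
        by (intro Bochner_Integration.integral_cong) (auto simp: F1_def F2_def)
      finally show ?thesis ..
    qed
    have pt: "(indicator {0..norm (H \<xi>)} l :: ennreal) \<le> ennreal (4 / l\<^sup>2) * ennreal ((norm (fourier F2 \<xi>))\<^sup>2)"
        for \<xi>
    proof (cases "l \<le> norm (H \<xi>)")
      case True
      have "l / 2 \<le> norm (fourier F2 \<xi>)" using True f1[of \<xi>] norm_triangle_ineq[of "fourier F1 \<xi>" "fourier F2
          \<xi>"]
        unfolding Hsum by linarith
      then have "(l / 2)\<^sup>2 \<le> (norm (fourier F2 \<xi>))\<^sup>2" using l by (intro power_mono) auto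
      then have "1 \<le> 4 / l\<^sup>2 * (norm (fourier F2 \<xi>))\<^sup>2" using l by (simp add: field_simps)
      then show ?thesis using True l by (simp add: ennreal_mult[symmetric])
    qed auto
    have "(\<integral>\<^sup>+\<xi>. indicator {0..norm (H \<xi>)} l \<partial>lborel)
        \<le> (\<integral>\<^sup>+\<xi>. ennreal (4 / l\<^sup>2) * ennreal ((norm (fourier F2 \<xi>))\<^sup>2) \<partial>lborel)"
      by (intro nn_integral_mono pt)
    also have "\<dots> = ennreal (4 / l\<^sup>2) * (\<integral>\<^sup>+\<xi>. ennreal ((norm (fourier F2 \<xi>))\<^sup>2) \<partial>lborel)"
      by (rule nn_integral_cmult) auto
    also have "\<dots> \<le> ennreal (4 / l\<^sup>2) * (ennreal (2 * pi) * (\<integral>\<^sup>+x. ennreal ((norm (F2 x))\<^sup>2) \<partial>lborel))"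
      using plancherel_le[OF i2] unfolding fourier_lborel[OF \<open>F2 \<in> _\<close>] by (intro mult_left_mono) auto
    also have "(\<integral>\<^sup>+x. ennreal ((norm (F2 x))\<^sup>2) \<partial>lborel)
        = (\<integral>\<^sup>+x. ennreal ((norm (F x))\<^sup>2) * of_bool (small l x) \<partial>lborel)"
      by (intro nn_integral_cong) (auto simp: F2_def)
    also have "ennreal (4 / l\<^sup>2) * (ennreal (2 * pi) * \<dots>) = ennreal (8 * pi / l\<^sup>2) * \<dots>"
      by (simp add: mult.assoc[symmetric] ennreal_mult[symmetric])
    finally show ?thesis .
  qed
  have layer: "ennreal (norm (H \<xi>) powr q) = (\<integral>\<^sup>+l. ennreal (q * l powr (q - 1)) * indicator {0..norm (H \<xi>)} l
      \<partial>lborel)" for \<xi>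
  proof -
    have "(\<integral>\<^sup>+l. ennreal (q * l powr (q - 1)) * indicator {0..norm (H \<xi>)} l \<partial>lborel)
      = ennreal q * (\<integral>\<^sup>+l. ennreal (l powr (q - 1)) * indicator {0..norm (H \<xi>)} l \<partial>lborel)"
      using q by (simp add: nn_integral_cmult[symmetric] ennreal_mult mult_ac)
    also have "\<dots> = ennreal (norm (H \<xi>) powr q)"
      using q by (subst nn_integral_powr_from_0) (auto simp: ennreal_mult[symmetric])
    finally show ?thesis ..
  qed
  have inner: "(\<integral>\<^sup>+l. ennreal (8 * pi * q * l powr (q - 3)) * (ennreal ((norm (F x))\<^sup>2) * (of_bool (small l x)
      * indicator {0..} l)) \<partial>lborel)
     \<le> ennreal (8 * pi * q / (q - 2) * (2 * A) powr (q - 2)) * ennreal (norm (F x) powr p)" for x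
  proof (cases "F x = 0")
    case False
    define L where "L = 2 * A * norm (F x) powr (1 - p)"
    have L0: "L > 0" using A False by (simp add: L_def)
    have sL: "small l x \<longleftrightarrow> l \<le> L" for l
    proof -
      have P: "norm (F x) powr (p - 1) > 0" using False by simp
      have "norm (F x) powr (1 - p) = inverse (norm (F x) powr (p - 1))" by (subst powr_minus[symmetric]) simp
      then have "L = 2 * A / norm (F x) powr (p - 1)" by (simp add: L_def divide_inverse)
      then show ?thesis by (simp add: small_def pos_le_divide_eq[OF P] mult.commute)
    qed
    have "(\<integral>\<^sup>+l. ennreal (8 * pi * q * l powr (q - 3)) * (ennreal ((norm (F x))\<^sup>2) * (of_bool (small l x)
        * indicator {0..} l)) \<partial>lborel)
      = (\<integral>\<^sup>+l. ennreal (8 * pi * q * (norm (F x))\<^sup>2) * (ennreal (l powr ((q - 2) - 1)) * indicator {0..L} l)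
          \<partial>lborel)"
      using q by (intro nn_integral_cong) (auto simp: sL ennreal_mult mult_ac split: split_indicator)
    also have "\<dots> = ennreal (8 * pi * q * (norm (F x))\<^sup>2) * (\<integral>\<^sup>+l. ennreal (l powr ((q - 2) - 1))
        * indicator {0..L} l \<partial>lborel)"
      by (rule nn_integral_cmult) auto
    also have "\<dots> = ennreal (8 * pi * q * (norm (F x))\<^sup>2 * (L powr (q - 2) / (q - 2)))"
      using q L0 by (subst nn_integral_powr_from_0) (auto simp del: times_divide_eq_right intro!:
          ennreal_mult[symmetric])
    also have "(norm (F x))\<^sup>2 * L powr (q - 2) = (2 * A) powr (q - 2) * norm (F x) powr p"
    proof -
      have "L powr (q - 2) = (2 * A) powr (q - 2) * norm (F x) powr (p - 2)"
        using A by (simp add: L_def powr_mult powr_powr q)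
      moreover have "(norm (F x))\<^sup>2 * norm (F x) powr (p - 2) = norm (F x) powr p"
        using False powr_add[of "norm (F x)" 2 "p - 2"] by (simp add: powr_two_nonneg)
      ultimately show ?thesis by (simp add: mult_ac)
    qed
    then have "8 * pi * q * (norm (F x))\<^sup>2 * (L powr (q - 2) / (q - 2))
        = 8 * pi * q / (q - 2) * (2 * A) powr (q - 2) * norm (F x) powr p"
      by (simp add: field_simps)
    finally show ?thesis using q by (subst ennreal_mult[symmetric]) auto
  qed auto
  have "Lp_pow q H = (\<integral>\<^sup>+\<xi>. \<integral>\<^sup>+l. ennreal (q * l powr (q - 1)) * indicator {0..norm (H \<xi>)} l \<partial>lborel \<partial>lborel)"
    unfolding Lp_pow_lborel layer ..
  also have "\<dots> = (\<integral>\<^sup>+l. \<integral>\<^sup>+\<xi>. ennreal (q * l powr (q - 1)) * indicator {0..norm (H \<xi>)} l \<partial>lborel \<partial>lborel)"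
    unfolding indicator_def atLeastAtMost_iff by (rule lborel_pair.Fubini') measurable
  also have "\<dots> = (\<integral>\<^sup>+l. ennreal (q * l powr (q - 1)) * (\<integral>\<^sup>+\<xi>. indicator {0..norm (H \<xi>)} l \<partial>lborel) \<partial>lborel)"
    unfolding indicator_def atLeastAtMost_iff by (intro nn_integral_cong nn_integral_cmult) measurable
  also have "\<dots> \<le> (\<integral>\<^sup>+l. \<integral>\<^sup>+x. ennreal (8 * pi * q * l powr (q - 3)) * (ennreal ((norm (F x))\<^sup>2)
      * (of_bool (small l x) * indicator {0..} l)) \<partial>lborel \<partial>lborel)"
  proof (intro nn_integral_mono)
    fix l :: real
    show "ennreal (q * l powr (q - 1)) * (\<integral>\<^sup>+\<xi>. indicator {0..norm (H \<xi>)} l \<partial>lborel)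
       \<le> (\<integral>\<^sup>+x. ennreal (8 * pi * q * l powr (q - 3)) * (ennreal ((norm (F x))\<^sup>2) * (of_bool (small l x)
           * indicator {0..} l)) \<partial>lborel)"
    proof (cases "l > 0")
      case True
      have "ennreal (q * l powr (q - 1)) * (\<integral>\<^sup>+\<xi>. indicator {0..norm (H \<xi>)} l \<partial>lborel)
        \<le> ennreal (q * l powr (q - 1)) * (ennreal (8 * pi / l\<^sup>2) * (\<integral>\<^sup>+x. ennreal ((norm (F x))\<^sup>2)
            * of_bool (small l x) \<partial>lborel))"
        by (intro mult_left_mono level True) auto
      also have "\<dots> = ennreal (8 * pi * q * l powr (q - 3)) * (\<integral>\<^sup>+x. ennreal ((norm (F x))\<^sup>2) * of_bool (small l
          x) \<partial>lborel)"
      proof -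
        have "l powr (q - 1) = l powr (q - 3) * l\<^sup>2" using True powr_add[of l "q - 3" 2]
            by (simp add: powr_two_nonneg)
        then have "q * l powr (q - 1) * (8 * pi / l\<^sup>2) = 8 * pi * q * l powr (q - 3)" using True by simp
        then show ?thesis using q by (simp add: mult.assoc[symmetric] ennreal_mult[symmetric])
      qed
      also have "\<dots> = (\<integral>\<^sup>+x. ennreal (8 * pi * q * l powr (q - 3)) * (ennreal ((norm (F x))\<^sup>2) * of_bool (small l
          x)) \<partial>lborel)"
        by (rule nn_integral_cmult[symmetric]) measurable
      finally show ?thesis using True by simp
    next
      case False
      then show ?thesis by (cases "l = 0") (auto simp: not_less)
    qed
  qed
  also have "\<dots> = (\<integral>\<^sup>+x. \<integral>\<^sup>+l. ennreal (8 * pi * q * l powr (q - 3)) * (ennreal ((norm (F x))\<^sup>2)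
      * (of_bool (small l x) * indicator {0..} l)) \<partial>lborel \<partial>lborel)"
    by (rule lborel_pair.Fubini') measurable
  also have "\<dots> \<le> (\<integral>\<^sup>+x. ennreal (8 * pi * q / (q - 2) * (2 * A) powr (q - 2)) * ennreal (norm (F x) powr p)
      \<partial>lborel)"
    by (intro nn_integral_mono inner)
  also have "\<dots> = ennreal (8 * pi * q / (q - 2) * (2 * A) powr (q - 2)) * Lp_pow p F"
    unfolding Lp_pow_lborel by (rule nn_integral_cmult) measurable
  also have "\<dots> \<le> ennreal (8 * pi * q / (q - 2) * (2 * A) powr (q - 2)) * ennreal A"
    by (intro mult_left_mono FA) auto
  also have "\<dots> = ennreal (8 * pi * q * 2 powr (q - 2) / (q - 2) * A powr (q - 1))"
  proof -
    have "A powr (q - 1) = A powr (q - 2) * A" using A powr_add[of A "q - 2" 1] by simp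
    then have "8 * pi * q / (q - 2) * (2 * A) powr (q - 2) * A
        = 8 * pi * q * 2 powr (q - 2) / (q - 2) * A powr (q - 1)"
      using A by (simp add: powr_mult)
    then show ?thesis using A q by (simp add: ennreal_mult[symmetric])
  qed
  finally show ?thesis by (simp add: H_def q(2) flip: q_def)
qed

text \<open>
  At \<open>p = 2\<close>, where the constant of the interpolation blows up, the statement is the Plancherel inequality.
\<close>

lemma hausdorff_young:
  assumes p: "1 < p" "p \<le> 2"
  obtains C where "C > 0" "\<And>F A. integrable lborel F \<Longrightarrow> A > 0 \<Longrightarrow> Lp_pow p F \<le> ennreal A \<Longrightarrow>
    Lp_pow (p / (p - 1)) (fourier F) \<le> ennreal (C * A powr (1 / (p - 1)))"
proof (cases "p = 2")
  case True
  show ?thesis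
  proof (rule that[of "2 * pi"])
    fix F :: "real \<Rightarrow> complex" and A :: real
    assume F: "integrable lborel F" and A: "A > 0" "Lp_pow p F \<le> ennreal A"
    have [measurable]: "F \<in> borel_measurable borel" using F by auto
    have "Lp_pow 2 (fourier F) \<le> ennreal (2 * pi) * Lp_pow 2 F"
      using plancherel_le[OF F] by (simp add: Lp_pow_lborel powr_two_nonneg fourier_lborel)
    also have "\<dots> \<le> ennreal (2 * pi) * ennreal A" using A True by (intro mult_left_mono) auto
    finally show "Lp_pow (p / (p - 1)) (fourier F) \<le> ennreal (2 * pi * A powr (1 / (p - 1)))"
      using True A by (simp add: ennreal_mult)
  qed auto
next
  case False
  with p have p: "1 < p" "p < 2" by auto
  show ?thesis
  proof (rule that[OF _ hausdorff_young_below_2[OF p]])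
    have "p / (p - 1) > 2" using p by (simp add: field_simps)
    then show "0 < 8 * pi * (p / (p - 1)) * 2 powr (p / (p - 1) - 2) / (p / (p - 1) - 2)"
      using p by (intro divide_pos_pos mult_pos_pos) auto
  qed
qed

section \<open>The Fourier transform on \<open>L\<^sup>p\<close>\<close>

lemma powr_add_le:
  fixes u v p :: real
  assumes "0 \<le> u" "0 \<le> v" "0 \<le> p"
  shows "(u + v) powr p \<le> 2 powr p * (u powr p + v powr p)"
proof -
  have "(u + v) powr p \<le> (2 * max u v) powr p" using assms by (intro powr_mono2) auto
  also have "\<dots> = 2 powr p * max u v powr p" using assms by (intro powr_mult)
  also have "max u v powr p \<le> u powr p + v powr p" by (auto simp: max_def)
  finally show ?thesis by (simp add: mult_left_mono)
qed

lemma Lp_pow_add_le: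
  assumes [measurable]: "f \<in> borel_measurable borel" "g \<in> borel_measurable borel" and p: "0 \<le> p"
  shows "Lp_pow p (\<lambda>x. f x + g x) \<le> ennreal (2 powr p) * (Lp_pow p f + Lp_pow p g)"
proof -
  have "Lp_pow p (\<lambda>x. f x + g x) \<le> (\<integral>\<^sup>+x. ennreal (2 powr p) * (ennreal (norm (f x) powr p) + ennreal (norm (g
      x) powr p)) \<partial>lborel)"
    unfolding Lp_pow_lborel
  proof (intro nn_integral_mono)
    fix x
    have "norm (f x + g x) powr p \<le> (norm (f x) + norm (g x)) powr p" using p norm_triangle_ineq
        by (intro powr_mono2) auto
    also have "\<dots> \<le> 2 powr p * (norm (f x) powr p + norm (g x) powr p)" using p by (intro powr_add_le) auto
    finally show "ennreal (norm (f x + g x) powr p) \<le> ennreal (2 powr p) * (ennreal (norm (f x) powr p)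
        + ennreal (norm (g x) powr p))"
      by (simp add: ennreal_plus[symmetric] ennreal_mult[symmetric] ennreal_leI del: ennreal_plus)
  qed
  also have "\<dots> = ennreal (2 powr p) * (Lp_pow p f + Lp_pow p g)"
    unfolding Lp_pow_lborel by (subst nn_integral_cmult, measurable, subst nn_integral_add) auto
  finally show ?thesis .
qed

lemma Lp_pow_cong_AE: "AE x in lebesgue. f x = g x \<Longrightarrow> Lp_pow p f = Lp_pow p g"
  unfolding Lp_pow_def by (rule nn_integral_cong_AE) auto

lemma Lp_pow_minus_commute: "Lp_pow p (\<lambda>x. f x - g x) = Lp_pow p (\<lambda>x. g x - f x)"
  by (simp add: Lp_pow_def norm_minus_commute)

lemma complex_borel_representative:
  fixes f :: "real \<Rightarrow> complex"
  assumes f: "f \<in> borel_measurable lebesgue"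
  obtains f' where "f' \<in> borel_measurable borel" "AE x in lebesgue. f x = f' x"
proof -
  have "(\<lambda>x. Re (f x)) \<in> borel_measurable lebesgue" "(\<lambda>x. Im (f x)) \<in> borel_measurable lebesgue" using f by auto
  then obtain u v where uv [measurable]: "u \<in> borel_measurable borel" "v \<in> borel_measurable borel"
    and ae: "AE x in lborel. Re (f x) = u x" "AE x in lborel. Im (f x) = v x"
    using completion_ex_borel_measurable_real[of "\<lambda>x. Re (f x)" lborel]
      completion_ex_borel_measurable_real[of "\<lambda>x. Im (f x)" lborel] by auto
  show ?thesis
  proof (rule that[of "\<lambda>x. Complex (u x) (v x)"])
    show "(\<lambda>x. Complex (u x) (v x)) \<in> borel_measurable borel"
      by (subst borel_measurable_complex_iff) auto
    from ae have "AE x in lborel. f x = Complex (u x) (v x)" by eventually_elim (auto simp: complex_eq_iff)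
    then show "AE x in lebesgue. f x = Complex (u x) (v x)" by (rule AE_completion)
  qed
qed

lemma fourier_cong_AE:
  assumes "f \<in> borel_measurable lebesgue" "g \<in> borel_measurable lebesgue" "AE x in lebesgue. f x = g x"
  shows "fourier f = fourier g"
proof
  fix \<xi>
  have [measurable]: "(\<lambda>x::real. exp (- (\<i> * complex_of_real (x * \<xi>)))) \<in> borel_measurable lebesgue"
    by (rule measurable_completion) measurable
  note [measurable] = assms(1,2)
  show "fourier f \<xi> = fourier g \<xi>" unfolding fourier_def
  proof (rule integral_cong_AE)
    show "AE x in lebesgue. exp (- (\<i> * complex_of_real (x * \<xi>))) * f x
        = exp (- (\<i> * complex_of_real (x * \<xi>))) * g x"
      using assms(3) by eventually_elim simp
  qed measurable
qed

text \<open>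
  Completeness of \<open>L\<^sup>q\<close> for rapidly convergent sequences. The series of the functions
  \<open>(2\<^sup>n \<bar>G\<^sub>n - G\<^sub>n\<^sub>+\<^sub>1\<bar>) powr q\<close> has a finite integral, so almost everywhere the differences are
  \<open>O(2 powr - n)\<close> and \<open>G\<^sub>n\<close> converges; Fatou's lemma turns the hypothesis into the estimate for the limit.
\<close>

lemma Lp_complete_fast:
  fixes G :: "nat \<Rightarrow> real \<Rightarrow> complex"
  assumes [measurable]: "\<And>n. G n \<in> borel_measurable borel" and q: "q > 0"
    and fast: "\<And>n m. n \<le> m \<Longrightarrow> Lp_pow q (\<lambda>x. G n x - G m x) \<le> ennreal ((1 / 4) powr (q * real n))"
  obtains g where "g \<in> borel_measurable borel"
    "\<And>n. Lp_pow q (\<lambda>x. G n x - g x) \<le> ennreal ((1 / 4) powr (q * real n))"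
proof -
  define D where "D n x = ennreal ((2 powr real n * norm (G n x - G (Suc n) x)) powr q)" for n x
  have [measurable]: "D n \<in> borel_measurable borel" for n unfolding D_def by measurable
  have D: "(\<integral>\<^sup>+x. D n x \<partial>lborel) \<le> ennreal (((1/2) powr q) ^ n)" for n
  proof -
    have "(\<integral>\<^sup>+x. D n x \<partial>lborel) = (\<integral>\<^sup>+x. ennreal (2 powr (q * real n)) * ennreal (norm (G n x - G (Suc n) x)
        powr q) \<partial>lborel)"
      by (intro nn_integral_cong) (auto simp: D_def powr_mult powr_powr ennreal_mult mult_ac)
    also have "\<dots> = ennreal (2 powr (q * real n)) * Lp_pow q (\<lambda>x. G n x - G (Suc n) x)"
      unfolding Lp_pow_lborel by (rule nn_integral_cmult) auto
    also have "\<dots> \<le> ennreal (2 powr (q * real n)) * ennreal ((1 / 4) powr (q * real n))"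
      by (intro mult_left_mono fast) auto
    also have "\<dots> = ennreal (((1/2) powr q) ^ n)"
    proof -
      have "2 powr (q * real n) * (1 / 4) powr (q * real n) = (1/2::real) powr (q * real n)"
        by (subst powr_mult[symmetric]) auto
      also have "\<dots> = ((1/2) powr q) ^ n" by (simp add: powr_powr[symmetric] powr_realpow)
      finally show ?thesis by (simp add: ennreal_mult[symmetric])
    qed
    finally show ?thesis .
  qed
  have "(\<integral>\<^sup>+x. (\<Sum>n. D n x) \<partial>lborel) = (\<Sum>n. \<integral>\<^sup>+x. D n x \<partial>lborel)"
    by (rule nn_integral_suminf) auto
  also have "\<dots> \<le> (\<Sum>n. ennreal (((1/2) powr q) ^ n))" by (intro suminf_le D) auto
  also have "\<dots> = ennreal (\<Sum>n. ((1/2) powr q) ^ n)"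
    using q powr_less_mono2[of q "1/2" 1] by (intro suminf_ennreal2 summable_geometric) auto
  finally have "(\<integral>\<^sup>+x. (\<Sum>n. D n x) \<partial>lborel) \<noteq> \<infinity>" by (auto simp: top_unique)
  then have "AE x in lborel. (\<Sum>n. D n x) \<noteq> \<infinity>"
    by (intro nn_integral_PInf_AE) auto
  then have conv: "AE x in lborel. convergent (\<lambda>n. G n x)"
  proof eventually_elim
    case (elim x)
    then obtain B where B: "(\<Sum>n. D n x) = ennreal B" "0 \<le> B" by (cases "\<Sum>n. D n x") auto
    have le: "norm (G (Suc n) x - G n x) \<le> B powr (1 / q) * (1/2) ^ n" for n
    proof -
      have "D n x \<le> ennreal B" using B(1) ennreal_suminf_lessD[of "\<lambda>n. D n x" ] sum_le_suminf[of "\<lambda>n. D n x"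
          "{n}"] by simp
      then have "(2 powr real n * norm (G n x - G (Suc n) x)) powr q \<le> B" using B by (simp add: D_def)
      then have "((2 powr real n * norm (G n x - G (Suc n) x)) powr q) powr (1 / q) \<le> B powr (1 / q)"
        using q by (intro powr_mono2) auto
      then have "2 ^ n * norm (G n x - G (Suc n) x) \<le> B powr (1 / q)" using q
          by (simp add: powr_powr powr_realpow)
      then show ?thesis by (simp add: norm_minus_commute field_simps power_one_over)
    qed
    have "summable (\<lambda>n. G (Suc n) x - G n x)"
      by (rule summable_comparison_test'[OF _ le]) (intro summable_mult summable_geometric, simp)
    then have "convergent (\<lambda>n. (\<Sum>i<n. G (Suc i) x - G i x))" by (simp add: summable_iff_convergent)
    then have "convergent (\<lambda>n. G n x - G 0 x)" by (simp only: sum_lessThan_telescope[of "\<lambda>i. G i x"])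
    then have "convergent (\<lambda>n. (G n x - G 0 x) + G 0 x)" by (rule convergent_add[OF _ convergent_const])
    then show ?case by simp
  qed
  define g where "g x = lim (\<lambda>n. G n x)" for x
  have [measurable]: "g \<in> borel_measurable borel" unfolding g_def by measurable
  show ?thesis
  proof (rule that)
    show "g \<in> borel_measurable borel" by measurable
    fix n
    have "Lp_pow q (\<lambda>x. G n x - g x) = (\<integral>\<^sup>+x. liminf (\<lambda>m. ennreal (norm (G n x - G m x) powr q)) \<partial>lborel)"
      unfolding Lp_pow_lborel
    proof (rule nn_integral_cong_AE)
      from conv show "AE x in lborel. ennreal (norm (G n x - g x) powr q)
          = liminf (\<lambda>m. ennreal (norm (G n x - G m x) powr q))"
      proof eventually_elim
        case (elim x)
        then have "(\<lambda>m. G m x) \<longlonglongrightarrow> g x" by (simp add: g_def convergent_LIMSEQ_iff)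
        then have "(\<lambda>m. ennreal (norm (G n x - G m x) powr q)) \<longlonglongrightarrow> ennreal (norm (G n x - g x) powr q)"
          using q by (intro tendsto_ennrealI tendsto_powr' tendsto_intros) auto
        then show ?case by (intro lim_imp_Liminf[symmetric]) auto
      qed
    qed
    also have "\<dots> \<le> liminf (\<lambda>m. Lp_pow q (\<lambda>x. G n x - G m x))"
      unfolding Lp_pow_lborel by (rule nn_integral_liminf) auto
    also have "\<dots> \<le> ennreal ((1 / 4) powr (q * real n))"
      by (intro Liminf_le eventually_sequentiallyI[of n] fast) auto
    finally show "Lp_pow q (\<lambda>x. G n x - g x) \<le> ennreal ((1 / 4) powr (q * real n))" .
  qed
qed

text \<open>
  The truncations of \<open>f\<close> to \<open>[-n, n]\<close> converge to \<open>f\<close> in \<open>L\<^sup>p\<close>, and by the Hausdorff--Young inequality a fast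
  subsequence of them has transforms that converge rapidly in \<open>L\<^sup>q\<close>.
\<close>

lemma is_fourier_Lp_exists:
  assumes p: "1 < p" "p \<le> 2" and f [measurable]: "f \<in> borel_measurable borel" and fp: "Lp_pow p f < \<infinity>"
  shows "\<exists>g. is_fourier_Lp p f g"
proof -
  define q where "q = p / (p - 1)"
  have q: "q > 1" using p by (simp add: q_def field_simps)
  obtain C where C: "C > 0" and HY: "\<And>F A. integrable lborel F \<Longrightarrow> A > 0 \<Longrightarrow> Lp_pow p F \<le> ennreal A \<Longrightarrow>
    Lp_pow q (fourier F) \<le> ennreal (C * A powr (1 / (p - 1)))"
    using hausdorff_young[OF p] unfolding q_def by blast
  define T where "T n x = (if \<bar>x\<bar> \<le> real n then f x else 0)" for n x
  have [measurable]: "T n \<in> borel_measurable borel" for n unfolding T_def by measurable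
  have intT: "integrable lborel (T n)" for n
  proof (rule integrableI_bounded)
    have "(\<integral>\<^sup>+x. ennreal (norm (T n x)) \<partial>lborel) \<le> (\<integral>\<^sup>+x. indicator {-real n..real n} x + ennreal (norm (f x)
        powr p) \<partial>lborel)"
    proof (intro nn_integral_mono)
      fix x
      show "ennreal (norm (T n x)) \<le> indicator {-real n..real n} x + ennreal (norm (f x) powr p)"
      proof (cases "\<bar>x\<bar> \<le> real n")
        case True
        have "norm (f x) \<le> 1 + norm (f x) powr p"
        proof (cases "norm (f x) \<le> 1")
          case False
          then have "norm (f x) powr 1 \<le> norm (f x) powr p" using p by (intro powr_mono) auto
          then show ?thesis using False by simp
        qed (simp add: add_increasing2)
        moreover have "T n x = f x" using True by (simp add: T_def)
        ultimately have "ennreal (norm (T n x)) \<le> ennreal (1 + norm (f x) powr p)"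
            by (simp only:) (rule ennreal_leI)
        also have "\<dots> = ennreal 1 + ennreal (norm (f x) powr p)" by (rule ennreal_plus) auto
        also have "ennreal 1 = indicator {-real n..real n} x" using True by (simp add: indicator_def abs_le_iff)
        finally show ?thesis .
      qed (simp add: T_def)
    qed
    also have "\<dots> = emeasure lborel {-real n..real n} + Lp_pow p f"
      unfolding Lp_pow_lborel by (subst nn_integral_add) auto
    also have "\<dots> < \<infinity>" using fp by simp
    finally show "(\<integral>\<^sup>+x. ennreal (norm (T n x)) \<partial>lborel) < \<infinity>" .
  qed measurable
  \<comment> \<open>the accuracy in \<open>L\<^sup>p\<close> that guarantees the accuracy \<open>4 powr - (q n)\<close> for the transforms\<close>
  define \<delta> where "\<delta> n = ((1 / 4) powr (q * real n) / C) powr (p - 1)" for n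
  have \<delta>: "\<delta> n > 0" "C * \<delta> n powr (1 / (p - 1)) = (1 / 4) powr (q * real n)" for n
    using C p by (auto simp: \<delta>_def powr_powr)
  have lim: "(\<lambda>n. Lp_pow p (\<lambda>x. T n x - f x)) \<longlonglongrightarrow> 0"
  proof -
    have "(\<lambda>n. \<integral>\<^sup>+x. ennreal (norm (T n x - f x) powr p) \<partial>lborel) \<longlonglongrightarrow> (\<integral>\<^sup>+x. 0 \<partial>(lborel :: real measure))"
    proof (rule nn_integral_dominated_convergence[where w="\<lambda>x. ennreal (norm (f x) powr p)"])
      show "AE x in lborel. (\<lambda>n. ennreal (norm (T n x - f x) powr p)) \<longlonglongrightarrow> 0"
      proof (intro AE_I2 tendsto_eventually)
        fix x
        show "\<forall>\<^sub>F n in sequentially. ennreal (norm (T n x - f x) powr p) = 0"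
          by (intro eventually_sequentiallyI[of "nat \<lceil>\<bar>x\<bar>\<rceil>"]) (auto simp: T_def nat_le_iff ceiling_le_iff)
      qed
    qed (use fp in \<open>auto simp: Lp_pow_lborel T_def\<close>)
    then show ?thesis by (simp add: Lp_pow_lborel)
  qed
  have tail: "Lp_pow p (\<lambda>x. T n x - T m x) \<le> Lp_pow p (\<lambda>x. T n x - f x)" if "n \<le> m" for n m
    unfolding Lp_pow_lborel using that by (intro nn_integral_mono) (auto simp: T_def)
  have "\<exists>N. \<forall>k. N k \<ge> k \<and> (\<forall>n\<ge>N k. Lp_pow p (\<lambda>x. T n x - f x) \<le> ennreal (\<delta> k))"
  proof (intro choice allI)
    fix k
    have "\<forall>\<^sub>F n in sequentially. Lp_pow p (\<lambda>x. T n x - f x) < ennreal (\<delta> k)"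
      using \<delta>(1) by (intro order_tendstoD(2)[OF lim]) auto
    then obtain N where "\<And>n. n \<ge> N \<Longrightarrow> Lp_pow p (\<lambda>x. T n x - f x) < ennreal (\<delta> k)"
      by (auto simp: eventually_sequentially)
    then show "\<exists>N\<ge>k. \<forall>n\<ge>N. Lp_pow p (\<lambda>x. T n x - f x) \<le> ennreal (\<delta> k)"
      by (intro exI[of _ "max N k"]) (auto intro: less_imp_le)
  qed
  then obtain N where N: "\<And>k. N k \<ge> k" "\<And>k n. n \<ge> N k \<Longrightarrow> Lp_pow p (\<lambda>x. T n x - f x) \<le> ennreal (\<delta> k)" by blast
  \<comment> \<open>taking maxima makes the indices of the subsequence increasing\<close>
  define M where "M k = Max (N ` {..k})" for k
  have M: "M k \<ge> N k" "\<And>j. j \<le> k \<Longrightarrow> M j \<le> M k" for k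
    unfolding M_def by (auto intro!: Max_ge Max_mono)
  have diff: "fourier (T n) \<xi> - fourier (T m) \<xi> = fourier (\<lambda>x. T n x - T m x) \<xi>" for n m \<xi>
  proof -
    have "fourier (T n) \<xi> - fourier (T m) \<xi> = (LINT x|lborel. exp (- (\<i> * of_real (x * \<xi>))) * T n x - exp (- (\<i>
        * of_real (x * \<xi>))) * T m x)"
      unfolding fourier_lborel[OF \<open>T n \<in> _\<close>] fourier_lborel[OF \<open>T m \<in> _\<close>]
      by (rule Bochner_Integration.integral_diff[symmetric]; intro integrable_fourier_kernel intT)
    also have "\<dots> = fourier (\<lambda>x. T n x - T m x) \<xi>"
      by (subst fourier_lborel) (auto simp: right_diff_distrib)
    finally show ?thesis .
  qed
  obtain g where g [measurable]: "g \<in> borel_measurable borel"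
    and gl: "\<And>n. Lp_pow q (\<lambda>\<xi>. fourier (T (M n)) \<xi> - g \<xi>) \<le> ennreal ((1 / 4) powr (q * real n))"
  proof (rule Lp_complete_fast[of "\<lambda>n. fourier (T (M n))" q])
    fix n m :: nat assume nm: "n \<le> m"
    have "Lp_pow q (\<lambda>\<xi>. fourier (T (M n)) \<xi> - fourier (T (M m)) \<xi>)
        = Lp_pow q (fourier (\<lambda>x. T (M n) x - T (M m) x))"
      by (simp add: diff)
    also have "\<dots> \<le> ennreal (C * \<delta> n powr (1 / (p - 1)))"
    proof (rule HY)
      show "integrable lborel (\<lambda>x. T (M n) x - T (M m) x)" by (intro Bochner_Integration.integrable_diff intT)
      show "Lp_pow p (\<lambda>x. T (M n) x - T (M m) x) \<le> ennreal (\<delta> n)"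
        using tail[OF M(2)[OF nm]] N(2)[OF M(1)] order_trans by blast
    qed (rule \<delta>)
    finally show "Lp_pow q (\<lambda>\<xi>. fourier (T (M n)) \<xi> - fourier (T (M m)) \<xi>)
        \<le> ennreal ((1 / 4) powr (q * real n))"
      by (simp add: \<delta>)
  qed (use q in auto)
  have Tp: "Lp_pow p (T n) < \<infinity>" for n
  proof -
    have "Lp_pow p (T n) \<le> Lp_pow p f" unfolding Lp_pow_lborel by (intro nn_integral_mono) (auto simp: T_def)
    then show ?thesis using fp by simp
  qed
  show ?thesis unfolding is_fourier_Lp_def q_def[symmetric]
  proof (intro exI[of _ g] conjI exI[of _ "\<lambda>n. T (M n)"] allI)
    obtain A where A: "Lp_pow p (T (M 0)) \<le> ennreal A" "A > 0"
    proof -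
      obtain A where "Lp_pow p (T (M 0)) = ennreal A" "A \<ge> 0" using Tp[of "M 0"]
          by (cases "Lp_pow p (T (M 0))") auto
      then show ?thesis by (intro that[of "A + 1"]) auto
    qed
    have "Lp_pow q (fourier (T (M 0))) < \<infinity>" using HY[OF intT A(2,1)]
        by (auto simp: top_unique intro: le_less_trans)
    moreover have "Lp_pow q (\<lambda>\<xi>. g \<xi> - fourier (T (M 0)) \<xi>) < \<infinity>"
      using gl[of 0] by (subst Lp_pow_minus_commute) (auto intro: le_less_trans)
    moreover have "Lp_pow q (\<lambda>\<xi>. fourier (T (M 0)) \<xi> + (g \<xi> - fourier (T (M 0)) \<xi>))
        \<le> ennreal (2 powr q) * (Lp_pow q (fourier (T (M 0))) + Lp_pow q (\<lambda>\<xi>. g \<xi> - fourier (T (M 0)) \<xi>))"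
      using q by (intro Lp_pow_add_le) auto
    ultimately have "Lp_pow q g < \<infinity>" by (auto simp: ennreal_mult_less_top intro: le_less_trans)
    then show "g \<in> Lp_space q" by (auto simp: Lp_space_def intro!: measurable_completion)
    show "T (M n) \<in> Lp_space 1 \<inter> Lp_space p" for n
      using Tp[of "M n"] intT[of "M n"] by (auto simp: Lp_space_def Lp_pow_lborel integrable_iff_bounded intro!:
          measurable_completion)
    show "(\<lambda>n. Lp_pow p (\<lambda>x. T (M n) x - f x)) \<longlonglongrightarrow> 0"
    proof (rule filterlim_compose[OF lim])
      show "filterlim M at_top sequentially"
        by (rule filterlim_at_top_mono[OF filterlim_ident]) (auto intro!: always_eventually order_trans[OF N(1)
            M(1)])
    qed
    show "(\<lambda>n. Lp_pow q (\<lambda>\<xi>. fourier (T (M n)) \<xi> - g \<xi>)) \<longlonglongrightarrow> 0"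
    proof (rule tendsto_sandwich[OF _ _ tendsto_const])
      have "(\<lambda>n. ((1/4) powr q) ^ n) \<longlonglongrightarrow> 0" using q powr_less_mono2[of q "1/4" 1]
          by (intro LIMSEQ_power_zero) auto
      then have "(\<lambda>n. (1 / 4) powr (q * real n)) \<longlonglongrightarrow> 0" by (simp add: powr_powr[symmetric] powr_realpow)
      then show "(\<lambda>n. ennreal ((1 / 4) powr (q * real n))) \<longlonglongrightarrow> 0" using tendsto_ennrealI by fastforce
    qed (use gl in auto)
  qed
qed

section \<open>Smooth step functions\<close>

text \<open>
  The sets over which the truncation of \<open>w\<close> to \<open>[-M, M]\<close> has vanishing integral form a Dynkin system that
  contains the half-lines, hence all Borel sets.
\<close>

lemma AE_zero_if_interval_integrals_zero:
  fixes w :: "real \<Rightarrow> complex"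
  assumes [measurable]: "w \<in> borel_measurable borel"
    and int: "\<And>M. set_integrable lborel {-M..M} w"
    and zero: "\<And>c d. c < d \<Longrightarrow> (LINT x:{c..d}|lborel. w x) = 0"
  shows "AE x in lborel. w x = 0"
proof -
  have zero': "(LINT x:{c..d}|lborel. w x) = 0" for c d
  proof -
    consider "c < d" | "c = d" | "d < c" by linarith
    then show ?thesis
    proof cases
      case 2
      have "(LINT x:{c..d}|lborel. w x) = (LINT (x::real)|lborel. 0)" unfolding set_lebesgue_integral_def
        by (intro integral_cong_AE) (use 2 AE_lborel_singleton[of c] in auto)
      then show ?thesis by simp
    qed (use zero in \<open>auto simp: set_lebesgue_integral_def\<close>)
  qed
  have "AE x in lborel. x \<in> {-real M..real M} \<longrightarrow> w x = 0" for M :: nat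
  proof -
    define f where "f x = indicator {-real M..real M} x *\<^sub>R w x" for x
    have f: "integrable lborel f" using int[of "real M"] unfolding f_def set_integrable_def .
    have [measurable]: "f \<in> borel_measurable borel" unfolding f_def by measurable
    have fA: "integrable lborel (\<lambda>x. indicator A x *\<^sub>R f x)" if "A \<in> sets borel" for A
      using f that by (intro integrable_mult_indicator) auto
    have "(LINT x:A|lborel. f x) = 0" if A: "A \<in> sets borel" for A
    proof -
      have "Int_stable (range (\<lambda>a::real. {..a}))" by (auto simp: Int_stable_def)
      moreover have "range (\<lambda>a::real. {..a}) \<subseteq> Pow UNIV" by auto
      moreover have "A \<in> sigma_sets UNIV (range (\<lambda>a::real. {..a}))"
        using A unfolding borel_eq_atMost by (simp add: sets_measure_of)
      ultimately show ?thesis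
      proof (induction rule: sigma_sets_induct_disjoint)
        case (basic A)
        then obtain a where a: "A = {..a}" by auto
        have "(LINT x:A|lborel. f x) = (LINT x:{-real M..min a (real M)}|lborel. w x)"
          unfolding set_lebesgue_integral_def f_def a
          by (intro Bochner_Integration.integral_cong) (auto split: split_indicator)
        then show ?case by (simp only: zero')
      next
        case empty then show ?case by (simp add: set_lebesgue_integral_def)
      next
        case (compl A)
        then have [measurable]: "A \<in> sets borel" unfolding borel_eq_atMost by (simp add: sets_measure_of)
        have "(LINT x:UNIV - A|lborel. f x) = (LINT x|lborel. f x - indicator A x *\<^sub>R f x)"
          unfolding set_lebesgue_integral_def
              by (intro Bochner_Integration.integral_cong) (auto split: split_indicator)
        also have "\<dots> = (LINT x|lborel. f x) - (LINT x:A|lborel. f x)"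
          unfolding set_lebesgue_integral_def by (rule Bochner_Integration.integral_diff[OF f fA]) auto
        also have "(LINT x|lborel. f x) = 0" using zero'[of "-real M" "real M"]
            by (simp add: f_def set_lebesgue_integral_def)
        finally show ?case using compl by simp
      next
        case (union A)
        then have [measurable]: "A i \<in> sets borel" for i unfolding borel_eq_atMost
            by (auto simp: sets_measure_of)
        have "set_integrable lborel (\<Union>i. A i) f" unfolding set_integrable_def by (rule fA) measurable
        then have "(LINT x:(\<Union>i. A i)|lborel. f x) = (\<Sum>i. (LINT x:(A i)|lborel. f x))"
          using union(1) by (intro lebesgue_integral_countable_add) (auto simp: disjoint_family_on_def)
        then show ?case using union by simp
      qed
    qed
    then have "AE x in lborel. f x = 0" by (intro sigma_finite_measure.density_zero[OF
        lborel.sigma_finite_measure_axioms f]) auto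
    then show ?thesis by eventually_elim (auto simp: f_def)
  qed
  then have "AE x in lborel. \<forall>M::nat. x \<in> {-real M..real M} \<longrightarrow> w x = 0" by (subst AE_all_countable) auto
  then show ?thesis
  proof eventually_elim
    case (elim x)
    obtain M :: nat where "\<bar>x\<bar> \<le> real M" using real_arch_simple by blast
    then show ?case using elim by (auto simp: abs_le_iff)
  qed
qed

text \<open>
  Carrying the sequence of derivatives in the definition makes closure under antiderivatives, differences and
  affine substitutions immediate, without reasoning about iterated \<open>deriv\<close>.
\<close>

definition smooth :: "(real \<Rightarrow> real) \<Rightarrow> bool" where
  "smooth f \<longleftrightarrow> (\<exists>D. D 0 = f \<and> (\<forall>k x. (D k has_real_derivative D (Suc k) x) (at x)))"

lemma smooth_iterated_deriv:
  assumes "D 0 = f" "\<And>k x. (D k has_real_derivative D (Suc k) x) (at x)"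
  shows "(deriv ^^ k) f = D k"
proof (induction k)
  case (Suc k)
  have "deriv (D k) = D (Suc k)" using assms(2) by (intro ext DERIV_imp_deriv)
  then show ?case using Suc by simp
qed (use assms in simp)

lemma smooth_imp_test_function:
  assumes "smooth f" and "\<And>x. x \<notin> {c..d} \<Longrightarrow> f x = 0"
  shows "test_function f"
proof -
  from assms(1) obtain D where D: "D 0 = f" "\<And>k x. (D k has_real_derivative D (Suc k) x) (at x)"
    unfolding smooth_def by blast
  have "{x. f x \<noteq> 0} \<subseteq> {c..d}" using assms(2) by blast
  then have "closure {x. f x \<noteq> 0} \<subseteq> {c..d}" by (rule closure_minimal) simp
  then have "compact (closure {x. f x \<noteq> 0})"
    by (meson bounded_closed_interval bounded_subset closed_closure compact_eq_bounded_closed)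
  then show ?thesis
    unfolding test_function_def smooth_iterated_deriv[of D f, OF D]
    using D(2) field_differentiable_def by blast
qed

lemma smooth_antiderivative:
  assumes "smooth f" "\<And>x. (F has_real_derivative f x) (at x)"
  shows "smooth F"
proof -
  from assms(1) obtain D where D: "D 0 = f" "\<And>k x. (D k has_real_derivative D (Suc k) x) (at x)"
    unfolding smooth_def by blast
  show ?thesis unfolding smooth_def
    by (intro exI[of _ "case_nat F D"]) (use D assms(2) in \<open>auto split: nat.split\<close>)
qed

lemma smooth_diff:
  assumes "smooth f" "smooth g"
  shows "smooth (\<lambda>x. f x - g x)"
proof -
  from assms obtain D E where "D 0 = f" "\<And>k x. (D k has_real_derivative D (Suc k) x) (at x)"
    "E 0 = g" "\<And>k x. (E k has_real_derivative E (Suc k) x) (at x)"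
    unfolding smooth_def by metis
  then show ?thesis unfolding smooth_def
    by (intro exI[of _ "\<lambda>k x. D k x - E k x"]) (auto intro!: DERIV_diff)
qed

lemma smooth_affine:
  assumes "smooth f"
  shows "smooth (\<lambda>x. f (r * x + s))"
proof -
  from assms obtain D where D: "D 0 = f" "\<And>k x. (D k has_real_derivative D (Suc k) x) (at x)"
    unfolding smooth_def by blast
  have "((\<lambda>x. r ^ k * D k (r * x + s)) has_real_derivative r ^ Suc k * D (Suc k) (r * x + s)) (at x)" for k x
  proof -
    have "((\<lambda>x. D k (r * x + s)) has_real_derivative D (Suc k) (r * x + s) * r) (at x)"
      by (rule DERIV_chain2[OF D(2)]) (auto intro!: derivative_eq_intros)
    from DERIV_cmult[OF this, of "r ^ k"] show ?thesis by (simp add: mult_ac)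
  qed
  then show ?thesis unfolding smooth_def
    by (intro exI[of _ "\<lambda>k x. r ^ k * D k (r * x + s)"]) (use D in auto)
qed

text \<open>
  On the unit interval this is \<open>P(x) v\<^sup>m exp (- v)\<close> with \<open>v = 1 / (x (1 - x))\<close>. The family is closed under
  differentiation because \<open>v' = - (1 - 2 x) v\<^sup>2\<close>, so that a single computation yields the derivatives of all
  orders.
\<close>

definition bump :: "real poly \<Rightarrow> nat \<Rightarrow> real \<Rightarrow> real" where
  "bump P m x = (if 0 < x \<and> x < 1 then poly P x * inverse (x * (1 - x)) ^ m * exp (- inverse (x * (1 - x))) else
      0)"

text \<open>
  Since \<open>v powr (m + 2) * exp (- v)\<close> is bounded, \<open>v\<^sup>m exp (- v)\<close> is of order \<open>v powr - 2 = (x (1 - x))\<^sup>2\<close>. The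
  bound gives differentiability at the endpoints \<open>0\<close> and \<open>1\<close>.
\<close>

lemma bump_quadratic_bound:
  obtains C where "\<And>x. \<bar>bump P m x\<bar> \<le> C * x\<^sup>2" "\<And>x. \<bar>bump P m x\<bar> \<le> C * (1 - x)\<^sup>2"
proof -
  have "bounded ((\<lambda>x. poly P x) ` {0..1})"
    by (intro compact_imp_bounded compact_continuous_image continuous_intros) auto
  then obtain B where "\<forall>x\<in>{0..1}. \<bar>poly P x\<bar> \<le> B" unfolding bounded_real by auto
  then have B: "\<And>x. 0 \<le> x \<Longrightarrow> x \<le> 1 \<Longrightarrow> \<bar>poly P x\<bar> \<le> B" by simp
  then have B0: "0 \<le> B" using order_trans[OF abs_ge_zero B[of 0]] by simp
  define n where "n = m + 2"
  have main: "\<bar>bump P m x\<bar> \<le> B * real n ^ n * (x * (1 - x))\<^sup>2" if x: "0 < x" "x < 1" for x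
  proof -
    define w where "w = x * (1 - x)"
    have w: "w > 0" using x by (simp add: w_def)
    define v where "v = inverse w"
    have v: "v > 0" using w by (simp add: v_def)
    have "(v / real n) ^ n \<le> (1 + v / real n) ^ n" using v by (intro power_mono) auto
    also have "\<dots> \<le> exp v" using v by (intro exp_ge_one_plus_x_over_n_power_n) (auto simp: n_def)
    finally have "v ^ n / real n ^ n \<le> exp v" by (simp only: power_divide)
    moreover have "real n ^ n > 0" by (simp add: n_def)
    ultimately have "v ^ n \<le> real n ^ n * exp v" by (simp only: pos_divide_le_eq mult.commute)
    then have "v ^ m * v\<^sup>2 * exp (- v) \<le> real n ^ n"
        by (simp add: n_def power_add exp_minus field_simps power2_eq_square)
    moreover have "v\<^sup>2 = 1 / w\<^sup>2" by (simp add: v_def power_inverse inverse_eq_divide power_divide)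
    ultimately have le: "v ^ m * exp (- v) \<le> real n ^ n * w\<^sup>2" using w by (simp add: field_simps)
    have "\<bar>bump P m x\<bar> = \<bar>poly P x\<bar> * (v ^ m * exp (- v))" using x v
        by (simp add: bump_def v_def w_def abs_mult)
    also have "\<dots> \<le> B * (real n ^ n * w\<^sup>2)" using x v B0 by (intro mult_mono B le) auto
    finally show ?thesis by (simp add: w_def mult_ac)
  qed
  show ?thesis
  proof (rule that[of "B * real n ^ n"])
    fix x :: real
    have *: "\<bar>bump P m x\<bar> \<le> B * real n ^ n * y" if "0 \<le> y" "0 < x \<Longrightarrow> x < 1 \<Longrightarrow> (x * (1 - x))\<^sup>2 \<le> y" for y
    proof (cases "0 < x \<and> x < 1")
      case True
      then show ?thesis using that B0 by (intro order_trans[OF main] mult_left_mono) auto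
    next
      case False
      then have "bump P m x = 0" unfolding bump_def by (rule if_not_P)
      then show ?thesis using that B0 by simp
    qed
    show "\<bar>bump P m x\<bar> \<le> B * real n ^ n * x\<^sup>2"
      by (rule *) (auto simp: power_mult_distrib intro!: mult_right_le_one_le power_le_one)
    show "\<bar>bump P m x\<bar> \<le> B * real n ^ n * (1 - x)\<^sup>2"
      by (rule *) (auto simp: power_mult_distrib intro!: mult_left_le_one_le power_le_one)
  qed
qed

lemma DERIV_zero_of_quadratic_bound:
  fixes f :: "real \<Rightarrow> real"
  assumes "\<And>x. \<bar>f x\<bar> \<le> C * (x - a)\<^sup>2"
  shows "(f has_real_derivative 0) (at a)"
proof -
  have fa: "f a = 0" using assms[of a] by simp
  have "(\<lambda>h. (f (a + h) - f a) / h) \<midarrow>0\<rightarrow> 0"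
  proof (rule tendsto_0_le[where K=1])
    show "((\<lambda>h. C * \<bar>h\<bar>) \<longlongrightarrow> 0) (at 0)" by (auto intro!: tendsto_eq_intros)
    show "\<forall>\<^sub>F h in at 0. norm ((f (a + h) - f a) / h) \<le> norm (C * \<bar>h\<bar>) * 1"
    proof (intro always_eventually allI)
      fix h
      show "norm ((f (a + h) - f a) / h) \<le> norm (C * \<bar>h\<bar>) * 1"
      proof (cases "h = 0")
        case False
        then show ?thesis using assms[of "a + h"] fa
            by (simp add: field_simps power2_eq_square abs_mult[symmetric])
      qed auto
    qed
  qed
  then show ?thesis by (simp add: DERIV_def)
qed

text \<open>
  The polynomial factor of the derivative, written over \<open>v powr (m + 2)\<close>; here \<open>[:0, 1, -1:]\<close> is \<open>x (1 - x)\<close>.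
\<close>

definition bump_next :: "real poly \<Rightarrow> nat \<Rightarrow> real poly" where
  "bump_next P m = pderiv P * [:0, 1, -1:]\<^sup>2 - smult (real m) (P * [:1, -2:] * [:0, 1, -1:]) + P * [:1, -2:]"

lemma bump_has_derivative: "(bump P m has_real_derivative bump (bump_next P m) (m + 2) x) (at x)"
proof -
  obtain C where C: "\<And>x. \<bar>bump P m x\<bar> \<le> C * x\<^sup>2" "\<And>x. \<bar>bump P m x\<bar> \<le> C * (1 - x)\<^sup>2"
    using bump_quadratic_bound by blast
  consider "0 < x" "x < 1" | "x = 0" | "x = 1" | "x < 0" | "x > 1" by linarith
  then show ?thesis
  proof cases
    case 1
    define w where "w = x * (1 - x)"
    have w: "w > 0" using 1 by (simp add: w_def)
    define I where "I y = inverse (y * (1 - y))" for y :: real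
    define D where "D = - (1 - 2 * x) * (inverse w)\<^sup>2"
    have Ix: "I x = inverse w" by (simp add: I_def w_def)
    have dI: "(I has_real_derivative D) (at x)"
      unfolding I_def D_def using w by (auto intro!: derivative_eq_intros simp: w_def power2_eq_square
          divide_inverse algebra_simps)
    have "((\<lambda>y. exp (- I y)) has_real_derivative exp (- I x) * (- D)) (at x)"
      by (rule DERIV_chain2[OF DERIV_exp DERIV_minus[OF dI]])
    from DERIV_mult[OF DERIV_mult[OF poly_DERIV[of P x] DERIV_power[OF dI, of m]] this]
    have "((\<lambda>y. poly P y * I y ^ m * exp (- I y)) has_real_derivative
       (poly (pderiv P) x * inverse w ^ m + real m * (- (1 - 2 * x) * (inverse w)\<^sup>2) * inverse w ^ (m - 1)
           * poly P x) * exp (- inverse w)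
        + exp (- inverse w) * (- (- (1 - 2 * x) * (inverse w)\<^sup>2)) * (poly P x * inverse w ^ m)) (at x)"
      by (rule DERIV_cong) (simp add: Ix D_def mult_ac)
    also have "(poly (pderiv P) x * inverse w ^ m + real m * (- (1 - 2 * x) * (inverse w)\<^sup>2) * inverse w ^ (m -
        1) * poly P x) * exp (- inverse w)
        + exp (- inverse w) * (- (- (1 - 2 * x) * (inverse w)\<^sup>2)) * (poly P x * inverse w ^ m)
            = bump (bump_next P m) (m + 2) x"
    proof -
      have e: "inverse w ^ m = inverse w ^ (m + 2) * w\<^sup>2" using w
          by (simp add: power_add power2_eq_square field_simps)
      have e2: "real m * inverse w ^ (m - 1) * (inverse w)\<^sup>2 = real m * (inverse w ^ (m + 2) * w)"
        using w by (cases m) (auto simp: power2_eq_square field_simps)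
      have "bump (bump_next P m) (m + 2) x = (poly (pderiv P) x * w\<^sup>2 - real m * (poly P x * (1 - 2 * x) * w)
          + poly P x * (1 - 2 * x)) * inverse w ^ (m + 2) * exp (- inverse w)"
        using 1 by (simp add: bump_def bump_next_def w_def algebra_simps)
      also have "\<dots> = (poly (pderiv P) x * (inverse w ^ (m + 2) * w\<^sup>2) - (real m * (inverse w ^ (m + 2) * w))
          * (1 - 2 * x) * poly P x) * exp (- inverse w)
         + exp (- inverse w) * (1 - 2 * x) * (inverse w)\<^sup>2 * (poly P x * inverse w ^ m)"
        by (simp add: power_add power2_eq_square algebra_simps)
      finally show ?thesis unfolding e[symmetric] e2[symmetric] by (simp add: algebra_simps)
    qed
    finally show ?thesis
      by (rule has_field_derivative_transform_within_open[of _ _ _ "{0<..<1}"]) (use 1 in \<open>auto simp: bump_def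
          I_def\<close>)
  next
    case 2
    have "(bump P m has_real_derivative 0) (at 0)"
        by (rule DERIV_zero_of_quadratic_bound[of _ C]) (use C in auto)
    then show ?thesis using 2 by (simp add: bump_def)
  next
    case 3
    have "(bump P m has_real_derivative 0) (at 1)"
        by (rule DERIV_zero_of_quadratic_bound[of _ C]) (use C in \<open>auto simp: power2_commute\<close>)
    then show ?thesis using 3 by (simp add: bump_def)
  next
    case 4
    have "((\<lambda>x. 0) has_real_derivative 0) (at x)" by simp
    then have "(bump P m has_real_derivative 0) (at x)"
      by (rule has_field_derivative_transform_within_open[of _ _ _ "{..<0}"]) (use 4 in \<open>auto simp: bump_def\<close>)
    then show ?thesis using 4 by (simp add: bump_def)
  next
    case 5
    have "((\<lambda>x. 0) has_real_derivative 0) (at x)" by simp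
    then have "(bump P m has_real_derivative 0) (at x)"
      by (rule has_field_derivative_transform_within_open[of _ _ _ "{1<..}"]) (use 5 in \<open>auto simp: bump_def\<close>)
    then show ?thesis using 5 by (simp add: bump_def)
  qed
qed

lemma smooth_bump: "smooth (bump P 0)"
proof -
  define S where "S k = ((\<lambda>(P, m). (bump_next P m, m + 2)) ^^ k) (P, 0)" for k
  have "((\<lambda>x. bump (fst (S k)) (snd (S k)) x) has_real_derivative bump (fst (S (Suc k))) (snd (S (Suc k))) x)
      (at x)" for k x
    using bump_has_derivative[of "fst (S k)" "snd (S k)" x] by (simp add: S_def case_prod_beta)
  then show ?thesis unfolding smooth_def
    by (intro exI[of _ "\<lambda>k. bump (fst (S k)) (snd (S k))"]) (auto simp: S_def)
qed

text \<open>
  Vanishing of \<open>f\<close> to the left of \<open>c\<close> makes the integral from \<open>c\<close>, which is \<open>0\<close> for \<open>x < c\<close> because the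
  interval is then empty, an antiderivative on the whole line.
\<close>

lemma antiderivative_from:
  fixes f :: "real \<Rightarrow> real"
  assumes cont: "continuous_on UNIV f" and z: "\<And>x. x \<le> c \<Longrightarrow> f x = 0"
  shows "((\<lambda>x. integral {c..x} f) has_real_derivative f x) (at x)"
proof (cases "x < c")
  case True
  have "((\<lambda>x. 0) has_real_derivative 0) (at x)" by simp
  then have "((\<lambda>x. integral {c..x} f) has_real_derivative 0) (at x)"
    by (rule has_field_derivative_transform_within_open[of _ _ _ "{..<c}"]) (use True in auto)
  then show ?thesis using True z by simp
next
  case False
  have eq: "integral {c - 1..y} f = integral {c..y} f" if "y > c - 1" for y
  proof (cases "y \<ge> c")
    case True
    have "integral {c - 1..c} f = 0"
      using Henstock_Kurzweil_Integration.integral_cong[of "{c-1..c}" f "\<lambda>_. 0"] z by auto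
    moreover have "integral {c - 1..c} f + integral {c..y} f = integral {c - 1..y} f"
      using True by (intro Henstock_Kurzweil_Integration.integral_combine integrable_continuous_real
          continuous_on_subset[OF cont]) auto
    ultimately show ?thesis by simp
  next
    case False
    then show ?thesis using Henstock_Kurzweil_Integration.integral_cong[of "{c-1..y}" f "\<lambda>_. 0"] z by auto
  qed
  have "((\<lambda>x. integral {c - 1..x} f) has_real_derivative f x) (at x within {c - 1..x + 1})"
    using False by (intro integral_has_real_derivative continuous_on_subset[OF cont]) auto
  then have "((\<lambda>x. integral {c - 1..x} f) has_real_derivative f x) (at x within {c - 1<..<x + 1})"
    by (rule DERIV_subset) auto
  then have "((\<lambda>x. integral {c - 1..x} f) has_real_derivative f x) (at x)"
    by (subst (asm) at_within_open) (use False in auto)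
  then show ?thesis
    by (rule has_field_derivative_transform_within_open[of _ _ _ "{c - 1<..}"]) (use False eq in auto)
qed

lemma smooth_continuous: "smooth f \<Longrightarrow> continuous_on UNIV f"
  unfolding smooth_def by (metis DERIV_isCont continuous_at_imp_continuous_on)

lemma smooth_step_exists:
  obtains H :: "real \<Rightarrow> real" where "smooth H" "\<And>x. 0 \<le> H x" "\<And>x. H x \<le> 1"
    "\<And>x. x \<le> 0 \<Longrightarrow> H x = 0" "\<And>x. 1 \<le> x \<Longrightarrow> H x = 1" "mono H"
proof -
  define \<beta> where "\<beta> = bump 1 0"
  have sm: "smooth \<beta>" unfolding \<beta>_def by (rule smooth_bump)
  have cont: "continuous_on UNIV \<beta>" by (rule smooth_continuous[OF sm])
  have b0: "\<beta> x \<ge> 0" for x by (simp add: \<beta>_def bump_def)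
  have bz: "\<beta> x = 0" if "x \<le> 0 \<or> 1 \<le> x" for x using that by (auto simp: \<beta>_def bump_def)
  define B where "B x = integral {0..x} \<beta>" for x
  have dB: "(B has_real_derivative \<beta> x) (at x)" for x
    unfolding B_def by (rule antiderivative_from[OF cont]) (use bz in auto)
  have smB: "smooth B" by (rule smooth_antiderivative[OF sm dB])
  have monoB: "B x \<le> B y" if "x \<le> y" for x y
    by (rule DERIV_nonneg_imp_nondecreasing[OF that]) (use dB b0 in blast)
  have B0: "B x = 0" if "x \<le> 0" for x using that by (cases "x = 0") (auto simp: B_def)
  have B1: "B x = B 1" if "x \<ge> 1" for x
  proof -
    have "integral {0..1} \<beta> + integral {1..x} \<beta> = integral {0..x} \<beta>"
      using that by (intro Henstock_Kurzweil_Integration.integral_combine integrable_continuous_real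
          continuous_on_subset[OF cont]) auto
    moreover have "integral {1..x} \<beta> = 0" using Henstock_Kurzweil_Integration.integral_cong[of "{1..x}" \<beta> "\<lambda>_.
        0"] bz by auto
    ultimately show ?thesis by (simp add: B_def)
  qed
  have pos: "B 1 > 0"
  proof (rule ccontr)
    assume "\<not> B 1 > 0"
    then have "B x = 0" if "0 \<le> x" "x \<le> 1" for x
      using monoB[of 0 x] monoB[of x 1] B0[of 0] that by auto
    then have "((\<lambda>x. 0) has_real_derivative \<beta> (1/2)) (at (1/2))"
      by (intro has_field_derivative_transform_within_open[OF dB, where S="{0<..<1}"]) auto
    then have "\<beta> (1/2) = 0" using DERIV_unique DERIV_const by blast
    then show False by (simp add: \<beta>_def bump_def)
  qed
  define H where "H x = B x / B 1" for x
  have "smooth H"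
  proof -
    from smB obtain D where D: "D 0 = B" "\<And>k x. (D k has_real_derivative D (Suc k) x) (at x)"
      unfolding smooth_def by blast
    show ?thesis unfolding smooth_def
      by (intro exI[of _ "\<lambda>k x. D k x / B 1"]) (use D in \<open>auto simp: H_def intro!: DERIV_cdivide\<close>)
  qed
  moreover have "0 \<le> B x" "B x \<le> B 1" for x
    using monoB[of 0 x] monoB[of x 1] B0[of 0] B0[of x] B1[of x] pos by (cases "x \<le> 0"; cases "x \<ge> 1"; auto)+
  ultimately have *: "smooth H" "0 \<le> H x" "H x \<le> 1" for x
    using pos by (auto simp: H_def)
  show ?thesis
  proof (rule that[OF *])
    show "H x = 0" if "x \<le> 0" for x using B0[OF that] by (simp add: H_def)
    show "H x = 1" if "1 \<le> x" for x using B1[OF that] pos by (simp add: H_def)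
    show "mono H" unfolding H_def mono_def using monoB pos by (auto intro: divide_right_mono)
  qed
qed

section \<open>Increments of Sobolev functions\<close>

text \<open>
  Let \<open>A\<close> be a smooth approximation of the indicator of \<open>(c, d]\<close> and \<open>J\<close> its antiderivative. The test function
  \<open>J(x - h) - J(x)\<close> has derivative \<open>A(x - h) - A(x)\<close>. In the limit the definition of the weak derivative says
  that the function \<open>a \<mapsto> u(a + h) - u(a) - \<integral>\<^bsub>a..a+h\<^esub> v\<close> has integral \<open>0\<close> over \<open>(c, d]\<close>, for all \<open>c < d\<close>.
\<close>

lemma weak_deriv_increment:
  fixes u v :: "real \<Rightarrow> complex"
  assumes [measurable]: "u \<in> borel_measurable borel" "v \<in> borel_measurable borel"
    and u: "\<And>M. set_integrable lborel {-M..M} u" and v: "\<And>M. set_integrable lborel {-M..M} v"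
    and weak: "\<And>\<phi>. test_function \<phi> \<Longrightarrow> (LINT x|lborel. deriv \<phi> x *\<^sub>R u x) = - (LINT x|lborel. \<phi> x *\<^sub>R v x)"
    and h: "h > 0"
  shows "AE a in lborel. u (a + h) - u a = (LINT x:{a..a + h}|lborel. v x)"
proof -
  define V where "V a = (LINT x|lborel. (if a \<le> x \<and> x \<le> a + h then v x else 0))" for a
  have V: "(LINT x:{a..a + h}|lborel. v x) = V a" for a
    unfolding V_def set_lebesgue_integral_def by (intro Bochner_Integration.integral_cong) auto
  have [measurable]: "V \<in> borel_measurable borel" unfolding V_def by measurable
  have sub: "set_integrable lborel {c..d} w" if "\<And>M. set_integrable lborel {-M..M} w" for w :: "real \<Rightarrow> complex"
      and c d
    by (rule set_integrable_subset[OF that[of "max \<bar>c\<bar> \<bar>d\<bar>"]]) auto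
  have ush: "set_integrable lborel {c..d} (\<lambda>a. u (a + h))" for c d
  proof -
    have "integrable lborel (\<lambda>x. indicator {c + h..d + h} (h + 1 * x) *\<^sub>R u (h + 1 * x))"
      using sub[OF u, of "c + h" "d + h"] unfolding set_integrable_def
          by (rule lborel_integrable_real_affine) auto
    then show ?thesis unfolding set_integrable_def
      by (rule back_subst[where P="integrable lborel"]) (auto simp: add.commute split: split_indicator)
  qed
  have Vint: "set_integrable lborel {c..d} V" for c d
    unfolding set_integrable_def
  proof (rule integrableI_bounded_set_indicator[where B="LINT x|lborel. norm (indicator {c..d + h} x *\<^sub>R v x)"])
    show "AE x in lborel. x \<in> {c..d} \<longrightarrow> norm (V x) \<le> (LINT x|lborel. norm (indicator {c..d + h} x *\<^sub>R v x))"
    proof (intro AE_I2 impI)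
      fix a assume a: "a \<in> {c..d}"
      show "norm (V a) \<le> (LINT x|lborel. norm (indicator {c..d + h} x *\<^sub>R v x))"
        unfolding V[symmetric] set_lebesgue_integral_def
      proof (rule Bochner_Integration.integral_norm_bound_integral[OF _ integrable_norm])
        show "integrable lborel (\<lambda>x. indicator {a..a + h} x *\<^sub>R v x)" "integrable lborel (\<lambda>x. indicator {c..d
            + h} x *\<^sub>R v x)"
          using sub[OF v] unfolding set_integrable_def by auto
        show "norm (indicator {a..a + h} x *\<^sub>R v x) \<le> norm (indicator {c..d + h} x *\<^sub>R v x)" for x
          using a by (auto split: split_indicator)
      qed
    qed
  qed (auto simp: emeasure_lborel_Icc_eq)
  define w where "w a = u (a + h) - u a - V a" for a
  have "AE a in lborel. w a = 0"
  proof (rule AE_zero_if_interval_integrals_zero)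
    show "w \<in> borel_measurable borel" unfolding w_def by measurable
    show wint: "set_integrable lborel {-M..M} w" for M
      unfolding w_def by (intro set_integral_diff(1) ush sub[OF u] Vint)
    fix c d :: real assume cd: "c < d"
    obtain H :: "real \<Rightarrow> real" where H: "smooth H" "\<And>x. 0 \<le> H x" "\<And>x. H x \<le> 1"
      "\<And>x. x \<le> 0 \<Longrightarrow> H x = 0" "\<And>x. 1 \<le> x \<Longrightarrow> H x = 1" "mono H"
      using smooth_step_exists by metis
    define A where "A n x = H (real (Suc n) * x + - (real (Suc n) * c)) - H (real (Suc n) * x + - (real (Suc n)
        * d))" for n x
    have smA: "smooth (A n)" for n unfolding A_def by (intro smooth_diff smooth_affine H)
    have contA: "continuous_on UNIV (A n)" for n by (rule smooth_continuous[OF smA])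
    have [measurable]: "A n \<in> borel_measurable borel" for n by (rule borel_measurable_continuous_onI[OF contA])
    have A01: "0 \<le> A n x" "A n x \<le> 1" for n x
    proof -
      have "H (real (Suc n) * x + - (real (Suc n) * d)) \<le> H (real (Suc n) * x + - (real (Suc n) * c))"
        using cd by (intro monoD[OF H(6)]) auto
      then show "0 \<le> A n x" "A n x \<le> 1" using H(2)[of "real (Suc n) * x + - (real (Suc n) * d)"] H(3)[of "real
          (Suc n) * x + - (real (Suc n) * c)"]
        unfolding A_def by linarith+
    qed
    have Alo: "A n x = 0" if "x \<le> c" for n x
    proof -
      have "real (Suc n) * x \<le> real (Suc n) * c" "real (Suc n) * x \<le> real (Suc n) * d" using that cd
          by (intro mult_left_mono; simp)+
      then show ?thesis unfolding A_def using H(4) by simp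
    qed
    have Ahi: "A n x = 0" if "d + 1 \<le> x" for n x
    proof -
      have "1 * 1 \<le> real (Suc n) * (x - d)" "1 * 1 \<le> real (Suc n) * (x - c)" using that cd
          by (intro mult_mono; simp)+
      then show ?thesis unfolding A_def using H(5) by (simp add: algebra_simps)
    qed
    have step: "(\<lambda>n. H (real (Suc n) * x + - (real (Suc n) * e))) \<longlonglongrightarrow> of_bool (e < x)" for x e
    proof (cases "e < x")
      case True
      obtain N :: nat where N: "1 / (x - e) \<le> real N" using real_arch_simple by blast
      show ?thesis
      proof (intro tendsto_eventually eventually_sequentiallyI[of N])
        fix n assume "N \<le> n"
        then have "1 / (x - e) \<le> real (Suc n)" using N by auto
        then have "1 \<le> real (Suc n) * (x - e)" using True by (simp only: pos_divide_le_eq diff_gt_0_iff_gt)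
        then show "H (real (Suc n) * x + - (real (Suc n) * e)) = of_bool (e < x)" using H(5) True
            by (simp add: algebra_simps)
      qed
    next
      case False
      then have "real (Suc n) * x + - (real (Suc n) * e) \<le> 0" for n using mult_left_mono[of x e "real (Suc n)"]
          by simp
      then show ?thesis using H(4) False by simp
    qed
    have Alim: "(\<lambda>n. A n x) \<longlonglongrightarrow> of_bool (c < x \<and> x \<le> d)" for x
    proof -
      have "(\<lambda>n. A n x) \<longlonglongrightarrow> of_bool (c < x) - of_bool (d < x)" unfolding A_def by (intro tendsto_diff step)
      also have "of_bool (c < x) - of_bool (d < x) = (of_bool (c < x \<and> x \<le> d) :: real)" using cd by auto
      finally show ?thesis .
    qed
    define J where "J n x = integral {c..x} (A n)" for n x
    have dJ: "(J n has_real_derivative A n x) (at x)" for n x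
      unfolding J_def by (rule antiderivative_from[OF contA Alo])
    define \<phi> where "\<phi> n x = J n (x - h) - J n x" for n x
    have \<phi>_int: "\<phi> n x = - (LINT a|lborel. of_bool (x - h \<le> a \<and> a \<le> x) * A n a)" for n x
    proof -
      have "(A n has_integral (J n x - J n (x - h))) {x - h..x}"
        using h by (intro fundamental_theorem_of_calculus)
          (auto simp: has_real_derivative_iff_has_vector_derivative[symmetric] intro: DERIV_subset[OF dJ])
      then have "J n x - J n (x - h) = integral {x - h..x} (A n)" by (simp add: integral_unique)
      also have "\<dots> = (LINT a:{x - h..x}|lborel. A n a)"
        by (intro set_borel_integral_eq_integral(2)[symmetric] borel_integrable_atLeastAtMost')
           (auto intro: continuous_on_subset[OF contA])
      also have "\<dots> = (LINT a|lborel. of_bool (x - h \<le> a \<and> a \<le> x) * A n a)"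
        unfolding set_lebesgue_integral_def by (intro Bochner_Integration.integral_cong) auto
      finally show ?thesis unfolding \<phi>_def by simp
    qed
    have win: "integrable lborel (\<lambda>a. of_bool (x - h \<le> a \<and> a \<le> x) :: real)" "(LINT a|lborel. of_bool (x - h
        \<le> a \<and> a \<le> x) :: real) = h" for x
    proof -
      have "(\<lambda>a. of_bool (x - h \<le> a \<and> a \<le> x) :: real) = indicator {x - h..x}" by (auto simp: indicator_def)
      then show "integrable lborel (\<lambda>a. of_bool (x - h \<le> a \<and> a \<le> x) :: real)" "(LINT a|lborel. of_bool (x - h
          \<le> a \<and> a \<le> x) :: real) = h"
        using h by auto
    qed
    define \<psi> where "\<psi> x = (LINT a|lborel. of_bool (x - h \<le> a \<and> a \<le> x) * of_bool (c < a \<and> a \<le> d) :: real)" for x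
    have [measurable]: "\<psi> \<in> borel_measurable borel" unfolding \<psi>_def by measurable
    have \<phi>lim: "(\<lambda>n. \<phi> n x) \<longlonglongrightarrow> - \<psi> x" for x
      unfolding \<phi>_int \<psi>_def
      by (intro tendsto_minus integral_dominated_convergence[where w="\<lambda>a. of_bool (x - h \<le> a \<and> a
          \<le> x)"] win AE_I2 tendsto_mult tendsto_const Alim)
         (use A01 in \<open>auto simp: abs_mult\<close>)
    have \<phi>b: "\<bar>\<phi> n x\<bar> \<le> h" for n x
    proof -
      have "norm (LINT a|lborel. of_bool (x - h \<le> a \<and> a \<le> x) * A n a) \<le> (LINT a|lborel. of_bool (x - h \<le> a \<and> a
          \<le> x))"
        by (intro Bochner_Integration.integral_norm_bound_integral win Bochner_Integration.integrable_bound[OF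
            win(1)[of x]] AE_I2)
           (use A01 in auto)
      then show ?thesis unfolding \<phi>_int win by simp
    qed
    have J0: "J n x = 0" if "x \<le> c" for n x using that by (cases "x = c") (auto simp: J_def)
    have J1: "J n x = J n (d + 1)" if "d + 1 \<le> x" for n x
    proof (rule DERIV_isconst2[where a="d+1" and b="x+1"])
      show "continuous_on {d + 1..x + 1} (J n)" using dJ by (meson DERIV_isCont continuous_at_imp_continuous_on)
      show "(J n has_real_derivative 0) (at y)" if "d + 1 < y" for y using dJ[of n y] Ahi[of y n] that by simp
    qed (use that in auto)
    define M where "M = \<bar>c\<bar> + \<bar>d\<bar> + 1 + h"
    have \<phi>0: "\<phi> n x = 0" if "x \<notin> {c..d + 1 + h}" for n x
      using that h J0[of x n] J0[of "x - h" n] J1[of x n] J1[of "x - h" n] unfolding \<phi>_def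
          by (cases "x < c") auto
    have test: "test_function (\<phi> n)" for n
    proof (rule smooth_imp_test_function[OF _ \<phi>0])
      have "smooth (J n)" by (rule smooth_antiderivative[OF smA dJ])
      then show "smooth (\<phi> n)" using smooth_diff[OF smooth_affine[of "J n" 1 "-h"]] unfolding \<phi>_def by simp
    qed
    have d\<phi>: "deriv (\<phi> n) x = A n (x - h) - A n x" for n x
    proof (rule DERIV_imp_deriv)
      have "((\<lambda>x. J n (x - h)) has_real_derivative A n (x - h) * 1) (at x)"
        by (rule DERIV_chain2[OF dJ]) (auto intro!: derivative_eq_intros)
      then show "(\<phi> n has_real_derivative A n (x - h) - A n x) (at x)"
        unfolding \<phi>_def using DERIV_diff[OF _ dJ] by fastforce
    qed
    have [measurable]: "\<phi> n \<in> borel_measurable borel" for n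
      unfolding \<phi>_int by measurable
    have uM: "integrable lborel (\<lambda>x. indicator {-M..M} x *\<^sub>R u x)"
        and vM: "integrable lborel (\<lambda>x. indicator {-M..M} x *\<^sub>R v x)"
      using u[of M] v[of M] unfolding set_integrable_def by auto
    have L1: "(\<lambda>n. LINT x|lborel. deriv (\<phi> n) x *\<^sub>R u x) \<longlonglongrightarrow> (LINT x|lborel. (of_bool (c < x - h \<and> x - h
        \<le> d) - of_bool (c < x \<and> x \<le> d)) *\<^sub>R u x)"
      unfolding d\<phi>
    proof (rule integral_dominated_convergence[where w="\<lambda>x. norm (indicator {-M..M} x *\<^sub>R u x)"])
      show "AE x in lborel. (\<lambda>n. (A n (x - h) - A n x) *\<^sub>R u x) \<longlonglongrightarrow> (of_bool (c < x - h \<and> x - h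
          \<le> d) - of_bool (c < x \<and> x \<le> d)) *\<^sub>R u x"
        by (intro AE_I2 tendsto_intros Alim)
      show "AE x in lborel. norm ((A n (x - h) - A n x) *\<^sub>R u x) \<le> norm (indicator {-M..M} x *\<^sub>R u x)" for n
      proof (intro AE_I2)
        fix x
        have "\<bar>A n (x - h) - A n x\<bar> \<le> indicator {-M..M} x"
        proof (cases "x \<in> {-M..M}")
          case True then show ?thesis using A01[of n x] A01[of n "x - h"] by auto
        next
          case False
          then have "(x \<le> c \<and> x - h \<le> c) \<or> (d + 1 \<le> x \<and> d + 1 \<le> x - h)" using h unfolding M_def by auto
          then show ?thesis using Alo Ahi by auto
        qed
        then show "norm ((A n (x - h) - A n x) *\<^sub>R u x) \<le> norm (indicator {-M..M} x *\<^sub>R u x)"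
          by (auto simp: mult_right_mono)
      qed
    qed (use integrable_norm[OF uM] in auto)
    have L2: "(\<lambda>n. LINT x|lborel. \<phi> n x *\<^sub>R v x) \<longlonglongrightarrow> (LINT x|lborel. (- \<psi> x) *\<^sub>R v x)"
    proof (rule integral_dominated_convergence[where w="\<lambda>x. h * norm (indicator {-M..M} x *\<^sub>R v x)"])
      show "AE x in lborel. (\<lambda>n. \<phi> n x *\<^sub>R v x) \<longlonglongrightarrow> (- \<psi> x) *\<^sub>R v x"
        by (intro AE_I2 tendsto_intros \<phi>lim)
      show "AE x in lborel. norm (\<phi> n x *\<^sub>R v x) \<le> h * norm (indicator {-M..M} x *\<^sub>R v x)" for n
      proof (intro AE_I2)
        fix x
        have "\<bar>\<phi> n x\<bar> \<le> h * indicator {-M..M} x"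
        proof (cases "x \<in> {-M..M}")
          case False
          then have "x \<notin> {c..d + 1 + h}" using h unfolding M_def by auto
          then show ?thesis using \<phi>0 h by simp
        qed (use \<phi>b in simp)
        then have "\<bar>\<phi> n x\<bar> * norm (v x) \<le> h * indicator {-M..M} x * norm (v x)" by (rule mult_right_mono) simp
        then show "norm (\<phi> n x *\<^sub>R v x) \<le> h * norm (indicator {-M..M} x *\<^sub>R v x)" by (simp add: mult_ac)
      qed
    qed (use integrable_mult_right[OF integrable_norm[OF vM], of h] in auto)
    have "(\<lambda>n. - (LINT x|lborel. \<phi> n x *\<^sub>R v x)) \<longlonglongrightarrow> - (LINT x|lborel. (- \<psi> x) *\<^sub>R v x)"
        by (rule tendsto_minus[OF L2])
    then have eq: "(LINT x|lborel. (of_bool (c < x - h \<and> x - h \<le> d) - of_bool (c < x \<and> x \<le> d)) *\<^sub>R u x)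
        = (LINT x|lborel. \<psi> x *\<^sub>R v x)"
      using LIMSEQ_unique[OF L1] unfolding weak[OF test] by auto
    have iu: "integrable lborel (\<lambda>x. of_bool (c < x \<and> x
        \<le> d) *\<^sub>R u x)" "integrable lborel (\<lambda>x. of_bool (c < x - h \<and> x - h \<le> d) *\<^sub>R u x)"
      by (rule Bochner_Integration.integrable_bound[OF uM]; use h in \<open>auto simp: M_def indicator_def\<close>)+
    have iuh: "integrable lborel (\<lambda>x. of_bool (c < x \<and> x \<le> d) *\<^sub>R u (x + h))"
      using lborel_integrable_real_affine[OF iu(2), of 1 h] by (simp add: add.commute)
    have iV: "integrable lborel (\<lambda>x. of_bool (c < x \<and> x \<le> d) *\<^sub>R V x)"
      by (rule Bochner_Integration.integrable_bound[OF Vint[of c d, unfolded set_integrable_def]]) (auto simp: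
          indicator_def)
    have "(LINT x|lborel. (of_bool (c < x - h \<and> x - h \<le> d) - of_bool (c < x \<and> x \<le> d)) *\<^sub>R u x)
       = (LINT x|lborel. of_bool (c < x - h \<and> x - h \<le> d) *\<^sub>R u x) - (LINT x|lborel. of_bool (c < x \<and> x
           \<le> d) *\<^sub>R u x)"
      unfolding scaleR_diff_left by (rule Bochner_Integration.integral_diff[OF iu(2,1)])
    also have "(LINT x|lborel. of_bool (c < x - h \<and> x - h \<le> d) *\<^sub>R u x) = (LINT x|lborel. of_bool (c < x \<and> x
        \<le> d) *\<^sub>R u (x + h))"
      by (subst lborel_integral_real_affine[where c=1 and t=h]) (auto simp: add.commute)
    finally have e1: "(LINT x|lborel. \<psi> x *\<^sub>R v x) = (LINT x|lborel. of_bool (c < x \<and> x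
        \<le> d) *\<^sub>R u (x + h)) - (LINT x|lborel. of_bool (c < x \<and> x \<le> d) *\<^sub>R u x)"
      using eq by simp
    define K where "K x a = of_bool (x - h \<le> a \<and> a \<le> x) * of_bool (c < a \<and> a \<le> d) * v x" for x a
    have iK: "integrable (lborel \<Otimes>\<^sub>M lborel) (case_prod K)"
    proof (rule Bochner_Integration.integrable_bound)
      show "integrable (lborel \<Otimes>\<^sub>M lborel) (\<lambda>(x, a). indicator {-M..M} x *\<^sub>R v x * complex_of_real (indicator
          {c..d} a))"
        by (intro integrable_tensor lborel_pair.pair_sigma_finite_axioms vM integrable_of_real
            integrable_real_indicator)
           (auto simp: emeasure_lborel_Icc_eq)
      show "case_prod K \<in> borel_measurable (lborel \<Otimes>\<^sub>M lborel)" unfolding K_def case_prod_beta' by measurable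
      show "AE x in lborel \<Otimes>\<^sub>M lborel. norm (case_prod K x)
          \<le> norm (case x of (x, a) \<Rightarrow> indicator {-M..M} x *\<^sub>R v x * complex_of_real (indicator {c..d} a))"
        using h by (intro AE_I2) (auto simp: K_def M_def indicator_def)
    qed
    have "(LINT x|lborel. \<psi> x *\<^sub>R v x) = (LINT x|lborel. (LINT a|lborel. K x a))"
    proof (intro Bochner_Integration.integral_cong refl)
      fix x
      have "(LINT a|lborel. K x a) = (LINT a|lborel. complex_of_real (of_bool (x - h \<le> a \<and> a
          \<le> x) * of_bool (c < a \<and> a \<le> d)) * v x)"
        unfolding K_def by (intro Bochner_Integration.integral_cong) auto
      also have "\<dots> = (LINT a|lborel. complex_of_real (of_bool (x - h \<le> a \<and> a \<le> x) * of_bool (c < a \<and> a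
          \<le> d))) * v x"
        by (rule integral_mult_left_zero)
      also have "\<dots> = \<psi> x *\<^sub>R v x" unfolding integral_complex_of_real \<psi>_def by (simp add: scaleR_conv_of_real)
      finally show "\<psi> x *\<^sub>R v x = (LINT a|lborel. K x a)" ..
    qed
    also have "\<dots> = (LINT a|lborel. (LINT x|lborel. K x a))"
      by (rule lborel_pair.Fubini_integral[symmetric]) (use iK in simp)
    also have "\<dots> = (LINT a|lborel. of_bool (c < a \<and> a \<le> d) *\<^sub>R V a)"
    proof (intro Bochner_Integration.integral_cong refl)
      fix a
      have "of_bool (c < a \<and> a \<le> d) *\<^sub>R V a = (LINT x|lborel. of_bool (c < a \<and> a \<le> d) *\<^sub>R (if a \<le> x \<and> x
          \<le> a + h then v x else 0))"
        unfolding V_def by simp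
      also have "\<dots> = (LINT x|lborel. K x a)"
        by (intro Bochner_Integration.integral_cong) (auto simp: K_def)
      finally show "(LINT x|lborel. K x a) = of_bool (c < a \<and> a \<le> d) *\<^sub>R V a" ..
    qed
    finally have e2: "(LINT x|lborel. \<psi> x *\<^sub>R v x) = (LINT a|lborel. of_bool (c < a \<and> a \<le> d) *\<^sub>R V a)" .
    have "(LINT x:{c..d}|lborel. w x) = (LINT x|lborel. of_bool (c < x \<and> x \<le> d) *\<^sub>R w x)"
      unfolding set_lebesgue_integral_def
    proof (rule integral_cong_AE)
      show "AE x in lborel. indicat_real {c..d} x *\<^sub>R w x = of_bool (c < x \<and> x \<le> d) *\<^sub>R w x"
        using AE_lborel_singleton[of c] by eventually_elim (auto simp: indicator_def)
    qed (auto simp: w_def)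
    also have "\<dots> = (LINT x|lborel. of_bool (c < x \<and> x \<le> d) *\<^sub>R u (x + h) - of_bool (c < x \<and> x
        \<le> d) *\<^sub>R u x - of_bool (c < x \<and> x \<le> d) *\<^sub>R V x)"
      unfolding w_def by (simp add: scaleR_diff_right)
    also have "\<dots> = (LINT x|lborel. of_bool (c < x \<and> x \<le> d) *\<^sub>R u (x + h)) - (LINT x|lborel. of_bool (c < x \<and> x
        \<le> d) *\<^sub>R u x) - (LINT x|lborel. of_bool (c < x \<and> x \<le> d) *\<^sub>R V x)"
      by (simp add: Bochner_Integration.integral_diff Bochner_Integration.integrable_diff iuh iu iV)
    also have "\<dots> = 0" using e1 e2 by simp
    finally show "(LINT x:{c..d}|lborel. w x) = 0" .
  qed
  then show ?thesis unfolding V w_def by eventually_elim simp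
qed

text \<open>
  Up to the factor \<open>2 powr p\<close> this is Jensen's inequality. Integrate \<open>\<bar>v\<bar> \<le> l + l powr (1 - p) * \<bar>v\<bar> powr p\<close>
  and choose \<open>l\<close> such that both terms are equal.
\<close>

lemma interval_jensen:
  fixes v :: "real \<Rightarrow> complex"
  assumes [measurable]: "v \<in> borel_measurable borel" and p: "p > 1" and h: "h > 0" and t: "t \<ge> 0"
    and le: "ennreal t \<le> (\<integral>\<^sup>+x. ennreal (norm (v x)) * indicator {a..a + h} x \<partial>lborel)"
  shows "ennreal (t powr p) \<le> ennreal (2 powr p * h powr (p - 1)) * (\<integral>\<^sup>+x. ennreal (norm (v x) powr p)
      * indicator {a..a + h} x \<partial>lborel)"
proof (cases "(\<integral>\<^sup>+x. ennreal (norm (v x) powr p) * indicator {a..a + h} x \<partial>lborel)")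
  case top
  then show ?thesis using h by (simp add: ennreal_mult_top)
next
  case (real r)
  have "t powr p \<le> 2 powr p * h powr (p - 1) * r"
  proof (rule field_le_epsilon)
    fix e :: real assume e: "e > 0"
    define K where "K = 2 powr p * h powr (p - 1)"
    have K: "K > 0" using h by (simp add: K_def)
    define r' where "r' = r + e / K"
    have r': "r' > 0" "r \<le> r'" using real(1) e K by (auto simp: r'_def intro!: add_nonneg_pos)
    \<comment> \<open>\<open>r'\<close> replaces \<open>r\<close> because \<open>l\<close> must be positive, also when \<open>r = 0\<close>\<close>
    define l where "l = (r' / h) powr (1 / p)"
    have l: "l > 0" using r' h by (simp add: l_def)
    have pt: "norm (v x) \<le> l + l powr (1 - p) * norm (v x) powr p" for x
    proof (cases "norm (v x) \<le> l")
      case False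
      then have "l powr (1 - p) * norm (v x) powr p \<ge> norm (v x) powr (1 - p) * norm (v x) powr p"
        using l p by (intro mult_right_mono powr_mono2') auto
      moreover have "norm (v x) powr (1 - p) * norm (v x) powr p = norm (v x)"
        using False l by (simp add: powr_add[symmetric])
      ultimately show ?thesis using l by linarith
    qed (simp add: add_increasing2)
    have "ennreal t \<le> (\<integral>\<^sup>+x. ennreal l * indicator {a..a + h} x + ennreal (l powr (1 - p)) * (ennreal (norm (v
        x) powr p) * indicator {a..a + h} x) \<partial>lborel)"
    proof (rule order_trans[OF le], rule nn_integral_mono)
      fix x
      have "ennreal (norm (v x)) \<le> ennreal l + ennreal (l powr (1 - p)) * ennreal (norm (v x) powr p)"
        using pt[of x] l by (simp add: ennreal_mult[symmetric] ennreal_plus[symmetric] ennreal_leI del: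
            ennreal_plus)
      then show "ennreal (norm (v x)) * indicator {a..a + h} x
          \<le> ennreal l * indicator {a..a + h} x + ennreal (l powr (1 - p)) * (ennreal (norm (v x) powr p)
              * indicator {a..a + h} x)"
        by (auto split: split_indicator)
    qed
    also have "\<dots> = ennreal l * ennreal h + ennreal (l powr (1 - p)) * ennreal r"
      using h unfolding real(2)[symmetric] by (subst nn_integral_add) (auto simp: nn_integral_cmult)
    also have "\<dots> = ennreal (l * h + l powr (1 - p) * r)"
      using l h real(1) by (simp add: ennreal_mult ennreal_plus)
    finally have "t \<le> l * h + l powr (1 - p) * r" using l h real(1) by (subst (asm) ennreal_le_iff) auto
    also have "\<dots> \<le> l * h + l powr (1 - p) * r'" using r' by (intro add_left_mono mult_left_mono) auto
    also have "l powr (1 - p) * r' = l * h"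
    proof -
      have "l powr p = r' / h" using r' h p by (simp add: l_def powr_powr)
      then have "r' = l powr p * h" using h by simp
      then show ?thesis using l by (simp add: mult.assoc[symmetric] powr_add[symmetric])
    qed
    finally have "t powr p \<le> (2 * (l * h)) powr p" using t p by (intro powr_mono2) (auto simp: mult.commute)
    also have "\<dots> = 2 powr p * (r' / h) * h powr p"
      using l h p r' by (simp add: powr_mult l_def powr_powr)
    also have "\<dots> = K * r'" using h by (simp add: K_def powr_diff)
    also have "\<dots> = 2 powr p * h powr (p - 1) * r + e" using K by (simp add: r'_def distrib_left flip: K_def)
    finally show "t powr p \<le> 2 powr p * h powr (p - 1) * r + e" .
  qed
  then show ?thesis using real by (simp add: ennreal_mult[symmetric] ennreal_leI)
qed

lemma Lp_pow_increment_le: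
  fixes u v :: "real \<Rightarrow> complex"
  assumes [measurable]: "u \<in> borel_measurable borel" "v \<in> borel_measurable borel"
    and v: "\<And>M. set_integrable lborel {-M..M} v" and h: "h > 0" and p: "p > 1"
    and incr: "AE a in lborel. u (a + h) - u a = (LINT x:{a..a + h}|lborel. v x)"
  shows "Lp_pow p (\<lambda>x. u (x + h) - u x) \<le> ennreal (2 powr p * h powr p) * Lp_pow p v"
proof -
  have "Lp_pow p (\<lambda>x. u (x + h) - u x) \<le> (\<integral>\<^sup>+a. ennreal (2 powr p * h powr (p - 1)) * (\<integral>\<^sup>+x. ennreal (norm (v x)
      powr p) * of_bool (a \<le> x \<and> x \<le> a + h) \<partial>lborel) \<partial>lborel)"
    unfolding Lp_pow_lborel
  proof (rule nn_integral_mono_AE)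
    from incr show "AE a in lborel. ennreal (norm (u (a + h) - u a) powr p)
       \<le> ennreal (2 powr p * h powr (p - 1)) * (\<integral>\<^sup>+x. ennreal (norm (v x) powr p) * of_bool (a \<le> x \<and> x
           \<le> a + h) \<partial>lborel)"
    proof eventually_elim
      case (elim a)
      have "set_integrable lborel {a..a + h} v"
        by (rule set_integrable_subset[OF v[of "\<bar>a\<bar> + h"]]) auto
      then have "ennreal (norm (LINT x:{a..a + h}|lborel. v x))
          \<le> (\<integral>\<^sup>+x. ennreal (norm (indicator {a..a + h} x *\<^sub>R v x)) \<partial>lborel)"
        unfolding set_lebesgue_integral_def set_integrable_def by (rule integral_norm_bound_ennreal)
      also have "\<dots> = (\<integral>\<^sup>+x. ennreal (norm (v x)) * indicator {a..a + h} x \<partial>lborel)"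
        by (intro nn_integral_cong) (auto split: split_indicator)
      finally have "ennreal (norm (u (a + h) - u a)) \<le> (\<integral>\<^sup>+x. ennreal (norm (v x)) * indicator {a..a
          + h} x \<partial>lborel)"
        unfolding elim .
      from interval_jensen[OF _ p h _ this]
      have "ennreal (norm (u (a + h) - u a) powr p) \<le> ennreal (2 powr p * h powr (p - 1)) * (\<integral>\<^sup>+x. ennreal (norm
          (v x) powr p) * indicator {a..a + h} x \<partial>lborel)"
        by simp
      also have "(\<integral>\<^sup>+x. ennreal (norm (v x) powr p) * indicator {a..a + h} x \<partial>lborel)
          = (\<integral>\<^sup>+x. ennreal (norm (v x) powr p) * of_bool (a \<le> x \<and> x \<le> a + h) \<partial>lborel)"
        by (intro nn_integral_cong) (auto split: split_indicator)
      finally show ?case .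
    qed
  qed
  also have "\<dots> = ennreal (2 powr p * h powr (p - 1)) * (\<integral>\<^sup>+a. \<integral>\<^sup>+x. ennreal (norm (v x) powr p) * of_bool (a
      \<le> x \<and> x \<le> a + h) \<partial>lborel \<partial>lborel)"
    by (rule nn_integral_cmult) measurable
  also have "(\<integral>\<^sup>+a. \<integral>\<^sup>+x. ennreal (norm (v x) powr p) * of_bool (a \<le> x \<and> x \<le> a + h) \<partial>lborel \<partial>lborel)
     = (\<integral>\<^sup>+x. \<integral>\<^sup>+a. ennreal (norm (v x) powr p) * of_bool (a \<le> x \<and> x \<le> a + h) \<partial>lborel \<partial>lborel)"
    by (rule lborel_pair.Fubini') measurable
  also have "\<dots> = (\<integral>\<^sup>+x. ennreal (norm (v x) powr p) * ennreal h \<partial>lborel)"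
  proof (rule nn_integral_cong)
    fix x
    have "(\<integral>\<^sup>+a. ennreal (norm (v x) powr p) * of_bool (a \<le> x \<and> x \<le> a + h) \<partial>lborel)
        = (\<integral>\<^sup>+a. ennreal (norm (v x) powr p) * indicator {x - h..x} a \<partial>lborel)"
      by (intro nn_integral_cong) (auto split: split_indicator)
    also have "\<dots> = ennreal (norm (v x) powr p) * ennreal h" using h by (subst nn_integral_cmult) auto
    finally show "(\<integral>\<^sup>+a. ennreal (norm (v x) powr p) * of_bool (a \<le> x \<and> x \<le> a + h) \<partial>lborel)
        = ennreal (norm (v x) powr p) * ennreal h" .
  qed
  also have "\<dots> = Lp_pow p v * ennreal h" unfolding Lp_pow_lborel by (rule nn_integral_multc) measurable
  also have "ennreal (2 powr p * h powr (p - 1)) * (Lp_pow p v * ennreal h)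
      = ennreal (2 powr p * h powr (p - 1) * h) * Lp_pow p v"
    using h by (simp add: ennreal_mult mult_ac)
  also have "2 powr p * h powr (p - 1) * h = 2 powr p * h powr p" using h powr_add[of h "p - 1" 1] by simp
  finally show ?thesis .
qed

lemma nn_integral_shift: 
  fixes g :: "real \<Rightarrow> ennreal"
  assumes [measurable]: "g \<in> borel_measurable borel"
  shows "(\<integral>\<^sup>+y. g y \<partial>lborel) = (\<integral>\<^sup>+h. g (x + h) \<partial>lborel)"
  using nn_integral_real_affine[of g 1 x] by simp

text \<open>
  In the variable \<open>h = y - x\<close> the seminorm is the integral of \<open>\<bar>h\<bar> powr (- s p - 1)\<close> times the \<open>p\<close>-th power of
  the norm of the increment. It would be too large if all the steps \<open>h\<close> between \<open>1 / (2 R)\<close> and \<open>1 / R\<close> had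
  large increments.
\<close>

lemma gagliardo_small_increments:
  fixes f :: "real \<Rightarrow> complex"
  assumes [measurable]: "f \<in> borel_measurable borel" and s: "0 < s" and p: "1 < p"
    and G: "gagliardo_pow s p f < \<infinity>"
  obtains I where "I > 0" "\<And>R. R > 0 \<Longrightarrow> \<exists>h\<in>{1 / (2 * R)..1 / R}. Lp_pow p (\<lambda>x. f (x + h) - f x)
      \<le> ennreal (I * R powr (- s * p))"
proof -
  define D where "D h = Lp_pow p (\<lambda>x. f (x + h) - f x)" for h
  have "gagliardo_pow s p f = (\<integral>\<^sup>+(x, y). ennreal (norm (f x - f y) powr p / \<bar>x - y\<bar> powr (s * p + 1)) \<partial>(lborel
      \<Otimes>\<^sub>M lborel))"
    unfolding gagliardo_pow_def lborel_prod by (rule nn_integral_completion)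
  also have "\<dots> = (\<integral>\<^sup>+x. \<integral>\<^sup>+y. ennreal (norm (f x - f y) powr p / \<bar>x - y\<bar> powr (s * p + 1)) \<partial>lborel \<partial>lborel)"
    by (subst lborel.nn_integral_fst[symmetric]) auto
  also have "\<dots> = (\<integral>\<^sup>+x. \<integral>\<^sup>+h. ennreal (norm (f x - f (x + h)) powr p / \<bar>x - (x + h)\<bar> powr (s * p
      + 1)) \<partial>lborel \<partial>lborel)"
    by (intro nn_integral_cong nn_integral_shift) measurable
  also have "\<dots> = (\<integral>\<^sup>+h. \<integral>\<^sup>+x. ennreal (norm (f x - f (x + h)) powr p / \<bar>x - (x + h)\<bar> powr (s * p
      + 1)) \<partial>lborel \<partial>lborel)"
    by (rule lborel_pair.Fubini'[symmetric]) measurable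
  also have "\<dots> = (\<integral>\<^sup>+h. ennreal (1 / \<bar>h\<bar> powr (s * p + 1)) * D h \<partial>lborel)"
  proof (rule nn_integral_cong)
    fix h :: real
    have "(\<integral>\<^sup>+x. ennreal (norm (f x - f (x + h)) powr p / \<bar>x - (x + h)\<bar> powr (s * p + 1)) \<partial>lborel)
       = (\<integral>\<^sup>+x. ennreal (1 / \<bar>h\<bar> powr (s * p + 1)) * ennreal (norm (f (x + h) - f x) powr p) \<partial>lborel)"
      by (intro nn_integral_cong) (simp add: ennreal_mult[symmetric] norm_minus_commute)
    also have "\<dots> = ennreal (1 / \<bar>h\<bar> powr (s * p + 1)) * D h"
      unfolding D_def Lp_pow_lborel by (rule nn_integral_cmult) measurable
    finally show "(\<integral>\<^sup>+x. ennreal (norm (f x - f (x + h)) powr p / \<bar>x - (x + h)\<bar> powr (s * p + 1)) \<partial>lborel)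
        = ennreal (1 / \<bar>h\<bar> powr (s * p + 1)) * D h" .
  qed
  finally have "(\<integral>\<^sup>+h. ennreal (1 / \<bar>h\<bar> powr (s * p + 1)) * D h \<partial>lborel) < \<infinity>" using G by simp
  then obtain A where A: "A \<ge> 0" "(\<integral>\<^sup>+h. ennreal (1 / \<bar>h\<bar> powr (s * p + 1)) * D h \<partial>lborel) = ennreal A"
    by (cases "\<integral>\<^sup>+h. ennreal (1 / \<bar>h\<bar> powr (s * p + 1)) * D h \<partial>lborel") auto
  show ?thesis
  proof (rule that[of "2 * (A + 1)"])
    fix R :: real assume R: "R > 0"
    show "\<exists>h\<in>{1 / (2 * R)..1 / R}. Lp_pow p (\<lambda>x. f (x + h) - f x) \<le> ennreal (2 * (A + 1) * R powr (- s * p))"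
    proof (rule ccontr)
      assume "\<not> ?thesis"
      then have big: "ennreal (2 * (A + 1) * R powr (- s * p)) \<le> D h" if "h \<in> {1 / (2 * R)..1 / R}" for h
        using that unfolding D_def by (meson linear)
      have "ennreal (A + 1) = ennreal (2 * (A + 1) * R) * ennreal (1 / R - 1 / (2 * R))"
        using A R by (simp add: ennreal_mult[symmetric] field_simps)
      also have "\<dots> = (\<integral>\<^sup>+h. ennreal (2 * (A + 1) * R) * indicator {1 / (2 * R)..1 / R} h \<partial>lborel)"
        using R by (subst nn_integral_cmult) (auto simp: frac_le)
      also have "\<dots> \<le> (\<integral>\<^sup>+h. ennreal (1 / \<bar>h\<bar> powr (s * p + 1)) * D h \<partial>lborel)"
      proof (rule nn_integral_mono)
        fix h :: real
        show "ennreal (2 * (A + 1) * R) * indicator {1 / (2 * R)..1 / R} h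
            \<le> ennreal (1 / \<bar>h\<bar> powr (s * p + 1)) * D h"
        proof (cases "h \<in> {1 / (2 * R)..1 / R}")
          case True
          have h: "h > 0" using True R by (auto intro: less_le_trans[of 0 "1 / (2 * R)"])
          have "R powr (s * p + 1) = (1 / R) powr (- (s * p + 1))" using R
              by (simp only: powr_minus_divide powr_divide) simp
          moreover have "s * p > 0" using s p by (intro mult_pos_pos) auto
          then have "(1 / R) powr (- (s * p + 1)) \<le> h powr (- (s * p + 1))" using True h R
              by (intro powr_mono2') auto
          ultimately have "R powr (s * p + 1) \<le> 1 / \<bar>h\<bar> powr (s * p + 1)" using h
              by (simp only: powr_minus_divide[of h])
          then have "ennreal (R powr (s * p + 1)) * ennreal (2 * (A + 1) * R powr (- s * p))
              \<le> ennreal (1 / \<bar>h\<bar> powr (s * p + 1)) * D h"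
            by (intro mult_mono big True ennreal_leI) auto
          moreover have "R powr (s * p + 1) * (2 * (A + 1) * R powr (- s * p)) = 2 * (A + 1) * R"
            using R by (simp add: powr_add powr_minus field_simps)
          moreover have "ennreal (R powr (s * p + 1)) * ennreal (2 * (A + 1) * R powr (- s * p))
              = ennreal (R powr (s * p + 1) * (2 * (A + 1) * R powr (- s * p)))"
            using A by (intro ennreal_mult[symmetric]) auto
          ultimately have "ennreal (2 * (A + 1) * R) \<le> ennreal (1 / \<bar>h\<bar> powr (s * p + 1)) * D h" by (simp only:)
          then show ?thesis using True by simp
        qed simp
      qed
      also have "\<dots> = ennreal A" by (rule A)
      finally show False using A by (subst (asm) ennreal_le_iff) auto
    qed
  qed (use A in auto)
qed

lemma locally_integrable_borel:
  assumes u: "locally_integrable u" and [measurable]: "u' \<in> borel_measurable borel"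
      and ae: "AE x in lebesgue. u x = u' x"
  shows "set_integrable lborel {-M..M} u'"
proof -
  have "set_integrable lebesgue {-M..M} u" using u compact_Icc unfolding locally_integrable_def by blast
  then have i: "integrable lebesgue (\<lambda>x. indicator {-M..M} x *\<^sub>R u x)" unfolding set_integrable_def .
  have "integrable lebesgue (\<lambda>x. indicator {-M..M} x *\<^sub>R u' x)"
  proof (rule integrable_cong_AE_imp[OF i])
    show "(\<lambda>x. indicator {-M..M} x *\<^sub>R u' x) \<in> borel_measurable lebesgue"
        by (rule measurable_completion) measurable
    show "AE x in lebesgue. indicat_real {- M..M} x *\<^sub>R u x = indicat_real {- M..M} x *\<^sub>R u' x"
      using ae by eventually_elim simp
  qed
  then show ?thesis unfolding set_integrable_def by (subst (asm) integrable_completion) measurable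
qed

lemma locally_integrable_measurable:
  assumes u: "locally_integrable u"
  shows "u \<in> borel_measurable lebesgue"
proof -
  have m: "(\<lambda>x. indicator {-real n..real n} x *\<^sub>R u x) \<in> borel_measurable lebesgue" for n :: nat
    using u compact_Icc[of "-real n" "real n"] unfolding locally_integrable_def set_integrable_def
    by (blast intro: borel_measurable_integrable)
  show ?thesis
  proof (rule borel_measurable_LIMSEQ_metric[OF m])
    fix x :: real
    show "(\<lambda>n. indicat_real {- real n..real n} x *\<^sub>R u x) \<longlonglongrightarrow> u x"
      by (intro tendsto_eventually eventually_sequentiallyI[of "nat \<lceil>\<bar>x\<bar>\<rceil>"])
         (auto simp: indicator_def nat_le_iff ceiling_le_iff)
  qed
qed

lemma test_function_continuous:
  assumes "test_function \<phi>"
  shows "continuous_on UNIV ((deriv ^^ k) \<phi>)"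
  using assms unfolding test_function_def
  by (meson continuous_at_imp_continuous_on field_differentiable_imp_continuous_at)

text \<open>
  A common form of the hypothesis for all orders of smoothness: for \<open>s < 1\<close> it comes from the Gagliardo
  seminorm, and for \<open>s \<ge> 1\<close> the first weak derivative gives increments of order \<open>h\<close>.
\<close>

lemma sobolev_small_increments:
  assumes s: "0 < s" and p: "1 < p" and f: "f \<in> sobolev_space s p"
    and [measurable]: "f' \<in> borel_measurable borel" and ae: "AE x in lebesgue. f x = f' x"
  obtains I where "I > 0" "\<And>R. R \<ge> 1 \<Longrightarrow> \<exists>h\<in>{1 / (2 * R)..1 / R}. Lp_pow p (\<lambda>x. f' (x + h) - f' x)
      \<le> ennreal (I * R powr (- min s 1 * p))"
proof (cases "s < 1")
  case True
  then have "nat \<lfloor>s\<rfloor> = 0" "frac s = s" using s by (auto simp: frac_eq floor_eq_iff nat_eq_iff2)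
  then have "gagliardo_pow s p f < \<infinity>"
    using f s by (auto simp: sobolev_space_def sobolev_norm_pow_def weak_deriv_def)
  moreover have "gagliardo_pow s p f = gagliardo_pow s p f'"
  proof -
    have "AE z in lborel \<Otimes>\<^sub>M lborel. f (fst z) = f' (fst z) \<and> f (snd z) = f' (snd z)"
    proof -
      from ae have ae': "AE x in lborel. f x = f' x" by (simp add: AE_completion_iff)
      then obtain N where N: "N \<in> null_sets lborel" "{x. f x \<noteq> f' x} \<subseteq> N"
        unfolding eventually_ae_filter by auto
      have [measurable]: "N \<in> sets lborel" using N by auto
      have "AE x in lborel. AE y in lborel. x \<notin> N \<and> y \<notin> N"
        using AE_not_in[OF N(1)] by (auto elim: eventually_mono)
      then have "AE z in lborel \<Otimes>\<^sub>M lborel. fst z \<notin> N \<and> snd z \<notin> N"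
      proof (intro lborel_pair.AE_pair_measure)
        show "{z \<in> space (lborel \<Otimes>\<^sub>M lborel). fst z \<notin> N \<and> snd z \<notin> N} \<in> sets (lborel \<Otimes>\<^sub>M lborel)"
          by measurable
      qed simp
      then show ?thesis by eventually_elim (use N(2) in auto)
    qed
    then have "AE z in lebesgue. f (fst z) = f' (fst z) \<and> f (snd z) = f' (snd z)"
      unfolding lborel_prod by (rule AE_completion)
    then show ?thesis unfolding gagliardo_pow_def
      by (intro nn_integral_cong_AE) (auto simp: case_prod_beta elim: eventually_mono)
  qed
  ultimately have G': "gagliardo_pow s p f' < \<infinity>" by simp
  obtain I where "I > 0" "\<And>R. R > 0 \<Longrightarrow> \<exists>h\<in>{1 / (2 * R)..1 / R}. Lp_pow p (\<lambda>x. f' (x + h) - f' x)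
      \<le> ennreal (I * R powr (- s * p))"
    by (rule gagliardo_small_increments[OF assms(4) s p G']) blast
  then show ?thesis using True by (intro that[of I]) (auto simp: min_def)
next
  case False
  define m where "m = nat \<lfloor>s\<rfloor>"
  have m: "1 \<in> {1..m}" using False by (auto simp: m_def le_nat_iff le_floor_iff)
  have fin: "sobolev_norm_pow s p f < \<infinity>" using f by (simp add: sobolev_space_def)
  then have ex: "\<forall>\<alpha>\<in>{1..m}. \<exists>v. is_weak_deriv \<alpha> f v"
    unfolding sobolev_norm_pow_def Let_def m_def[symmetric] by (auto split: if_splits)
  define v where "v = weak_deriv 1 f"
  have "\<exists>v. is_weak_deriv 1 f v" using ex m by blast
  then have "is_weak_deriv 1 f (SOME v. is_weak_deriv 1 f v)" by (rule someI_ex)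
  then have wd: "is_weak_deriv 1 f v" by (simp add: v_def weak_deriv_def)
  have "Lp_pow p v \<le> (\<Sum>\<alpha>\<in>{1..m}. Lp_pow p (weak_deriv \<alpha> f))"
    unfolding v_def by (rule member_le_sum[OF m]) auto
  also have "\<dots> \<le> sobolev_norm_pow s p f"
    using ex unfolding sobolev_norm_pow_def Let_def m_def[symmetric]
        by (simp add: add_increasing add_increasing2)
  finally have vfin: "Lp_pow p v < \<infinity>" using fin by auto
  have loc: "locally_integrable f" "locally_integrable v" using wd by (auto simp: is_weak_deriv_def)
  obtain v' where v' [measurable]: "v' \<in> borel_measurable borel" "AE x in lebesgue. v x = v' x"
    using complex_borel_representative[OF locally_integrable_measurable[OF loc(2)]] by blast
  have v'fin: "Lp_pow p v' < \<infinity>" using vfin Lp_pow_cong_AE[OF v'(2)] by simp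
  have weak: "(LINT x|lborel. deriv \<phi> x *\<^sub>R f' x) = - (LINT x|lborel. \<phi> x *\<^sub>R v' x)" if \<phi>: "test_function \<phi>"
      for \<phi>
  proof -
    have c0 [measurable]: "\<phi> \<in> borel_measurable borel" and c1 [measurable]: "deriv \<phi> \<in> borel_measurable borel"
      using test_function_continuous[OF \<phi>, of 0] test_function_continuous[OF \<phi>, of 1]
      by (auto intro: borel_measurable_continuous_onI)
    have trans: "(LINT x|lebesgue. g x *\<^sub>R u x) = (LINT x|lborel. g x *\<^sub>R u' x)"
      if [measurable]: "g \<in> borel_measurable borel" "u' \<in> borel_measurable borel" and l: "locally_integrable u"
          and "AE x in lebesgue. u x = u' x" for g :: "real \<Rightarrow> real" and u u' :: "real \<Rightarrow> complex"
    proof -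
      have [measurable]: "g \<in> borel_measurable lebesgue" "u' \<in> borel_measurable lebesgue" using that
          by (auto intro: measurable_completion)
      have [measurable]: "u \<in> borel_measurable lebesgue" by (rule locally_integrable_measurable[OF l])
      have "(LINT x|lebesgue. g x *\<^sub>R u x) = (LINT x|lebesgue. g x *\<^sub>R u' x)"
        by (rule integral_cong_AE) (use that(4) in \<open>auto elim: eventually_mono\<close>)
      also have "\<dots> = (LINT x|lborel. g x *\<^sub>R u' x)" by (rule integral_completion) measurable
      finally show ?thesis .
    qed
    have "(LINT x|lebesgue. deriv \<phi> x *\<^sub>R f x) = - (LINT x|lebesgue. \<phi> x *\<^sub>R v x)"
      using wd \<phi> by (simp add: is_weak_deriv_def)
    then show ?thesis using trans[OF c1 \<open>f' \<in> _\<close> loc(1) ae] trans[OF c0 v'(1) loc(2) v'(2)] by simp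
  qed
  obtain N where N: "N \<ge> 0" "Lp_pow p v' = ennreal N" using v'fin by (cases "Lp_pow p v'") auto
  have incr: "Lp_pow p (\<lambda>x. f' (x + h) - f' x) \<le> ennreal (2 powr p * h powr p) * Lp_pow p v'" if h: "h > 0"
      for h
  proof (rule Lp_pow_increment_le[OF _ _ _ h p])
    show li: "\<And>M. set_integrable lborel {- M..M} v'" by (rule locally_integrable_borel[OF loc(2) v'])
    show "AE a in lborel. f' (a + h) - f' a = (LINT x:{a..a + h}|lborel. v' x)"
      by (rule weak_deriv_increment[OF _ _ locally_integrable_borel[OF loc(1) _ ae] li weak h]) auto
  qed auto
  show ?thesis
  proof (rule that[of "2 powr p * N + 1"])
    show "2 powr p * N + 1 > 0" using N by (simp add: add_nonneg_pos)
    fix R :: real assume R: "1 \<le> R"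
    have "Lp_pow p (\<lambda>x. f' (x + 1 / R) - f' x) \<le> ennreal (2 powr p * (1 / R) powr p) * Lp_pow p v'"
      using R by (intro incr) auto
    also have "\<dots> = ennreal (2 powr p * N * R powr (- p))"
      using R N by (simp add: ennreal_mult[symmetric] powr_divide powr_minus_divide)
    also have "\<dots> \<le> ennreal ((2 powr p * N + 1) * R powr (- p))"
      by (intro ennreal_leI mult_right_mono) auto
    also have "- p = - min s 1 * p" using False by simp
    finally show "\<exists>h\<in>{1 / (2 * R)..1 / R}. Lp_pow p (\<lambda>x. f' (x + h) - f' x)
        \<le> ennreal ((2 powr p * N + 1) * R powr (- min s 1 * p))"
      using R by (intro bexI[of _ "1 / R"]) (auto simp: frac_le)
  qed
qed

section \<open>Decay of the Fourier transform on dyadic annuli\<close>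

lemma norm_exp_minus_one_lower:
  fixes y :: real
  assumes "1 / 2 \<le> \<bar>y\<bar>" "\<bar>y\<bar> \<le> 2"
  shows "2 * sin (1 / 4) \<le> norm (exp (\<i> * of_real y) - 1)"
proof -
  have "(sin (1 / 4))\<^sup>2 \<le> (sin (\<bar>y\<bar> / 2))\<^sup>2"
    using assms pi_gt3 by (intro power_mono) (auto simp: sin_le_zero intro!: sin_monotone_2pi_le sin_ge_zero)
  also have "(sin (\<bar>y\<bar> / 2))\<^sup>2 = (sin (y / 2))\<^sup>2" by (cases "y \<ge> 0") auto
  finally have s: "(2 * sin (1 / 4))\<^sup>2 \<le> 4 * (sin (y / 2))\<^sup>2" by simp
  have "(norm (exp (\<i> * of_real y) - 1))\<^sup>2 = (cos y - 1)\<^sup>2 + (sin y)\<^sup>2"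
    by (simp add: cmod_power2 Re_exp Im_exp)
  also have "\<dots> = 2 - 2 * cos y"
    using sin_cos_squared_add[of y] by (simp add: power2_eq_square algebra_simps)
  also have "\<dots> = 4 * (sin (y / 2))\<^sup>2" using cos_double_sin[of "y / 2"] by simp
  finally have "(2 * sin (1 / 4))\<^sup>2 \<le> (norm (exp (\<i> * of_real y) - 1))\<^sup>2" using s by simp
  then show ?thesis by (rule power2_le_imp_le) simp
qed

text \<open>
  The predicate \<open>is_fourier_Lp\<close> with Borel measurable representatives, so that Fubini and Tonelli apply on
  \<open>lborel\<close>.
\<close>

definition is_fourier_borel :: "real \<Rightarrow> (real \<Rightarrow> complex) \<Rightarrow> (real \<Rightarrow> complex) \<Rightarrow> bool" where
  "is_fourier_borel p f g \<longleftrightarrow> g \<in> borel_measurable borel \<and> Lp_pow (p / (p - 1)) g < \<infinity> \<and>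
     (\<exists>F :: nat \<Rightarrow> real \<Rightarrow> complex.
        (\<forall>n. F n \<in> borel_measurable borel \<and> integrable lborel (F n) \<and> Lp_pow p (F n) < \<infinity>) \<and>
        (\<lambda>n. Lp_pow p (\<lambda>x. F n x - f x)) \<longlonglongrightarrow> 0 \<and>
        (\<lambda>n. Lp_pow (p / (p - 1)) (\<lambda>\<xi>. fourier (F n) \<xi> - g \<xi>)) \<longlonglongrightarrow> 0)"

lemma is_fourier_Lp_borel:
  assumes g: "is_fourier_Lp p f g" and ae: "AE x in lebesgue. f x = f' x"
  obtains g' where "AE x in lebesgue. g x = g' x" "is_fourier_borel p f' g'"
proof -
  from g obtain F where gs: "g \<in> Lp_space (p / (p - 1))" and F: "\<And>n. F n \<in> Lp_space 1 \<inter> Lp_space p"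
     "(\<lambda>n. Lp_pow p (\<lambda>x. F n x - f x)) \<longlonglongrightarrow> 0"
     "(\<lambda>n. Lp_pow (p / (p - 1)) (\<lambda>\<xi>. fourier (F n) \<xi> - g \<xi>)) \<longlonglongrightarrow> 0"
    unfolding is_fourier_Lp_def by blast
  obtain g' where g': "g' \<in> borel_measurable borel" "AE x in lebesgue. g x = g' x"
    using complex_borel_representative gs unfolding Lp_space_def by blast
  have "\<exists>F'. \<forall>n. F' n \<in> borel_measurable borel \<and> (AE x in lebesgue. F n x = F' n x)"
  proof (intro choice allI)
    fix n
    have "F n \<in> borel_measurable lebesgue" using F(1)[of n] by (simp add: Lp_space_def)
    then show "\<exists>F'. F' \<in> borel_measurable borel \<and> (AE x in lebesgue. F n x = F' x)"
      by (rule complex_borel_representative) blast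
  qed
  then obtain F' where F': "\<And>n. F' n \<in> borel_measurable borel" "\<And>n. AE x in lebesgue. F n x = F' n x" by blast
  show ?thesis
  proof (rule that[OF g'(2)])
    show "is_fourier_borel p f' g'" unfolding is_fourier_borel_def
    proof (intro conjI exI[of _ F'] allI)
      show "g' \<in> borel_measurable borel" by fact
      show "Lp_pow (p / (p - 1)) g' < \<infinity>" using gs Lp_pow_cong_AE[OF g'(2)] by (simp add: Lp_space_def)
      show "F' n \<in> borel_measurable borel" for n by fact
      show "Lp_pow p (F' n) < \<infinity>" for n using F(1)[of n] Lp_pow_cong_AE[OF F'(2)[of n]]
          by (simp add: Lp_space_def)
      have "Lp_pow 1 (F' n) < \<infinity>" for n using F(1)[of n] Lp_pow_cong_AE[OF F'(2)[of n]]
          by (simp add: Lp_space_def)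
      then show "integrable lborel (F' n)" for n
        using F'(1)[of n] by (auto simp: integrable_iff_bounded Lp_pow_lborel)
      have "Lp_pow p (\<lambda>x. F n x - f x) = Lp_pow p (\<lambda>x. F' n x - f' x)" for n
        by (rule Lp_pow_cong_AE) (use F'(2)[of n] ae in eventually_elim, simp)
      then show "(\<lambda>n. Lp_pow p (\<lambda>x. F' n x - f' x)) \<longlonglongrightarrow> 0" using F(2) by simp
      have "fourier (F n) = fourier (F' n)" for n
        by (rule fourier_cong_AE[OF _ _ F'(2)]) (use F(1) F'(1) in \<open>auto simp: Lp_space_def intro:
            measurable_completion\<close>)
      moreover have "Lp_pow (p / (p - 1)) (\<lambda>\<xi>. fourier (F n) \<xi> - g \<xi>)
          = Lp_pow (p / (p - 1)) (\<lambda>\<xi>. fourier (F n) \<xi> - g' \<xi>)" for n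
        by (rule Lp_pow_cong_AE) (use g'(2) in eventually_elim, simp)
      ultimately show "(\<lambda>n. Lp_pow (p / (p - 1)) (\<lambda>\<xi>. fourier (F' n) \<xi> - g' \<xi>)) \<longlonglongrightarrow> 0" using F(3) by simp
    qed
  qed
qed

lemma Lp_pow_shift:
  assumes [measurable]: "f \<in> borel_measurable borel"
  shows "Lp_pow p (\<lambda>x. f (x + h)) = Lp_pow p f"
  unfolding Lp_pow_lborel using nn_integral_shift[of "\<lambda>x. ennreal (norm (f x) powr p)" h]
      by (simp add: add.commute)

lemma fourier_increment:
  assumes F: "integrable lborel F"
  shows "fourier (\<lambda>x. F (x + h) - F x) \<xi> = (exp (\<i> * of_real (h * \<xi>)) - 1) * fourier F \<xi>"
proof -
  have [measurable]: "F \<in> borel_measurable borel" using F by auto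
  have Fh: "integrable lborel (\<lambda>x. F (x + h))" using lborel_integrable_real_affine[OF F, of 1 h]
      by (simp add: add.commute)
  have "fourier (\<lambda>x. F (x + h) - F x) \<xi> = (LINT x|lborel. exp (- (\<i> * of_real (x * \<xi>))) * F (x + h) - exp (- (\<i>
      * of_real (x * \<xi>))) * F x)"
    by (subst fourier_lborel) (auto simp: right_diff_distrib)
  also have "\<dots> = (LINT x|lborel. exp (- (\<i> * of_real (x * \<xi>))) * F (x + h)) - fourier F \<xi>"
    unfolding fourier_lborel[OF \<open>F \<in> _\<close>] by (rule Bochner_Integration.integral_diff; intro
        integrable_fourier_kernel F Fh)
  also have "(LINT x|lborel. exp (- (\<i> * of_real (x * \<xi>))) * F (x + h))
      = exp (\<i> * of_real (h * \<xi>)) * fourier F \<xi>"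
  proof -
    have "exp (\<i> * of_real (h * \<xi>)) * fourier F \<xi> = (LINT x|lborel. exp (\<i> * of_real (h * \<xi>)) * (exp (- (\<i>
        * of_real (x * \<xi>))) * F x))"
      unfolding fourier_lborel[OF \<open>F \<in> _\<close>] by (rule integral_mult_right_zero[symmetric])
    also have "\<dots> = (LINT x|lborel. exp (\<i> * of_real (h * \<xi>)) * (exp (- (\<i> * of_real ((h + 1 * x) * \<xi>))) * F (h
        + 1 * x)))"
      by (subst lborel_integral_real_affine[where c=1 and t=h]) auto
    also have "\<dots> = (LINT x|lborel. exp (- (\<i> * of_real (x * \<xi>))) * F (x + h))"
    proof (intro Bochner_Integration.integral_cong refl)
      fix x
      have "exp (\<i> * of_real (h * \<xi>)) * exp (- (\<i> * of_real ((h + 1 * x) * \<xi>))) = exp (- (\<i> * of_real (x * \<xi>)))"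
        by (simp add: algebra_simps flip: exp_add)
      then show "exp (\<i> * of_real (h * \<xi>)) * (exp (- (\<i> * of_real ((h + 1 * x) * \<xi>))) * F (h + 1 * x))
          = exp (- (\<i> * of_real (x * \<xi>))) * F (x + h)"
        by (simp add: mult.assoc[symmetric] add.commute)
    qed
    finally show ?thesis ..
  qed
  finally show ?thesis by (simp add: algebra_simps)
qed

text \<open>
  The transform of an increment is a multiple of the transform. The inequality holds for the approximating
  integrable functions and passes to the limit.
\<close>

lemma hausdorff_young_increment:
  assumes p: "1 < p" "p \<le> 2" 
  obtains C where "C > 0" "\<And>f g h A. f \<in> borel_measurable borel \<Longrightarrow> is_fourier_borel p f g \<Longrightarrow> A > 0 \<Longrightarrow>
     Lp_pow p (\<lambda>x. f (x + h) - f x) \<le> ennreal A \<Longrightarrow>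
     Lp_pow (p / (p - 1)) (\<lambda>\<xi>. (exp (\<i> * of_real (h * \<xi>)) - 1) * g \<xi>) \<le> ennreal (C * A powr (1 / (p - 1)))"
proof -
  define q where "q = p / (p - 1)"
  have q: "q > 1" using p by (simp add: q_def field_simps)
  obtain C where C: "C > 0" and HY: "\<And>F A. integrable lborel F \<Longrightarrow> A > 0 \<Longrightarrow> Lp_pow p F \<le> ennreal A \<Longrightarrow>
    Lp_pow q (fourier F) \<le> ennreal (C * A powr (1 / (p - 1)))"
    using hausdorff_young[OF p] unfolding q_def by blast
  define C' where "C' = 2 powr q * C * (2 powr p * 2) powr (1 / (p - 1))"
  show ?thesis
  proof (rule that[of C'])
    show "C' > 0" using C by (simp add: C'_def)
    fix f g :: "real \<Rightarrow> complex" and h A :: real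
    assume f [measurable]: "f \<in> borel_measurable borel" and g: "is_fourier_borel p f g" and A: "A > 0"
      and le: "Lp_pow p (\<lambda>x. f (x + h) - f x) \<le> ennreal A"
    from g obtain F where [measurable]: "g \<in> borel_measurable borel" "\<And>n. F n \<in> borel_measurable borel"
      and F: "\<And>n. integrable lborel (F n)"
      "(\<lambda>n. Lp_pow p (\<lambda>x. F n x - f x)) \<longlonglongrightarrow> 0" "(\<lambda>n. Lp_pow q (\<lambda>\<xi>. fourier (F n) \<xi> - g \<xi>)) \<longlonglongrightarrow> 0"
      unfolding is_fourier_borel_def q_def[symmetric] by blast
    define m where "m \<xi> = exp (\<i> * of_real (h * \<xi>)) - 1" for \<xi>
    have [measurable]: "m \<in> borel_measurable borel" unfolding m_def by measurable
    have m2: "norm (m \<xi>) \<le> 2" for \<xi>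
      unfolding m_def using norm_triangle_ineq4[of "exp (\<i> * of_real (h * \<xi>))" 1] by simp
    have d1: "Lp_pow p (\<lambda>x. F n (x + h) - F n x) \<le> ennreal (2 powr p) * (ennreal A + ennreal (2 powr p)
        * (Lp_pow p (\<lambda>x. F n x - f x) + Lp_pow p (\<lambda>x. F n x - f x)))" for n
    proof -
      have "Lp_pow p (\<lambda>x. F n (x + h) - F n x) = Lp_pow p (\<lambda>x. (f (x + h) - f x) + ((F n (x + h) - f (x + h))
          + (f x - F n x)))"
        by (simp add: algebra_simps)
      also have "\<dots> \<le> ennreal (2 powr p) * (Lp_pow p (\<lambda>x. f (x + h) - f x) + Lp_pow p (\<lambda>x. (F n (x + h) - f (x
          + h)) + (f x - F n x)))"
        using p by (intro Lp_pow_add_le) auto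
      also have "\<dots> \<le> ennreal (2 powr p) * (ennreal A + ennreal (2 powr p) * (Lp_pow p (\<lambda>x. F n (x + h) - f (x
          + h)) + Lp_pow p (\<lambda>x. f x - F n x)))"
        using p by (intro mult_left_mono add_mono le Lp_pow_add_le) auto
      also have "Lp_pow p (\<lambda>x. F n (x + h) - f (x + h)) = Lp_pow p (\<lambda>x. F n x - f x)"
        using Lp_pow_shift[of "\<lambda>x. F n x - f x" p h] by simp
      finally show ?thesis by (simp add: Lp_pow_minus_commute[of p f])
    qed
    have lim: "(\<lambda>n. ennreal (2 powr p) * (ennreal A + ennreal (2 powr p) * (Lp_pow p (\<lambda>x. F n x - f x)
        + Lp_pow p (\<lambda>x. F n x - f x)))) \<longlonglongrightarrow> ennreal (2 powr p) * (ennreal A + ennreal (2 powr p) * (0 + 0))"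
      by (intro tendsto_intros ennreal_tendsto_cmult F) auto
    have "ennreal (2 powr p) * (ennreal A + ennreal (2 powr p) * (0 + 0)) < ennreal (2 powr p * 2 * A)"
      using A by (simp add: ennreal_mult[symmetric] ennreal_lessI)
    from order_tendstoD(2)[OF lim this]
    have ev: "\<forall>\<^sub>F n in sequentially. Lp_pow p (\<lambda>x. F n (x + h) - F n x) \<le> ennreal (2 powr p * 2 * A)"
      by eventually_elim (use d1 in \<open>meson le_less_trans less_imp_le\<close>)
    have ev2: "\<forall>\<^sub>F n in sequentially. Lp_pow q (\<lambda>\<xi>. m \<xi> * g \<xi>) \<le> ennreal (2 powr q) * (ennreal (C * (2 powr p
        * 2 * A) powr (1 / (p - 1))) + ennreal (2 powr q) * Lp_pow q (\<lambda>\<xi>. fourier (F n) \<xi> - g \<xi>))"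
      using ev
    proof eventually_elim
      case (elim n)
      have i: "integrable lborel (\<lambda>x. F n (x + h) - F n x)"
        using lborel_integrable_real_affine[OF F(1)[of n], of 1 h] F(1)[of n]
            by (intro Bochner_Integration.integrable_diff) (auto simp: add.commute)
      have "Lp_pow q (\<lambda>\<xi>. m \<xi> * g \<xi>) = Lp_pow q (\<lambda>\<xi>. m \<xi> * fourier (F n) \<xi> + m \<xi> * (g \<xi> - fourier (F n) \<xi>))"
        by (simp add: algebra_simps)
      also have "\<dots> \<le> ennreal (2 powr q) * (Lp_pow q (\<lambda>\<xi>. m \<xi> * fourier (F n) \<xi>) + Lp_pow q (\<lambda>\<xi>. m \<xi>
          * (g \<xi> - fourier (F n) \<xi>)))"
        using q by (intro Lp_pow_add_le) auto
      also have "(\<lambda>\<xi>. m \<xi> * fourier (F n) \<xi>) = fourier (\<lambda>x. F n (x + h) - F n x)"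
        unfolding m_def fourier_increment[OF F(1), abs_def] by simp
      also have "Lp_pow q \<dots> \<le> ennreal (C * (2 powr p * 2 * A) powr (1 / (p - 1)))"
        using A by (intro HY i elim) auto
      also have "Lp_pow q (\<lambda>\<xi>. m \<xi> * (g \<xi> - fourier (F n) \<xi>))
          \<le> (\<integral>\<^sup>+\<xi>. ennreal (2 powr q) * ennreal (norm (fourier (F n) \<xi> - g \<xi>) powr q) \<partial>lborel)"
        unfolding Lp_pow_lborel
      proof (intro nn_integral_mono)
        fix \<xi>
        have "norm (m \<xi> * (g \<xi> - fourier (F n) \<xi>)) powr q \<le> (2 * norm (fourier (F n) \<xi> - g \<xi>)) powr q"
          unfolding norm_mult norm_minus_commute[of "g \<xi>"] using q by (intro powr_mono2 mult_right_mono m2) auto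
        then show "ennreal (norm (m \<xi> * (g \<xi> - fourier (F n) \<xi>)) powr q)
            \<le> ennreal (2 powr q) * ennreal (norm (fourier (F n) \<xi> - g \<xi>) powr q)"
          by (simp add: ennreal_mult[symmetric] powr_mult ennreal_leI)
      qed
      also have "\<dots> = ennreal (2 powr q) * Lp_pow q (\<lambda>\<xi>. fourier (F n) \<xi> - g \<xi>)"
        unfolding Lp_pow_lborel by (rule nn_integral_cmult) auto
      finally show ?case by (simp add: add_left_mono add_right_mono mult_left_mono)
    qed
    have lim2: "(\<lambda>n. ennreal (2 powr q) * (ennreal (C * (2 powr p * 2 * A) powr (1 / (p - 1))) + ennreal (2 powr
        q) * Lp_pow q (\<lambda>\<xi>. fourier (F n) \<xi> - g \<xi>)))
       \<longlonglongrightarrow> ennreal (2 powr q) * (ennreal (C * (2 powr p * 2 * A) powr (1 / (p - 1))) + ennreal (2 powr q) * 0)"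
      by (intro tendsto_intros ennreal_tendsto_cmult F) auto
    have "Lp_pow q (\<lambda>\<xi>. m \<xi> * g \<xi>) \<le> ennreal (2 powr q) * (ennreal (C * (2 powr p * 2 * A) powr (1 / (p - 1)))
        + ennreal (2 powr q) * 0)"
      by (rule tendsto_lowerbound[OF lim2 ev2]) simp
    also have "\<dots> = ennreal (C' * A powr (1 / (p - 1)))"
      using C A by (simp add: ennreal_mult[symmetric] C'_def powr_mult mult_ac)
    finally show "Lp_pow (p / (p - 1)) (\<lambda>\<xi>. (exp (\<i> * of_real (h * \<xi>)) - 1) * g \<xi>)
        \<le> ennreal (C' * A powr (1 / (p - 1)))"
      unfolding m_def q_def .
  qed
qed

text \<open>
  Integrated over a set of finite measure this bounds the \<open>L\<^sup>2\<close> norm by the \<open>L\<^sup>q\<close> norm; the best choice of the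
  free parameter \<open>l\<close> recovers Hoelder's inequality up to a constant.
\<close>

lemma L2_le_Lq:
  fixes x l q :: real
  assumes "x \<ge> 0" "l > 0" "q \<ge> 2"
  shows "x\<^sup>2 \<le> l powr (2 - q) * x powr q + l\<^sup>2"
proof (cases "x \<le> l")
  case True
  then have "x\<^sup>2 \<le> l\<^sup>2" using assms by (intro power_mono) auto
  then show ?thesis by (simp add: add_increasing)
next
  case False
  then have "x powr (2 - q) * x powr q \<le> l powr (2 - q) * x powr q"
    using assms by (intro mult_right_mono powr_mono2') auto
  moreover have "x powr (2 - q) * x powr q = x\<^sup>2" using False assms
      by (simp add: powr_add[symmetric] powr_two_nonneg)
  ultimately show ?thesis by (simp add: add_increasing2)
qed

text \<open>
  For \<open>\<bar>\<xi>\<bar>\<close> between \<open>R\<close> and \<open>2 R\<close> and \<open>h\<close> between \<open>1 / (2 R)\<close> and \<open>1 / R\<close> the product \<open>h \<bar>\<xi>\<bar>\<close> lies in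
  \<open>[1/2, 2]\<close>, so the factor \<open>exp (\<i> h \<xi>) - 1\<close> is bounded below. For the squares of the norms, the passage from
  \<open>L\<^sup>q\<close> to \<open>L\<^sup>2\<close> costs a factor \<open>R powr (1 - 2 / q)\<close>, and \<open>1 - 2 / q = 2 / p - 1\<close>.
\<close>

lemma dyadic_L2_decay:
  assumes p: "1 < p" "p \<le> 2" and s: "0 < s" and [measurable]: "f \<in> borel_measurable borel"
      and g: "is_fourier_borel p f g"
    and I: "I > 0" "\<And>R. R \<ge> 1 \<Longrightarrow> \<exists>h\<in>{1 / (2 * R)..1 / R}. Lp_pow p (\<lambda>x. f (x + h) - f x)
        \<le> ennreal (I * R powr (- s * p))"
  obtains C where "C > 0" "\<And>R. R \<ge> 1 \<Longrightarrow>
    (\<integral>\<^sup>+\<xi>. ennreal ((norm (g \<xi>))\<^sup>2) * indicator {\<xi>. R \<le> \<bar>\<xi>\<bar> \<and> \<bar>\<xi>\<bar> \<le> 2 * R} \<xi> \<partial>lborel)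
        \<le> ennreal (C * R powr (2 / p - 1 - 2 * s))"
proof -
  define q where "q = p / (p - 1)"
  have q: "q \<ge> 2" "p * (1 / (p - 1)) = q" "1 - 2 / q = 2 / p - 1" using p by (auto simp: q_def field_simps)
  have gm [measurable]: "g \<in> borel_measurable borel" using g by (simp add: is_fourier_borel_def)
  obtain C where C: "C > 0" and HY0: "\<And>f g h A. f \<in> borel_measurable borel \<Longrightarrow> is_fourier_borel p f g \<Longrightarrow> A > 0 \<Longrightarrow>
     Lp_pow p (\<lambda>x. f (x + h) - f x) \<le> ennreal A \<Longrightarrow>
     Lp_pow (p / (p - 1)) (\<lambda>\<xi>. (exp (\<i> * of_real (h * \<xi>)) - 1) * g \<xi>) \<le> ennreal (C * A powr (1 / (p - 1)))"
    by (rule hausdorff_young_increment[OF p]) blast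
  note HY = HY0[OF \<open>f \<in> _\<close> g, folded q_def]
  define c where "c = 2 * sin (1 / 4 :: real)"
  have c: "c > 0" unfolding c_def using pi_gt3 by (simp add: sin_gt_zero)
  define C1 where "C1 = c powr (- q) * (C * I powr (1 / (p - 1)))"
  have C1: "C1 > 0" using c C I by (simp add: C1_def)
  show ?thesis
  proof (rule that[of "C1 + 4"])
    show "C1 + 4 > 0" using C1 by simp
    fix R :: real assume R: "R \<ge> 1"
    define An where "An = {\<xi>::real. R \<le> \<bar>\<xi>\<bar> \<and> \<bar>\<xi>\<bar> \<le> 2 * R}"
    have [measurable]: "An \<in> sets borel" unfolding An_def by measurable
    obtain h where h: "h \<in> {1 / (2 * R)..1 / R}" "Lp_pow p (\<lambda>x. f (x + h) - f x)
        \<le> ennreal (I * R powr (- s * p))"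
      using I(2)[OF R] by blast
    have "(\<integral>\<^sup>+\<xi>. ennreal (norm (g \<xi>) powr q) * indicator An \<xi> \<partial>lborel)
        \<le> (\<integral>\<^sup>+\<xi>. ennreal (c powr (- q)) * ennreal (norm ((exp (\<i> * of_real (h * \<xi>)) - 1) * g \<xi>) powr q)
            \<partial>lborel)"
    proof (rule nn_integral_mono)
      fix \<xi>
      show "ennreal (norm (g \<xi>) powr q) * indicator An \<xi> \<le> ennreal (c powr (- q)) * ennreal (norm ((exp (\<i>
          * of_real (h * \<xi>)) - 1) * g \<xi>) powr q)"
      proof (cases "\<xi> \<in> An")
        case True
        have h0: "h > 0" using h R by (auto intro: less_le_trans[of 0 "1 / (2 * R)"])
        have "1 / (2 * R) * R \<le> h * \<bar>\<xi>\<bar>" "h * \<bar>\<xi>\<bar> \<le> 1 / R * (2 * R)"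
          using True h R h0 unfolding An_def by (intro mult_mono; auto)+
        then have "c \<le> norm (exp (\<i> * of_real (h * \<xi>)) - 1)"
          unfolding c_def using h0 R by (intro norm_exp_minus_one_lower) (auto simp: abs_mult)
        then have "c * norm (g \<xi>) \<le> norm ((exp (\<i> * of_real (h * \<xi>)) - 1) * g \<xi>)"
          unfolding norm_mult by (intro mult_right_mono) auto
        then have "(c * norm (g \<xi>)) powr q \<le> norm ((exp (\<i> * of_real (h * \<xi>)) - 1) * g \<xi>) powr q"
          using c q by (intro powr_mono2) auto
        then have "c powr (- q) * (c powr q * norm (g \<xi>) powr q)
            \<le> c powr (- q) * norm ((exp (\<i> * of_real (h * \<xi>)) - 1) * g \<xi>) powr q"
          using c by (intro mult_left_mono) (auto simp: powr_mult)
        moreover have "c powr (- q) * (c powr q * norm (g \<xi>) powr q) = norm (g \<xi>) powr q"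
          using c by (simp add: mult.assoc[symmetric] powr_add[symmetric])
        ultimately show ?thesis using True by (simp add: ennreal_mult[symmetric] ennreal_leI)
      qed simp
    qed
    also have "\<dots> = ennreal (c powr (- q)) * Lp_pow q (\<lambda>\<xi>. (exp (\<i> * of_real (h * \<xi>)) - 1) * g \<xi>)"
      unfolding Lp_pow_lborel by (rule nn_integral_cmult) measurable
    also have "\<dots> \<le> ennreal (c powr (- q)) * ennreal (C * (I * R powr (- s * p)) powr (1 / (p - 1)))"
      using I R h by (intro mult_left_mono HY) auto
    also have "\<dots> = ennreal (C1 * R powr (- s * q))"
    proof -
      have "(I * R powr (- s * p)) powr (1 / (p - 1)) = I powr (1 / (p - 1)) * R powr (- s * q)"
        using I R q(2) by (simp add: powr_mult powr_powr flip: q(2))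
      then show ?thesis using c C I by (simp add: C1_def ennreal_mult[symmetric] mult_ac)
    qed
    finally have Lq: "(\<integral>\<^sup>+\<xi>. ennreal (norm (g \<xi>) powr q) * indicator An \<xi> \<partial>lborel)
        \<le> ennreal (C1 * R powr (- s * q))" .
    \<comment> \<open>with this \<open>l\<close> both terms of \<open>L2_le_Lq\<close> contribute the same power of \<open>R\<close>\<close>
    define l where "l = R powr (- s - 1 / q)"
    have l: "l > 0" using R by (simp add: l_def)
    have "(\<integral>\<^sup>+\<xi>. ennreal ((norm (g \<xi>))\<^sup>2) * indicator An \<xi> \<partial>lborel)
      \<le> (\<integral>\<^sup>+\<xi>. ennreal (l powr (2 - q)) * (ennreal (norm (g \<xi>) powr q) * indicator An \<xi>) + ennreal (l\<^sup>2)
          * indicator An \<xi> \<partial>lborel)"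
    proof (rule nn_integral_mono)
      fix \<xi>
      have "(norm (g \<xi>))\<^sup>2 \<le> l powr (2 - q) * norm (g \<xi>) powr q + l\<^sup>2" using L2_le_Lq[OF norm_ge_zero l q(1)] .
      then have "ennreal ((norm (g \<xi>))\<^sup>2) \<le> ennreal (l powr (2 - q)) * ennreal (norm (g \<xi>) powr q)
          + ennreal (l\<^sup>2)"
        by (simp add: ennreal_mult[symmetric] ennreal_plus[symmetric] ennreal_leI del: ennreal_plus)
      then show "ennreal ((norm (g \<xi>))\<^sup>2) * indicator An \<xi>
          \<le> ennreal (l powr (2 - q)) * (ennreal (norm (g \<xi>) powr q) * indicator An \<xi>) + ennreal (l\<^sup>2)
              * indicator An \<xi>"
        by (auto split: split_indicator)
    qed
    also have "\<dots> = ennreal (l powr (2 - q)) * (\<integral>\<^sup>+\<xi>. ennreal (norm (g \<xi>) powr q) * indicator An \<xi> \<partial>lborel)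
        + ennreal (l\<^sup>2) * emeasure lborel An"
      by (subst nn_integral_add) (auto simp: nn_integral_cmult)
    also have "\<dots> \<le> ennreal (l powr (2 - q)) * ennreal (C1 * R powr (- s * q)) + ennreal (l\<^sup>2) * ennreal (4 * R)"
    proof (intro add_mono mult_left_mono Lq)
      have "emeasure lborel An \<le> emeasure lborel {-(2 * R)..2 * R}" by (intro emeasure_mono) (auto simp: An_def)
      then show "emeasure lborel An \<le> ennreal (4 * R)" using R by simp
    qed auto
    also have "\<dots> = ennreal ((C1 + 4) * R powr (2 / p - 1 - 2 * s))"
    proof -
      have "(- s - 1 / q) * (2 - q) + - s * q = 2 / p - 1 - 2 * s" using q(1)
          by (simp add: q(3)[symmetric] field_simps)
      then have e1: "l powr (2 - q) * R powr (- s * q) = R powr (2 / p - 1 - 2 * s)"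
        by (simp add: l_def powr_powr powr_add[symmetric])
      have "(- s - 1 / q) * 2 + 1 = 2 / p - 1 - 2 * s" using q(1) by (simp add: q(3)[symmetric] field_simps)
      moreover have "l\<^sup>2 = R powr ((- s - 1 / q) * 2)" using l
          by (simp add: powr_two_nonneg[symmetric] l_def powr_powr)
      moreover have "R powr ((- s - 1 / q) * 2) * R = R powr ((- s - 1 / q) * 2 + 1)" using R
          by (simp only: powr_add) simp
      ultimately have e2: "l\<^sup>2 * R = R powr (2 / p - 1 - 2 * s)" by (simp only:)
      have "l powr (2 - q) * (C1 * R powr (- s * q)) + l\<^sup>2 * (4 * R) = (C1 + 4) * R powr (2 / p - 1 - 2 * s)"
        using e1 e2 by (simp add: algebra_simps)
      then show ?thesis using C1 R by (simp add: ennreal_mult[symmetric] ennreal_plus[symmetric] del: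
          ennreal_plus)
    qed
    finally show "(\<integral>\<^sup>+\<xi>. ennreal ((norm (g \<xi>))\<^sup>2) * indicator {\<xi>. R \<le> \<bar>\<xi>\<bar> \<and> \<bar>\<xi>\<bar> \<le> 2 * R} \<xi> \<partial>lborel)
        \<le> ennreal ((C1 + 4) * R powr (2 / p - 1 - 2 * s))"
      unfolding An_def .
  qed
qed

section \<open>Van der Corput estimates\<close>

text \<open>
  The second mean value theorem expresses the integral through integrals of \<open>f\<close> over the two parts of
  \<open>[a, b]\<close>.
\<close>

lemma integral_le_monotone_amplitude:
  fixes f g :: "real \<Rightarrow> real"
  assumes f: "f integrable_on {a..b}" and ab: "a \<le> b"
    and mono: "(\<forall>x y. a \<le> x \<longrightarrow> x \<le> y \<longrightarrow> y \<le> b \<longrightarrow> g x \<le> g y) \<or> (\<forall>x y. a \<le> x \<longrightarrow> x \<le> y \<longrightarrow> y \<le> b \<longrightarrow> g y \<le> g x)"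
    and g: "\<And>x. a \<le> x \<Longrightarrow> x \<le> b \<Longrightarrow> \<bar>g x\<bar> \<le> G"
    and B: "\<And>c. a \<le> c \<Longrightarrow> c \<le> b \<Longrightarrow> \<bar>integral {a..c} f\<bar> \<le> B"
  shows "\<bar>integral {a..b} (\<lambda>x. g x * f x)\<bar> \<le> 3 * G * B"
proof -
  have G0: "0 \<le> G" using g[of a] ab by linarith
  have B0: "0 \<le> B" using B[of a] ab by auto
  have key: "\<exists>c\<in>{a..b}. integral {a..b} (\<lambda>x. h x * f x) = h a * integral {a..c} f + h b * integral {c..b} f"
    if h: "\<And>x y. a \<le> x \<Longrightarrow> x \<le> y \<Longrightarrow> y \<le> b \<Longrightarrow> h x \<le> h y" for h :: "real \<Rightarrow> real"
    using second_mean_value_theorem[OF f ab, of h] h by metis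
  have fin: "\<bar>h a * integral {a..c} f + h b * integral {c..b} f\<bar> \<le> 3 * G * B"
    if c: "c \<in> {a..b}" and ha: "\<bar>h a\<bar> \<le> G" and hb: "\<bar>h b\<bar> \<le> G" for c :: real and h :: "real \<Rightarrow> real"
  proof -
    have "integral {a..c} f + integral {c..b} f = integral {a..b} f"
      using c f by (intro Henstock_Kurzweil_Integration.integral_combine) auto
    then have "\<bar>integral {c..b} f\<bar> \<le> 2 * B" using B[of c] B[of b] c ab by auto
    then have "\<bar>h b * integral {c..b} f\<bar> \<le> G * (2 * B)" unfolding abs_mult by (intro mult_mono hb G0) auto
    moreover have "\<bar>h a * integral {a..c} f\<bar> \<le> G * B" unfolding abs_mult using c
        by (intro mult_mono ha G0 B) auto
    ultimately show ?thesis by (simp add: algebra_simps)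
  qed
  from mono show ?thesis
  proof
    assume "\<forall>x y. a \<le> x \<longrightarrow> x \<le> y \<longrightarrow> y \<le> b \<longrightarrow> g x \<le> g y"
    then obtain c where c: "c \<in> {a..b}" "integral {a..b} (\<lambda>x. g x * f x)
        = g a * integral {a..c} f + g b * integral {c..b} f"
      using key[of g] by auto
    show ?thesis unfolding c(2) using fin[OF c(1), of g] g ab by auto
  next
    assume "\<forall>x y. a \<le> x \<longrightarrow> x \<le> y \<longrightarrow> y \<le> b \<longrightarrow> g y \<le> g x"
    then obtain c where c: "c \<in> {a..b}" "integral {a..b} (\<lambda>x. - g x * f x)
        = - g a * integral {a..c} f + - g b * integral {c..b} f"
      using key[of "\<lambda>x. - g x"] by auto
    have "\<bar>integral {a..b} (\<lambda>x. - g x * f x)\<bar> \<le> 3 * G * B"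
      unfolding c(2) using fin[OF c(1), of "\<lambda>x. - g x"] g ab by auto
    then show ?thesis by simp
  qed
qed

text \<open>
  Write \<open>cos \<theta> = (1 / \<theta>') * (\<theta>' cos \<theta>)\<close>: the first factor is monotone and bounded by \<open>1 / l\<close>, and the second
  is the derivative of \<open>sin \<theta>\<close>.
\<close>

lemma van_der_Corput_1:
  fixes \<theta> \<theta>' :: "real \<Rightarrow> real"
  assumes ab: "a \<le> b" and d: "\<And>x. a \<le> x \<Longrightarrow> x \<le> b \<Longrightarrow> (\<theta> has_real_derivative \<theta>' x) (at x within {a..b})"
    and mono: "(\<forall>x y. a \<le> x \<longrightarrow> x \<le> y \<longrightarrow> y \<le> b \<longrightarrow> \<theta>' x \<le> \<theta>' y) \<or> (\<forall>x y. a \<le> x \<longrightarrow> x \<le> y \<longrightarrow> y \<le> b \<longrightarrow> \<theta>' y \<le> \<theta>' x)"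
    and l: "0 < l" and sgn: "(\<forall>x. a \<le> x \<longrightarrow> x \<le> b \<longrightarrow> l \<le> \<theta>' x) \<or> (\<forall>x. a \<le> x \<longrightarrow> x \<le> b \<longrightarrow> \<theta>' x \<le> - l)"
  shows "\<bar>integral {a..b} (\<lambda>x. cos (\<theta> x))\<bar> \<le> 6 / l"
proof -
  have ne: "\<theta>' x \<noteq> 0" if "a \<le> x" "x \<le> b" for x
    using sgn l that by force
  have ftc: "((\<lambda>x. \<theta>' x * cos (\<theta> x)) has_integral (sin (\<theta> c) - sin (\<theta> a))) {a..c}" if "a \<le> c" "c \<le> b" for c
  proof (rule fundamental_theorem_of_calculus[OF that(1)])
    fix x assume x: "x \<in> {a..c}"
    have "(\<theta> has_real_derivative \<theta>' x) (at x within {a..c})"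
      by (rule DERIV_subset[OF d]) (use x that in auto)
    then have "((\<lambda>x. sin (\<theta> x)) has_real_derivative cos (\<theta> x) * \<theta>' x) (at x within {a..c})"
      by (auto intro!: derivative_eq_intros)
    then show "((\<lambda>x. sin (\<theta> x)) has_vector_derivative \<theta>' x * cos (\<theta> x)) (at x within {a..c})"
      by (simp add: has_real_derivative_iff_has_vector_derivative mult.commute)
  qed
  have "\<bar>integral {a..b} (\<lambda>x. inverse (\<theta>' x) * (\<theta>' x * cos (\<theta> x)))\<bar> \<le> 3 * (1 / l) * 2"
  proof (rule integral_le_monotone_amplitude)
    show "(\<lambda>x. \<theta>' x * cos (\<theta> x)) integrable_on {a..b}" using ftc[of b] ab by auto
    show "a \<le> b" by fact
    have inv: "inverse (\<theta>' y) \<le> inverse (\<theta>' x)" if "a \<le> x" "x \<le> b" "a \<le> y" "y \<le> b" "\<theta>' x \<le> \<theta>' y" for x y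
    proof -
      from sgn show ?thesis
      proof
        assume "\<forall>x. a \<le> x \<longrightarrow> x \<le> b \<longrightarrow> l \<le> \<theta>' x"
        then have "0 < \<theta>' x" using l that by force
        then show ?thesis using that by (intro le_imp_inverse_le) auto
      next
        assume "\<forall>x. a \<le> x \<longrightarrow> x \<le> b \<longrightarrow> \<theta>' x \<le> - l"
        then have "\<theta>' y < 0" using l that by force
        then show ?thesis using that by (intro le_imp_inverse_le_neg) auto
      qed
    qed
    show "(\<forall>x y. a \<le> x \<longrightarrow> x \<le> y \<longrightarrow> y \<le> b \<longrightarrow> inverse (\<theta>' x) \<le> inverse (\<theta>' y)) \<or>
       (\<forall>x y. a \<le> x \<longrightarrow> x \<le> y \<longrightarrow> y \<le> b \<longrightarrow> inverse (\<theta>' y) \<le> inverse (\<theta>' x))"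
      using mono inv by (meson order_trans)
    show "\<bar>inverse (\<theta>' x)\<bar> \<le> 1 / l" if "a \<le> x" "x \<le> b" for x
    proof -
      have "l \<le> \<bar>\<theta>' x\<bar>" using sgn that l by force
      then show ?thesis using l by (simp add: divide_inverse le_imp_inverse_le)
    qed
    show "\<bar>integral {a..c} (\<lambda>x. \<theta>' x * cos (\<theta> x))\<bar> \<le> 2" if "a \<le> c" "c \<le> b" for c
    proof -
      have "integral {a..c} (\<lambda>x. \<theta>' x * cos (\<theta> x)) = sin (\<theta> c) - sin (\<theta> a)" using ftc[OF that] by blast
      moreover have "\<bar>sin (\<theta> c) - sin (\<theta> a)\<bar> \<le> 2"
        using abs_sin_le_one[of "\<theta> c"] abs_sin_le_one[of "\<theta> a"] by linarith
      ultimately show ?thesis by simp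
    qed
  qed
  also have "integral {a..b} (\<lambda>x. inverse (\<theta>' x) * (\<theta>' x * cos (\<theta> x))) = integral {a..b} (\<lambda>x. cos (\<theta> x))"
    by (intro Henstock_Kurzweil_Integration.integral_cong) (use ne in auto)
  finally show ?thesis by simp
qed

lemma abs_integral_cos_le:
  fixes \<theta> :: "real \<Rightarrow> real"
  assumes "a \<le> b" "continuous_on {a..b} \<theta>"
  shows "\<bar>integral {a..b} (\<lambda>x. cos (\<theta> x))\<bar> \<le> b - a"
proof -
  have "norm (integral {a..b} (\<lambda>x. cos (\<theta> x))) \<le> 1 * (b - a)"
    using assms by (intro integral_bound) (auto intro!: continuous_intros)
  then show ?thesis by simp
qed

text \<open>
  The derivative \<open>\<theta>'\<close> increases at rate \<open>l\<close>, so outside an interval of length \<open>1 / sqrt l\<close> on either side of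
  its zero it exceeds \<open>sqrt l\<close> in modulus and the first derivative test applies; on these intervals the
  trivial bound is used.
\<close>

lemma van_der_Corput_2_pos:
  fixes \<theta> \<theta>' \<theta>'' :: "real \<Rightarrow> real"
  assumes ab: "a \<le> b" and d: "\<And>x. a \<le> x \<Longrightarrow> x \<le> b \<Longrightarrow> (\<theta> has_real_derivative \<theta>' x) (at x within {a..b})"
    and d2: "\<And>x. a \<le> x \<Longrightarrow> x \<le> b \<Longrightarrow> (\<theta>' has_real_derivative \<theta>'' x) (at x within {a..b})"
    and l: "0 < l" and dd: "\<And>x. a \<le> x \<Longrightarrow> x \<le> b \<Longrightarrow> l \<le> \<theta>'' x"
  shows "\<bar>integral {a..b} (\<lambda>x. cos (\<theta> x))\<bar> \<le> 14 / sqrt l"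
proof -
  have cont: "continuous_on {a..b} \<theta>" using d
      by (meson DERIV_continuous atLeastAtMost_iff continuous_on_eq_continuous_within)
  have cont': "continuous_on {a..b} \<theta>'" using d2
      by (meson DERIV_continuous atLeastAtMost_iff continuous_on_eq_continuous_within)
  have incr: "\<theta>' x + l * (y - x) \<le> \<theta>' y" if "a \<le> x" "x \<le> y" "y \<le> b" for x y
  proof -
    have "(\<theta>' x - l * x) \<le> (\<theta>' y - l * y)"
    proof (rule DERIV_nonneg_imp_increasing_open[OF that(2)])
      fix u assume u: "x < u" "u < y"
      have "(\<theta>' has_real_derivative \<theta>'' u) (at u within {x<..<y})"
        by (rule DERIV_subset[OF d2]) (use u that in auto)
      then have "(\<theta>' has_real_derivative \<theta>'' u) (at u)" by (subst (asm) at_within_open) (use u in auto)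
      then have "((\<lambda>x. \<theta>' x - l * x) has_real_derivative \<theta>'' u - l) (at u)"
        by (auto intro!: derivative_eq_intros)
      then show "\<exists>z. ((\<lambda>x. \<theta>' x - l * x) has_real_derivative z) (at u) \<and> 0 \<le> z" using dd[of u] u that by force
    next
      show "continuous_on {x..y} (\<lambda>x. \<theta>' x - l * x)"
        by (intro continuous_intros continuous_on_subset[OF cont']) (use that in auto)
    qed
    then show ?thesis by (simp add: algebra_simps)
  qed
  have mono: "\<forall>x y. a \<le> x \<longrightarrow> x \<le> y \<longrightarrow> y \<le> b \<longrightarrow> \<theta>' x \<le> \<theta>' y"
  proof (intro allI impI)
    fix x y assume "a \<le> x" "x \<le> y" "y \<le> b"
    then show "\<theta>' x \<le> \<theta>' y" using incr[of x y] l mult_nonneg_nonneg[of l "y - x"] by linarith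
  qed
  define \<rho> where "\<rho> = 1 / sqrt l"
  have \<rho>: "\<rho> > 0" "l * \<rho> = sqrt l" "6 / sqrt l = 6 * \<rho>" "14 / sqrt l = 14 * \<rho>"
    using l by (auto simp: \<rho>_def real_div_sqrt)
  have comb: "integral {u..v} (\<lambda>x. cos (\<theta> x)) + integral {v..w} (\<lambda>x. cos (\<theta> x))
      = integral {u..w} (\<lambda>x. cos (\<theta> x))"
    if "a \<le> u" "u \<le> v" "v \<le> w" "w \<le> b" for u v w
    using that by (intro Henstock_Kurzweil_Integration.integral_combine integrable_continuous_real
        continuous_intros continuous_on_subset[OF cont]) auto
  have dsub: "(\<theta> has_real_derivative \<theta>' x) (at x within {u..v})" if "a \<le> u" "v \<le> b" "u \<le> x" "x \<le> v" for u v x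
    by (rule DERIV_subset[OF d]) (use that in auto)
  have triv: "\<bar>integral {u..v} (\<lambda>x. cos (\<theta> x))\<bar> \<le> v - u" if "a \<le> u" "u \<le> v" "v \<le> b" for u v
    using that by (intro abs_integral_cos_le continuous_on_subset[OF cont]) auto
  have right: "\<bar>integral {u..v} (\<lambda>x. cos (\<theta> x))\<bar> \<le> 7 * \<rho>" if uv: "a \<le> u" "u \<le> v" "v \<le> b" "0 \<le> \<theta>' u" for u v
  proof (cases "v \<le> u + \<rho>")
    case True
    then show ?thesis using triv[of u v] that \<rho> by linarith
  next
    case False
    have "\<bar>integral {u + \<rho>..v} (\<lambda>x. cos (\<theta> x))\<bar> \<le> 6 / sqrt l"
    proof (rule van_der_Corput_1)
      show "(\<forall>x. u + \<rho> \<le> x \<longrightarrow> x \<le> v \<longrightarrow> sqrt l \<le> \<theta>' x) \<or> (\<forall>x. u + \<rho> \<le> x \<longrightarrow> x \<le> v \<longrightarrow> \<theta>' x \<le> - sqrt l)"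
      proof (intro disjI1 allI impI)
        fix x assume x: "u + \<rho> \<le> x" "x \<le> v"
        have "l * \<rho> \<le> l * (x - u)" using x l by (intro mult_left_mono) auto
        then show "sqrt l \<le> \<theta>' x" using incr[of u x] x uv \<rho> by simp
      qed
      show "(\<forall>x y. u + \<rho> \<le> x \<longrightarrow> x \<le> y \<longrightarrow> y \<le> v \<longrightarrow> \<theta>' x \<le> \<theta>' y) \<or>
         (\<forall>x y. u + \<rho> \<le> x \<longrightarrow> x \<le> y \<longrightarrow> y \<le> v \<longrightarrow> \<theta>' y \<le> \<theta>' x)"
        using mono uv \<rho> by (intro disjI1) auto
    qed (use uv \<rho> False l dsub in auto)
    moreover have "\<bar>integral {u..u + \<rho>} (\<lambda>x. cos (\<theta> x))\<bar> \<le> \<rho>" using triv[of u "u + \<rho>"] uv \<rho> False by auto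
    ultimately show ?thesis using comb[of u "u + \<rho>" v] uv \<rho> False by auto
  qed
  have left: "\<bar>integral {u..v} (\<lambda>x. cos (\<theta> x))\<bar> \<le> 7 * \<rho>" if uv: "a \<le> u" "u \<le> v" "v \<le> b" "\<theta>' v \<le> 0" for u v
  proof (cases "v \<le> u + \<rho>")
    case True
    then show ?thesis using triv[of u v] that \<rho> by linarith
  next
    case False
    have "\<bar>integral {u..v - \<rho>} (\<lambda>x. cos (\<theta> x))\<bar> \<le> 6 / sqrt l"
    proof (rule van_der_Corput_1)
      show "(\<forall>x. u \<le> x \<longrightarrow> x \<le> v - \<rho> \<longrightarrow> sqrt l \<le> \<theta>' x) \<or> (\<forall>x. u \<le> x \<longrightarrow> x \<le> v - \<rho> \<longrightarrow> \<theta>' x \<le> - sqrt l)"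
      proof (intro disjI2 allI impI)
        fix x assume x: "u \<le> x" "x \<le> v - \<rho>"
        have "l * \<rho> \<le> l * (v - x)" using x l by (intro mult_left_mono) auto
        then show "\<theta>' x \<le> - sqrt l" using incr[of x v] x uv \<rho> by simp
      qed
      show "(\<forall>x y. u \<le> x \<longrightarrow> x \<le> y \<longrightarrow> y \<le> v - \<rho> \<longrightarrow> \<theta>' x \<le> \<theta>' y) \<or>
         (\<forall>x y. u \<le> x \<longrightarrow> x \<le> y \<longrightarrow> y \<le> v - \<rho> \<longrightarrow> \<theta>' y \<le> \<theta>' x)"
        using mono uv \<rho> by (intro disjI1) auto
    qed (use uv \<rho> False l dsub in auto)
    moreover have "\<bar>integral {v - \<rho>..v} (\<lambda>x. cos (\<theta> x))\<bar> \<le> \<rho>" using triv[of "v - \<rho>" v] uv \<rho> False by auto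
    ultimately show ?thesis using comb[of u "v - \<rho>" v] uv \<rho> False by auto
  qed
  consider "0 \<le> \<theta>' a" | "\<theta>' b \<le> 0" | "\<theta>' a \<le> 0" "0 \<le> \<theta>' b" by linarith
  then show ?thesis
  proof cases
    case 1 then show ?thesis using right[of a b] ab \<rho> by auto
  next
    case 2 then show ?thesis using left[of a b] ab \<rho> by auto
  next
    case 3
    then obtain c where c: "a \<le> c" "c \<le> b" "\<theta>' c = 0" using IVT'[of \<theta>' a 0 b] ab cont' by auto
    show ?thesis using right[of c b] left[of a c] comb[of a c b] c \<rho> by auto
  qed
qed

lemma van_der_Corput_2:
  fixes \<theta> \<theta>' \<theta>'' :: "real \<Rightarrow> real"
  assumes ab: "a \<le> b" and d: "\<And>x. a \<le> x \<Longrightarrow> x \<le> b \<Longrightarrow> (\<theta> has_real_derivative \<theta>' x) (at x within {a..b})"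
    and d2: "\<And>x. a \<le> x \<Longrightarrow> x \<le> b \<Longrightarrow> (\<theta>' has_real_derivative \<theta>'' x) (at x within {a..b})"
    and l: "0 < l" and dd: "(\<forall>x. a \<le> x \<longrightarrow> x \<le> b \<longrightarrow> l \<le> \<theta>'' x) \<or> (\<forall>x. a \<le> x \<longrightarrow> x \<le> b \<longrightarrow> \<theta>'' x \<le> - l)"
  shows "\<bar>integral {a..b} (\<lambda>x. cos (\<theta> x))\<bar> \<le> 14 / sqrt l"
  using dd
proof
  assume "\<forall>x. a \<le> x \<longrightarrow> x \<le> b \<longrightarrow> l \<le> \<theta>'' x"
  then show ?thesis by (intro van_der_Corput_2_pos[OF ab d d2 l]) auto
next
  assume neg: "\<forall>x. a \<le> x \<longrightarrow> x \<le> b \<longrightarrow> \<theta>'' x \<le> - l"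
  have "\<bar>integral {a..b} (\<lambda>x. cos (- \<theta> x))\<bar> \<le> 14 / sqrt l"
  proof (rule van_der_Corput_2_pos[OF ab _ _ l, of _ "\<lambda>x. - \<theta>' x" "\<lambda>x. - \<theta>'' x"])
    fix x assume x: "a \<le> x" "x \<le> b"
    show "((\<lambda>x. - \<theta> x) has_real_derivative - \<theta>' x) (at x within {a..b})" using d[OF x] by (rule DERIV_minus)
    show "((\<lambda>x. - \<theta>' x) has_real_derivative - \<theta>'' x) (at x within {a..b})" using d2[OF x] by (rule DERIV_minus)
    show "l \<le> - \<theta>'' x" using neg x by force
  qed
  then show ?thesis by simp
qed

text \<open>
  The damping is used only through powers, which can be integrated explicitly.
\<close>

lemma exp_minus_powr_le:
  fixes y k :: real
  assumes "y > 0" "0 \<le> k" "k \<le> 1"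
  shows "exp (- y) \<le> y powr (- k)"
proof -
  have "y powr k \<le> (max 1 y) powr 1"
  proof (cases "y \<le> 1")
    case True then show ?thesis using assms powr_mono2[of k y 1] by auto
  next
    case False then show ?thesis using assms powr_mono[of k 1 y] by auto
  qed
  also have "\<dots> = max 1 y" by simp
  also have "\<dots> \<le> 1 + y" using assms by simp
  also have "\<dots> \<le> exp y" by (rule exp_ge_add_one_self)
  finally have "inverse (exp y) \<le> inverse (y powr k)" using assms by (intro le_imp_inverse_le) auto
  then show ?thesis by (simp add: exp_minus powr_minus)
qed

lemma min_le_powr_interpolate:
  fixes X A B \<epsilon> :: real
  assumes "0 \<le> X" "X \<le> A" "X \<le> B" "0 \<le> \<epsilon>" "\<epsilon> \<le> 1"
  shows "X \<le> A powr \<epsilon> * B powr (1 - \<epsilon>)"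
proof (cases "X = 0")
  case False
  then have "X = X powr \<epsilon> * X powr (1 - \<epsilon>)" using assms by (simp add: powr_add[symmetric])
  also have "\<dots> \<le> A powr \<epsilon> * B powr (1 - \<epsilon>)" using assms by (intro mult_mono powr_mono2) auto
  finally show ?thesis .
qed auto

lemma phase_derivs:
  fixes z \<tau> c a x :: real
  assumes "x > 0"
  shows "((\<lambda>x. z * x + \<tau> * x powr a + c) has_real_derivative z + a * \<tau> * x powr (a - 1)) (at x within S)"
    and "((\<lambda>x. z + a * \<tau> * x powr (a - 1)) has_real_derivative a * (a - 1) * \<tau> * x powr (a - 2)) (at x within
        S)"
proof -
  show "((\<lambda>x. z * x + \<tau> * x powr a + c) has_real_derivative z + a * \<tau> * x powr (a - 1)) (at x within S)"
    using assms by (auto intro!: derivative_eq_intros simp: powr_diff)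
  have "((\<lambda>x. x powr (a - 1)) has_real_derivative (a - 1) * x powr (a - 1 - 1)) (at x within S)"
    using has_real_derivative_powr[OF assms] by (rule has_field_derivative_at_within)
  then have "((\<lambda>x. z + (a * \<tau>) * x powr (a - 1)) has_real_derivative 0 + (a * \<tau>) * ((a - 1) * x powr (a - 1 -
      1))) (at x within S)"
    by (intro DERIV_add DERIV_const DERIV_cmult)
  then show "((\<lambda>x. z + a * \<tau> * x powr (a - 1)) has_real_derivative a * (a - 1) * \<tau> * x powr (a - 2)) (at x
      within S)"
    by (simp add: mult_ac)
qed

lemma powr_mono_exponent_sign:
  fixes x y r :: real
  assumes "0 < x" "x \<le> y"
  shows "(0 \<le> r \<longrightarrow> x powr r \<le> y powr r) \<and> (r \<le> 0 \<longrightarrow> y powr r \<le> x powr r)"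
  using assms powr_mono2[of r x y] powr_mono2'[of r x y] by auto

text \<open>
  The first term comes from the range of parameters where \<open>\<bar>\<theta>'\<bar> \<ge> \<bar>z\<bar> / 2\<close> for the phase
  \<open>\<theta>(\<xi>) = z \<xi> + \<tau> \<xi> powr a + c\<close>: there the integral is at most \<open>12 / \<bar>z\<bar>\<close> and at most \<open>R\<close>, hence at most a
  geometric mean of the two, which is integrable in \<open>z\<close> near \<open>0\<close>. In the remaining range
  \<open>\<bar>\<tau>\<bar> \<ge> k \<bar>z\<bar> R powr (1 - a)\<close>. Then the damping is at most \<open>exp (- Y powr \<gamma>)\<close> with
  \<open>Y = k \<bar>z\<bar> R powr (1 - a + a / \<gamma>)\<close>, which is bounded by \<open>Y powr - \<beta>\<close>, and \<open>\<bar>\<theta>''\<bar>\<close> is at least a multiple of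
  \<open>\<bar>z\<bar> / R\<close> if \<open>a \<noteq> 1\<close>. The phase shift \<open>c\<close> covers sine as well as cosine.
\<close>

lemma dyadic_cos_bound:
  fixes a \<gamma> \<epsilon> \<beta> :: real
  assumes a: "a > 0" and \<gamma>: "\<gamma> > 1" and \<epsilon>: "0 < \<epsilon>" "\<epsilon> < 1" and \<beta>: "0 \<le> \<beta>" "\<beta> < 1"
  obtains C where "C > 0"
    "\<And>R z \<tau> B c. R > 0 \<Longrightarrow> z \<noteq> 0 \<Longrightarrow> \<bar>\<tau>\<bar> powr \<gamma> \<le> B \<Longrightarrow>
       \<bar>integral {R..2 * R} (\<lambda>\<xi>. exp (- B * \<xi> powr a) * cos (z * \<xi> + \<tau> * \<xi> powr a + c))\<bar>
       \<le> C * (R powr \<epsilon> * \<bar>z\<bar> powr (\<epsilon> - 1) +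
              (if a = 1 then R powr (1 - \<beta> / \<gamma>) * \<bar>z\<bar> powr (- \<beta>)
               else R powr (1 / 2 + \<beta> * (a - 1 - a / \<gamma>)) * \<bar>z\<bar> powr (- 1 / 2 - \<beta>)))"
proof -
  \<comment> \<open>\<open>m\<close> and \<open>n\<close> compare powers of \<open>\<xi>\<close> in \<open>[R, 2 R]\<close> with powers of \<open>R\<close>, whatever the sign of the exponent\<close>
  define m where "m = max 1 (2 powr (a - 1))"
  define n where "n = min 1 (2 powr (a - 2))"
  have m: "m \<ge> 1" and n: "n > 0" by (auto simp: m_def n_def)
  define k where "k = 1 / (2 * a * m)"
  have k: "k > 0" using a m by (simp add: k_def)
  define l0 where "l0 = a * \<bar>a - 1\<bar> * k * n"
  define D where "D = 3 * (12 powr (1 - \<epsilon>) + 14 / sqrt l0 * k powr (- \<beta>) + k powr (- \<beta>))"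
  show ?thesis
  proof (rule that[of "D + 1"])
    have "D \<ge> 0" unfolding D_def l0_def using k n a
        by (intro mult_nonneg_nonneg add_nonneg_nonneg divide_nonneg_nonneg) auto
    then show "D + 1 > 0" by simp
    fix R z \<tau> B c :: real
    assume R: "R > 0" and z: "z \<noteq> 0" and B: "\<bar>\<tau>\<bar> powr \<gamma> \<le> B"
    define \<theta> where "\<theta> x = z * x + \<tau> * x powr a + c" for x
    define \<theta>' where "\<theta>' x = z + a * \<tau> * x powr (a - 1)" for x
    define \<theta>'' where "\<theta>'' x = a * (a - 1) * \<tau> * x powr (a - 2)" for x
    have B0: "B \<ge> 0" using B powr_ge_zero order_trans by blast
    have d: "(\<theta> has_real_derivative \<theta>' x) (at x within S)" "(\<theta>' has_real_derivative \<theta>'' x) (at x within S)"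
        if "R \<le> x" for x S
      unfolding \<theta>_def \<theta>'_def \<theta>''_def using R that by (auto intro!: phase_derivs)
    have cont: "continuous_on {R..y} \<theta>" for y
      using d(1) by (meson DERIV_continuous atLeastAtMost_iff continuous_on_eq_continuous_within)
    have up: "x powr (a - 1) \<le> m * R powr (a - 1)" if "R \<le> x" "x \<le> 2 * R" for x
    proof (cases "a \<ge> 1")
      case True
      then have "x powr (a - 1) \<le> (2 * R) powr (a - 1)" using that R by (intro powr_mono2) auto
      also have "\<dots> = 2 powr (a - 1) * R powr (a - 1)" using R by (simp add: powr_mult)
      also have "\<dots> \<le> m * R powr (a - 1)" by (intro mult_right_mono) (auto simp: m_def)
      finally show ?thesis .
    next
      case False
      then have "x powr (a - 1) \<le> 1 * R powr (a - 1)" using that R powr_mono2'[of "a - 1" R x] by auto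
      also have "\<dots> \<le> m * R powr (a - 1)" by (intro mult_right_mono m) auto
      finally show ?thesis .
    qed
    have low: "n * R powr (a - 2) \<le> x powr (a - 2)" if "R \<le> x" "x \<le> 2 * R" for x
    proof (cases "a \<ge> 2")
      case True
      have "n * R powr (a - 2) \<le> 1 * R powr (a - 2)" by (intro mult_right_mono) (auto simp: n_def)
      also have "\<dots> \<le> x powr (a - 2)" using True that R powr_mono2[of "a - 2" R x] by auto
      finally show ?thesis .
    next
      case False
      have "n * R powr (a - 2) \<le> 2 powr (a - 2) * R powr (a - 2)" by (intro mult_right_mono) (auto simp: n_def)
      also have "\<dots> = (2 * R) powr (a - 2)" using R by (simp add: powr_mult)
      also have "\<dots> \<le> x powr (a - 2)" using False that R powr_mono2'[of "a - 2" x "2 * R"] by auto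
      finally show ?thesis .
    qed
    have mono': "(\<forall>x y. R \<le> x \<longrightarrow> x \<le> y \<longrightarrow> y \<le> b \<longrightarrow> \<theta>' x \<le> \<theta>' y) \<or> (\<forall>x y. R \<le> x \<longrightarrow> x \<le> y \<longrightarrow> y \<le> b \<longrightarrow> \<theta>' y \<le> \<theta>' x)"
        for b
    proof -
      have ps: "(0 \<le> a - 1 \<longrightarrow> x powr (a - 1) \<le> y powr (a - 1)) \<and> (a - 1 \<le> 0 \<longrightarrow> y powr (a - 1) \<le> x powr (a - 1))"
          if "R \<le> x" "x \<le> y" for x y
        using powr_mono_exponent_sign[of x y "a - 1"] that R by auto
      have *: "0 \<le> a * \<tau> \<or> a * \<tau> \<le> 0" "0 \<le> a - 1 \<or> a - 1 \<le> 0" by linarith+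
      consider "0 \<le> a * \<tau>" "0 \<le> a - 1" | "0 \<le> a * \<tau>" "a - 1 \<le> 0" | "a * \<tau> \<le> 0" "0 \<le> a - 1" | "a * \<tau> \<le> 0" "a - 1
          \<le> 0"
        using * by blast
      then show ?thesis
      proof cases
        case 1
        show ?thesis unfolding \<theta>'_def by (intro disjI1 allI impI add_left_mono mult_left_mono) (use ps 1 in
            auto)
      next
        case 2
        show ?thesis unfolding \<theta>'_def by (intro disjI2 allI impI add_left_mono mult_left_mono) (use ps 2 in
            auto)
      next
        case 3
        show ?thesis unfolding \<theta>'_def by (intro disjI2 allI impI add_left_mono mult_left_mono_neg) (use ps 3 in
            auto)
      next
        case 4
        show ?thesis unfolding \<theta>'_def by (intro disjI1 allI impI add_left_mono mult_left_mono_neg) (use ps 4 in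
            auto)
      qed
    qed
    \<comment> \<open>The amplitude decreases, so it is enough to bound the integrals without it on all intervals
      that begin at \<open>R\<close>, and to multiply by its value at \<open>R\<close>.\<close>
    have main: "\<exists>J. exp (- B * R powr a) * J \<le> D / 3 * (R powr \<epsilon> * \<bar>z\<bar> powr (\<epsilon> - 1) +
              (if a = 1 then R powr (1 - \<beta> / \<gamma>) * \<bar>z\<bar> powr (- \<beta>)
               else R powr (1 / 2 + \<beta> * (a - 1 - a / \<gamma>)) * \<bar>z\<bar> powr (- 1 / 2 - \<beta>))) \<and>
         (\<forall>y. R \<le> y \<longrightarrow> y \<le> 2 * R \<longrightarrow> \<bar>integral {R..y} (\<lambda>x. cos (\<theta> x))\<bar> \<le> J)" (is "\<exists>J. _ * J
             \<le> D / 3 * (?P1 + ?P2) \<and> _")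
    proof (cases "2 * a * \<bar>\<tau>\<bar> * (m * R powr (a - 1)) \<le> \<bar>z\<bar>")
      case True
      have small: "\<bar>a * \<tau> * x powr (a - 1)\<bar> \<le> \<bar>z\<bar> / 2" if "R \<le> x" "x \<le> 2 * R" for x
      proof -
        have "\<bar>a * \<tau> * x powr (a - 1)\<bar> = a * \<bar>\<tau>\<bar> * x powr (a - 1)" using a by (simp add: abs_mult)
        also have "\<dots> \<le> a * \<bar>\<tau>\<bar> * (m * R powr (a - 1))" using up[OF that] a by (intro mult_left_mono) auto
        finally show ?thesis using True by simp
      qed
      have "\<bar>integral {R..y} (\<lambda>x. cos (\<theta> x))\<bar> \<le> (2 * R - R) powr \<epsilon> * (6 / (\<bar>z\<bar> / 2)) powr (1 - \<epsilon>)" if y: "R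
          \<le> y" "y \<le> 2 * R" for y
      proof (rule min_le_powr_interpolate)
        show "\<bar>integral {R..y} (\<lambda>x. cos (\<theta> x))\<bar> \<le> 2 * R - R"
          using abs_integral_cos_le[OF y(1) cont] y by linarith
        show "\<bar>integral {R..y} (\<lambda>x. cos (\<theta> x))\<bar> \<le> 6 / (\<bar>z\<bar> / 2)"
        proof (rule van_der_Corput_1[OF y(1)])
          show "(\<theta> has_real_derivative \<theta>' x) (at x within {R..y})" if "R \<le> x" for x by (rule d[OF that])
          show "(\<forall>x. R \<le> x \<longrightarrow> x \<le> y \<longrightarrow> \<bar>z\<bar> / 2 \<le> \<theta>' x) \<or> (\<forall>x. R \<le> x \<longrightarrow> x \<le> y \<longrightarrow> \<theta>' x \<le> - (\<bar>z\<bar> / 2))"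
          proof (cases "z > 0")
            case True
            then have "\<bar>z\<bar> / 2 \<le> \<theta>' x" if "R \<le> x" "x \<le> y" for x
              using small[of x] that y unfolding \<theta>'_def by linarith
            then show ?thesis by blast
          next
            case False
            then have "\<theta>' x \<le> - (\<bar>z\<bar> / 2)" if "R \<le> x" "x \<le> y" for x
              using small[of x] that y unfolding \<theta>'_def by linarith
            then show ?thesis by blast
          qed
        qed (use mono' z in auto)
      qed (use \<epsilon> in auto)
      moreover have "(2 * R - R) powr \<epsilon> * (6 / (\<bar>z\<bar> / 2)) powr (1 - \<epsilon>) = 12 powr (1 - \<epsilon>) * ?P1"
        using z R by (simp add: powr_divide powr_diff field_simps)
      ultimately have J: "\<forall>y. R \<le> y \<longrightarrow> y \<le> 2 * R \<longrightarrow> \<bar>integral {R..y} (\<lambda>x. cos (\<theta> x))\<bar> \<le> 12 powr (1 - \<epsilon>) * ?P1"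
          by (simp only:) blast
      have "exp (- B * R powr a) * (12 powr (1 - \<epsilon>) * ?P1) \<le> 1 * (12 powr (1 - \<epsilon>) * ?P1)"
        using B0 by (intro mult_right_mono) auto
      also have "\<dots> \<le> D / 3 * (?P1 + ?P2)"
      proof -
        have "12 powr (1 - \<epsilon>) \<le> D / 3" unfolding D_def l0_def using k n a
            by (auto intro!: add_nonneg_nonneg mult_nonneg_nonneg)
        then have "12 powr (1 - \<epsilon>) * ?P1 \<le> D / 3 * (?P1 + ?P2)" using \<open>D \<ge> 0\<close> by (intro mult_mono) auto
        then show ?thesis by simp
      qed
      finally show ?thesis using J by blast
    next
      case False
      then have t1: "\<bar>z\<bar> < 2 * a * m * R powr (a - 1) * \<bar>\<tau>\<bar>" by (simp add: mult_ac)
      have t: "k * \<bar>z\<bar> * R powr (1 - a) \<le> \<bar>\<tau>\<bar>"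
      proof -
        have "R powr (1 - a) * R powr (a - 1) = 1" using R by (simp add: powr_add[symmetric])
        moreover have "k * \<bar>z\<bar> * R powr (1 - a) \<le> k * (2 * a * m * R powr (a - 1) * \<bar>\<tau>\<bar>) * R powr (1 - a)"
          using t1 k by (intro mult_right_mono mult_left_mono) auto
        moreover have "k * (2 * a * m) = 1" using a m by (simp add: k_def)
        moreover have "k * (2 * a * m * R powr (a - 1) * \<bar>\<tau>\<bar>) * R powr (1 - a)
            = (k * (2 * a * m)) * (R powr (1 - a) * R powr (a - 1)) * \<bar>\<tau>\<bar>"
          by (simp only: mult_ac)
        ultimately show ?thesis by (simp only: mult_1)
      qed
      have tpos: "k * \<bar>z\<bar> * R powr (1 - a) > 0" using k z R by auto
      define Y where "Y = k * \<bar>z\<bar> * R powr (1 - a + a / \<gamma>)"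
      have Y: "Y > 0" using k z R by (simp add: Y_def)
      have YB: "Y powr \<gamma> \<le> B * R powr a"
      proof -
        have "Y = (k * \<bar>z\<bar> * R powr (1 - a)) * R powr (a / \<gamma>)" unfolding Y_def powr_add by (simp add: mult_ac)
        also have "\<dots> powr \<gamma> = (k * \<bar>z\<bar> * R powr (1 - a)) powr \<gamma> * R powr a"
          using tpos \<gamma> by (subst powr_mult) (auto simp: powr_powr)
        also have "\<dots> \<le> \<bar>\<tau>\<bar> powr \<gamma> * R powr a" using tpos t \<gamma> by (intro mult_right_mono powr_mono2) auto
        also have "\<dots> \<le> B * R powr a" by (intro mult_right_mono B) auto
        finally show ?thesis .
      qed
      have damp: "exp (- B * R powr a) \<le> k powr (- \<beta>) * \<bar>z\<bar> powr (- \<beta>) * R powr (\<beta> * (a - 1 - a / \<gamma>))"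
      proof -
        have "exp (- B * R powr a) \<le> exp (- (Y powr \<gamma>))" using YB by simp
        also have "\<dots> \<le> (Y powr \<gamma>) powr (- (\<beta> / \<gamma>))" using Y \<beta> \<gamma> by (intro exp_minus_powr_le) auto
        also have "\<dots> = Y powr (- \<beta>)" using \<gamma> by (simp add: powr_powr)
        also have "\<dots> = k powr (- \<beta>) * \<bar>z\<bar> powr (- \<beta>) * R powr (\<beta> * (a - 1 - a / \<gamma>))"
          using k z R unfolding Y_def by (simp add: powr_mult powr_powr algebra_simps)
        finally show ?thesis .
      qed
      show ?thesis
      proof (cases "a = 1")
        case True
        have J: "\<forall>y. R \<le> y \<longrightarrow> y \<le> 2 * R \<longrightarrow> \<bar>integral {R..y} (\<lambda>x. cos (\<theta> x))\<bar> \<le> R"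
          using abs_integral_cos_le[OF _ cont] by (metis add_le_cancel_left diff_add_cancel mult_2 order_trans
              add.commute diff_le_eq)
        have "exp (- B * R powr a) * R \<le> k powr (- \<beta>) * \<bar>z\<bar> powr (- \<beta>) * R powr (\<beta> * (a - 1 - a / \<gamma>)) * R"
          using R by (intro mult_right_mono damp) auto
        also have "\<dots> = k powr (- \<beta>) * ?P2"
          using True R powr_add[of R "- (\<beta> / \<gamma>)" 1] by (simp add: mult_ac)
        also have "\<dots> \<le> D / 3 * (?P1 + ?P2)"
        proof (rule mult_mono)
          show "k powr (- \<beta>) \<le> D / 3" unfolding D_def l0_def using k n a
              by (auto intro!: add_nonneg_nonneg mult_nonneg_nonneg)
        qed (use \<open>D \<ge> 0\<close> in auto)
        finally show ?thesis using J by blast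
      next
        case False
        define l where "l = l0 * (\<bar>z\<bar> / R)"
        have l0: "l0 > 0" using False a k n by (simp add: l0_def)
        have l: "l > 0" using l0 z R by (simp add: l_def)
        have lb: "l \<le> \<bar>a * (a - 1) * \<tau>\<bar> * x powr (a - 2)" if "R \<le> x" "x \<le> 2 * R" for x
        proof -
          have "R powr (1 - a) * R powr (a - 2) = 1 / R" using R
              by (simp add: powr_add[symmetric] powr_minus_divide)
          then have "l = a * \<bar>a - 1\<bar> * (k * \<bar>z\<bar> * R powr (1 - a)) * (n * R powr (a - 2))"
            unfolding l_def l0_def by (simp add: mult_ac)
          also have "\<dots> \<le> a * \<bar>a - 1\<bar> * \<bar>\<tau>\<bar> * x powr (a - 2)"
            using t low[OF that] a n by (intro mult_mono mult_left_mono) auto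
          finally show ?thesis using a by (simp add: abs_mult mult_ac)
        qed
        have J: "\<forall>y. R \<le> y \<longrightarrow> y \<le> 2 * R \<longrightarrow> \<bar>integral {R..y} (\<lambda>x. cos (\<theta> x))\<bar> \<le> 14 / sqrt l"
        proof (intro allI impI)
          fix y assume y: "R \<le> y" "y \<le> 2 * R"
          show "\<bar>integral {R..y} (\<lambda>x. cos (\<theta> x))\<bar> \<le> 14 / sqrt l"
          proof (rule van_der_Corput_2[OF y(1)])
            show "(\<theta> has_real_derivative \<theta>' x) (at x within {R..y})" "(\<theta>' has_real_derivative \<theta>'' x) (at x
                within {R..y})" if "R \<le> x" for x
              using d[OF that] by auto
            show "(\<forall>x. R \<le> x \<longrightarrow> x \<le> y \<longrightarrow> l \<le> \<theta>'' x) \<or> (\<forall>x. R \<le> x \<longrightarrow> x \<le> y \<longrightarrow> \<theta>'' x \<le> - l)"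
            proof (cases "a * (a - 1) * \<tau> \<ge> 0")
              case True
              then have "l \<le> \<theta>'' x" if "R \<le> x" "x \<le> y" for x using lb[of x] that y unfolding \<theta>''_def by auto
              then show ?thesis by blast
            next
              case False
              then have "\<theta>'' x \<le> - l" if "R \<le> x" "x \<le> y" for x using lb[of x] that y unfolding \<theta>''_def by auto
              then show ?thesis by blast
            qed
          qed (rule l)
        qed
        have "14 / sqrt l = 14 / sqrt l0 * (R powr (1/2) * \<bar>z\<bar> powr (- 1/2))"
          using R z l0 by (simp add: l_def real_sqrt_mult real_sqrt_divide powr_minus_divide powr_half_sqrt)
        then have "exp (- B * R powr a) * (14 / sqrt l)
            \<le> k powr (- \<beta>) * \<bar>z\<bar> powr (- \<beta>) * R powr (\<beta> * (a - 1 - a / \<gamma>)) * (14 / sqrt l0 * (R powr (1/2)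
                * \<bar>z\<bar> powr (- 1/2)))"
          using l l0 damp by (simp only:) (intro mult_right_mono damp, auto)
        also have "\<dots> = 14 / sqrt l0 * k powr (- \<beta>) * ?P2"
        proof -
          have "R powr (1 / 2 + \<beta> * (a - 1 - a / \<gamma>)) = R powr (1/2) * R powr (\<beta> * (a - 1 - a / \<gamma>))"
              by (rule powr_add)
          moreover have "\<bar>z\<bar> powr (- 1 / 2 - \<beta>) = \<bar>z\<bar> powr (- 1/2) * \<bar>z\<bar> powr (- \<beta>)"
              by (simp add: powr_add[symmetric])
          ultimately show ?thesis using False by (simp only: if_False mult_ac)
        qed
        also have "\<dots> \<le> D / 3 * (?P1 + ?P2)"
        proof (rule mult_mono)
          show "14 / sqrt l0 * k powr (- \<beta>) \<le> D / 3" unfolding D_def using k l0 by auto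
        qed (use \<open>D \<ge> 0\<close> in auto)
        finally show ?thesis using J by blast
      qed
    qed
    then obtain J where J: "exp (- B * R powr a) * J \<le> D / 3 * (?P1 + ?P2)"
       "\<And>y. R \<le> y \<Longrightarrow> y \<le> 2 * R \<Longrightarrow> \<bar>integral {R..y} (\<lambda>x. cos (\<theta> x))\<bar> \<le> J" by blast
    have "\<bar>integral {R..2 * R} (\<lambda>x. exp (- B * x powr a) * cos (\<theta> x))\<bar> \<le> 3 * exp (- B * R powr a) * J"
    proof (rule integral_le_monotone_amplitude)
      show "(\<lambda>x. cos (\<theta> x)) integrable_on {R..2 * R}"
          by (intro integrable_continuous_real continuous_intros cont)
      have dec: "exp (- B * y powr a) \<le> exp (- B * x powr a)" if "R \<le> x" "x \<le> y" for x y
        using that R a B0 by (auto intro!: mult_left_mono powr_mono2)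
      show "(\<forall>x y. R \<le> x \<longrightarrow> x \<le> y \<longrightarrow> y \<le> 2 * R \<longrightarrow> exp (- B * x powr a) \<le> exp (- B * y powr a)) \<or>
        (\<forall>x y. R \<le> x \<longrightarrow> x \<le> y \<longrightarrow> y \<le> 2 * R \<longrightarrow> exp (- B * y powr a) \<le> exp (- B * x powr a))" using dec by blast
      show "\<bar>exp (- B * x powr a)\<bar> \<le> exp (- B * R powr a)" if "R \<le> x" for x using dec[of R x] that by simp
    qed (use R J in auto)
    also have "\<dots> \<le> D * (?P1 + ?P2)" using J(1) by simp
    also have "\<dots> \<le> (D + 1) * (?P1 + ?P2)" by (intro mult_right_mono) auto
    finally show "\<bar>integral {R..2 * R} (\<lambda>\<xi>. exp (- B * \<xi> powr a) * cos (z * \<xi> + \<tau> * \<xi> powr a + c))\<bar>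
        \<le> (D + 1) * (?P1 + ?P2)"
      unfolding \<theta>_def .
  qed
qed

section \<open>The maximal function on a dyadic annulus\<close>

text \<open>
  The multiplier of the operator together with the character \<open>exp (\<i> x \<xi>)\<close>.
\<close>

definition wave :: "real \<Rightarrow> real \<Rightarrow> real \<Rightarrow> real \<Rightarrow> real \<Rightarrow> complex" where
  "wave a \<gamma> t x \<xi> = exp (\<i> * of_real (x * \<xi>)) * exp (\<i> * of_real (t * \<bar>\<xi>\<bar> powr a))
        * of_real (exp (- (t powr \<gamma> * \<bar>\<xi>\<bar> powr a)))"

lemma wave_measurable [measurable (raw)]:
  assumes "t \<in> borel_measurable N" "x \<in> borel_measurable N" "\<xi> \<in> borel_measurable N"
  shows "(\<lambda>w. wave a \<gamma> (t w) (x w) (\<xi> w)) \<in> borel_measurable N"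
  using assms unfolding wave_def by measurable

lemma norm_wave: "norm (wave a \<gamma> t x \<xi>) = exp (- (t powr \<gamma> * \<bar>\<xi>\<bar> powr a))"
  by (simp add: wave_def norm_mult)

lemma norm_wave_le_1: "norm (wave a \<gamma> t x \<xi>) \<le> 1"
  unfolding norm_wave by simp

text \<open>
  Phases subtract, whereas damping exponents add up.
\<close>

lemma wave_mult_cnj:
  "wave a \<gamma> t x \<xi> * cnj (wave a \<gamma> t' y \<xi>) =
     exp (\<i> * of_real ((x - y) * \<xi> + (t - t') * \<bar>\<xi>\<bar> powr a)) * of_real (exp (- (t powr \<gamma> + t' powr \<gamma>)
         * \<bar>\<xi>\<bar> powr a))"
proof -
  have "wave a \<gamma> t x \<xi> * cnj (wave a \<gamma> t' y \<xi>) = exp (\<i> * of_real (x * \<xi>) + \<i> * of_real (t * \<bar>\<xi>\<bar> powr a)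
      + of_real (- (t powr \<gamma> * \<bar>\<xi>\<bar> powr a))
     + (- \<i> * of_real (y * \<xi>) - \<i> * of_real (t' * \<bar>\<xi>\<bar> powr a) + of_real (- (t' powr \<gamma> * \<bar>\<xi>\<bar> powr a))))"
    unfolding wave_def by (simp only: complex_cnj_mult exp_cnj exp_of_real[symmetric] exp_add exp_diff
        complex_cnj_complex_of_real complex_cnj_i)
      (simp add: exp_minus divide_inverse)
  also have "\<dots> = exp (\<i> * of_real ((x - y) * \<xi> + (t - t') * \<bar>\<xi>\<bar> powr a) + of_real (- (t powr \<gamma> + t' powr \<gamma>)
      * \<bar>\<xi>\<bar> powr a))"
    by (rule arg_cong[where f=exp]) (simp add: algebra_simps)
  finally show ?thesis by (simp only: exp_add exp_of_real)
qed

definition annulus :: "real \<Rightarrow> real set" where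
  "annulus R = {\<xi>. R \<le> \<bar>\<xi>\<bar> \<and> \<bar>\<xi>\<bar> \<le> 2 * R}"

lemma annulus_measurable [measurable]: "annulus R \<in> sets borel"
  unfolding annulus_def by measurable

text \<open>
  The kernel of the \<open>T T\<^sup>*\<close> argument for frequencies in an annulus; \<open>z\<close> and \<open>\<tau>\<close> are the differences of the
  points and of the times, and \<open>B\<close> is the total damping.
\<close>

definition wave_kernel :: "real \<Rightarrow> real \<Rightarrow> real \<Rightarrow> real \<Rightarrow> real \<Rightarrow> complex" where
  "wave_kernel a R B \<tau> z =
     (LINT \<xi>|lborel. exp (\<i> * of_real (z * \<xi> + \<tau> * \<bar>\<xi>\<bar> powr a)) * of_real (exp (- B * \<bar>\<xi>\<bar> powr a))
        * of_real (indicator (annulus R) \<xi>))"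

lemma half_annulus_kernel:
  fixes a z \<tau> B D R :: real
  assumes R: "R > 0"
    and D: "\<And>c. \<bar>integral {R..2 * R} (\<lambda>\<xi>. exp (- B * \<xi> powr a) * cos (z * \<xi> + \<tau> * \<xi> powr a + c))\<bar> \<le> D"
  shows "norm (LINT \<xi>|lborel. indicator {R..2 * R} \<xi> *\<^sub>R (exp (\<i> * of_real (z * \<xi> + \<tau> * \<bar>\<xi>\<bar> powr a))
      * of_real (exp (- B * \<bar>\<xi>\<bar> powr a)))) \<le> 2 * D"
proof -
  define E where "E \<xi> = exp (\<i> * of_real (z * \<xi> + \<tau> * \<bar>\<xi>\<bar> powr a)) * complex_of_real (exp (- B * \<bar>\<xi>\<bar> powr a))"
      for \<xi>
  have [measurable]: "E \<in> borel_measurable borel" unfolding E_def by measurable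
  have int: "integrable lborel (\<lambda>\<xi>. indicator {R..2 * R} \<xi> *\<^sub>R E \<xi>)"
    by (rule borel_integrable_atLeastAtMost'[unfolded set_integrable_def])
       (use R in \<open>auto simp: E_def intro!: continuous_intros\<close>)
  have c: "(LINT \<xi>|lborel. indicator {R..2 * R} \<xi> * (exp (- B * \<xi> powr a) * cos (z * \<xi> + \<tau> * \<xi> powr a + c)))
     = integral {R..2 * R} (\<lambda>\<xi>. exp (- B * \<xi> powr a) * cos (z * \<xi> + \<tau> * \<xi> powr a + c))" for c
  proof -
    have "continuous_on {R..2 * R} (\<lambda>\<xi>. exp (- B * \<xi> powr a) * cos (z * \<xi> + \<tau> * \<xi> powr a + c))"
      using R by (auto intro!: continuous_intros)
    from set_borel_integral_eq_integral(2)[OF borel_integrable_atLeastAtMost'[OF this]]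
    show ?thesis unfolding set_lebesgue_integral_def real_scaleR_def .
  qed
  define K where "K = (LINT \<xi>|lborel. indicator {R..2 * R} \<xi> *\<^sub>R E \<xi>)"
  have "Re K = (LINT \<xi>|lborel. Re (indicator {R..2 * R} \<xi> *\<^sub>R E \<xi>))" unfolding K_def
      by (rule integral_Re[OF int, symmetric])
  also have "\<dots> = (LINT \<xi>|lborel. indicator {R..2 * R} \<xi> * (exp (- B * \<xi> powr a) * cos (z * \<xi> + \<tau> * \<xi> powr a
      + 0)))"
    using R by (intro Bochner_Integration.integral_cong) (auto simp: E_def Re_exp split: split_indicator)
  also have "\<bar>\<dots>\<bar> \<le> D" unfolding c by (rule D)
  finally have re: "\<bar>Re K\<bar> \<le> D" .
  have "Im K = (LINT \<xi>|lborel. Im (indicator {R..2 * R} \<xi> *\<^sub>R E \<xi>))" unfolding K_def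
      by (rule integral_Im[OF int, symmetric])
  also have "\<dots> = (LINT \<xi>|lborel. indicator {R..2 * R} \<xi> * (exp (- B * \<xi> powr a) * cos (z * \<xi> + \<tau> * \<xi> powr a
      + - (pi / 2))))"
    using R by (intro Bochner_Integration.integral_cong) (auto simp: E_def Im_exp cos_diff split:
        split_indicator)
  also have "\<bar>\<dots>\<bar> \<le> D" unfolding c by (rule D)
  finally have "\<bar>Im K\<bar> \<le> D" .
  with re have "norm K \<le> 2 * D" using cmod_le[of K] by linarith
  then show ?thesis unfolding K_def E_def .
qed

text \<open>
  Reflection of the negative half of the annulus replaces \<open>z\<close> by \<open>- z\<close>.
\<close>

lemma annulus_kernel:
  fixes a z \<tau> B D R :: real
  assumes R: "R > 0"
    and D: "\<And>c z'. \<bar>z'\<bar> = \<bar>z\<bar> \<Longrightarrow> \<bar>integral {R..2 * R} (\<lambda>\<xi>. exp (- B * \<xi> powr a) * cos (z' * \<xi> + \<tau> * \<xi> powr a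
        + c))\<bar> \<le> D"
  shows "norm (wave_kernel a R B \<tau> z) \<le> 4 * D"
proof -
  define E where "E z \<xi> = exp (\<i> * of_real (z * \<xi> + \<tau> * \<bar>\<xi>\<bar> powr a)) * complex_of_real (exp (- B * \<bar>\<xi>\<bar> powr a))"
      for z \<xi>
  have [measurable]: "E z \<in> borel_measurable borel" for z unfolding E_def by measurable
  have int: "integrable lborel (\<lambda>\<xi>. indicator {R..2 * R} \<xi> *\<^sub>R E z \<xi>)" for z
    by (rule borel_integrable_atLeastAtMost'[unfolded set_integrable_def])
       (use R in \<open>auto simp: E_def intro!: continuous_intros\<close>)
  have int2: "integrable lborel (\<lambda>\<xi>. indicator {R..2 * R} (- \<xi>) *\<^sub>R E (- z) (- \<xi>))"
    using lborel_integrable_real_affine[OF int[of "-z"], of "-1" 0] by simp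
  have "(LINT \<xi>|lborel. E z \<xi> * of_real (indicator (annulus R) \<xi>))
      = (LINT \<xi>|lborel. indicator {R..2 * R} \<xi> *\<^sub>R E z \<xi> + indicator {R..2 * R} (- \<xi>) *\<^sub>R E (- z) (- \<xi>))"
    using R by (intro Bochner_Integration.integral_cong) (auto simp: E_def annulus_def split: split_indicator)
  also have "\<dots> = (LINT \<xi>|lborel. indicator {R..2 * R} \<xi> *\<^sub>R E z \<xi>) + (LINT \<xi>|lborel. indicator {R..2
      * R} (- \<xi>) *\<^sub>R E (- z) (- \<xi>))"
    by (rule Bochner_Integration.integral_add[OF int int2])
  also have "(LINT \<xi>|lborel. indicator {R..2 * R} (- \<xi>) *\<^sub>R E (- z) (- \<xi>))
      = (LINT \<xi>|lborel. indicator {R..2 * R} \<xi> *\<^sub>R E (- z) \<xi>)"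
    by (subst (2) lborel_integral_real_affine[where c="-1" and t=0]) auto
  also have "norm ((LINT \<xi>|lborel. indicator {R..2 * R} \<xi> *\<^sub>R E z \<xi>) + \<dots>) \<le> 2 * D + 2 * D"
    unfolding E_def by (intro norm_triangle_mono half_annulus_kernel R D) auto
  finally show ?thesis unfolding wave_kernel_def E_def by simp
qed

text \<open>
  The parameter \<open>\<beta>\<close> of \<open>dyadic_cos_bound\<close> is chosen so that the exponent of \<open>R\<close> is below \<open>2 \<sigma>\<close> while the
  singularity in \<open>z\<close> remains integrable. If \<open>a \<noteq> 1\<close>, the choice \<open>\<beta> = 0\<close> gives the exponent \<open>1 / 2\<close>, and \<open>\<beta>\<close>
  close to \<open>1 / 2\<close> gives exponents close to \<open>a / 2 * (1 - 1 / \<gamma>)\<close>; if \<open>a = 1\<close>, then \<open>\<beta>\<close> close to \<open>1\<close> gives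
  exponents close to \<open>1 - 1 / \<gamma>\<close>.
\<close>

lemma annulus_kernel_bound:
  fixes a \<gamma> \<sigma> :: real
  assumes a: "a > 0" and \<gamma>: "\<gamma> > 1"
    and \<sigma>: "(a \<noteq> 1 \<and> \<sigma> > min (a / 4 * (1 - 1 / \<gamma>)) (1 / 4)) \<or> (a = 1 \<and> \<sigma> > 1 / 2 * (1 - 1 / \<gamma>))"
  obtains C e b1 b2 where "C > 0" "e < 2 * \<sigma>" "b1 < 1" "b2 < 1"
    "\<And>R z \<tau> B. R \<ge> 1 \<Longrightarrow> z \<noteq> 0 \<Longrightarrow> \<bar>\<tau>\<bar> powr \<gamma> \<le> B \<Longrightarrow>
      norm (wave_kernel a R B \<tau> z)
      \<le> C * R powr e * (\<bar>z\<bar> powr (- b1) + \<bar>z\<bar> powr (- b2))"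
proof -
  have g1: "1 - 1 / \<gamma> > 0" using \<gamma> by simp
  have \<sigma>0: "\<sigma> > 0"
  proof -
    have "a / 4 * (1 - 1 / \<gamma>) > 0" using a g1 by simp
    then have "min (a / 4 * (1 - 1 / \<gamma>)) (1 / 4) > 0" by simp
    moreover have "1 / 2 * (1 - 1 / \<gamma>) > 0" by (rule mult_pos_pos[OF _ g1]) simp
    ultimately show ?thesis using \<sigma> by linarith
  qed
  define \<epsilon> where "\<epsilon> = min (1/2) \<sigma>"
  have \<epsilon>: "0 < \<epsilon>" "\<epsilon> < 1" "\<epsilon> < 2 * \<sigma>" using \<sigma>0 by (auto simp: \<epsilon>_def)
  \<comment> \<open>the exponents of \<open>R\<close> and of \<open>1 / \<bar>z\<bar>\<close> in the second term of \<open>dyadic_cos_bound\<close>\<close>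
  define ex where "ex \<beta> = (if a = 1 then 1 - \<beta> / \<gamma> else 1 / 2 + \<beta> * (a - 1 - a / \<gamma>))" for \<beta>
  define bx where "bx \<beta> = (if a = 1 then \<beta> else 1 / 2 + \<beta>)" for \<beta> :: real
  have "\<exists>\<beta>. 0 \<le> \<beta> \<and> \<beta> < 1 \<and> ex \<beta> < 2 * \<sigma> \<and> bx \<beta> < 1"
  proof (cases "a = 1")
    case True
    define gap where "gap = 2 * \<sigma> - (1 - 1 / \<gamma>)"
    have gap: "gap > 0" using \<sigma> True by (simp add: gap_def)
    define \<delta> where "\<delta> = min 1 (\<gamma> * gap / 2)"
    have \<delta>: "0 < \<delta>" "\<delta> \<le> 1" "\<delta> \<le> \<gamma> * gap / 2" using gap \<gamma> by (auto simp: \<delta>_def)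
    have "\<delta> / \<gamma> \<le> gap / 2" using \<delta>(3) \<gamma> by (simp add: field_simps)
    moreover have "1 - (1 - \<delta>) / \<gamma> = (1 - 1 / \<gamma>) + \<delta> / \<gamma>" by (simp add: diff_divide_distrib)
    ultimately have "ex (1 - \<delta>) < 2 * \<sigma>" using True gap unfolding ex_def gap_def by simp
    then show ?thesis using \<delta> True by (intro exI[of _ "1 - \<delta>"]) (auto simp: bx_def)
  next
    case False
    show ?thesis
    proof (cases "\<sigma> > 1 / 4")
      case True
      then show ?thesis using False by (intro exI[of _ 0]) (auto simp: ex_def bx_def)
    next
      case F2: False
      then have s: "\<sigma> > a / 4 * (1 - 1 / \<gamma>)" using \<sigma> False by (auto simp: min_def split: if_splits)
      define K where "K = a - 1 - a / \<gamma>"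
      define gap where "gap = 2 * \<sigma> - (1 / 2 + K / 2)"
      have gap: "gap > 0" using s by (simp add: gap_def K_def field_simps)
      define \<delta> where "\<delta> = min (1/2) (gap / (2 * (\<bar>K\<bar> + 1)))"
      have "0 < \<delta>" using gap by (simp add: \<delta>_def)
      moreover have "\<delta> \<le> 1/2" "\<delta> \<le> gap / (2 * (\<bar>K\<bar> + 1))"
        unfolding \<delta>_def by (rule min.cobounded1, rule min.cobounded2)
      ultimately have \<delta>: "0 < \<delta>" "\<delta> \<le> 1/2" "\<delta> \<le> gap / (2 * (\<bar>K\<bar> + 1))" by blast+
      have "- (\<delta> * K) \<le> \<delta> * (\<bar>K\<bar> + 1)" using mult_left_mono[of "- K" "\<bar>K\<bar> + 1" \<delta>] \<delta> by simp
      also have "\<dots> \<le> gap / (2 * (\<bar>K\<bar> + 1)) * (\<bar>K\<bar> + 1)" using \<delta> by (intro mult_right_mono) auto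
      also have "\<dots> = gap / 2" by (simp add: field_simps)
      finally have "1 / 2 + (1 / 2 - \<delta>) * K < 2 * \<sigma>" using gap by (simp add: gap_def algebra_simps)
      then show ?thesis using \<delta> False by (intro exI[of _ "1 / 2 - \<delta>"]) (auto simp: ex_def bx_def K_def)
    qed
  qed
  then obtain \<beta> where \<beta>: "0 \<le> \<beta>" "\<beta> < 1" "ex \<beta> < 2 * \<sigma>" "bx \<beta> < 1" by blast
  obtain C where C: "C > 0" and bd: "\<And>R z \<tau> B c. R > 0 \<Longrightarrow> z \<noteq> 0 \<Longrightarrow> \<bar>\<tau>\<bar> powr \<gamma> \<le> B \<Longrightarrow>
       \<bar>integral {R..2 * R} (\<lambda>\<xi>. exp (- B * \<xi> powr a) * cos (z * \<xi> + \<tau> * \<xi> powr a + c))\<bar>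
       \<le> C * (R powr \<epsilon> * \<bar>z\<bar> powr (\<epsilon> - 1) +
              (if a = 1 then R powr (1 - \<beta> / \<gamma>) * \<bar>z\<bar> powr (- \<beta>)
               else R powr (1 / 2 + \<beta> * (a - 1 - a / \<gamma>)) * \<bar>z\<bar> powr (- 1 / 2 - \<beta>)))"
    by (rule dyadic_cos_bound[OF a \<gamma> \<epsilon>(1,2) \<beta>(1,2)]) blast
  define e where "e = max \<epsilon> (ex \<beta>)"
  show ?thesis
  proof (rule that[of "4 * C" e "1 - \<epsilon>" "bx \<beta>"])
    show "4 * C > 0" "e < 2 * \<sigma>" "1 - \<epsilon> < 1" "bx \<beta> < 1" using C \<epsilon> \<beta> by (auto simp: e_def)
    fix R z \<tau> B :: real
    assume R: "1 \<le> R" and z: "z \<noteq> 0" and B: "\<bar>\<tau>\<bar> powr \<gamma> \<le> B"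
    have le: "R powr \<epsilon> * \<bar>z\<bar> powr (\<epsilon> - 1) + (if a = 1 then R powr (1 - \<beta> / \<gamma>) * \<bar>z\<bar> powr (- \<beta>)
               else R powr (1 / 2 + \<beta> * (a - 1 - a / \<gamma>)) * \<bar>z\<bar> powr (- 1 / 2 - \<beta>))
       \<le> R powr e * (\<bar>z\<bar> powr (- (1 - \<epsilon>)) + \<bar>z\<bar> powr (- bx \<beta>))"
    proof -
      have "(if a = 1 then R powr (1 - \<beta> / \<gamma>) * \<bar>z\<bar> powr (- \<beta>)
               else R powr (1 / 2 + \<beta> * (a - 1 - a / \<gamma>)) * \<bar>z\<bar> powr (- 1 / 2 - \<beta>))
                  = R powr (ex \<beta>) * \<bar>z\<bar> powr (- bx \<beta>)"
        by (simp add: ex_def bx_def)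
      moreover have "R powr \<epsilon> * \<bar>z\<bar> powr (\<epsilon> - 1) \<le> R powr e * \<bar>z\<bar> powr (- (1 - \<epsilon>))"
        using R by (auto intro!: mult_right_mono powr_mono simp: e_def)
      moreover have "R powr (ex \<beta>) * \<bar>z\<bar> powr (- bx \<beta>) \<le> R powr e * \<bar>z\<bar> powr (- bx \<beta>)"
        using R by (intro mult_right_mono powr_mono) (auto simp: e_def)
      ultimately show ?thesis by (simp add: distrib_left)
    qed
    have "norm (wave_kernel a R B \<tau> z)
       \<le> 4 * (C * (R powr e * (\<bar>z\<bar> powr (- (1 - \<epsilon>)) + \<bar>z\<bar> powr (- bx \<beta>))))"
    proof (rule annulus_kernel)
      fix c z' :: real assume z': "\<bar>z'\<bar> = \<bar>z\<bar>"
      have "R > 0" "z' \<noteq> 0" using R z z' by auto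
      from bd[OF this B, of c] z'
      show "\<bar>integral {R..2 * R} (\<lambda>\<xi>. exp (- B * \<xi> powr a) * cos (z' * \<xi> + \<tau> * \<xi> powr a + c))\<bar>
          \<le> C * (R powr e * (\<bar>z\<bar> powr (- (1 - \<epsilon>)) + \<bar>z\<bar> powr (- bx \<beta>)))"
        using mult_left_mono[OF le, of C] C by (simp only:) linarith
    qed (use R in auto)
    then show "norm (wave_kernel a R B \<tau> z)
       \<le> 4 * C * R powr e * (\<bar>z\<bar> powr (- (1 - \<epsilon>)) + \<bar>z\<bar> powr (- bx \<beta>))" by (simp only: mult.assoc)
  qed
qed

lemma nn_integral_abs_powr_local:
  assumes b: "b < 1" and M: "M \<ge> 0"
  shows "(\<integral>\<^sup>+z. ennreal (\<bar>z\<bar> powr (- b)) * indicator {-M..M} z \<partial>lborel)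
      = ennreal (2 * (M powr (1 - b) / (1 - b)))"
proof -
  have pos: "(\<integral>\<^sup>+z. ennreal (\<bar>z\<bar> powr (- b)) * indicator {0..M} z \<partial>lborel) = ennreal (M powr (1 - b) / (1 - b))"
  proof -
    have "(\<integral>\<^sup>+z. ennreal (\<bar>z\<bar> powr (- b)) * indicator {0..M} z \<partial>lborel)
        = (\<integral>\<^sup>+z. ennreal (z powr ((1 - b) - 1)) * indicator {0..M} z \<partial>lborel)"
      by (intro nn_integral_cong) (auto split: split_indicator)
    then show ?thesis using nn_integral_powr_from_0[of "1 - b" M] b M by simp
  qed
  have "(\<integral>\<^sup>+z. ennreal (\<bar>z\<bar> powr (- b)) * indicator {-M..M} z \<partial>lborel)
     = (\<integral>\<^sup>+z. ennreal (\<bar>z\<bar> powr (- b)) * indicator {0..M} z + ennreal (\<bar>-z\<bar> powr (- b)) * indicator {0..M} (-z)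
         \<partial>lborel)"
  proof (rule nn_integral_cong_AE)
    have "AE z in lborel. z \<noteq> (0::real)" by (rule AE_lborel_singleton)
    then show "AE z in lborel. ennreal (\<bar>z\<bar> powr (- b)) * indicator {-M..M} z
        = ennreal (\<bar>z\<bar> powr (- b)) * indicator {0..M} z + ennreal (\<bar>-z\<bar> powr (- b)) * indicator {0..M} (-z)"
      by eventually_elim (auto split: split_indicator)
  qed
  also have "\<dots> = (\<integral>\<^sup>+z. ennreal (\<bar>z\<bar> powr (- b)) * indicator {0..M} z \<partial>lborel) + (\<integral>\<^sup>+z. ennreal (\<bar>-z\<bar> powr (-
      b)) * indicator {0..M} (-z) \<partial>lborel)"
    by (rule nn_integral_add) measurable
  also have "(\<integral>\<^sup>+z. ennreal (\<bar>-z\<bar> powr (- b)) * indicator {0..M} (-z) \<partial>lborel)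
      = (\<integral>\<^sup>+z. ennreal (\<bar>z\<bar> powr (- b)) * indicator {0..M} z \<partial>lborel)"
    using nn_integral_real_affine[of "\<lambda>z. ennreal (\<bar>z\<bar> powr (- b)) * indicator {0..M} z" "-1" 0] by simp
  finally show ?thesis using b unfolding pos by (simp add: ennreal_plus[symmetric] del: ennreal_plus)
qed

text \<open>
  The damping at two times controls the difference of the times; hence the kernel bound is uniform in all
  times.
\<close>

lemma abs_diff_powr_le:
  fixes t u \<gamma> :: real
  assumes "t > 0" "u > 0" "\<gamma> > 0"
  shows "\<bar>t - u\<bar> powr \<gamma> \<le> t powr \<gamma> + u powr \<gamma>"
proof -
  have "\<bar>t - u\<bar> powr \<gamma> \<le> max t u powr \<gamma>" using assms by (intro powr_mono2) auto
  also have "\<dots> \<le> t powr \<gamma> + u powr \<gamma>" by (auto simp: max_def)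
  finally show ?thesis .
qed

text \<open>
  Let \<open>H(x)\<close> be the part of the solution at the point \<open>x\<close> and time \<open>t(x)\<close>, \<open>W\<close> the truncation of \<open>cnj H\<close> to
  \<open>[-M, M]\<close>, and \<open>V\<close> the transposed operator applied to \<open>W\<close>. Then \<open>Q = \<integral> \<bar>W\<bar>\<^sup>2 = \<integral> W H\<close> equals \<open>\<integral> g V\<close> over
  the annulus, and the Schur test gives \<open>\<integral> \<bar>V\<bar>\<^sup>2 \<le> c' Q\<close> there. As \<open>2 \<bar>g V\<bar> \<le> c' \<bar>g\<bar>\<^sup>2 + \<bar>V\<bar>\<^sup>2 / c'\<close>, half of
  \<open>Q\<close> is absorbed on the left.
\<close>

lemma maximal_linearized:
  fixes g :: "real \<Rightarrow> complex" and t :: "real \<Rightarrow> real"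
  assumes \<gamma>: "\<gamma> > 1" and C: "C > 0" and b: "b1 < 1" "b2 < 1"
    and K: "\<And>R z \<tau> B. R \<ge> 1 \<Longrightarrow> z \<noteq> 0 \<Longrightarrow> \<bar>\<tau>\<bar> powr \<gamma> \<le> B \<Longrightarrow>
      norm (wave_kernel a R B \<tau> z)
      \<le> C * R powr e * (\<bar>z\<bar> powr (- b1) + \<bar>z\<bar> powr (- b2))"
    and R: "R \<ge> 1" and M: "M > 0"
    and [measurable]: "g \<in> borel_measurable borel" "t \<in> borel_measurable borel" and t: "\<And>x. t x > 0"
    and N: "(\<integral>\<^sup>+\<xi>. ennreal ((norm (g \<xi>))\<^sup>2) * indicator (annulus R) \<xi> \<partial>lborel) \<le> ennreal N"
    and c: "c = C * (2 * ((2 * M) powr (1 - b1) / (1 - b1)) + 2 * ((2 * M) powr (1 - b2) / (1 - b2)))"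
  shows "(\<integral>\<^sup>+x. ennreal ((norm (LINT \<xi>|lborel. indicator (annulus R) \<xi> *\<^sub>R (g \<xi> * wave a \<gamma> (t x) x \<xi>)))\<^sup>2)
      * indicator {-M..M} x \<partial>lborel)
     \<le> ennreal (c * R powr e * N)"
proof -
  define S where "S = annulus R"
  have [measurable]: "S \<in> sets borel" unfolding S_def by measurable
  have Sfin: "emeasure lborel S < \<infinity>"
  proof -
    have "emeasure lborel S \<le> emeasure lborel {-(2 * R)..2 * R}"
        by (intro emeasure_mono) (auto simp: S_def annulus_def)
    also have "\<dots> < \<infinity>" by (simp add: emeasure_lborel_Icc_eq)
    finally show ?thesis .
  qed
  define G where "G \<xi> = indicator S \<xi> *\<^sub>R g \<xi>" for \<xi>
  have [measurable]: "G \<in> borel_measurable borel" unfolding G_def by measurable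
  have G2: "(\<integral>\<^sup>+\<xi>. ennreal ((norm (G \<xi>))\<^sup>2) \<partial>lborel) \<le> ennreal N"
  proof -
    have "(\<integral>\<^sup>+\<xi>. ennreal ((norm (G \<xi>))\<^sup>2) \<partial>lborel) = (\<integral>\<^sup>+\<xi>. ennreal ((norm (g \<xi>))\<^sup>2) * indicator (annulus R) \<xi>
        \<partial>lborel)"
      by (intro nn_integral_cong) (auto simp: G_def S_def split: split_indicator)
    then show ?thesis using N by simp
  qed
  have iG: "integrable lborel G"
  proof (rule integrableI_bounded)
    have "(\<integral>\<^sup>+\<xi>. ennreal (norm (G \<xi>)) \<partial>lborel) \<le> (\<integral>\<^sup>+\<xi>. ennreal ((norm (G \<xi>))\<^sup>2) + indicator S \<xi> \<partial>lborel)"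
    proof (rule nn_integral_mono)
      fix \<xi>
      show "ennreal (norm (G \<xi>)) \<le> ennreal ((norm (G \<xi>))\<^sup>2) + indicator S \<xi>"
      proof (cases "\<xi> \<in> S")
        case True
        have "norm (G \<xi>) \<le> (norm (G \<xi>))\<^sup>2 + 1"
          using sum_squares_bound[of "norm (G \<xi>)" "1/2"] by (simp add: power2_eq_square)
        then have "ennreal (norm (G \<xi>)) \<le> ennreal ((norm (G \<xi>))\<^sup>2 + 1)" by (rule ennreal_leI)
        also have "\<dots> = ennreal ((norm (G \<xi>))\<^sup>2) + ennreal 1" by (rule ennreal_plus) auto
        finally show ?thesis using True by simp
      qed (simp add: G_def)
    qed
    also have "\<dots> = (\<integral>\<^sup>+\<xi>. ennreal ((norm (G \<xi>))\<^sup>2) \<partial>lborel) + emeasure lborel S"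
      by (subst nn_integral_add) auto
    also have "\<dots> < \<infinity>" using Sfin le_less_trans[OF G2] by (auto simp: ennreal_add_less_top)
    finally show "(\<integral>\<^sup>+\<xi>. ennreal (norm (G \<xi>)) \<partial>lborel) < \<infinity>" .
  qed measurable
  define H where "H x = (LINT \<xi>|lborel. G \<xi> * wave a \<gamma> (t x) x \<xi>)" for x
  have H: "H x = (LINT \<xi>|lborel. indicator (annulus R) \<xi> *\<^sub>R (g \<xi> * wave a \<gamma> (t x) x \<xi>))" for x
    unfolding H_def G_def S_def by simp
  have [measurable]: "H \<in> borel_measurable borel" unfolding H_def by measurable
  define B0 where "B0 = (LINT \<xi>|lborel. norm (G \<xi>))"
  have HB: "norm (H x) \<le> B0" for x
    unfolding H_def B0_def
  proof (rule Bochner_Integration.integral_norm_bound_integral)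
    show "integrable lborel (\<lambda>\<xi>. G \<xi> * wave a \<gamma> (t x) x \<xi>)"
      by (rule Bochner_Integration.integrable_bound[OF iG]) (auto simp: norm_mult intro!: mult_right_le_one_le
          norm_wave_le_1)
  qed (use iG in \<open>auto simp: norm_mult intro!: mult_right_le_one_le norm_wave_le_1\<close>)
  define W where "W x = indicator {-M..M} x *\<^sub>R cnj (H x)" for x
  have [measurable]: "cnj \<in> borel_measurable borel" by (intro borel_measurable_continuous_onI continuous_intros)
  have [measurable]: "W \<in> borel_measurable borel" unfolding W_def by measurable
  have iW: "integrable lborel W"
    unfolding W_def using HB
    by (intro integrableI_bounded_set_indicator[where B=B0]) (auto simp: emeasure_lborel_Icc_eq)
  define Q where "Q = (\<integral>\<^sup>+x. ennreal ((norm (W x))\<^sup>2) \<partial>lborel)"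
  have iW2: "integrable lborel (\<lambda>x. (norm (W x))\<^sup>2)"
  proof -
    have "integrable lborel (\<lambda>x. indicator {-M..M} x *\<^sub>R (norm (H x))\<^sup>2)"
      using HB power_mono[OF HB, of _ 2] by (intro integrableI_bounded_set_indicator[where B="B0\<^sup>2"]) (auto
          simp: emeasure_lborel_Icc_eq)
    also have "(\<lambda>x. indicator {-M..M} x *\<^sub>R (norm (H x))\<^sup>2) = (\<lambda>x. (norm (W x))\<^sup>2)"
      by (auto simp: W_def split: split_indicator)
    finally show ?thesis .
  qed
  define Qr where "Qr = (LINT x|lborel. (norm (W x))\<^sup>2)"
  have Qr: "Q = ennreal Qr" "Qr \<ge> 0" unfolding Q_def Qr_def by (auto intro!: nn_integral_eq_integral iW2)
  define V where "V \<xi> = (LINT x|lborel. W x * wave a \<gamma> (t x) x \<xi>)" for \<xi>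
  have [measurable]: "V \<in> borel_measurable borel" unfolding V_def by measurable
  have c0: "c > 0" unfolding c using C b M by (intro mult_pos_pos add_pos_pos divide_pos_pos) auto
  define c' where "c' = c * R powr e"
  have c': "c' > 0" using c0 R by (simp add: c'_def)
  define \<kappa> where "\<kappa> z = C * R powr e * (\<bar>z\<bar> powr (- b1) + \<bar>z\<bar> powr (- b2)) * indicator {-(2 * M)..2 * M} z"
      for z
  have VQ: "(\<integral>\<^sup>+\<xi>. ennreal ((norm (V \<xi>))\<^sup>2 * indicator S \<xi>) \<partial>lborel) \<le> ennreal c' * Q"
  proof -
    have "(\<integral>\<^sup>+\<xi>. ennreal ((norm (V \<xi>))\<^sup>2 * indicator S \<xi>) \<partial>lborel) \<le> (\<integral>\<^sup>+z. ennreal (\<kappa> z) \<partial>lborel) * Q"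
      unfolding V_def Q_def
    proof (rule TT_star_schur[OF _ norm_wave_le_1 _ _ iW])
      show "(\<lambda>(x, \<xi>). wave a \<gamma> (t x) x \<xi>) \<in> borel_measurable (borel \<Otimes>\<^sub>M borel)" unfolding case_prod_beta'
          by measurable
      show "integrable lborel (indicat_real S)" using Sfin by (intro integrable_real_indicator) auto
      show "\<kappa> \<in> borel_measurable borel" unfolding \<kappa>_def by measurable
      show "\<kappa> (- z) = \<kappa> z" for z by (auto simp: \<kappa>_def split: split_indicator)
      fix x y assume xy: "x \<noteq> y" "W x \<noteq> 0" "W y \<noteq> 0"
      then have xyM: "\<bar>x\<bar> \<le> M" "\<bar>y\<bar> \<le> M" by (auto simp: W_def split: split_indicator_asm)
      have "norm (LINT \<xi>|lborel. wave a \<gamma> (t x) x \<xi> * cnj (wave a \<gamma> (t y) y \<xi>) * of_real (indicator S \<xi>))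
        \<le> C * R powr e * (\<bar>x - y\<bar> powr (- b1) + \<bar>x - y\<bar> powr (- b2))"
        unfolding wave_mult_cnj S_def using xy \<gamma> t
            by (intro K[unfolded wave_kernel_def] R abs_diff_powr_le) auto
      moreover have "x - y \<in> {-(2 * M)..2 * M}" using xyM by (auto simp: abs_le_iff)
      then have "C * R powr e * (\<bar>x - y\<bar> powr (- b1) + \<bar>x - y\<bar> powr (- b2)) = \<kappa> (x - y)" by (simp add: \<kappa>_def)
      ultimately show "norm (LINT \<xi>|lborel. wave a \<gamma> (t x) x \<xi> * cnj (wave a \<gamma> (t y) y \<xi>) * of_real (indicator S
          \<xi>)) \<le> \<kappa> (x - y)" by (simp only:)
    qed auto
    also have "(\<integral>\<^sup>+z. ennreal (\<kappa> z) \<partial>lborel) = ennreal c'"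
    proof -
      have "(\<integral>\<^sup>+z. ennreal (\<kappa> z) \<partial>lborel) = (\<integral>\<^sup>+z. ennreal (C * R powr e) * (ennreal (\<bar>z\<bar> powr (- b1))
          * indicator {-(2 * M)..2 * M} z + ennreal (\<bar>z\<bar> powr (- b2)) * indicator {-(2 * M)..2 * M} z) \<partial>lborel)"
      proof (rule nn_integral_cong)
        fix z :: real
        have "ennreal (C * R powr e * (\<bar>z\<bar> powr (- b1) + \<bar>z\<bar> powr (- b2)))
            = ennreal (C * R powr e) * (ennreal (\<bar>z\<bar> powr (- b1)) + ennreal (\<bar>z\<bar> powr (- b2)))"
          using C by (subst ennreal_mult) (auto simp: ennreal_plus)
        then show "ennreal (\<kappa> z) = ennreal (C * R powr e) * (ennreal (\<bar>z\<bar> powr (- b1)) * indicator {-(2 * M)..2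
            * M} z + ennreal (\<bar>z\<bar> powr (- b2)) * indicator {-(2 * M)..2 * M} z)"
          by (auto simp: \<kappa>_def split: split_indicator)
      qed
      also have "\<dots> = ennreal (C * R powr e) * (ennreal (2 * ((2 * M) powr (1 - b1) / (1 - b1))) + ennreal (2
          * ((2 * M) powr (1 - b2) / (1 - b2))))"
        using b M by (subst nn_integral_cmult, measurable, subst nn_integral_add) (auto simp:
            nn_integral_abs_powr_local)
      also have "\<dots> = ennreal c'"
        using b M C unfolding c'_def c by (subst ennreal_plus[symmetric], simp, simp, subst
            ennreal_mult[symmetric]) (auto simp: mult_ac intro!: add_nonneg_nonneg)
      finally show ?thesis .
    qed
    finally show ?thesis .
  qed
  have "complex_of_real Qr = (LINT \<xi>|lborel. G \<xi> * V \<xi>)"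
  proof -
    have iP: "integrable (lborel \<Otimes>\<^sub>M lborel) (\<lambda>(x, \<xi>). W x * (G \<xi> * wave a \<gamma> (t x) x \<xi>))"
    proof (rule Bochner_Integration.integrable_bound)
      show "integrable (lborel \<Otimes>\<^sub>M lborel) (\<lambda>(x, \<xi>). W x * G \<xi>)"
        by (intro integrable_tensor lborel_pair.pair_sigma_finite_axioms iW iG)
      show "(\<lambda>(x, \<xi>). W x * (G \<xi> * wave a \<gamma> (t x) x \<xi>)) \<in> borel_measurable (lborel \<Otimes>\<^sub>M lborel)"
          unfolding case_prod_beta' by measurable
    qed (auto simp: norm_mult intro!: AE_I2 mult_left_mono mult_right_le_one_le norm_wave_le_1)
    have "complex_of_real Qr = (LINT x|lborel. complex_of_real ((norm (W x))\<^sup>2))" unfolding Qr_def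
        by (rule integral_complex_of_real[symmetric])
    also have "\<dots> = (LINT x|lborel. W x * H x)"
    proof (intro Bochner_Integration.integral_cong refl)
      fix x
      have "complex_of_real ((norm (H x))\<^sup>2) = H x * cnj (H x)" by (rule complex_norm_square)
      then show "complex_of_real ((norm (W x))\<^sup>2) = W x * H x"
          by (auto simp: W_def mult.commute split: split_indicator)
    qed
    also have "\<dots> = (LINT x|lborel. (LINT \<xi>|lborel. W x * (G \<xi> * wave a \<gamma> (t x) x \<xi>)))" unfolding H_def by simp
    also have "\<dots> = (LINT \<xi>|lborel. (LINT x|lborel. W x * (G \<xi> * wave a \<gamma> (t x) x \<xi>)))"
      by (rule lborel_pair.Fubini_integral[symmetric]) (use iP in simp)
    also have "\<dots> = (LINT \<xi>|lborel. G \<xi> * V \<xi>)"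
      unfolding V_def integral_mult_right_zero[symmetric]
          by (intro Bochner_Integration.integral_cong) (auto simp: mult_ac)
    finally show ?thesis .
  qed
  moreover have "Qr = norm (complex_of_real Qr)" using Qr by simp
  ultimately have "ennreal Qr = ennreal (norm (LINT \<xi>|lborel. G \<xi> * V \<xi>))" by (simp only:)
  also have "\<dots> \<le> (\<integral>\<^sup>+\<xi>. ennreal (norm (G \<xi> * V \<xi>)) \<partial>lborel)"
    by (cases "integrable lborel (\<lambda>\<xi>. G \<xi> * V \<xi>)") (auto intro: integral_norm_bound_ennreal simp:
        not_integrable_integral_eq)
  also have "\<dots> \<le> (\<integral>\<^sup>+\<xi>. ennreal (c' / 2) * ennreal ((norm (G \<xi>))\<^sup>2) + ennreal (1 / (2 * c')) * ennreal ((norm (V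
      \<xi>))\<^sup>2 * indicator S \<xi>) \<partial>lborel)"
  proof (rule nn_integral_mono)
    fix \<xi>
    show "ennreal (norm (G \<xi> * V \<xi>)) \<le> ennreal (c' / 2) * ennreal ((norm (G \<xi>))\<^sup>2) + ennreal (1 / (2 * c'))
        * ennreal ((norm (V \<xi>))\<^sup>2 * indicator S \<xi>)"
    proof (cases "\<xi> \<in> S")
      case True
      have "0 \<le> (c' * norm (G \<xi>) - norm (V \<xi>))\<^sup>2" by simp
      then have "2 * c' * (norm (G \<xi>) * norm (V \<xi>)) \<le> c'\<^sup>2 * (norm (G \<xi>))\<^sup>2 + (norm (V \<xi>))\<^sup>2"
        by (simp add: power2_eq_square algebra_simps)
      then have "norm (G \<xi>) * norm (V \<xi>) \<le> c' / 2 * (norm (G \<xi>))\<^sup>2 + 1 / (2 * c') * (norm (V \<xi>))\<^sup>2"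
        using c' by (simp add: field_simps power2_eq_square)
      then have "ennreal (norm (G \<xi> * V \<xi>)) \<le> ennreal (c' / 2 * (norm (G \<xi>))\<^sup>2 + 1 / (2 * c') * (norm (V \<xi>))\<^sup>2)"
        unfolding norm_mult by (rule ennreal_leI)
      also have "\<dots> = ennreal (c' / 2) * ennreal ((norm (G \<xi>))\<^sup>2) + ennreal (1 / (2 * c')) * ennreal ((norm (V
          \<xi>))\<^sup>2)"
        using c' by (simp add: ennreal_mult[symmetric] ennreal_plus[symmetric] del: ennreal_plus
            times_divide_eq_left times_divide_eq_right)
      finally show ?thesis using True by simp
    qed (simp add: G_def)
  qed
  also have "\<dots> = ennreal (c' / 2) * (\<integral>\<^sup>+\<xi>. ennreal ((norm (G \<xi>))\<^sup>2) \<partial>lborel) + ennreal (1 / (2 * c'))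
      * (\<integral>\<^sup>+\<xi>. ennreal ((norm (V \<xi>))\<^sup>2 * indicator S \<xi>) \<partial>lborel)"
    by (subst nn_integral_add) (auto simp: nn_integral_cmult)
  also have "\<dots> \<le> ennreal (c' / 2) * ennreal N + ennreal (1 / (2 * c')) * (ennreal c' * Q)"
    by (intro add_mono mult_left_mono G2 VQ) auto
  finally have fin: "ennreal Qr \<le> ennreal (c' / 2) * ennreal N + ennreal (1 / (2 * c')) * (ennreal c' * Q)" .
  \<comment> \<open>\<open>ennreal\<close> sends negative \<open>N\<close> to \<open>0\<close>\<close>
  define N' where "N' = max 0 N"
  have N': "ennreal N = ennreal N'" "N' \<ge> 0" by (auto simp: N'_def max_def ennreal_neg)
  have "ennreal (c' / 2) * ennreal N + ennreal (1 / (2 * c')) * (ennreal c' * Q)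
      = ennreal (c' / 2 * N' + 1 / (2 * c') * (c' * Qr))"
    using c' Qr N' by (simp add: ennreal_mult[symmetric] ennreal_plus[symmetric] del: ennreal_plus
        times_divide_eq_left times_divide_eq_right)
  with fin have "ennreal Qr \<le> ennreal (c' / 2 * N' + 1 / (2 * c') * (c' * Qr))" by (simp only:)
  moreover have "0 \<le> c' / 2 * N' + 1 / (2 * c') * (c' * Qr)"
    using c' Qr(2) N'(2) by (intro add_nonneg_nonneg mult_nonneg_nonneg) auto
  ultimately have "Qr \<le> c' / 2 * N' + 1 / (2 * c') * (c' * Qr)" by (simp only: ennreal_le_iff)
  also have "1 / (2 * c') * (c' * Qr) = Qr / 2" using c' by simp
  finally have "Qr \<le> c' * N'" by simp
  then have "Q \<le> ennreal (c' * N')" unfolding Qr by (rule ennreal_leI)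
  also have "\<dots> = ennreal (c' * N)" using c' N' by (simp add: ennreal_mult' )
  finally have "Q \<le> ennreal (c * R powr e * N)" by (simp add: c'_def)
  also have "Q = (\<integral>\<^sup>+x. ennreal ((norm (H x))\<^sup>2) * indicator {-M..M} x \<partial>lborel)"
    unfolding Q_def by (intro nn_integral_cong) (auto simp: W_def split: split_indicator)
  finally show ?thesis unfolding H .
qed

text \<open>
  For finitely many times the one with the largest value is a measurable function of \<open>x\<close>; the bound for these
  functions passes to the supremum by monotone convergence.
\<close>

lemma maximal_countable:
  fixes g :: "real \<Rightarrow> complex" and r :: "nat \<Rightarrow> real"
  assumes \<gamma>: "\<gamma> > 1" and C: "C > 0" and b: "b1 < 1" "b2 < 1"
    and K: "\<And>R z \<tau> B. R \<ge> 1 \<Longrightarrow> z \<noteq> 0 \<Longrightarrow> \<bar>\<tau>\<bar> powr \<gamma> \<le> B \<Longrightarrow>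
      norm (wave_kernel a R B \<tau> z)
      \<le> C * R powr e * (\<bar>z\<bar> powr (- b1) + \<bar>z\<bar> powr (- b2))"
    and R: "R \<ge> 1" and M: "M > 0"
    and [measurable]: "g \<in> borel_measurable borel" and r: "\<And>k. r k > 0"
    and N: "(\<integral>\<^sup>+\<xi>. ennreal ((norm (g \<xi>))\<^sup>2) * indicator (annulus R) \<xi> \<partial>lborel) \<le> ennreal N"
    and c: "c = C * (2 * ((2 * M) powr (1 - b1) / (1 - b1)) + 2 * ((2 * M) powr (1 - b2) / (1 - b2)))"
  shows "(\<integral>\<^sup>+x. (SUP k. ennreal ((norm (LINT \<xi>|lborel. indicator (annulus R) \<xi> *\<^sub>R (g \<xi> * wave a \<gamma> (r k) x
      \<xi>)))\<^sup>2)) * indicator {-M..M} x \<partial>lborel)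
     \<le> ennreal (c * R powr e * N)"
proof -
  define U where "U t x = (LINT \<xi>|lborel. indicator (annulus R) \<xi> *\<^sub>R (g \<xi> * wave a \<gamma> t x \<xi>))" for t x
  \<comment> \<open>\<open>\<tau> k x\<close> is the first of the times \<open>r 0, \<dots>, r k\<close> at which the value at \<open>x\<close> is largest\<close>
  define \<tau> where "\<tau> = rec_nat (\<lambda>x. r 0) (\<lambda>k f x. if norm (U (f x) x) < norm (U (r (Suc k)) x) then r (Suc k)
      else f x)"
  have \<tau>0: "\<tau> 0 x = r 0" and \<tau>S: "\<tau> (Suc k) x = (if norm (U (\<tau> k x) x) < norm (U (r (Suc k)) x) then r (Suc k)
      else \<tau> k x)" for k x
    by (simp_all add: \<tau>_def)
  have Um: "(\<lambda>x. U (t x) x) \<in> borel_measurable borel" if [measurable]: "t \<in> borel_measurable borel" for t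
    unfolding U_def by measurable
  have \<tau>m: "\<tau> k \<in> borel_measurable borel" for k
  proof (induction k)
    case 0
    have "\<tau> 0 = (\<lambda>x. r 0)" by (rule ext) (rule \<tau>0)
    then show ?case by simp
  next
    case (Suc k)
    note [measurable] = Suc Um[OF Suc] Um[of "\<lambda>_. r (Suc k)", OF borel_measurable_const]
    show ?case unfolding \<tau>S[abs_def] by measurable
  qed
  have \<tau>pos: "\<tau> k x > 0" for k x by (induction k) (auto simp: \<tau>0 \<tau>S r)
  have best: "norm (U (r j) x) \<le> norm (U (\<tau> k x) x)" if "j \<le> k" for j k x
    using that
  proof (induction k)
    case (Suc k)
    then show ?case by (cases "j = Suc k") (auto simp: \<tau>S)
  qed (simp add: \<tau>0)
  have inc: "norm (U (\<tau> k x) x) \<le> norm (U (\<tau> (Suc k) x) x)" for k x by (simp add: \<tau>S)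
  define A where "A k x = ennreal ((norm (U (\<tau> k x) x))\<^sup>2) * indicator {-M..M} x" for k x
  have [measurable]: "A k \<in> borel_measurable borel" for k unfolding A_def using Um[OF \<tau>m] by measurable
  have "(\<integral>\<^sup>+x. (SUP k. ennreal ((norm (U (r k) x))\<^sup>2)) * indicator {-M..M} x \<partial>lborel)
      \<le> (\<integral>\<^sup>+x. (SUP k. A k x) \<partial>lborel)"
  proof (rule nn_integral_mono)
    fix x
    show "(SUP k. ennreal ((norm (U (r k) x))\<^sup>2)) * indicator {-M..M} x \<le> (SUP k. A k x)"
    proof (cases "x \<in> {-M..M}")
      case True
      have "(SUP k. ennreal ((norm (U (r k) x))\<^sup>2)) \<le> (SUP k. A k x)"
        using True by (intro SUP_mono bexI[of _ k for k]) (auto simp: A_def intro!: ennreal_leI power_mono best)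
      then show ?thesis using True by simp
    qed simp
  qed
  also have "\<dots> = (SUP k. \<integral>\<^sup>+x. A k x \<partial>lborel)"
  proof (rule nn_integral_monotone_convergence_SUP)
    show "incseq A" unfolding A_def
      by (intro incseq_SucI le_funI mult_right_mono ennreal_leI power_mono inc) auto
  qed measurable
  also have "\<dots> \<le> ennreal (c * R powr e * N)"
    unfolding A_def U_def by (intro SUP_least maximal_linearized[OF \<gamma> C b K R M _ \<tau>m \<tau>pos N c]) auto
  finally show ?thesis unfolding U_def .
qed

section \<open>Fourier inversion tested on intervals\<close>

text \<open>
  This form of Young's inequality, applied to \<open>x / l\<close> and \<open>l y\<close> with a parameter \<open>l\<close>, takes the place of
  Hoelder's inequality below.
\<close>

lemma young_conjugate:
  fixes x y p :: real
  assumes "x \<ge> 0" "y \<ge> 0" "p > 1"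
  shows "x * y \<le> x powr (p / (p - 1)) + y powr p"
proof (cases "x = 0 \<or> y = 0")
  case False
  then have xy: "x > 0" "y > 0" using assms by auto
  define q where "q = p / (p - 1)"
  have q: "q > 0" "(p - 1) * q = p" "q - 1 = 1 / (p - 1)" using assms by (auto simp: q_def field_simps)
  show ?thesis
  proof (cases "x \<le> y powr (p - 1)")
    case True
    then have "x * y \<le> y powr (p - 1) * y" using xy by (intro mult_right_mono) auto
    also have "\<dots> = y powr p" using xy powr_add[of y "p - 1" 1] by simp
    finally show ?thesis by (simp add: add_increasing)
  next
    case F: False
    have "y = (y powr (p - 1)) powr (q - 1)" using xy assms by (simp add: powr_powr q(3))
    also have "\<dots> \<le> x powr (q - 1)" using F xy q assms by (intro powr_mono2) auto
    finally have "x * y \<le> x * x powr (q - 1)" using xy by (intro mult_left_mono) auto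
    also have "\<dots> = x powr q" using xy powr_add[of x 1 "q - 1"] by simp
    finally show ?thesis by (simp add: q_def add_increasing2)
  qed
qed auto

lemma nn_integral_mult_le_young:
  fixes u v :: "real \<Rightarrow> complex"
  assumes [measurable]: "u \<in> borel_measurable borel" "v \<in> borel_measurable borel" and p: "p > 1" and l: "l > 0"
  shows "(\<integral>\<^sup>+x. ennreal (norm (u x * v x)) \<partial>lborel) \<le> ennreal (l powr (- (p / (p - 1)))) * Lp_pow (p / (p - 1))
      u + ennreal (l powr p) * Lp_pow p v"
proof -
  define q where "q = p / (p - 1)"
  have "(\<integral>\<^sup>+x. ennreal (norm (u x * v x)) \<partial>lborel) \<le> (\<integral>\<^sup>+x. ennreal (l powr (- q)) * ennreal (norm (u x) powr q)
      + ennreal (l powr p) * ennreal (norm (v x) powr p) \<partial>lborel)"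
  proof (rule nn_integral_mono)
    fix x
    have "norm (u x * v x) = (norm (u x) / l) * (l * norm (v x))" using l by (simp add: norm_mult)
    also have "\<dots> \<le> (norm (u x) / l) powr q + (l * norm (v x)) powr p" unfolding q_def using l p
        by (intro young_conjugate) auto
    also have "\<dots> = l powr (- q) * norm (u x) powr q + l powr p * norm (v x) powr p"
      using l by (simp add: powr_divide powr_mult powr_minus_divide)
    finally show "ennreal (norm (u x * v x)) \<le> ennreal (l powr (- q)) * ennreal (norm (u x) powr q)
        + ennreal (l powr p) * ennreal (norm (v x) powr p)"
      by (simp add: ennreal_mult[symmetric] ennreal_plus[symmetric] ennreal_leI del: ennreal_plus)
  qed
  also have "\<dots> = ennreal (l powr (- q)) * Lp_pow q u + ennreal (l powr p) * Lp_pow p v"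
    unfolding Lp_pow_lborel by (subst nn_integral_add) (auto simp: nn_integral_cmult)
  finally show ?thesis unfolding q_def .
qed

lemma integrable_mult_conjugate:
  fixes u v :: "real \<Rightarrow> complex"
  assumes [measurable]: "u \<in> borel_measurable borel" "v \<in> borel_measurable borel" and p: "p > 1"
    and fin: "Lp_pow (p / (p - 1)) u < \<infinity>" "Lp_pow p v < \<infinity>"
  shows "integrable lborel (\<lambda>x. u x * v x)"
proof (rule integrableI_bounded)
  have "(\<integral>\<^sup>+x. ennreal (norm (u x * v x)) \<partial>lborel) \<le> Lp_pow (p / (p - 1)) u + Lp_pow p v"
    using nn_integral_mult_le_young[of u v p 1] p by simp
  also have "\<dots> < \<infinity>" using fin by simp
  finally show "(\<integral>\<^sup>+x. ennreal (norm (u x * v x)) \<partial>lborel) < \<infinity>" .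
qed measurable

text \<open>
  The error is at most \<open>l powr - q\<close> times a quantity that tends to \<open>0\<close> plus \<open>l powr p\<close> times a constant;
  choose \<open>l\<close> small first.
\<close>

lemma integral_tendsto_conjugate:
  fixes G :: "nat \<Rightarrow> real \<Rightarrow> complex" and g v :: "real \<Rightarrow> complex"
  assumes Gm: "\<And>n. G n \<in> borel_measurable borel" and gm: "g \<in> borel_measurable borel"
      and vm: "v \<in> borel_measurable borel" and p: "p > 1"
    and Gn: "\<And>n. integrable lborel (\<lambda>x. G n x * v x)" and g: "integrable lborel (\<lambda>x. g x * v x)"
        and v: "Lp_pow p v < \<infinity>"
    and lim: "(\<lambda>n. Lp_pow (p / (p - 1)) (\<lambda>x. G n x - g x)) \<longlonglongrightarrow> 0"
  shows "(\<lambda>n. LINT x|lborel. G n x * v x) \<longlonglongrightarrow> (LINT x|lborel. g x * v x)"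
proof -
  note [measurable] = Gm gm vm
  define q where "q = p / (p - 1)"
  obtain A where A: "Lp_pow p v = ennreal A" "A \<ge> 0" using v by (cases "Lp_pow p v") auto
  have "(\<lambda>n. ennreal (norm ((LINT x|lborel. G n x * v x) - (LINT x|lborel. g x * v x)))) \<longlonglongrightarrow> 0"
  proof (rule order_tendstoI)
    fix e :: ennreal assume e: "0 < e"
    then obtain e' where e': "0 < ennreal e'" "ennreal e' < e" using dense[OF e]
        by (metis ennreal_cases top.not_eq_extremum less_top_ennreal order.strict_trans)
    have e'0: "e' > 0" using e' by simp
    define l where "l = (e' / (2 * (A + 1))) powr (1 / p)"
    have l: "l > 0" using e'0 A by (simp add: l_def)
    have lp: "l powr p * A \<le> e' / 2"
    proof -
      have "l powr p = e' / (2 * (A + 1))" using e'0 A p by (simp add: l_def powr_powr)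
      then have "l powr p * A = e' / 2 * (A / (A + 1))" by simp
      also have "\<dots> \<le> e' / 2 * 1" using e'0 A by (intro mult_left_mono) auto
      finally show ?thesis by simp
    qed
    have "(\<lambda>n. ennreal (l powr (- q)) * Lp_pow q (\<lambda>x. G n x - g x) + ennreal (e' / 2))
        \<longlonglongrightarrow> ennreal (l powr (- q)) * 0 + ennreal (e' / 2)"
      using lim unfolding q_def by (intro tendsto_add ennreal_tendsto_cmult tendsto_const) auto
    moreover have "ennreal (l powr (- q)) * 0 + ennreal (e' / 2) < ennreal e'" using e'0
        by (simp add: ennreal_lessI)
    ultimately have "\<forall>\<^sub>F n in sequentially. ennreal (l powr (- q)) * Lp_pow q (\<lambda>x. G n x - g x) + ennreal (e' /
        2) < ennreal e'"
      by (rule order_tendstoD(2))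
    then show "\<forall>\<^sub>F n in sequentially. ennreal (norm ((LINT x|lborel. G n x * v x) - (LINT x|lborel. g x
        * v x))) < e"
    proof eventually_elim
      case (elim n)
      have i: "integrable lborel (\<lambda>x. (G n x - g x) * v x)"
        using Bochner_Integration.integrable_diff[OF Gn[of n] g] by (simp add: left_diff_distrib)
      have "(LINT x|lborel. G n x * v x) - (LINT x|lborel. g x * v x) = (LINT x|lborel. (G n x - g x) * v x)"
        unfolding left_diff_distrib by (rule Bochner_Integration.integral_diff[OF Gn g, symmetric])
      then have "ennreal (norm ((LINT x|lborel. G n x * v x) - (LINT x|lborel. g x * v x)))
          \<le> (\<integral>\<^sup>+x. ennreal (norm ((G n x - g x) * v x)) \<partial>lborel)"
        using integral_norm_bound_ennreal[OF i] by simp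
      also have "\<dots> \<le> ennreal (l powr (- q)) * Lp_pow q (\<lambda>x. G n x - g x) + ennreal (l powr p) * Lp_pow p v"
        unfolding q_def using p l by (intro nn_integral_mult_le_young) auto
      also have "ennreal (l powr p) * Lp_pow p v \<le> ennreal (e' / 2)" using A lp
          by (simp add: ennreal_mult[symmetric] ennreal_leI)
      finally show ?case using elim e' by (meson add_left_mono le_less_trans less_trans)
    qed
  qed simp
  then have "(\<lambda>n. norm ((LINT x|lborel. G n x * v x) - (LINT x|lborel. g x * v x))) \<longlonglongrightarrow> 0"
    using tendsto_ennreal_iff[of "\<lambda>n. norm ((LINT x|lborel. G n x * v x) - (LINT x|lborel. g x
        * v x))" sequentially 0] by simp
  then show ?thesis by (simp add: tendsto_norm_zero_iff LIM_zero_cancel)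
qed

text \<open>
  The Fourier transform of the indicator of \<open>[c, d]\<close>, with the sign of inversion in the exponent.
\<close>

definition interval_transform :: "real \<Rightarrow> real \<Rightarrow> real \<Rightarrow> complex" where
  "interval_transform c d \<xi> = (LINT x|lborel. indicator {c..d} x *\<^sub>R exp (\<i> * of_real (x * \<xi>)))"

lemma interval_transform_measurable [measurable]: "interval_transform c d \<in> borel_measurable borel"
  unfolding interval_transform_def by measurable

lemma interval_transform_integrable: "integrable lborel (\<lambda>x. indicator {c..d} x *\<^sub>R exp (\<i> * of_real (x * \<xi>)))"
  by (intro integrableI_bounded_set_indicator[where B=1]) (auto simp: emeasure_lborel_Icc_eq)

lemma norm_interval_transform_le:
  assumes "c < d"
  shows "norm (interval_transform c d \<xi>) \<le> d - c" and "norm (interval_transform c d \<xi>) \<le> 2 / \<bar>\<xi>\<bar> \<or> \<xi> = 0"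
proof -
  have "norm (interval_transform c d \<xi>) \<le> (LINT x|lborel. indicator {c..d} x)"
    unfolding interval_transform_def
    by (rule Bochner_Integration.integral_norm_bound_integral[OF interval_transform_integrable])
       (auto intro!: integrable_real_indicator simp: emeasure_lborel_Icc_eq split: split_indicator)
  then show "norm (interval_transform c d \<xi>) \<le> d - c" using assms by simp
  show "norm (interval_transform c d \<xi>) \<le> 2 / \<bar>\<xi>\<bar> \<or> \<xi> = 0"
  proof (cases "\<xi> = 0")
    case False
    have "((\<lambda>x. exp (\<i> * of_real (x * \<xi>))) has_integral (exp (\<i> * of_real (d * \<xi>)) / (\<i> * of_real \<xi>) - exp (\<i>
        * of_real (c * \<xi>)) / (\<i> * of_real \<xi>))) {c..d}"
    proof (rule fundamental_theorem_of_calculus)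
      fix x assume "x \<in> {c..d}"
      have "((\<lambda>z. exp (\<i> * (z * of_real \<xi>)) / (\<i> * of_real \<xi>)) has_field_derivative exp (\<i> * (of_real x
          * of_real \<xi>)) * (\<i> * (1 * of_real \<xi>)) / (\<i> * of_real \<xi>)) (at (of_real x))"
        by (intro DERIV_cdivide DERIV_chain2[OF DERIV_exp] DERIV_cmult DERIV_cmult_right DERIV_ident)
      then have "((\<lambda>z. exp (\<i> * (z * of_real \<xi>)) / (\<i> * of_real \<xi>)) has_field_derivative exp (\<i> * (of_real x
          * of_real \<xi>))) (at (of_real x))"
        using False by simp
      from has_vector_derivative_real_field[OF this]
      show "((\<lambda>x. exp (\<i> * of_real (x * \<xi>)) / (\<i> * of_real \<xi>)) has_vector_derivative exp (\<i> * of_real (x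
          * \<xi>))) (at x within {c..d})"
        by (simp add: has_vector_derivative_at_within)
    qed (use assms in simp)
    then have "interval_transform c d \<xi> = exp (\<i> * of_real (d * \<xi>)) / (\<i> * of_real \<xi>) - exp (\<i> * of_real (c
        * \<xi>)) / (\<i> * of_real \<xi>)"
      using set_borel_integral_eq_integral(2)[of "{c..d}" "\<lambda>x. exp (\<i> * of_real (x
          * \<xi>))"] interval_transform_integrable[of c d \<xi>]
      unfolding interval_transform_def set_lebesgue_integral_def set_integrable_def
          by (simp add: integral_unique)
    also have "norm \<dots> \<le> norm (exp (\<i> * of_real (d * \<xi>)) / (\<i> * of_real \<xi>)) + norm (exp (\<i> * of_real (c
        * \<xi>)) / (\<i> * of_real \<xi>))"
      by (rule norm_triangle_ineq4)
    also have "\<dots> = 2 / \<bar>\<xi>\<bar>" by (simp add: norm_divide norm_mult del: of_real_mult)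
    finally show ?thesis by simp
  qed simp
qed

lemma nn_integral_abs_powr_tail:
  fixes p :: real
  assumes p: "p > 1"
  shows "(\<integral>\<^sup>+z. ennreal (\<bar>z\<bar> powr (- p)) * indicator {z. 1 \<le> \<bar>z\<bar>} z \<partial>lborel) < \<infinity>"
proof -
  have pos: "(\<integral>\<^sup>+z. ennreal (z powr (- p)) * indicator {1..} z \<partial>lborel) = ennreal (1 / (p - 1))"
  proof -
    have "((\<lambda>x. x powr (- p)) has_integral - (1 powr (- p + 1)) / (- p + 1)) {1..}"
      using p by (intro has_integral_powr_to_inf) auto
    also have "- (1 powr (- p + 1)) / (- p + 1) = 1 / (p - 1)" using p by (simp add: field_simps)
    finally show ?thesis by (intro nn_integral_has_integral_lebesgue') auto
  qed
  have "(\<integral>\<^sup>+z. ennreal (\<bar>z\<bar> powr (- p)) * indicator {z. 1 \<le> \<bar>z\<bar>} z \<partial>lborel)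
     \<le> (\<integral>\<^sup>+z. ennreal (z powr (- p)) * indicator {1..} z + ennreal ((-z) powr (- p)) * indicator {1..} (-z)
         \<partial>lborel)"
    by (intro nn_integral_mono) (auto split: split_indicator)
  also have "\<dots> = (\<integral>\<^sup>+z. ennreal (z powr (- p)) * indicator {1..} z \<partial>lborel) + (\<integral>\<^sup>+z. ennreal ((-z) powr (- p))
      * indicator {1..} (-z) \<partial>lborel)"
    by (rule nn_integral_add) measurable
  also have "(\<integral>\<^sup>+z. ennreal ((-z) powr (- p)) * indicator {1..} (-z) \<partial>lborel)
      = (\<integral>\<^sup>+z. ennreal (z powr (- p)) * indicator {1..} z \<partial>lborel)"
    using nn_integral_real_affine[of "\<lambda>z. ennreal (z powr (- p)) * indicator {1..} z" "-1" 0] by simp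
  finally show ?thesis unfolding pos by (auto simp: top_unique less_top[symmetric])
qed

text \<open>
  The transform is bounded and decays like \<open>1 / \<bar>\<xi>\<bar>\<close>; here \<open>p > 1\<close> is essential.
\<close>

lemma Lp_pow_interval_transform:
  assumes "c < d" and p: "p > 1"
  shows "Lp_pow p (interval_transform c d) < \<infinity>"
proof -
  have "Lp_pow p (interval_transform c d) \<le> (\<integral>\<^sup>+\<xi>. ennreal ((d - c) powr p) * indicator {-1..1} \<xi>
      + ennreal (2 powr p) * (ennreal (\<bar>\<xi>\<bar> powr (- p)) * indicator {z. 1 \<le> \<bar>z\<bar>} \<xi>) \<partial>lborel)"
    unfolding Lp_pow_lborel
  proof (rule nn_integral_mono)
    fix \<xi> :: real
    show "ennreal (norm (interval_transform c d \<xi>) powr p) \<le> ennreal ((d - c) powr p) * indicator {-1..1} \<xi>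
        + ennreal (2 powr p) * (ennreal (\<bar>\<xi>\<bar> powr (- p)) * indicator {z. 1 \<le> \<bar>z\<bar>} \<xi>)"
    proof (cases "\<bar>\<xi>\<bar> \<le> 1")
      case True
      have "norm (interval_transform c d \<xi>) powr p \<le> (d - c) powr p"
        using p by (intro powr_mono2 norm_interval_transform_le assms) auto
      then have "ennreal (norm (interval_transform c d \<xi>) powr p) \<le> ennreal ((d - c) powr p)"
          by (rule ennreal_leI)
      moreover have "\<xi> \<in> {-1..1}" using True by (auto simp: abs_le_iff)
      ultimately show ?thesis by (simp add: add_increasing2)
    next
      case False
      have "norm (interval_transform c d \<xi>) powr p \<le> (2 / \<bar>\<xi>\<bar>) powr p"
        using p norm_interval_transform_le(2)[OF assms(1), of \<xi>] False by (intro powr_mono2) auto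
      also have "\<dots> = 2 powr p * \<bar>\<xi>\<bar> powr (- p)" by (simp add: powr_divide powr_minus_divide)
      finally have "ennreal (norm (interval_transform c d \<xi>) powr p)
          \<le> ennreal (2 powr p) * ennreal (\<bar>\<xi>\<bar> powr (- p))"
        by (simp add: ennreal_mult[symmetric] ennreal_leI)
      then show ?thesis using False by (simp add: add_increasing)
    qed
  qed
  also have "\<dots> = ennreal ((d - c) powr p) * emeasure lborel {-1..1::real} + ennreal (2 powr p) * (\<integral>\<^sup>+\<xi>. ennreal
      (\<bar>\<xi>\<bar> powr (- p)) * indicator {z. 1 \<le> \<bar>z\<bar>} \<xi> \<partial>lborel)"
    by (subst nn_integral_add) (auto simp: nn_integral_cmult)
  also have "\<dots> < \<infinity>" using nn_integral_abs_powr_tail[OF p]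
      by (auto simp: ennreal_mult_less_top ennreal_add_less_top)
  finally show ?thesis .
qed

text \<open>
  With a Gaussian factor the left-hand side equals, by Fubini, the integral of \<open>F\<close> against \<open>2 \<pi>\<close> times a
  mollification of the indicator of \<open>[c, d]\<close>. This mollification, called \<open>P n\<close> after multiplication by \<open>2 \<pi>\<close>,
  is bounded and converges off the endpoints.
\<close>

lemma fourier_interval_transform:
  fixes F :: "real \<Rightarrow> complex"
  assumes F: "integrable lborel F" and cd: "c < d"
      and i: "integrable lborel (\<lambda>\<xi>. fourier F \<xi> * interval_transform c d \<xi>)"
  shows "(LINT \<xi>|lborel. fourier F \<xi> * interval_transform c d \<xi>) = 2 * of_real pi * (LINT y:{c..d}|lborel. F y)"
proof -
  have [measurable]: "F \<in> borel_measurable borel" using F by auto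
  define w where "w n \<xi> = exp (- (inverse (real (Suc n)) * \<xi>)\<^sup>2 / 2)" for n \<xi>
  have w_int: "integrable lborel (w n)" for n
  proof -
    have "integrable lborel (\<lambda>x. sqrt (2 * pi) * std_normal_density (0 + inverse (real (Suc n)) * x))"
      by (intro integrable_mult_right lborel_integrable_real_affine) auto
    then show ?thesis by (simp add: std_normal_density_def w_def[abs_def])
  qed
  have [measurable]: "w n \<in> borel_measurable borel" for n unfolding w_def by measurable
  define P where "P n y = (LINT z|lborel. sqrt (2 * pi) * exp (- z\<^sup>2 / 2) * indicator {c..d} (y + inverse (real
      (Suc n)) * z))" for n y
  have gauss: "integrable lborel (\<lambda>z. sqrt (2 * pi) * exp (- z\<^sup>2 / 2) :: real)" "(LINT z|lborel. sqrt (2 * pi)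
      * exp (- z\<^sup>2 / 2)) = 2 * pi"
  proof -
    have "(\<lambda>z. sqrt (2 * pi) * exp (- z\<^sup>2 / 2)) = (\<lambda>z. 2 * pi * std_normal_density z)"
      by (auto simp: std_normal_density_def field_simps)
    then show "integrable lborel (\<lambda>z. sqrt (2 * pi) * exp (- z\<^sup>2 / 2) :: real)" "(LINT z|lborel. sqrt (2 * pi)
        * exp (- z\<^sup>2 / 2)) = 2 * pi"
      by simp_all
  qed
  have sf: "pair_sigma_finite (lborel \<Otimes>\<^sub>M lborel :: (real\<times>real) measure) (lborel :: real measure)"
    by (auto intro!: pair_sigma_finite.intro sigma_finite_pair_measure lborel.sigma_finite_measure_axioms)
  have I: "integrable lborel (\<lambda>x. complex_of_real (indicator {c..d} x))"
    by (intro integrable_of_real integrable_real_indicator) (auto simp: emeasure_lborel_Icc_eq)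
  have step: "(LINT \<xi>|lborel. fourier F \<xi> * interval_transform c d \<xi> * of_real (w n \<xi>))
      = (LINT y|lborel. F y * of_real (P n y))" for n
  proof -
    define T where "T y x \<xi> = F y * of_real (indicator {c..d} x) * (exp (\<i> * of_real ((x - y) * \<xi>))
        * of_real (w n \<xi>))" for y x \<xi>
    have iT: "integrable ((lborel \<Otimes>\<^sub>M lborel) \<Otimes>\<^sub>M lborel) (\<lambda>(z, \<xi>). T (fst z) (snd z) \<xi>)"
    proof (rule Bochner_Integration.integrable_bound)
      show "integrable ((lborel \<Otimes>\<^sub>M lborel) \<Otimes>\<^sub>M lborel) (\<lambda>(z, \<xi>). (case z of (y, x) \<Rightarrow> F y * complex_of_real
          (indicator {c..d} x)) * of_real (w n \<xi>))"
        by (intro integrable_tensor sf lborel_pair.pair_sigma_finite_axioms F I integrable_of_real w_int)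
      show "(\<lambda>(z, \<xi>). T (fst z) (snd z) \<xi>) \<in> borel_measurable ((lborel \<Otimes>\<^sub>M lborel) \<Otimes>\<^sub>M lborel)"
        unfolding T_def case_prod_beta' by measurable
    qed (auto simp: T_def norm_mult)
    have "fourier F \<xi> * interval_transform c d \<xi> * of_real (w n \<xi>)
        = (LINT z|(lborel \<Otimes>\<^sub>M lborel). T (fst z) (snd z) \<xi>)" for \<xi>
    proof -
      have Fx: "integrable lborel (\<lambda>y. exp (- (\<i> * of_real (y * \<xi>))) * F y)"
          by (rule integrable_fourier_kernel[OF F])
      have Ix: "integrable lborel (\<lambda>x. indicator {c..d} x *\<^sub>R exp (\<i> * of_real (x * \<xi>)))"
          by (rule interval_transform_integrable)
      have tens: "integrable (lborel \<Otimes>\<^sub>M lborel) (\<lambda>(y, x). (exp (- (\<i> * of_real (y * \<xi>))) * F y)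
          * (indicator {c..d} x *\<^sub>R exp (\<i> * of_real (x * \<xi>))))"
        by (intro integrable_tensor Fx Ix lborel_pair.pair_sigma_finite_axioms)
      have "(LINT z|(lborel \<Otimes>\<^sub>M lborel). T (fst z) (snd z) \<xi>)
          = (LINT z|(lborel \<Otimes>\<^sub>M lborel). (case z of (y, x) \<Rightarrow> (exp (- (\<i> * of_real (y * \<xi>))) * F y)
              * (indicator {c..d} x *\<^sub>R exp (\<i> * of_real (x * \<xi>)))) * of_real (w n \<xi>))"
      proof (intro Bochner_Integration.integral_cong refl)
        fix z :: "real \<times> real"
        have "exp (\<i> * of_real ((snd z - fst z) * \<xi>)) = exp (- (\<i> * of_real (fst z * \<xi>))) * exp (\<i>
            * of_real (snd z * \<xi>))"
          by (simp add: algebra_simps flip: exp_add)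
        then show "T (fst z) (snd z) \<xi> = (case z of (y, x) \<Rightarrow> (exp (- (\<i> * of_real (y * \<xi>))) * F y)
            * (indicator {c..d} x *\<^sub>R exp (\<i> * of_real (x * \<xi>)))) * of_real (w n \<xi>)"
          unfolding T_def by (simp add: case_prod_beta scaleR_conv_of_real mult_ac)
      qed
      also have "\<dots> = (LINT z|(lborel \<Otimes>\<^sub>M lborel). (case z of (y, x) \<Rightarrow> (exp (- (\<i> * of_real (y * \<xi>))) * F y)
          * (indicator {c..d} x *\<^sub>R exp (\<i> * of_real (x * \<xi>))))) * of_real (w n \<xi>)"
        by (rule integral_mult_left_zero)
      also have "(LINT z|(lborel \<Otimes>\<^sub>M lborel). (case z of (y, x) \<Rightarrow> (exp (- (\<i> * of_real (y * \<xi>))) * F y)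
          * (indicator {c..d} x *\<^sub>R exp (\<i> * of_real (x * \<xi>)))))
         = (LINT y|lborel. (LINT x|lborel. (exp (- (\<i> * of_real (y * \<xi>))) * F y) * (indicator {c..d} x *\<^sub>R exp
             (\<i> * of_real (x * \<xi>)))))"
        using lborel_pair.integral_fst'[OF tens] by simp
      also have "\<dots> = (LINT y|lborel. (exp (- (\<i> * of_real (y * \<xi>))) * F y) * interval_transform c d \<xi>)"
        unfolding interval_transform_def by (simp only: integral_mult_right_zero)
      also have "\<dots> = fourier F \<xi> * interval_transform c d \<xi>"
        unfolding fourier_lborel[OF \<open>F \<in> _\<close>] by (rule integral_mult_left_zero)
      finally show ?thesis ..
    qed
    then have "(LINT \<xi>|lborel. fourier F \<xi> * interval_transform c d \<xi> * of_real (w n \<xi>))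
        = (LINT \<xi>|lborel. (LINT z|(lborel \<Otimes>\<^sub>M lborel). T (fst z) (snd z) \<xi>))"
      by simp
    also have "\<dots> = (LINT z|(lborel \<Otimes>\<^sub>M lborel). (LINT \<xi>|lborel. T (fst z) (snd z) \<xi>))"
      using iT by (rule pair_sigma_finite.Fubini_integral[OF sf])
    also have "\<dots> = (LINT y|lborel. (LINT x|lborel. (LINT \<xi>|lborel. T y x \<xi>)))"
      using lborel_pair.integral_fst'[OF pair_sigma_finite.integrable_fst[OF sf iT]] by simp
    also have "\<dots> = (LINT y|lborel. F y * of_real (P n y))"
    proof (intro Bochner_Integration.integral_cong refl)
      fix y
      define k where "k x = sqrt (2 * pi) / inverse (real (Suc n)) * exp (- ((x - y) / inverse (real (Suc n)))\<^sup>2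
          / 2)" for x
      have "(LINT \<xi>|lborel. T y x \<xi>) = F y * of_real (indicator {c..d} x * k x)" for x
      proof -
        have "(LINT \<xi>|lborel. T y x \<xi>) = F y * of_real (indicator {c..d} x) * (LINT \<xi>|lborel. exp (\<i>
            * of_real ((x - y) * \<xi>)) * of_real (w n \<xi>))"
          unfolding T_def by (rule integral_mult_right_zero)
        also have "(LINT \<xi>|lborel. exp (\<i> * of_real ((x - y) * \<xi>)) * of_real (w n \<xi>)) = of_real (k x)"
          unfolding w_def k_def by (rule gaussian_fourier) simp
        finally show ?thesis by (simp add: mult.assoc)
      qed
      then have "(LINT x|lborel. (LINT \<xi>|lborel. T y x \<xi>)) = (LINT x|lborel. F y * of_real (indicator {c..d} x
          * k x))" by simp
      also have "\<dots> = F y * (LINT x|lborel. complex_of_real (indicator {c..d} x * k x))"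
          by (rule integral_mult_right_zero)
      also have "(LINT x|lborel. complex_of_real (indicator {c..d} x * k x))
          = of_real (LINT x|lborel. indicator {c..d} x * k x)"
        by (rule integral_complex_of_real)
      also have "(LINT x|lborel. indicator {c..d} x * k x)
          = \<bar>inverse (real (Suc n))\<bar> *\<^sub>R (LINT z|lborel. indicator {c..d} (y + inverse (real (Suc n)) * z)
              * k (y + inverse (real (Suc n)) * z))"
        by (rule lborel_integral_real_affine) simp
      also have "\<dots> = (LINT z|lborel. inverse (real (Suc n)) * (indicator {c..d} (y + inverse (real (Suc n)) * z)
          * k (y + inverse (real (Suc n)) * z)))"
        by (simp only: real_scaleR_def integral_mult_right_zero) simp
      also have "\<dots> = P n y"
        unfolding P_def
      proof (intro Bochner_Integration.integral_cong refl)
        fix z :: real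
        define \<epsilon> where "\<epsilon> = inverse (real (Suc n))"
        have "\<epsilon> > 0" by (simp add: \<epsilon>_def)
        moreover have "k x = sqrt (2 * pi) / \<epsilon> * exp (- ((x - y) / \<epsilon>)\<^sup>2 / 2)" for x by (simp only: k_def \<epsilon>_def)
        ultimately have "\<epsilon> * (indicator {c..d} (y + \<epsilon> * z) * k (y + \<epsilon> * z))
            = sqrt (2 * pi) * exp (- z\<^sup>2 / 2) * indicator {c..d} (y + \<epsilon> * z)"
          by simp
        then show "inverse (real (Suc n)) * (indicator {c..d} (y + inverse (real (Suc n)) * z) * k (y
            + inverse (real (Suc n)) * z))
          = sqrt (2 * pi) * exp (- z\<^sup>2 / 2) * indicator {c..d} (y + inverse (real (Suc n)) * z)"
          unfolding \<epsilon>_def .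
      qed
      finally show "(LINT x|lborel. (LINT \<xi>|lborel. T y x \<xi>)) = F y * of_real (P n y)" .
    qed
    finally show ?thesis .
  qed
  have L1: "(\<lambda>n. LINT \<xi>|lborel. fourier F \<xi> * interval_transform c d \<xi> * of_real (w n \<xi>))
      \<longlonglongrightarrow> (LINT \<xi>|lborel. fourier F \<xi> * interval_transform c d \<xi>)"
  proof (rule integral_dominated_convergence[where w="\<lambda>\<xi>. norm (fourier F \<xi> * interval_transform c d \<xi>)"])
    show "AE \<xi> in lborel. (\<lambda>n. fourier F \<xi> * interval_transform c d \<xi> * of_real (w n \<xi>))
        \<longlonglongrightarrow> fourier F \<xi> * interval_transform c d \<xi>"
    proof (intro AE_I2)
      fix \<xi>
      have "(\<lambda>n. fourier F \<xi> * interval_transform c d \<xi> * of_real (w n \<xi>))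
          \<longlonglongrightarrow> fourier F \<xi> * interval_transform c d \<xi> * of_real (exp (- (0 * \<xi>)\<^sup>2 / 2))"
        unfolding w_def by (intro tendsto_intros LIMSEQ_inverse_real_of_nat) auto
      then show "(\<lambda>n. fourier F \<xi> * interval_transform c d \<xi> * of_real (w n \<xi>))
          \<longlonglongrightarrow> fourier F \<xi> * interval_transform c d \<xi>" by simp
    qed
    show "AE \<xi> in lborel. norm (fourier F \<xi> * interval_transform c d \<xi> * of_real (w n \<xi>))
        \<le> norm (fourier F \<xi> * interval_transform c d \<xi>)" for n
      by (intro AE_I2) (auto simp: norm_mult w_def intro!: mult_right_le_one_le)
  qed (use integrable_norm[OF i] in auto)
  have Pm [measurable]: "P n \<in> borel_measurable borel" for n unfolding P_def by measurable
  have Pb: "\<bar>P n y\<bar> \<le> 2 * pi" for n y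
  proof -
    have "norm (P n y) \<le> (LINT z|lborel. sqrt (2 * pi) * exp (- z\<^sup>2 / 2))"
      unfolding P_def
    proof (rule Bochner_Integration.integral_norm_bound_integral[OF _ gauss(1)])
      show "integrable lborel (\<lambda>z. sqrt (2 * pi) * exp (- z\<^sup>2 / 2) * indicator {c..d} (y + inverse (real (Suc
          n)) * z))"
        by (rule Bochner_Integration.integrable_bound[OF gauss(1)]) (auto simp: abs_mult split: split_indicator)
    qed (auto split: split_indicator)
    then show ?thesis unfolding gauss(2) by simp
  qed
  have Plim: "(\<lambda>n. P n y) \<longlonglongrightarrow> 2 * pi * indicator {c..d} y" if y: "y \<noteq> c" "y \<noteq> d" for y
  proof -
    have "(\<lambda>n. P n y) \<longlonglongrightarrow> (LINT z|lborel. sqrt (2 * pi) * exp (- z\<^sup>2 / 2) * indicator {c..d} y)"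
      unfolding P_def
    proof (rule integral_dominated_convergence[where w="\<lambda>z. sqrt (2 * pi) * exp (- z\<^sup>2 / 2)"])
      show "AE z in lborel. (\<lambda>n. sqrt (2 * pi) * exp (- z\<^sup>2 / 2) * indicator {c..d} (y + inverse (real (Suc n))
          * z)) \<longlonglongrightarrow> sqrt (2 * pi) * exp (- z\<^sup>2 / 2) * indicator {c..d} y"
      proof (intro AE_I2 tendsto_mult tendsto_const)
        fix z
        have lim: "(\<lambda>n. y + inverse (real (Suc n)) * z) \<longlonglongrightarrow> y + 0 * z"
            by (intro tendsto_intros LIMSEQ_inverse_real_of_nat)
        consider "y < c" | "c < y" "y < d" | "d < y" using y by linarith
        then show "(\<lambda>n. indicator {c..d} (y + inverse (real (Suc n)) * z) :: real) \<longlonglongrightarrow> indicator {c..d} y"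
        proof cases
          case 1
          then have "\<forall>\<^sub>F n in sequentially. y + inverse (real (Suc n)) * z < c"
              using order_tendstoD(2)[OF lim, of c] by simp
          then have "\<forall>\<^sub>F n in sequentially. (indicator {c..d} (y + inverse (real (Suc n)) * z) :: real)
              = indicator {c..d} y"
            by eventually_elim (use 1 in auto)
          then show ?thesis by (rule tendsto_eventually)
        next
          case 2
          then have "\<forall>\<^sub>F n in sequentially. c < y + inverse (real (Suc n)) * z" "\<forall>\<^sub>F n in sequentially. y
              + inverse (real (Suc n)) * z < d"
            using order_tendstoD[OF lim] by simp_all
          then have "\<forall>\<^sub>F n in sequentially. (indicator {c..d} (y + inverse (real (Suc n)) * z) :: real)
              = indicator {c..d} y"
            by eventually_elim (use 2 in auto)
          then show ?thesis by (rule tendsto_eventually)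
        next
          case 3
          then have "\<forall>\<^sub>F n in sequentially. d < y + inverse (real (Suc n)) * z"
              using order_tendstoD(1)[OF lim, of d] by simp
          then have "\<forall>\<^sub>F n in sequentially. (indicator {c..d} (y + inverse (real (Suc n)) * z) :: real)
              = indicator {c..d} y"
            by eventually_elim (use 3 in auto)
          then show ?thesis by (rule tendsto_eventually)
        qed
      qed
    qed (use gauss in \<open>auto split: split_indicator\<close>)
    also have "(LINT z|lborel. sqrt (2 * pi) * exp (- z\<^sup>2 / 2) * indicator {c..d} y)
        = 2 * pi * indicator {c..d} y"
      using gauss(2) by (simp only: integral_mult_left_zero)
    finally show ?thesis .
  qed
  have L2: "(\<lambda>n. LINT y|lborel. F y * of_real (P n y))
      \<longlonglongrightarrow> (LINT y|lborel. F y * of_real (2 * pi * indicator {c..d} y))"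
  proof (rule integral_dominated_convergence[where w="\<lambda>y. 2 * pi * norm (F y)"])
    have "AE y in lborel. y \<noteq> c" "AE y in lborel. y \<noteq> d" by (rule AE_lborel_singleton)+
    then show "AE y in lborel. (\<lambda>n. F y * of_real (P n y)) \<longlonglongrightarrow> F y * of_real (2 * pi * indicator {c..d} y)"
      by eventually_elim (intro tendsto_intros Plim)
    show "AE y in lborel. norm (F y * of_real (P n y)) \<le> 2 * pi * norm (F y)" for n
    proof (intro AE_I2)
      fix y
      have "norm (F y) * \<bar>P n y\<bar> \<le> norm (F y) * (2 * pi)" by (intro mult_left_mono Pb) auto
      then show "norm (F y * of_real (P n y)) \<le> 2 * pi * norm (F y)" by (simp add: norm_mult mult.commute)
    qed
  qed (use F in auto)
  have "(LINT \<xi>|lborel. fourier F \<xi> * interval_transform c d \<xi>)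
      = (LINT y|lborel. F y * of_real (2 * pi * indicator {c..d} y))"
    using LIMSEQ_unique[OF L1 L2[folded step]] .
  also have "\<dots> = (LINT y|lborel. (2 * of_real pi) * (indicator {c..d} y *\<^sub>R F y))"
    by (intro Bochner_Integration.integral_cong) (auto simp: scaleR_conv_of_real)
  also have "\<dots> = 2 * of_real pi * (LINT y:{c..d}|lborel. F y)"
    unfolding set_lebesgue_integral_def by (rule integral_mult_right_zero)
  finally show ?thesis .
qed

text \<open>
  The identity holds for the integrable functions that approximate \<open>f\<close>, and both sides are continuous: the
  left one since \<open>interval_transform\<close> is in \<open>L\<^sup>p\<close>, the right one since indicators of intervals are in \<open>L\<^sup>q\<close>.
\<close>

lemma parseval_interval:
  fixes f g :: "real \<Rightarrow> complex"
  assumes p: "1 < p" "p \<le> 2" and fm [measurable]: "f \<in> borel_measurable borel" and f: "Lp_pow p f < \<infinity>"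
      and g: "is_fourier_borel p f g" and cd: "c < d"
  shows "integrable lborel (\<lambda>\<xi>. g \<xi> * interval_transform c d \<xi>)"
    "(LINT \<xi>|lborel. g \<xi> * interval_transform c d \<xi>) = 2 * of_real pi * (LINT y:{c..d}|lborel. f y)"
proof -
  define q where "q = p / (p - 1)"
  have q: "q > 1" "q / (q - 1) = p" using p by (auto simp: q_def field_simps)
  from g obtain F where gm [measurable]: "g \<in> borel_measurable borel" and gq: "Lp_pow q g < \<infinity>"
      and Fm [measurable]: "\<And>n. F n \<in> borel_measurable borel"
    and F: "\<And>n. integrable lborel (F n)" "\<And>n. Lp_pow p (F n) < \<infinity>"
    "(\<lambda>n. Lp_pow p (\<lambda>x. F n x - f x)) \<longlonglongrightarrow> 0" "(\<lambda>n. Lp_pow q (\<lambda>\<xi>. fourier (F n) \<xi> - g \<xi>)) \<longlonglongrightarrow> 0"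
    unfolding is_fourier_borel_def q_def[symmetric] by blast
  have \<psi>: "Lp_pow p (interval_transform c d) < \<infinity>" by (rule Lp_pow_interval_transform[OF cd p(1)])
  show ig: "integrable lborel (\<lambda>\<xi>. g \<xi> * interval_transform c d \<xi>)"
    using gq \<psi> p unfolding q_def by (intro integrable_mult_conjugate) auto
  obtain C where C: "C > 0" and HY: "\<And>F A. integrable lborel F \<Longrightarrow> A > 0 \<Longrightarrow> Lp_pow p F \<le> ennreal A \<Longrightarrow>
    Lp_pow (p / (p - 1)) (fourier F) \<le> ennreal (C * A powr (1 / (p - 1)))"
    by (rule hausdorff_young[OF p]) blast
  have iF: "integrable lborel (\<lambda>\<xi>. fourier (F n) \<xi> * interval_transform c d \<xi>)" for n
  proof (rule integrable_mult_conjugate[OF _ _ p(1) _ \<psi>])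
    obtain A where A: "Lp_pow p (F n) = ennreal A" "A \<ge> 0" using F(2)[of n] by (cases "Lp_pow p (F n)") auto
    have "Lp_pow p (F n) \<le> ennreal (A + 1)" unfolding A by (rule ennreal_leI) simp
    then have "Lp_pow (p / (p - 1)) (fourier (F n)) \<le> ennreal (C * (A + 1) powr (1 / (p - 1)))" using A
        by (intro HY F) auto
    then show "Lp_pow (p / (p - 1)) (fourier (F n)) < \<infinity>" by (auto intro: le_less_trans)
  qed measurable
  have L1: "(\<lambda>n. LINT \<xi>|lborel. fourier (F n) \<xi> * interval_transform c d \<xi>)
      \<longlonglongrightarrow> (LINT \<xi>|lborel. g \<xi> * interval_transform c d \<xi>)"
    using F(4) unfolding q_def by (intro integral_tendsto_conjugate[OF _ gm _ p(1) iF ig \<psi>]) auto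
  define v where "v x = complex_of_real (indicator {c..d} x)" for x :: real
  have [measurable]: "v \<in> borel_measurable borel" unfolding v_def by measurable
  have vq: "Lp_pow q v < \<infinity>"
  proof -
    have "Lp_pow q v = (\<integral>\<^sup>+x. indicator {c..d} x \<partial>lborel)" unfolding Lp_pow_lborel v_def using q
      by (intro nn_integral_cong) (auto split: split_indicator)
    then show ?thesis using cd by simp
  qed
  have iv: "integrable lborel (\<lambda>x. u x * v x)" if "u \<in> borel_measurable borel" "Lp_pow p u < \<infinity>" for u
    using integrable_mult_conjugate[of u v q] that vq q by auto
  have L2: "(\<lambda>n. LINT x|lborel. F n x * v x) \<longlonglongrightarrow> (LINT x|lborel. f x * v x)"
    using integral_tendsto_conjugate[OF Fm fm \<open>v \<in> _\<close> q(1) iv[OF Fm F(2)] iv[OF fm f] vq] F(3) unfolding q(2)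
        by simp
  have v: "(LINT x|lborel. u x * v x) = (LINT y:{c..d}|lborel. u y)" for u :: "real \<Rightarrow> complex"
    unfolding v_def set_lebesgue_integral_def
        by (intro Bochner_Integration.integral_cong) (auto simp: scaleR_conv_of_real)
  have "(\<lambda>n. 2 * of_real pi * (LINT y:{c..d}|lborel. F n y)) \<longlonglongrightarrow> 2 * of_real pi * (LINT y:{c..d}|lborel. f y)"
    using tendsto_mult[OF tendsto_const L2] unfolding v .
  then show "(LINT \<xi>|lborel. g \<xi> * interval_transform c d \<xi>) = 2 * of_real pi * (LINT y:{c..d}|lborel. f y)"
    using LIMSEQ_unique[OF L1] unfolding fourier_interval_transform[OF F(1) cd iF] by simp
qed

section \<open>Almost everywhere convergence\<close>

lemma norm_le_one_plus_powr:
  fixes y q :: real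
  assumes "y \<ge> 0" "q \<ge> 1"
  shows "y \<le> 1 + y powr q"
proof (cases "y \<le> 1")
  case False
  then have "y powr 1 \<le> y powr q" using assms by (intro powr_mono) auto
  then show ?thesis using False by simp
qed (simp add: add_increasing2)

text \<open>
  Since \<open>\<bar>g\<bar> \<le> 1 + \<bar>g\<bar> powr q\<close> and \<open>\<bar>D\<bar> \<le> 1\<close>, the product is at most \<open>\<bar>D\<bar> + \<bar>g\<bar> powr q\<close>.
\<close>

lemma integrable_mult_bounded:
  fixes g :: "real \<Rightarrow> complex" and D :: "real \<Rightarrow> complex"
  assumes [measurable]: "g \<in> borel_measurable borel" "D \<in> borel_measurable borel" and q: "q \<ge> 1"
      and g: "Lp_pow q g < \<infinity>"
    and D1: "\<And>x. norm (D x) \<le> 1" and D: "integrable lborel D"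
  shows "integrable lborel (\<lambda>x. g x * D x)"
proof (rule integrableI_bounded)
  have "(\<integral>\<^sup>+x. ennreal (norm (g x * D x)) \<partial>lborel) \<le> (\<integral>\<^sup>+x. ennreal (norm (D x)) + ennreal (norm (g x) powr q)
      \<partial>lborel)"
  proof (rule nn_integral_mono)
    fix x
    have "norm (g x * D x) \<le> (1 + norm (g x) powr q) * norm (D x)"
      unfolding norm_mult by (intro mult_right_mono norm_le_one_plus_powr q) auto
    also have "\<dots> \<le> norm (D x) + norm (g x) powr q"
      using mult_left_mono[OF D1[of x], of "norm (g x) powr q"] by (simp add: algebra_simps)
    finally show "ennreal (norm (g x * D x)) \<le> ennreal (norm (D x)) + ennreal (norm (g x) powr q)"
      by (simp add: ennreal_plus[symmetric] ennreal_leI del: ennreal_plus)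
  qed
  also have "\<dots> = (\<integral>\<^sup>+x. ennreal (norm (D x)) \<partial>lborel) + Lp_pow q g"
    unfolding Lp_pow_lborel by (rule nn_integral_add) auto
  also have "\<dots> < \<infinity>" using D g by (simp add: integrable_iff_bounded)
  finally show "(\<integral>\<^sup>+x. ennreal (norm (g x * D x)) \<partial>lborel) < \<infinity>" .
qed measurable

lemma integrable_truncation:
  fixes g :: "real \<Rightarrow> complex"
  assumes [measurable]: "g \<in> borel_measurable borel" "S \<in> sets borel" and S: "S \<subseteq> {-L..L}" and q: "q \<ge> 1"
      and g: "Lp_pow q g < \<infinity>"
  shows "integrable lborel (\<lambda>x. indicator S x *\<^sub>R g x)"
proof -
  have "emeasure lborel S \<le> emeasure lborel {-L..L}" by (intro emeasure_mono S) auto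
  also have "\<dots> < \<infinity>" by (simp add: emeasure_lborel_Icc_eq)
  finally have "integrable lborel (\<lambda>x. complex_of_real (indicator S x))"
      by (intro integrable_of_real integrable_real_indicator) auto
  then have "integrable lborel (\<lambda>x. g x * complex_of_real (indicator S x))"
    by (intro integrable_mult_bounded[OF _ _ q g]) (auto split: split_indicator)
  then show ?thesis by (simp add: scaleR_conv_of_real mult.commute)
qed

text \<open>
  At a positive time the damping decays faster than \<open>\<bar>\<xi>\<bar> powr - 2\<close>, because \<open>exp y \<ge> (y / n)\<^sup>n\<close> and \<open>a n \<ge> 2\<close>
  for large \<open>n\<close>.
\<close>

lemma integrable_wave:
  assumes a: "a > 0" and t: "t > 0"
  shows "integrable lborel (wave a \<gamma> t x)"
proof (rule integrableI_bounded)
  show "wave a \<gamma> t x \<in> borel_measurable lborel" by measurable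
  obtain n :: nat where n: "2 / a \<le> real n" using real_arch_simple by blast
  have n0: "n > 0" using n a by (cases n) (auto simp: divide_le_0_iff)
  have an: "2 \<le> a * real n" using n a by (simp add: field_simps)
  define c where "c = t powr \<gamma> / real n"
  have c: "c > 0" using t n0 by (simp add: c_def)
  have decay: "exp (- (t powr \<gamma> * \<bar>\<xi>\<bar> powr a)) \<le> (1 / c ^ n) * \<bar>\<xi>\<bar> powr (- 2)" if \<xi>: "1 \<le> \<bar>\<xi>\<bar>" for \<xi>
  proof -
    define y where "y = t powr \<gamma> * \<bar>\<xi>\<bar> powr a"
    have y: "y \<ge> 0" by (simp add: y_def)
    have "(y / real n) ^ n \<le> (1 + y / real n) ^ n" using y by (intro power_mono) auto
    also have "\<dots> \<le> exp y" using y n0 by (intro exp_ge_one_plus_x_over_n_power_n) auto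
    finally have le: "(y / real n) ^ n \<le> exp y" .
    have "\<bar>\<xi>\<bar> powr 2 \<le> \<bar>\<xi>\<bar> powr (a * real n)" using \<xi> an by (intro powr_mono) auto
    also have "\<dots> = (\<bar>\<xi>\<bar> powr a) ^ n" using \<xi> by (simp add: powr_powr[symmetric] powr_realpow)
    finally have "c ^ n * \<bar>\<xi>\<bar> powr 2 \<le> c ^ n * (\<bar>\<xi>\<bar> powr a) ^ n" using c by (intro mult_left_mono) auto
    also have "\<dots> = (y / real n) ^ n" by (simp add: y_def c_def power_mult_distrib power_divide)
    finally have "c ^ n * \<bar>\<xi>\<bar> powr 2 \<le> exp y" using le by linarith
    then have "inverse (exp y) \<le> inverse (c ^ n * \<bar>\<xi>\<bar> powr 2)" using c \<xi> by (intro le_imp_inverse_le) auto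
    then have "exp (- y) \<le> (1 / c ^ n) * inverse (\<bar>\<xi>\<bar> powr 2)"
        by (simp only: exp_minus inverse_mult_distrib inverse_eq_divide[of "c ^ n"])
    then show ?thesis by (simp only: y_def powr_minus)
  qed
  have "(\<integral>\<^sup>+\<xi>. ennreal (norm (wave a \<gamma> t x \<xi>)) \<partial>lborel) \<le> (\<integral>\<^sup>+\<xi>. indicator {-1..1} \<xi> + ennreal (1 / c ^ n)
      * (ennreal (\<bar>\<xi>\<bar> powr (- 2)) * indicator {z. 1 \<le> \<bar>z\<bar>} \<xi>) \<partial>lborel)"
  proof (rule nn_integral_mono)
    fix \<xi> :: real
    show "ennreal (norm (wave a \<gamma> t x \<xi>)) \<le> indicator {-1..1} \<xi> + ennreal (1 / c ^ n) * (ennreal (\<bar>\<xi>\<bar> powr (-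
        2)) * indicator {z. 1 \<le> \<bar>z\<bar>} \<xi>)"
    proof (cases "\<bar>\<xi>\<bar> \<le> 1")
      case True
      then have "\<xi> \<in> {-1..1}" by (auto simp: abs_le_iff)
      then show ?thesis using norm_wave_le_1[of a \<gamma> t x \<xi>] by (simp add: add_increasing2)
    next
      case False
      have "ennreal (norm (wave a \<gamma> t x \<xi>)) \<le> ennreal ((1 / c ^ n) * \<bar>\<xi>\<bar> powr (- 2))"
        unfolding norm_wave using False by (intro ennreal_leI decay) auto
      also have "\<dots> = ennreal (1 / c ^ n) * ennreal (\<bar>\<xi>\<bar> powr (- 2))" using c by (intro ennreal_mult) auto
      finally show ?thesis using False by (simp add: add_increasing)
    qed
  qed
  also have "\<dots> = emeasure lborel {-1..1::real} + ennreal (1 / c ^ n) * (\<integral>\<^sup>+\<xi>. ennreal (\<bar>\<xi>\<bar> powr (- 2))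
      * indicator {z. 1 \<le> \<bar>z\<bar>} \<xi> \<partial>lborel)"
    by (subst nn_integral_add) (auto simp: nn_integral_cmult)
  also have "\<dots> < \<infinity>" using nn_integral_abs_powr_tail[of 2]
      by (auto simp: ennreal_mult_less_top ennreal_add_less_top)
  finally show "(\<integral>\<^sup>+\<xi>. ennreal (norm (wave a \<gamma> t x \<xi>)) \<partial>lborel) < \<infinity>" .
qed

lemma wave_tendsto:
  assumes "\<gamma> > 0" "X \<longlonglongrightarrow> t" "\<And>n. X n \<ge> 0"
  shows "(\<lambda>n. wave a \<gamma> (X n) x \<xi>) \<longlonglongrightarrow> wave a \<gamma> t x \<xi>"
proof -
  have *: "(\<lambda>n. X n powr \<gamma>) \<longlonglongrightarrow> t powr \<gamma>"
    by (rule tendsto_powr'[OF assms(2) tendsto_const]) (simp add: assms)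
  show ?thesis unfolding wave_def
    by (intro tendsto_mult tendsto_const tendsto_of_real tendsto_exp tendsto_minus assms(2) *)
qed

text \<open>
  The part of the solution with frequencies in \<open>S\<close>, multiplied by \<open>2 \<pi>\<close>.
\<close>

definition wave_part :: "(real \<Rightarrow> complex) \<Rightarrow> real \<Rightarrow> real \<Rightarrow> real set \<Rightarrow> real \<Rightarrow> real \<Rightarrow> complex" where
  "wave_part g a \<gamma> S t x = (LINT \<xi>|lborel. indicator S \<xi> *\<^sub>R (g \<xi> * wave a \<gamma> t x \<xi>))"

lemma wave_part_integrable:
  assumes [measurable]: "g \<in> borel_measurable borel" "S \<in> sets borel"
      and g: "integrable lborel (\<lambda>\<xi>. indicator S \<xi> *\<^sub>R g \<xi>)"
  shows "integrable lborel (\<lambda>\<xi>. indicator S \<xi> *\<^sub>R (g \<xi> * wave a \<gamma> t x \<xi>))"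
  by (rule Bochner_Integration.integrable_bound[OF g])
     (auto simp: norm_mult intro!: mult_left_mono mult_right_le_one_le norm_wave_le_1)

lemma wave_part_measurable [measurable]:
  assumes [measurable]: "g \<in> borel_measurable borel" "S \<in> sets borel"
  shows "wave_part g a \<gamma> S t \<in> borel_measurable borel"
  unfolding wave_part_def by measurable

lemma wave_part_tendsto:
  assumes [measurable]: "g \<in> borel_measurable borel" "S \<in> sets borel"
      and g: "integrable lborel (\<lambda>\<xi>. indicator S \<xi> *\<^sub>R g \<xi>)"
    and "\<gamma> > 0" "X \<longlonglongrightarrow> t" "\<And>n. X n \<ge> 0"
  shows "(\<lambda>n. wave_part g a \<gamma> S (X n) x) \<longlonglongrightarrow> wave_part g a \<gamma> S t x"
  unfolding wave_part_def
proof (rule integral_dominated_convergence[where w="\<lambda>\<xi>. norm (indicator S \<xi> *\<^sub>R g \<xi>)"])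
  show "AE \<xi> in lborel. (\<lambda>n. indicat_real S \<xi> *\<^sub>R (g \<xi> * wave a \<gamma> (X n) x \<xi>))
      \<longlonglongrightarrow> indicat_real S \<xi> *\<^sub>R (g \<xi> * wave a \<gamma> t x \<xi>)"
    by (intro AE_I2 tendsto_intros wave_tendsto assms)
  show "AE \<xi> in lborel. norm (indicat_real S \<xi> *\<^sub>R (g \<xi> * wave a \<gamma> (X n) x \<xi>)) \<le> norm (indicator S \<xi> *\<^sub>R g \<xi>)"
      for n
    by (intro AE_I2) (auto simp: norm_mult intro!: mult_left_mono mult_right_le_one_le norm_wave_le_1)
qed (use integrable_norm[OF g] in auto)

text \<open>
  The increments are dominated uniformly in \<open>t \<ge> 0\<close> by a summable sequence, so the limits in \<open>N\<close> and \<open>t\<close> can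
  be interchanged.
\<close>

lemma telescoping_limit:
  fixes V :: "nat \<Rightarrow> real \<Rightarrow> complex"
  assumes h: "summable h" and inc: "\<And>N t. t \<ge> 0 \<Longrightarrow> norm (V (Suc N) t - V N t) \<le> h N"
    and L: "\<And>t. t > 0 \<Longrightarrow> (\<lambda>N. V N t) \<longlonglongrightarrow> L t"
    and cont: "\<And>N. (V N \<longlongrightarrow> V N 0) (at_right 0)" and S: "(\<lambda>N. V N 0) \<longlonglongrightarrow> S"
  shows "(L \<longlongrightarrow> S) (at_right 0)"
proof -
  have h0: "h N \<ge> 0" for N using inc[of 0 N] norm_ge_zero order_trans by blast
  have diff: "norm (V (N + k) t - V N t) \<le> (\<Sum>i. h (i + N))" if "t \<ge> 0" for N k t
  proof -
    have "norm (V (N + k) t - V N t) \<le> (\<Sum>i<k. h (i + N))"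
    proof (induction k)
      case (Suc k)
      have "V (N + Suc k) t - V N t = (V (Suc (N + k)) t - V (N + k) t) + (V (N + k) t - V N t)" by simp
      then have "norm (V (N + Suc k) t - V N t) \<le> norm (V (Suc (N + k)) t - V (N + k) t) + norm (V (N
          + k) t - V N t)"
        using norm_triangle_ineq by metis
      also have "\<dots> \<le> h (N + k) + (\<Sum>i<k. h (i + N))" by (intro add_mono inc Suc that)
      finally show ?case by (simp add: add.commute)
    qed simp
    also have "\<dots> \<le> (\<Sum>i. h (i + N))" using h h0 by (intro sum_le_suminf) (auto simp: summable_iff_shift)
    finally show ?thesis .
  qed
  have lim_diff: "norm (l - V N t) \<le> (\<Sum>i. h (i + N))" if "t \<ge> 0" "(\<lambda>N. V N t) \<longlonglongrightarrow> l" for l N t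
  proof (rule tendsto_upperbound)
    show "(\<lambda>k. norm (V (N + k) t - V N t)) \<longlonglongrightarrow> norm (l - V N t)"
      using LIMSEQ_ignore_initial_segment[OF that(2), of N] by (intro tendsto_intros) (simp add: add.commute)
  qed (use diff that in auto)
  have tail: "(\<lambda>N. \<Sum>i. h (i + N)) \<longlonglongrightarrow> 0" using suminf_exist_split2[OF h] by simp
  show ?thesis
  proof (rule tendstoI)
    fix e :: real assume e: "e > 0"
    then have "\<forall>\<^sub>F N in sequentially. (\<Sum>i. h (i + N)) < e / 3" by (intro order_tendstoD(2)[OF tail]) auto
    then obtain N where N: "(\<Sum>i. h (i + N)) < e / 3" by (auto simp: eventually_sequentially)
    have "\<forall>\<^sub>F t in at_right 0. dist (V N t) (V N 0) < e / 3" using e by (intro tendstoD[OF cont]) auto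
    moreover have "\<forall>\<^sub>F t in at_right 0. t > (0::real)" by (rule eventually_at_right_less)
    ultimately show "\<forall>\<^sub>F t in at_right 0. dist (L t) S < e"
    proof eventually_elim
      case (elim t)
      have "norm (L t - V N t) \<le> (\<Sum>i. h (i + N))" using lim_diff[OF _ L] elim by simp
      moreover have "norm (S - V N 0) \<le> (\<Sum>i. h (i + N))" using lim_diff[OF _ S] by simp
      moreover have "dist (L t) S \<le> dist (L t) (V N t) + dist (V N t) (V N 0) + dist (V N 0) S"
        by (meson dist_triangle order_trans add_right_mono)
      ultimately show ?case using elim N by (simp add: dist_norm norm_minus_commute)
    qed
  qed
qed

text \<open>
  By continuity in \<open>t\<close>, a supremum over these countably many times is a supremum over all \<open>t \<ge> 0\<close>.
\<close>

lemma positive_rationals_enumeration: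
  obtains r :: "nat \<Rightarrow> real" where "\<And>k. r k > 0" "\<And>t. t \<ge> 0 \<Longrightarrow> \<exists>\<kappa>. (\<lambda>n. r (\<kappa> n)) \<longlonglongrightarrow> t"
proof -
  define Q where "Q = {x::real. x \<in> \<rat> \<and> x > 0}"
  have "countable Q" unfolding Q_def by (rule countable_subset[OF _ countable_rat]) auto
  moreover have "Q \<noteq> {}" unfolding Q_def by (auto intro!: exI[of _ 1])
  ultimately have Q: "range (from_nat_into Q) = Q" by (intro range_from_nat_into) auto
  show ?thesis
  proof (rule that[of "from_nat_into Q"])
    show "from_nat_into Q k > 0" for k using from_nat_into[OF \<open>Q \<noteq> {}\<close>, of k] by (simp add: Q_def)
    fix t :: real assume t: "t \<ge> 0"
    have "\<exists>\<kappa>. \<forall>n. t < from_nat_into Q (\<kappa> n) \<and> from_nat_into Q (\<kappa> n) < t + inverse (real (Suc n))"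
    proof (intro choice allI)
      fix n
      have "t < t + inverse (real (Suc n))" by simp
      then obtain x where "x \<in> \<rat>" "t < x" "x < t + inverse (real (Suc n))" using Rats_dense_in_real by blast
      moreover from this have "x \<in> range (from_nat_into Q)" unfolding Q using t by (simp add: Q_def)
      ultimately show "\<exists>k. t < from_nat_into Q k \<and> from_nat_into Q k < t + inverse (real (Suc n))" by auto
    qed
    then obtain \<kappa> where \<kappa>: "\<And>n. t < from_nat_into Q (\<kappa> n)" "\<And>n. from_nat_into Q (\<kappa> n) < t + inverse (real (Suc
        n))" by blast
    have "(\<lambda>n. from_nat_into Q (\<kappa> n)) \<longlonglongrightarrow> t"
    proof (rule tendsto_sandwich)
      show "(\<lambda>n. t) \<longlonglongrightarrow> t" by simp
      have "(\<lambda>n. t + inverse (real (Suc n))) \<longlonglongrightarrow> t + 0" by (intro tendsto_intros LIMSEQ_inverse_real_of_nat)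
      then show "(\<lambda>n. t + inverse (real (Suc n))) \<longlonglongrightarrow> t" by simp
    qed (use \<kappa> in \<open>auto intro!: always_eventually less_imp_le\<close>)
    then show "\<exists>\<kappa>. (\<lambda>n. from_nat_into Q (\<kappa> n)) \<longlonglongrightarrow> t" by blast
  qed
qed

lemma le_quadratic:
  fixes y l :: real
  assumes "l > 0"
  shows "y \<le> l * y\<^sup>2 + inverse l"
proof -
  have "0 \<le> (l * y - 1 / 2)\<^sup>2" by simp
  then have "l * y \<le> (l * y)\<^sup>2 + 1" by (simp add: power2_eq_square algebra_simps)
  then have "inverse l * (l * y) \<le> inverse l * ((l * y)\<^sup>2 + 1)" using assms by (intro mult_left_mono) auto
  then show ?thesis using assms by (simp add: power2_eq_square field_simps)
qed

text \<open>
  The square of the maximal function of the part of order \<open>N\<close> has local integral \<open>O(\<rho> powr (2 N))\<close>, where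
  \<open>\<rho> = 2 powr - \<delta>\<close> and \<open>e = 2 \<sigma> - 2 \<delta>\<close>; divided by \<open>\<rho>\<^sup>N\<close> these squares are still summable in the mean. The
  inequality \<open>y \<le> y\<^sup>2 / \<rho>\<^sup>N + \<rho>\<^sup>N\<close> turns this into summable bounds \<open>h\<close> for the functions themselves, with a
  locally integrable sum \<open>H\<close> that later also serves as a majorant. The value \<open>0\<close> of \<open>H\<close> marks the null set
  where the sum is infinite.
\<close>

lemma dyadic_maximal_sum:
  fixes g :: "real \<Rightarrow> complex"
  assumes a: "a > 0" and \<gamma>: "\<gamma> > 1"
    and \<sigma>: "(a \<noteq> 1 \<and> \<sigma> > min (a / 4 * (1 - 1 / \<gamma>)) (1 / 4)) \<or> (a = 1 \<and> \<sigma> > 1 / 2 * (1 - 1 / \<gamma>))"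
    and gm [measurable]: "g \<in> borel_measurable borel"
        and gi: "\<And>R. integrable lborel (\<lambda>\<xi>. indicator (annulus R) \<xi> *\<^sub>R g \<xi>)"
    and A: "A > 0" and decay: "\<And>R. R \<ge> 1 \<Longrightarrow> (\<integral>\<^sup>+\<xi>. ennreal ((norm (g \<xi>))\<^sup>2) * indicator (annulus R) \<xi> \<partial>lborel)
        \<le> ennreal (A * R powr (- 2 * \<sigma>))"
  obtains h :: "nat \<Rightarrow> real \<Rightarrow> real" and H :: "real \<Rightarrow> real"
    where "\<And>N t x. t \<ge> 0 \<Longrightarrow> H x \<noteq> 0 \<Longrightarrow> norm (wave_part g a \<gamma> (annulus (2 ^ N)) t x) \<le> h N x"
      "AE x in lborel. H x \<noteq> 0" "\<And>x. H x \<noteq> 0 \<Longrightarrow> summable (\<lambda>N. h N x) \<and> (\<Sum>N. h N x) \<le> H x"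
      "\<And>M. set_integrable lborel {-M..M} H"
proof -
  obtain C e b1 b2 where C: "C > 0" and e: "e < 2 * \<sigma>" and b: "b1 < 1" "b2 < 1"
    and K: "\<And>R z \<tau> B. R \<ge> 1 \<Longrightarrow> z \<noteq> 0 \<Longrightarrow> \<bar>\<tau>\<bar> powr \<gamma> \<le> B \<Longrightarrow>
      norm (wave_kernel a R B \<tau> z)
      \<le> C * R powr e * (\<bar>z\<bar> powr (- b1) + \<bar>z\<bar> powr (- b2))"
    by (rule annulus_kernel_bound[OF a \<gamma> \<sigma>]) blast
  obtain r :: "nat \<Rightarrow> real" where r: "\<And>k. r k > 0" and dense: "\<And>t. t \<ge> 0 \<Longrightarrow> \<exists>\<kappa>. (\<lambda>n. r (\<kappa> n)) \<longlonglongrightarrow> t"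
    by (rule positive_rationals_enumeration) blast
  define u where "u N t x = wave_part g a \<gamma> (annulus (2 ^ N)) t x" for N :: nat and t x
  define m where "m N x = (SUP k. ennreal ((norm (u N (r k) x))\<^sup>2))" for N x
  have [measurable]: "m N \<in> borel_measurable borel" for N unfolding m_def u_def by measurable
  have um: "ennreal ((norm (u N t x))\<^sup>2) \<le> m N x" if t: "t \<ge> 0" for N t x
  proof -
    obtain \<kappa> where \<kappa>: "(\<lambda>n. r (\<kappa> n)) \<longlonglongrightarrow> t" using dense[OF t] by blast
    have "(\<lambda>n. u N (r (\<kappa> n)) x) \<longlonglongrightarrow> u N t x"
      unfolding u_def using \<gamma> r by (intro wave_part_tendsto gi \<kappa>) (auto intro: less_imp_le)
    then have "(\<lambda>n. ennreal ((norm (u N (r (\<kappa> n)) x))\<^sup>2)) \<longlonglongrightarrow> ennreal ((norm (u N t x))\<^sup>2)"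
      by (intro tendsto_ennrealI tendsto_intros)
    then show ?thesis
      by (rule tendsto_upperbound) (auto simp: m_def intro!: always_eventually SUP_upper)
  qed
  define \<delta> where "\<delta> = (2 * \<sigma> - e) / 2"
  have \<delta>: "\<delta> > 0" "e = 2 * \<sigma> - 2 * \<delta>" using e by (auto simp: \<delta>_def field_simps)
  define \<rho> where "\<rho> = 2 powr (- \<delta>)"
  have \<rho>: "0 < \<rho>" "\<rho> < 1" using \<delta> by (auto simp: \<rho>_def powr_less_one)
  define b' where "b' N x = ennreal (inverse \<rho> ^ N) * m N x" for N x
  have [measurable]: "b' N \<in> borel_measurable borel" for N unfolding b'_def by measurable
  define B where "B x = (\<Sum>N. b' N x)" for x
  have [measurable]: "B \<in> borel_measurable borel" unfolding B_def by measurable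
  have Bint: "(\<integral>\<^sup>+x. B x * indicator {-M..M} x \<partial>lborel) < \<infinity>" if M: "M > 0" for M
  proof -
    define c where "c = C * (2 * ((2 * M) powr (1 - b1) / (1 - b1)) + 2 * ((2 * M) powr (1 - b2) / (1 - b2)))"
    have bN: "(\<integral>\<^sup>+x. b' N x * indicator {-M..M} x \<partial>lborel) \<le> ennreal (c * A * \<rho> ^ N)" for N
    proof -
      have R: "(2::real) ^ N \<ge> 1" by simp
      have "(\<integral>\<^sup>+x. b' N x * indicator {-M..M} x \<partial>lborel)
          = ennreal (inverse \<rho> ^ N) * (\<integral>\<^sup>+x. m N x * indicator {-M..M} x \<partial>lborel)"
        unfolding b'_def mult.assoc by (rule nn_integral_cmult) measurable
      also have "\<dots> \<le> ennreal (inverse \<rho> ^ N) * ennreal (c * (2 ^ N) powr e * (A * (2 ^ N) powr (- 2 * \<sigma>)))"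
        unfolding m_def u_def wave_part_def
        by (intro mult_left_mono maximal_countable[OF \<gamma> C b K R M gm r decay[OF R] c_def]) auto
      also have "\<dots> = ennreal (inverse \<rho> ^ N * (c * (2 ^ N) powr e * (A * (2 ^ N) powr (- 2 * \<sigma>))))"
        using \<rho> by (intro ennreal_mult'[symmetric]) auto
      also have "inverse \<rho> ^ N * (c * (2 ^ N) powr e * (A * (2 ^ N) powr (- 2 * \<sigma>))) = c * A * \<rho> ^ N"
      proof -
        have "(2 ^ N) powr e * (2 ^ N) powr (- 2 * \<sigma>) = ((2::real) ^ N) powr (- 2 * \<delta>)"
          unfolding \<delta>(2) by (simp add: powr_add[symmetric])
        also have "\<dots> = 2 powr (real N * (- 2 * \<delta>))" by (simp add: powr_realpow[symmetric] powr_powr)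
        also have "\<dots> = \<rho> powr (real N * 2)" by (simp add: \<rho>_def powr_powr mult_ac)
        also have "\<dots> = \<rho> ^ N * \<rho> ^ N" using \<rho>
            by (simp add: powr_realpow[symmetric] powr_add[symmetric] mult.commute)
        finally have *: "(2 ^ N) powr e * (2 ^ N) powr (- 2 * \<sigma>) = \<rho> ^ N * \<rho> ^ N" .
        have "inverse \<rho> ^ N * \<rho> ^ N = 1" using \<rho> by (simp add: power_mult_distrib[symmetric])
        then have "inverse \<rho> ^ N * (\<rho> ^ N * \<rho> ^ N) = \<rho> ^ N" by (simp add: mult.assoc[symmetric])
        moreover have "inverse \<rho> ^ N * (c * (2 ^ N) powr e * (A * (2 ^ N) powr (- 2 * \<sigma>)))
            = c * A * (inverse \<rho> ^ N * ((2 ^ N) powr e * (2 ^ N) powr (- 2 * \<sigma>)))"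
          by (simp only: mult_ac)
        ultimately show ?thesis by (simp only: *)
      qed
      finally show ?thesis .
    qed
    have "(\<integral>\<^sup>+x. B x * indicator {-M..M} x \<partial>lborel) = (\<integral>\<^sup>+x. (\<Sum>N. b' N x * indicator {-M..M} x) \<partial>lborel)"
      unfolding B_def by (simp add: ennreal_suminf_multc)
    also have "\<dots> = (\<Sum>N. \<integral>\<^sup>+x. b' N x * indicator {-M..M} x \<partial>lborel)" by (rule nn_integral_suminf) measurable
    also have "\<dots> \<le> (\<Sum>N. ennreal (c * A * \<rho> ^ N))" by (intro suminf_le bN) auto
    also have "\<dots> = ennreal (\<Sum>N. c * A * \<rho> ^ N)"
    proof (rule suminf_ennreal2)
      have "c \<ge> 0" unfolding c_def using C b M
          by (intro mult_nonneg_nonneg add_nonneg_nonneg divide_nonneg_nonneg) auto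
      then show "0 \<le> c * A * \<rho> ^ N" for N using A \<rho> by simp
      show "summable (\<lambda>N. c * A * \<rho> ^ N)" using \<rho> by (intro summable_mult summable_geometric) auto
    qed
    finally show ?thesis by (auto intro: le_less_trans)
  qed
  have Bfin: "AE x in lborel. B x \<noteq> \<infinity>"
  proof -
    have "AE x in lborel. \<forall>n::nat. B x * indicator {-real (Suc n)..real (Suc n)} x \<noteq> \<infinity>"
    proof (subst AE_all_countable, intro allI nn_integral_PInf_AE)
      show "(\<integral>\<^sup>+ x. B x * indicator {-real (Suc n)..real (Suc n)} x \<partial>lborel) \<noteq> \<infinity>" for n
          using Bint[of "real (Suc n)"] by simp
    qed measurable
    then show ?thesis
    proof eventually_elim
      case (elim x)
      obtain n :: nat where "\<bar>x\<bar> \<le> real n" using real_arch_simple by blast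
      then have "x \<in> {-real (Suc n)..real (Suc n)}" by auto
      then show ?case using elim[rule_format, of n] by (simp del: of_nat_Suc)
    qed
  qed
  \<comment> \<open>the geometric series \<open>1 / (1 - \<rho>)\<close> makes \<open>H\<close> positive wherever \<open>B\<close> is finite\<close>
  define H where "H x = (if B x = \<infinity> then 0 else enn2real (B x) + 1 / (1 - \<rho>))" for x
  define h where "h N x = enn2real (b' N x) + \<rho> ^ N" for N x
  have Hpos: "H x \<noteq> 0 \<longleftrightarrow> B x \<noteq> \<infinity>" for x using \<rho>
      by (auto simp: H_def add_nonneg_pos intro!: less_imp_neq[symmetric])
  have geo: "summable (\<lambda>N. \<rho> ^ N)" "(\<Sum>N. \<rho> ^ N) = 1 / (1 - \<rho>)" using \<rho> by (auto simp: suminf_geometric)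
  have bsum: "summable (\<lambda>N. enn2real (b' N x)) \<and> (\<Sum>N. enn2real (b' N x)) = enn2real (B x) \<and> (\<forall>N. b' N x \<noteq> \<infinity>)"
      if "B x \<noteq> \<infinity>" for x
  proof -
    have fin: "b' N x \<noteq> \<infinity>" for N
    proof -
      have "b' N x \<le> B x" unfolding B_def using sum_le_suminf[of "\<lambda>n. b' n x" "{N}"] by simp
      then show ?thesis using that by (auto simp: top_unique)
    qed
    have eq: "(\<Sum>N. ennreal (enn2real (b' N x))) = B x" unfolding B_def using fin
        by (intro suminf_cong) (simp add: less_top)
    then have s: "summable (\<lambda>N. enn2real (b' N x))" using that by (intro summable_suminf_not_top) auto
    have "ennreal (\<Sum>N. enn2real (b' N x)) = B x" using suminf_ennreal2[OF _ s] eq by simp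
    then have "(\<Sum>N. enn2real (b' N x)) = enn2real (B x)" using suminf_nonneg[OF s]
        by (metis enn2real_ennreal enn2real_nonneg)
    then show ?thesis using s fin by blast
  qed
  show ?thesis
  proof (rule that)
    show "AE x in lborel. H x \<noteq> 0" using Bfin unfolding Hpos .
    show "summable (\<lambda>N. h N x) \<and> (\<Sum>N. h N x) \<le> H x" if "H x \<noteq> 0" for x
    proof -
      have B: "B x \<noteq> \<infinity>" using that Hpos by blast
      then have "summable (\<lambda>N. h N x)" unfolding h_def using bsum geo by (intro summable_add) auto
      moreover have "(\<Sum>N. h N x) = H x" unfolding h_def H_def using bsum[OF B] geo B
          by (subst suminf_add[symmetric]) auto
      ultimately show ?thesis by simp
    qed
    show "norm (wave_part g a \<gamma> (annulus (2 ^ N)) t x) \<le> h N x" if t: "t \<ge> 0" and "H x \<noteq> 0" for N t x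
    proof -
      have B: "B x \<noteq> \<infinity>" using that Hpos by blast
      have l: "inverse \<rho> ^ N > 0" using \<rho> by simp
      have "ennreal (inverse \<rho> ^ N * (norm (u N t x))\<^sup>2) \<le> b' N x"
        unfolding b'_def using l um[OF t, of N x] by (subst ennreal_mult) (auto intro: mult_left_mono)
      also have "\<dots> = ennreal (enn2real (b' N x))" using bsum[OF B] by (simp add: less_top)
      finally have "inverse \<rho> ^ N * (norm (u N t x))\<^sup>2 \<le> enn2real (b' N x)" by (simp add: ennreal_le_iff)
      then show ?thesis using le_quadratic[OF l, of "norm (u N t x)"] unfolding h_def u_def
          by (simp add: power_inverse)
    qed
    show "set_integrable lborel {-M..M} H" for M
    proof (rule set_integrable_subset[of _ "{-(\<bar>M\<bar> + 1)..\<bar>M\<bar> + 1}"])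
      define M' where "M' = \<bar>M\<bar> + 1"
      have M': "M' > 0" by (simp add: M'_def)
      have [measurable]: "H \<in> borel_measurable borel" unfolding H_def by measurable
      have "integrable lborel (\<lambda>x. indicator {-M'..M'} x * H x)"
      proof (rule integrableI_bounded)
        have "(\<integral>\<^sup>+x. ennreal (norm (indicator {-M'..M'} x * H x)) \<partial>lborel)
            \<le> (\<integral>\<^sup>+x. B x * indicator {-M'..M'} x + ennreal (1 / (1 - \<rho>)) * indicator {-M'..M'} x \<partial>lborel)"
        proof (rule nn_integral_mono)
          fix x
          show "ennreal (norm (indicator {-M'..M'} x * H x))
              \<le> B x * indicator {-M'..M'} x + ennreal (1 / (1 - \<rho>)) * indicator {-M'..M'} x"
          proof (cases "x \<in> {-M'..M'} \<and> B x \<noteq> \<infinity>")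
            case True
            then have "ennreal (norm (indicator {-M'..M'} x * H x)) = ennreal (enn2real (B x) + 1 / (1 - \<rho>))"
                using \<rho> by (simp add: H_def)
            also have "\<dots> = B x + ennreal (1 / (1 - \<rho>))" using True \<rho>
                by (subst ennreal_plus) (auto simp: less_top)
            finally show ?thesis using True by simp
          qed (auto simp: H_def)
        qed
        also have "\<dots> = (\<integral>\<^sup>+x. B x * indicator {-M'..M'} x \<partial>lborel) + ennreal (1 / (1 - \<rho>)) * emeasure lborel
            {-M'..M'}"
          by (subst nn_integral_add) (auto simp: nn_integral_cmult)
        also have "\<dots> < \<infinity>" using Bint[OF M'] M' by (simp add: ennreal_mult_less_top)
        finally show "(\<integral>\<^sup>+x. ennreal (norm (indicator {-M'..M'} x * H x)) \<partial>lborel) < \<infinity>" .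
      qed measurable
      then show "set_integrable lborel {-(\<bar>M\<bar> + 1)..\<bar>M\<bar> + 1} H" unfolding set_integrable_def M'_def by simp
    qed auto
  qed
qed

lemma wave_part_increment:
  assumes gm [measurable]: "g \<in> borel_measurable borel" and gi: "\<And>S L. S \<in> sets borel \<Longrightarrow> S \<subseteq> {-L..L}
      \<Longrightarrow> integrable lborel (\<lambda>\<xi>. indicator S \<xi> *\<^sub>R g \<xi>)"
  shows "wave_part g a \<gamma> {-(2 ^ Suc N)..2 ^ Suc N} t x
      = wave_part g a \<gamma> {-(2 ^ N)..2 ^ N} t x + wave_part g a \<gamma> (annulus (2 ^ N)) t x"
proof -
  have i: "integrable lborel (\<lambda>\<xi>. indicator {-(2 ^ N)..2 ^ N} \<xi> *\<^sub>R (g \<xi> * wave a \<gamma> t x \<xi>))"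
    by (intro wave_part_integrable gi[where L="2 ^ N"] gm) auto
  have j: "integrable lborel (\<lambda>\<xi>. indicator (annulus (2 ^ N)) \<xi> *\<^sub>R (g \<xi> * wave a \<gamma> t x \<xi>))"
    by (intro wave_part_integrable gi[where L="2 * 2 ^ N"] gm) (auto simp: annulus_def)
  have "wave_part g a \<gamma> {-(2 ^ Suc N)..2 ^ Suc N} t x = (LINT \<xi>|lborel. indicator {-(2 ^ N)..2 ^ N} \<xi> *\<^sub>R (g \<xi>
      * wave a \<gamma> t x \<xi>) + indicator (annulus (2 ^ N)) \<xi> *\<^sub>R (g \<xi> * wave a \<gamma> t x \<xi>))"
    unfolding wave_part_def
  proof (rule integral_cong_AE)
    have "AE \<xi> in lborel. \<xi> \<noteq> (2::real) ^ N" "AE \<xi> in lborel. \<xi> \<noteq> - ((2::real) ^ N)"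
        by (rule AE_lborel_singleton)+
    then show "AE \<xi> in lborel. indicator {-(2 ^ Suc N)..2 ^ Suc N} \<xi> *\<^sub>R (g \<xi> * wave a \<gamma> t x \<xi>)
       = indicator {-(2 ^ N)..2 ^ N} \<xi> *\<^sub>R (g \<xi> * wave a \<gamma> t x \<xi>) + indicator (annulus (2 ^ N)) \<xi> *\<^sub>R (g \<xi>
           * wave a \<gamma> t x \<xi>)"
    proof eventually_elim
      case (elim \<xi>)
      have "(indicator {-(2 ^ Suc N)..2 ^ Suc N} \<xi> :: real)
          = indicator {-(2 ^ N)..2 ^ N} \<xi> + indicator (annulus (2 ^ N)) \<xi>"
        using elim by (auto simp: indicator_def annulus_def abs_le_iff abs_if split: if_splits)
      then show ?case by (simp only: scaleR_add_left)
    qed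
  qed measurable
  then show ?thesis unfolding wave_part_def by (simp add: Bochner_Integration.integral_add[OF i j])
qed

text \<open>
  At a point where \<open>H\<close> is not \<open>0\<close>, \<open>telescoping_limit\<close> shows that the limit exists and equals the limit \<open>S\<close> of
  the partial Fourier integrals. The majorant \<open>H\<close> permits integration over \<open>[c, d]\<close>; by Fubini the integral of
  \<open>S\<close> is the integral of \<open>g\<close> against \<open>interval_transform\<close>, that is \<open>2 \<pi>\<close> times the integral of \<open>f\<close>.
\<close>

lemma wave_integral_tendsto_AE:
  fixes f g :: "real \<Rightarrow> complex"
  assumes a: "a > 0" and \<gamma>: "\<gamma> > 1" and p: "1 < p" "p \<le> 2"
    and \<sigma>: "(a \<noteq> 1 \<and> \<sigma> > min (a / 4 * (1 - 1 / \<gamma>)) (1 / 4)) \<or> (a = 1 \<and> \<sigma> > 1 / 2 * (1 - 1 / \<gamma>))"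
    and fm [measurable]: "f \<in> borel_measurable borel" and f: "Lp_pow p f < \<infinity>" and g: "is_fourier_borel p f g"
    and A: "A > 0" and decay: "\<And>R. R \<ge> 1 \<Longrightarrow> (\<integral>\<^sup>+\<xi>. ennreal ((norm (g \<xi>))\<^sup>2) * indicator (annulus R) \<xi> \<partial>lborel)
        \<le> ennreal (A * R powr (- 2 * \<sigma>))"
  shows "AE x in lborel. ((\<lambda>t. LINT \<xi>|lborel. g \<xi> * wave a \<gamma> t x \<xi>) \<longlongrightarrow> 2 * of_real pi * f x) (at_right 0)"
proof -
  define q where "q = p / (p - 1)"
  have q: "q \<ge> 1" using p by (simp add: q_def field_simps)
  have gm [measurable]: "g \<in> borel_measurable borel" and gq: "Lp_pow q g < \<infinity>" using g
      unfolding is_fourier_borel_def q_def by auto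
  have gi: "integrable lborel (\<lambda>\<xi>. indicator S \<xi> *\<^sub>R g \<xi>)" if "S \<in> sets borel" "S \<subseteq> {-L..L}" for S L
    by (rule integrable_truncation[OF gm that q gq])
  have giA: "integrable lborel (\<lambda>\<xi>. indicator (annulus R) \<xi> *\<^sub>R g \<xi>)" for R
    by (rule gi[where L="2 * R"]) (auto simp: annulus_def)
  obtain h H where h: "\<And>N t x. t \<ge> 0 \<Longrightarrow> H x \<noteq> 0 \<Longrightarrow> norm (wave_part g a \<gamma> (annulus (2 ^ N)) t x) \<le> h N x"
      and H: "AE x in lborel. H x \<noteq> 0" "\<And>x. H x \<noteq> 0 \<Longrightarrow> summable (\<lambda>N. h N x) \<and> (\<Sum>N. h N x) \<le> H x"
      "\<And>M. set_integrable lborel {-M..M} H"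
    by (rule dyadic_maximal_sum[OF a \<gamma> \<sigma> gm giA A decay]) blast+
  define V where "V N t x = wave_part g a \<gamma> {-(2 ^ N)..2 ^ N} t x" for N :: nat and t x
  have [measurable]: "V N t \<in> borel_measurable borel" for N t unfolding V_def by measurable
  have inc: "V (Suc N) t x - V N t x = wave_part g a \<gamma> (annulus (2 ^ N)) t x" for N t x
    unfolding V_def using wave_part_increment[OF gm gi] by simp
  have incb: "norm (V (Suc N) t x - V N t x) \<le> h N x" if "t \<ge> 0" "H x \<noteq> 0" for N t x
    unfolding inc by (rule h[OF that])
  define S where "S x = lim (\<lambda>N. V N 0 x)" for x
  have [measurable]: "S \<in> borel_measurable borel" unfolding S_def by measurable
  have Slim: "(\<lambda>N. V N 0 x) \<longlonglongrightarrow> S x" if "H x \<noteq> 0" for x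
  proof -
    have "summable (\<lambda>N. V (Suc N) 0 x - V N 0 x)"
      by (rule summable_comparison_test'[OF conjunct1[OF H(2)[OF that]], of 0]) (rule incb[OF order_refl that])
    then have "convergent (\<lambda>n. \<Sum>i<n. V (Suc i) 0 x - V i 0 x)" by (simp add: summable_iff_convergent)
    then have "convergent (\<lambda>n. V n 0 x - V 0 0 x)" by (simp only: sum_lessThan_telescope[of "\<lambda>i. V i 0 x"])
    then have "convergent (\<lambda>n. (V n 0 x - V 0 0 x) + V 0 0 x)" by (rule convergent_add[OF _ convergent_const])
    then show ?thesis by (simp add: S_def convergent_LIMSEQ_iff)
  qed
  have conv: "((\<lambda>t. LINT \<xi>|lborel. g \<xi> * wave a \<gamma> t x \<xi>) \<longlongrightarrow> S x) (at_right 0)" if x: "H x \<noteq> 0" for x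
  proof (rule telescoping_limit[where h="\<lambda>N. h N x" and V="\<lambda>N t. V N t x"])
    show "summable (\<lambda>N. h N x)" using H(2)[OF x] by blast
    show "norm (V (Suc N) t x - V N t x) \<le> h N x" if "0 \<le> t" for N t by (rule incb[OF that x])
    show "(\<lambda>N. V N 0 x) \<longlonglongrightarrow> S x" by (rule Slim[OF x])
    show "(\<lambda>N. V N t x) \<longlonglongrightarrow> (LINT \<xi>|lborel. g \<xi> * wave a \<gamma> t x \<xi>)" if t: "0 < t" for t
      unfolding V_def wave_part_def
    proof (rule integral_dominated_convergence[where w="\<lambda>\<xi>. norm (g \<xi> * wave a \<gamma> t x \<xi>)"])
      have i: "integrable lborel (\<lambda>\<xi>. g \<xi> * wave a \<gamma> t x \<xi>)"
        by (intro integrable_mult_bounded[OF gm _ q gq norm_wave_le_1 integrable_wave[OF a t]]) measurable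
      show "integrable lborel (\<lambda>\<xi>. norm (g \<xi> * wave a \<gamma> t x \<xi>))" by (rule integrable_norm[OF i])
      show "AE \<xi> in lborel. (\<lambda>N. indicat_real {- (2 ^ N)..2 ^ N} \<xi> *\<^sub>R (g \<xi> * wave a \<gamma> t x \<xi>))
          \<longlonglongrightarrow> g \<xi> * wave a \<gamma> t x \<xi>"
      proof (intro AE_I2 tendsto_eventually)
        fix \<xi> :: real
        obtain n :: nat where n: "\<bar>\<xi>\<bar> < 2 ^ n" using real_arch_pow[of 2 "\<bar>\<xi>\<bar>"] by auto
        show "\<forall>\<^sub>F N in sequentially. indicat_real {- (2 ^ N)..2 ^ N} \<xi> *\<^sub>R (g \<xi> * wave a \<gamma> t x \<xi>)
            = g \<xi> * wave a \<gamma> t x \<xi>"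
        proof (rule eventually_sequentiallyI[of n])
          fix N assume "n \<le> N"
          then have "(2::real) ^ n \<le> 2 ^ N" by (intro power_increasing) auto
          then have "\<bar>\<xi>\<bar> \<le> 2 ^ N" using n by linarith
          then have "\<xi> \<in> {- (2 ^ N)..2 ^ N}" by (auto simp: abs_le_iff)
          then show "indicat_real {- (2 ^ N)..2 ^ N} \<xi> *\<^sub>R (g \<xi> * wave a \<gamma> t x \<xi>) = g \<xi> * wave a \<gamma> t x \<xi>"
              by simp
        qed
      qed
    qed (auto split: split_indicator)
    show "((\<lambda>t. V N t x) \<longlongrightarrow> V N 0 x) (at_right 0)" for N
      unfolding tendsto_at_iff_sequentially
    proof (intro allI impI)
      fix X :: "nat \<Rightarrow> real" assume X: "\<forall>i. X i \<in> {0<..} - {0}" "X \<longlonglongrightarrow> 0"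
      show "((\<lambda>t. V N t x) \<circ> X) \<longlonglongrightarrow> V N 0 x"
        unfolding V_def comp_def using X \<gamma>
        by (intro wave_part_tendsto gm gi[where L="2 ^ N"]) (auto intro: less_imp_le)
    qed
  qed
  have fi: "set_integrable lborel {-M..M} f" for M
    unfolding set_integrable_def using p f by (intro integrable_truncation[of f _ M p]) auto
  have Vb: "norm (V N 0 x) \<le> (LINT \<xi>|lborel. norm (indicator {-1..1} \<xi> *\<^sub>R g \<xi>)) + H x" if x: "H x \<noteq> 0" for N x
  proof -
    have h0: "h N x \<ge> 0" for N using incb[OF order_refl x, of N] norm_ge_zero order_trans by blast
    have "norm (V N 0 x - V 0 0 x) \<le> (\<Sum>i<N. h i x)"
    proof (induction N)
      case (Suc N)
      have "V (Suc N) 0 x - V 0 0 x = (V (Suc N) 0 x - V N 0 x) + (V N 0 x - V 0 0 x)" by simp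
      then have "norm (V (Suc N) 0 x - V 0 0 x) \<le> norm (V (Suc N) 0 x - V N 0 x) + norm (V N 0 x - V 0 0 x)"
        using norm_triangle_ineq by metis
      then show ?case using Suc incb[OF order_refl x, of N] by simp
    qed simp
    also have "\<dots> \<le> (\<Sum>i. h i x)" using H(2)[OF x] h0 by (intro sum_le_suminf) auto
    also have "\<dots> \<le> H x" using H(2)[OF x] by blast
    finally have "norm (V N 0 x - V 0 0 x) \<le> H x" .
    moreover have "norm (V 0 0 x) \<le> (LINT \<xi>|lborel. norm (indicator {-1..1} \<xi> *\<^sub>R g \<xi>))"
      unfolding V_def wave_part_def
    proof (rule Bochner_Integration.integral_norm_bound_integral)
      show "integrable lborel (\<lambda>\<xi>. indicat_real {- (2 ^ 0)..2 ^ 0} \<xi> *\<^sub>R (g \<xi> * wave a \<gamma> 0 x \<xi>))"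
        by (intro wave_part_integrable gm gi[where L=1]) auto
      show "integrable lborel (\<lambda>\<xi>. norm (indicator {-1..1} \<xi> *\<^sub>R g \<xi>))"
          by (intro integrable_norm gi[where L=1]) auto
    qed (auto simp: norm_mult intro!: mult_left_mono mult_right_le_one_le norm_wave_le_1)
    moreover have "norm (V N 0 x) \<le> norm (V N 0 x - V 0 0 x) + norm (V 0 0 x)"
        by (metis diff_add_cancel norm_triangle_ineq)
    ultimately show ?thesis by linarith
  qed
  have dom: "integrable lborel (\<lambda>x. indicator {c..d} x *\<^sub>R S x) \<and> (\<lambda>N. LINT x|lborel. indicator {c..d} x *\<^sub>R V N
      0 x) \<longlonglongrightarrow> (LINT x|lborel. indicator {c..d} x *\<^sub>R S x)" for c d :: real
  proof -
    define w where "w x = indicator {c..d} x * ((LINT \<xi>|lborel. norm (indicator {-1..1} \<xi> *\<^sub>R g \<xi>)) + H x)"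
        for x
    have H': "set_integrable lborel {c..d} H" by (rule set_integrable_subset[OF H(3)[of "max \<bar>c\<bar> \<bar>d\<bar>"]]) auto
    have "set_integrable lborel {c..d} (\<lambda>x. (LINT \<xi>|lborel. norm (indicator {-1..1} \<xi> *\<^sub>R g \<xi>)))"
      unfolding set_integrable_def real_scaleR_def
          by (intro integrable_mult_left integrable_real_indicator) (auto simp: emeasure_lborel_Icc_eq)
    from set_integral_add(1)[OF this H'] have w: "integrable lborel w"
      unfolding w_def set_integrable_def real_scaleR_def .
    have l: "AE x in lborel. (\<lambda>N. indicator {c..d} x *\<^sub>R V N 0 x) \<longlonglongrightarrow> indicator {c..d} x *\<^sub>R S x"
      using H(1) by eventually_elim (intro tendsto_intros Slim)
    have le: "AE x in lborel. norm (indicator {c..d} x *\<^sub>R V N 0 x) \<le> w x" for N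
      using H(1) by eventually_elim (use Vb in \<open>auto simp: w_def split: split_indicator\<close>)
    show ?thesis
      using integrable_dominated_convergence[OF _ _ w l le] integral_dominated_convergence[OF _ _ w l le]
          by auto
  qed
  have VF: "(LINT x|lborel. indicator {c..d} x *\<^sub>R V N 0 x)
      = (LINT \<xi>|lborel. indicator {-(2 ^ N)..2 ^ N} \<xi> *\<^sub>R (g \<xi> * interval_transform c d \<xi>))" for c d N
  proof -
    define T where "T x \<xi> = complex_of_real (indicator {c..d} x) * (indicator {-(2 ^ N)..2 ^ N} \<xi> *\<^sub>R g \<xi>)
        * exp (\<i> * of_real (x * \<xi>))" for x \<xi> :: real
    have iT: "integrable (lborel \<Otimes>\<^sub>M lborel) (\<lambda>(x, \<xi>). T x \<xi>)"
    proof (rule Bochner_Integration.integrable_bound)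
      show "integrable (lborel \<Otimes>\<^sub>M lborel) (\<lambda>(x, \<xi>). complex_of_real (indicator {c..d} x) * (indicator {-(2 ^
          N)..2 ^ N} \<xi> *\<^sub>R g \<xi>))"
        by (intro integrable_tensor lborel_pair.pair_sigma_finite_axioms gi[where L="2 ^ N"] integrable_of_real
            integrable_real_indicator) (auto simp: emeasure_lborel_Icc_eq)
      show "(\<lambda>(x, \<xi>). T x \<xi>) \<in> borel_measurable (lborel \<Otimes>\<^sub>M lborel)" unfolding T_def case_prod_beta'
          by measurable
    qed (auto simp: T_def norm_mult)
    have "(LINT x|lborel. indicator {c..d} x *\<^sub>R V N 0 x) = (LINT x|lborel. (LINT \<xi>|lborel. T x \<xi>))"
    proof (intro Bochner_Integration.integral_cong refl)
      fix x
      have "(LINT \<xi>|lborel. T x \<xi>) = (LINT \<xi>|lborel. indicator {c..d} x *\<^sub>R (indicator {-(2 ^ N)..2 ^ N} \<xi> *\<^sub>R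
          (g \<xi> * wave a \<gamma> 0 x \<xi>)))"
        by (intro Bochner_Integration.integral_cong) (auto simp: T_def wave_def scaleR_conv_of_real mult_ac)
      then show "indicator {c..d} x *\<^sub>R V N 0 x = (LINT \<xi>|lborel. T x \<xi>)"
        unfolding V_def wave_part_def by (simp only: integral_scaleR_right)
    qed
    also have "\<dots> = (LINT \<xi>|lborel. (LINT x|lborel. T x \<xi>))"
      by (rule lborel_pair.Fubini_integral[symmetric]) (use iT in simp)
    also have "\<dots> = (LINT \<xi>|lborel. indicator {-(2 ^ N)..2 ^ N} \<xi> *\<^sub>R (g \<xi> * interval_transform c d \<xi>))"
    proof (intro Bochner_Integration.integral_cong refl)
      fix \<xi>
      have "(LINT x|lborel. T x \<xi>) = (LINT x|lborel. (indicator {-(2 ^ N)..2 ^ N} \<xi> *\<^sub>R g \<xi>) * (indicator {c..d}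
          x *\<^sub>R exp (\<i> * of_real (x * \<xi>))))"
        by (intro Bochner_Integration.integral_cong) (auto simp: T_def scaleR_conv_of_real mult_ac)
      then show "(LINT x|lborel. T x \<xi>) = indicator {-(2 ^ N)..2 ^ N} \<xi> *\<^sub>R (g \<xi> * interval_transform c d \<xi>)"
        unfolding interval_transform_def by (simp only: integral_mult_right_zero) (simp only: mult_scaleR_left)
    qed
    finally show ?thesis .
  qed
  have "AE x in lborel. S x - 2 * of_real pi * f x = 0"
  proof (rule AE_zero_if_interval_integrals_zero)
    have fi': "set_integrable lborel {-M..M} (\<lambda>x. 2 * of_real pi * f x)" for M using fi
        by (intro set_integrable_mult_right) auto
    have Si: "set_integrable lborel {-M..M} S" for M unfolding set_integrable_def using dom by blast
    show "set_integrable lborel {-M..M} (\<lambda>x. S x - 2 * of_real pi * f x)" for M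
        by (intro set_integral_diff(1) Si fi')
    fix c d :: real assume cd: "c < d"
    have "(\<lambda>N. LINT \<xi>|lborel. indicator {-(2 ^ N)..2 ^ N} \<xi> *\<^sub>R (g \<xi> * interval_transform c d \<xi>))
        \<longlonglongrightarrow> (LINT \<xi>|lborel. g \<xi> * interval_transform c d \<xi>)"
    proof (rule integral_dominated_convergence[where w="\<lambda>\<xi>. norm (g \<xi> * interval_transform c d \<xi>)"])
      show "integrable lborel (\<lambda>\<xi>. norm (g \<xi> * interval_transform c d \<xi>))"
        by (rule integrable_norm[OF parseval_interval(1)[OF p fm f g cd]])
      show "AE \<xi> in lborel. (\<lambda>N. indicat_real {- (2 ^ N)..2 ^ N} \<xi> *\<^sub>R (g \<xi> * interval_transform c d \<xi>))
          \<longlonglongrightarrow> g \<xi> * interval_transform c d \<xi>"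
      proof (intro AE_I2 tendsto_eventually)
        fix \<xi> :: real
        obtain n :: nat where n: "\<bar>\<xi>\<bar> < 2 ^ n" using real_arch_pow[of 2 "\<bar>\<xi>\<bar>"] by auto
        show "\<forall>\<^sub>F N in sequentially. indicat_real {- (2 ^ N)..2 ^ N} \<xi> *\<^sub>R (g \<xi> * interval_transform c d \<xi>)
            = g \<xi> * interval_transform c d \<xi>"
        proof (rule eventually_sequentiallyI[of n])
          fix N assume "n \<le> N"
          then have "(2::real) ^ n \<le> 2 ^ N" by (intro power_increasing) auto
          then have "\<bar>\<xi>\<bar> \<le> 2 ^ N" using n by linarith
          then have "\<xi> \<in> {- (2 ^ N)..2 ^ N}" by (auto simp: abs_le_iff)
          then show "indicat_real {- (2 ^ N)..2 ^ N} \<xi> *\<^sub>R (g \<xi> * interval_transform c d \<xi>)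
              = g \<xi> * interval_transform c d \<xi>" by simp
        qed
      qed
    qed (auto split: split_indicator)
    then have "(LINT x|lborel. indicator {c..d} x *\<^sub>R S x) = (LINT \<xi>|lborel. g \<xi> * interval_transform c d \<xi>)"
      using dom[of c d] LIMSEQ_unique unfolding VF by blast
    also have "\<dots> = 2 * of_real pi * (LINT y:{c..d}|lborel. f y)" by (rule parseval_interval(2)[OF p fm f g cd])
    finally have e: "(LINT x:{c..d}|lborel. S x) = (LINT x:{c..d}|lborel. 2 * of_real pi * f x)"
      by (simp add: set_lebesgue_integral_def)
    have sub: "set_integrable lborel {c..d} w" if "\<And>M. set_integrable lborel {-M..M} w"
        for w :: "real \<Rightarrow> complex"
      by (rule set_integrable_subset[OF that[of "max \<bar>c\<bar> \<bar>d\<bar>"]]) auto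
    show "(LINT x:{c..d}|lborel. S x - 2 * of_real pi * f x) = 0"
      using set_integral_diff(2)[OF sub[OF Si] sub[OF fi']] e by simp
  qed measurable
  then show ?thesis using H(1)
  proof eventually_elim
    case (elim x)
    then show ?case using conv[of x] by simp
  qed
qed

text \<open>
  It remains to pass to Borel representatives of \<open>f\<close> and of its Fourier transform, which changes the operator
  nowhere and \<open>f\<close> only on a null set, and to check that the thresholds are the conditions on
  \<open>\<sigma> = min s 1 - (1 / p - 1 / 2)\<close> in \<open>annulus_kernel_bound\<close>.
\<close>

theorem theorem1p2:
  fixes s a \<gamma> p :: real
  assumes "s > 0" and "a > 0" and "\<gamma> > 1" and "1 < p" and "p \<le> 2"
    and "(0 < a \<and> a < 1 \<and> s > (2 - p) / (2 * p) + a / 4 * (1 - 1 / \<gamma>))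
       \<or> (a = 1 \<and> s > 1 / p - 1 / (2 * \<gamma>))
       \<or> (a > 1 \<and> s > (2 - p) / (2 * p) + min (a / 4 * (1 - 1 / \<gamma>)) (1 / 4))"
  shows "\<forall>f \<in> sobolev_space s p. AE x in lebesgue.
           ((\<lambda>t. landau_schroedinger p a \<gamma> t f x) \<longlongrightarrow> f x) (at_right 0)"
proof
  fix f assume fs: "f \<in> sobolev_space s p"
  then have fL: "f \<in> borel_measurable lebesgue" "Lp_pow p f < \<infinity>" by (auto simp: sobolev_space_def Lp_space_def)
  obtain f' where fm [measurable]: "f' \<in> borel_measurable borel" and ff: "AE x in lebesgue. f x = f' x"
    using complex_borel_representative[OF fL(1)] by blast
  have f': "Lp_pow p f' < \<infinity>" using fL Lp_pow_cong_AE[OF ff] by simp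
  define s' where "s' = min s 1"
  define \<sigma> where "\<sigma> = s' - (1 / p - 1 / 2)"
  have s': "s' > 0" using assms by (simp add: s'_def)
  have ident: "(2 - p) / (2 * p) = 1 / p - 1 / 2" using assms by (simp add: field_simps)
  have p1: "1 / p < 1" using assms by simp
  have g0: "0 < 1 - 1 / \<gamma>" "1 - 1 / \<gamma> < 1" using assms by auto
  have \<sigma>: "(a \<noteq> 1 \<and> \<sigma> > min (a / 4 * (1 - 1 / \<gamma>)) (1 / 4)) \<or> (a = 1 \<and> \<sigma> > 1 / 2 * (1 - 1 / \<gamma>))"
  proof (cases "a = 1")
    case True
    then have "s > 1 / p - 1 / (2 * \<gamma>)" using assms by auto
    moreover have "1 > 1 / p - 1 / (2 * \<gamma>)" using p1 assms by (smt (verit) divide_pos_pos)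
    ultimately have "s' > 1 / p - 1 / (2 * \<gamma>)" by (simp add: s'_def)
    moreover have "1 / 2 * (1 - 1 / \<gamma>) = 1 / 2 - 1 / (2 * \<gamma>)" by (simp add: field_simps)
    ultimately show ?thesis using True by (simp add: \<sigma>_def)
  next
    case False
    have "s > 1 / p - 1 / 2 + min (a / 4 * (1 - 1 / \<gamma>)) (1 / 4)"
      using assms(6) False unfolding ident by auto
    moreover have "1 > 1 / p - 1 / 2 + min (a / 4 * (1 - 1 / \<gamma>)) (1 / 4)"
        using p1 min.cobounded2[of "a / 4 * (1 - 1 / \<gamma>)" "1 / 4"] by linarith
    ultimately have "s' > 1 / p - 1 / 2 + min (a / 4 * (1 - 1 / \<gamma>)) (1 / 4)" by (simp add: s'_def)
    then show ?thesis using False by (simp add: \<sigma>_def)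
  qed
  obtain G where G: "is_fourier_Lp p f' G" using is_fourier_Lp_exists[OF assms(4,5) fm f'] by blast
  have "Lp_pow p (\<lambda>x. F x - f' x) = Lp_pow p (\<lambda>x. F x - f x)" for F
    by (rule Lp_pow_cong_AE) (use ff in eventually_elim, simp)
  then have "is_fourier_Lp p f G" using G unfolding is_fourier_Lp_def by simp
  then have "is_fourier_Lp p f (fourier_Lp p f)" unfolding fourier_Lp_def
      by (rule someI[where P="is_fourier_Lp p f"])
  then obtain g where gae: "AE \<xi> in lebesgue. fourier_Lp p f \<xi> = g \<xi>" and g: "is_fourier_borel p f' g"
    by (rule is_fourier_Lp_borel[OF _ ff]) blast
  have gm [measurable]: "g \<in> borel_measurable borel" using g by (simp add: is_fourier_borel_def)
  have FL: "fourier_Lp p f \<in> borel_measurable lebesgue"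
    using \<open>is_fourier_Lp p f (fourier_Lp p f)\<close> by (simp add: is_fourier_Lp_def Lp_space_def)
  obtain I where I: "I > 0" "\<And>R. R \<ge> 1 \<Longrightarrow> \<exists>h\<in>{1 / (2 * R)..1 / R}. Lp_pow p (\<lambda>x. f' (x + h) - f' x)
      \<le> ennreal (I * R powr (- s' * p))"
    unfolding s'_def by (rule sobolev_small_increments[OF assms(1,4) fs fm ff]) blast
  obtain A where A: "A > 0" "\<And>R. R \<ge> 1 \<Longrightarrow>
    (\<integral>\<^sup>+\<xi>. ennreal ((norm (g \<xi>))\<^sup>2) * indicator {\<xi>. R \<le> \<bar>\<xi>\<bar> \<and> \<bar>\<xi>\<bar> \<le> 2 * R} \<xi> \<partial>lborel)
        \<le> ennreal (A * R powr (2 / p - 1 - 2 * s'))"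
    by (rule dyadic_L2_decay[OF assms(4,5) s' fm g I]) blast+
  have e: "2 / p - 1 - 2 * s' = - 2 * \<sigma>" by (simp add: \<sigma>_def)
  have "AE x in lborel. ((\<lambda>t. LINT \<xi>|lborel. g \<xi> * wave a \<gamma> t x \<xi>) \<longlongrightarrow> 2 * of_real pi * f' x) (at_right 0)"
    by (rule wave_integral_tendsto_AE[OF assms(2-5) \<sigma> fm f' g A(1)]) (use A(2) in \<open>simp only: e annulus_def\<close>)
  then have conv: "AE x in lebesgue. ((\<lambda>t. LINT \<xi>|lborel. g \<xi> * wave a \<gamma> t x \<xi>)
      \<longlongrightarrow> 2 * of_real pi * f' x) (at_right 0)"
    by (rule AE_completion)
  have op: "landau_schroedinger p a \<gamma> t f x = 1 / (2 * of_real pi) * (LINT \<xi>|lborel. g \<xi> * wave a \<gamma> t x \<xi>)"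
      for t x
  proof -
    have [measurable]: "wave a \<gamma> t x \<in> borel_measurable lebesgue" by (rule measurable_completion) measurable
    have [measurable]: "g \<in> borel_measurable lebesgue" by (rule measurable_completion) measurable
    note [measurable] = FL
    have "landau_schroedinger p a \<gamma> t f x = 1 / (2 * of_real pi) * (LINT \<xi>|lebesgue. fourier_Lp p f \<xi>
        * wave a \<gamma> t x \<xi>)"
      unfolding landau_schroedinger_def wave_def by (simp only: mult.assoc)
    also have "(LINT \<xi>|lebesgue. fourier_Lp p f \<xi> * wave a \<gamma> t x \<xi>) = (LINT \<xi>|lebesgue. g \<xi> * wave a \<gamma> t x \<xi>)"
      by (rule integral_cong_AE) (use gae in \<open>auto elim: eventually_mono\<close>)
    also have "\<dots> = (LINT \<xi>|lborel. g \<xi> * wave a \<gamma> t x \<xi>)" by (rule integral_completion) measurable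
    finally show ?thesis .
  qed
  from conv ff show "AE x in lebesgue. ((\<lambda>t. landau_schroedinger p a \<gamma> t f x) \<longlongrightarrow> f x) (at_right 0)"
  proof eventually_elim
    case (elim x)
    have "((\<lambda>t. landau_schroedinger p a \<gamma> t f x) \<longlongrightarrow> 1 / (2 * of_real pi) * (2 * of_real pi * f' x)) (at_right 0)"
      unfolding op by (intro tendsto_intros elim)
    then show ?case using elim by simp
  qed
qed

end
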